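(* Let $H=(H_1,\ldots,H_N)\in(0,1)^N$ and $K=(K_1,\ldots,K_N)\in(0,1)^N$. Let $X^H=\{X^H(s),s\in\mathbb{R}^N\}$ and $X^K=\{X^K(t),t\in\mathbb{R}^N\}$ be two independent $(N,d)$-Gaussian random fields whose associated real-valued random fields $X_0^H$ and $X_0^K$ satisfy Conditions (C1) and (C2) on $I=[0,1]^N$ with index $H$ and with index $K$, respectively. Let $L_C(X^H,X^K)$ be the collision local time of $X^H$ and $X^K$ on $I$. Then: (i) $L_C(X^H,X^K)\in L^2(\Omega,\mathbb{P})$ if and only if $\sum_{j=1}^N\frac{1}{H_j\wedge K_j}>d$. (ii) $L_C(X^H,X^K)\in D_1$ if and only if $\sum_{j=1}^N\frac{1}{H_j\wedge K_j}>d+2$.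
   Context: $N,d\ge1$ are integers, $I=[0,1]^N$, and $a\wedge b=\min\{a,b\}$. An $(N,d)$-Gaussian random field is $X(t)=(X_1(t),\ldots,X_d(t))\in\mathbb{R}^d$, where $X_1,\ldots,X_d$ are independent copies of a real-valued centered Gaussian random field $X_0$ (the associated real-valued field) with continuous covariance function. Sample paths are taken to be continuous on $I$. Condition (C1) with index $H$: there is a constant $0<c_1<\infty$ such that $\mathbb{E}[(X_0(s)-X_0(t))^2]\le c_1\sum_{j=1}^N|s_j-t_j|^{2H_j}$ for all $s,t\in I$. Condition (C2) with index $H$: there is a constant $c_2>0$ such that $\mathrm{Var}(X_0(t)\mid X_0(s))\ge c_2\sum_{j=1}^N\min\{|s_j-t_j|^{2H_j},|t_j|^{2H_j}\}$ for all $s,t\in I$ (conditional variance of $X_0(t)$ given $X_0(s)$). The collision local time is formally $L_C(X^H,X^K)=\int_I\delta(X^H(s)-X^K(s))\,ds$; that is, it is the local time at $x=0$ on $I$ of the field $Z(s)=X^H(s)-X^K(s)$, defined as the limit in $L^2(\Omega,\mathbb{P})$ as $\varepsilon\to0$ of $\int_I p_\varepsilon(X^H(s)-X^K(s))\,ds$, where $p_\varepsilon(x)=(2\pi\varepsilon)^{-d/2}\exp(-\|x\|^2/(2\varepsilon))$. The assertion $L_C(X^H,X^K)\in L^2(\Omega,\mathbb{P})$ means that this $L^2$ limit exists, and $L_C(X^H,X^K)\in D_1$ means that it exists and belongs to $D_1$. Chaos expansion and $D_1$: let $\mathcal{P}_n$ be the closure in $L^2(\Omega,\mathbb{P})$ of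 the set of all polynomials of degree at most $n$ in finitely many of the underlying Gaussian variables (the values of the coordinates of $Z$), and let $\mathcal{C}_n$ be the orthogonal complement of $\mathcal{P}_{n-1}$ in $\mathcal{P}_n$ (with $\mathcal{C}_0$ the constants). Every square-integrable functional $F$ of the field has a unique chaos expansion $F=\sum_{n\ge0}F_n$, $F_n\in\mathcal{C}_n$, and $D_1=\{F\in L^2(\Omega,\mathbb{P}):\ \sum_{n\ge0}n\,\mathbb{E}(|F_n|^2)<\infty\}$. *)

theory Defs
  imports "HOL-Probability.Probability"
begin

section \<open>Gaussian random fields\<close>

text \<open>
  Random fields are curried as \<open>X t \<omega>\<close>, with parameter \<open>t\<close> in \<open>real ^ 'n\<close> and values in
  \<open>real\<close> or \<open>real ^ 'd\<close>, so that the integers \<open>N, d \<ge> 1\<close> are \<open>CARD('n)\<close> and \<open>CARD('d)\<close>.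
\<close>

abbreviation unit_cube :: "(real ^ 'n) set"
  where "unit_cube \<equiv> cbox 0 1"

text \<open>The second alternative is the degenerate Gaussian law \<open>N(0, 0)\<close>, which must be admitted:
  a field may vanish at a point, and linear combinations may vanish.\<close>

definition centered_gaussian :: "'w measure \<Rightarrow> ('w \<Rightarrow> real) \<Rightarrow> bool" where
  "centered_gaussian M Y \<longleftrightarrow>
     Y \<in> borel_measurable M \<and>
     ((\<exists>\<sigma>>0. distributed M lborel Y (\<lambda>x. ennreal (normal_density 0 \<sigma> x))) \<or> (AE \<omega> in M. Y \<omega> = 0))"

definition centered_gaussian_field :: "'w measure \<Rightarrow> (real ^ 'n \<Rightarrow> 'w \<Rightarrow> real) \<Rightarrow> bool" where
  "centered_gaussian_field M X0 \<longleftrightarrow>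
     (\<forall>T a. finite T \<longrightarrow> centered_gaussian M (\<lambda>\<omega>. \<Sum>t\<in>T. a t * X0 t \<omega>))"

text \<open>The covariance function of a centered field is \<open>(s, t) \<mapsto> E (X0 s * X0 t)\<close>.\<close>

definition continuous_covariance :: "'w measure \<Rightarrow> (real ^ 'n \<Rightarrow> 'w \<Rightarrow> real) \<Rightarrow> bool" where
  "continuous_covariance M X0 \<longleftrightarrow>
     continuous_on UNIV (\<lambda>(s, t). \<integral>\<omega>. X0 s \<omega> * X0 t \<omega> \<partial>M)"

text \<open>
  The \<open>(N, d)\<close>-Gaussian random field \<open>X\<close> with associated real-valued field \<open>X0\<close>. Independence and
  equality in law of the coordinate fields are meant as processes, that is, as random elements of
  the product space of all functions of the parameter.
\<close>

definition gaussian_random_field ::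
  "'w measure \<Rightarrow> (real ^ 'n \<Rightarrow> 'w \<Rightarrow> real ^ 'd) \<Rightarrow> (real ^ 'n \<Rightarrow> 'w \<Rightarrow> real) \<Rightarrow> bool" where
  "gaussian_random_field M X X0 \<longleftrightarrow>
     centered_gaussian_field M X0 \<and>
     continuous_covariance M X0 \<and>
     prob_space.indep_vars M (\<lambda>_. Pi\<^sub>M UNIV (\<lambda>_. borel)) (\<lambda>i \<omega> t. X t \<omega> $ i) UNIV \<and>
     (\<forall>i. distr M (Pi\<^sub>M UNIV (\<lambda>_. borel)) (\<lambda>\<omega> t. X t \<omega> $ i) =
          distr M (Pi\<^sub>M UNIV (\<lambda>_. borel)) (\<lambda>\<omega> t. X0 t \<omega>)) \<and>
     (\<forall>\<omega>\<in>space M. continuous_on unit_cube (\<lambda>t. X t \<omega>))"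

definition independent_fields ::
  "'w measure \<Rightarrow> (real ^ 'n \<Rightarrow> 'w \<Rightarrow> real ^ 'd) \<Rightarrow> (real ^ 'n \<Rightarrow> 'w \<Rightarrow> real ^ 'd) \<Rightarrow> bool" where
  "independent_fields M X Y \<longleftrightarrow>
     prob_space.indep_var M
       (Pi\<^sub>M UNIV (\<lambda>_. borel)) (\<lambda>\<omega> t. X t \<omega>) (Pi\<^sub>M UNIV (\<lambda>_. borel)) (\<lambda>\<omega> t. Y t \<omega>)"


section \<open>Conditions (C1) and (C2)\<close>

text \<open>\<open>Var (Y | V)\<close>, as a random variable (for jointly Gaussian \<open>Y, V\<close> it is a.s. constant).\<close>

definition cond_variance :: "'w measure \<Rightarrow> ('w \<Rightarrow> real) \<Rightarrow> ('w \<Rightarrow> real) \<Rightarrow> 'w \<Rightarrow> real" where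
  "cond_variance M Y V =
     (let G = vimage_algebra (space M) V borel
      in real_cond_exp M G (\<lambda>\<omega>. (Y \<omega> - real_cond_exp M G Y \<omega>)\<^sup>2))"

definition condition_C1 :: "'w measure \<Rightarrow> (real ^ 'n \<Rightarrow> 'w \<Rightarrow> real) \<Rightarrow> real ^ 'n \<Rightarrow> bool" where
  "condition_C1 M X0 H \<longleftrightarrow>
     (\<exists>c>0. \<forall>s\<in>unit_cube. \<forall>t\<in>unit_cube.
        (\<integral>\<omega>. (X0 s \<omega> - X0 t \<omega>)\<^sup>2 \<partial>M) \<le> c * (\<Sum>j\<in>UNIV. \<bar>s $ j - t $ j\<bar> powr (2 * H $ j)))"

definition condition_C2 :: "'w measure \<Rightarrow> (real ^ 'n \<Rightarrow> 'w \<Rightarrow> real) \<Rightarrow> real ^ 'n \<Rightarrow> bool" where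
  "condition_C2 M X0 H \<longleftrightarrow>
     (\<exists>c>0. \<forall>s\<in>unit_cube. \<forall>t\<in>unit_cube. AE \<omega> in M.
        cond_variance M (X0 t) (X0 s) \<omega> \<ge>
          c * (\<Sum>j\<in>UNIV. min (\<bar>s $ j - t $ j\<bar> powr (2 * H $ j)) (\<bar>t $ j\<bar> powr (2 * H $ j))))"


section \<open>Square-integrable functionals and the chaos expansion\<close>

text \<open>Elements of \<open>L\<^sup>2\<close> are represented by functions; they are not identified almost everywhere.\<close>

definition L2 :: "'w measure \<Rightarrow> ('w \<Rightarrow> real) set" where
  "L2 M = {F \<in> borel_measurable M. integrable M (\<lambda>\<omega>. (F \<omega>)\<^sup>2)}"

definition tendsto_L2 :: "'w measure \<Rightarrow> ('i \<Rightarrow> 'w \<Rightarrow> real) \<Rightarrow> ('w \<Rightarrow> real) \<Rightarrow> 'i filter \<Rightarrow> bool" where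
  "tendsto_L2 M F L \<F> \<longleftrightarrow>
     L \<in> L2 M \<and> (\<forall>\<^sub>F i in \<F>. F i \<in> L2 M) \<and>
     ((\<lambda>i. \<integral>\<omega>. (F i \<omega> - L \<omega>)\<^sup>2 \<partial>M) \<longlongrightarrow> 0) \<F>"

text \<open>Polynomials of degree at most \<open>n\<close> in finitely many of the variables in \<open>V\<close>; a monomial is the
  product of a list \<open>l\<close> of at most \<open>n\<close> variables.\<close>

definition polynomials_upto :: "('w \<Rightarrow> real) set \<Rightarrow> nat \<Rightarrow> ('w \<Rightarrow> real) set" where
  "polynomials_upto V n =
     {(\<lambda>\<omega>. \<Sum>l\<in>A. c l * (\<Prod>v\<leftarrow>l. v \<omega>)) | A c.
        finite A \<and> (\<forall>l\<in>A. set l \<subseteq> V \<and> length l \<le> n)}"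

definition poly_closure :: "'w measure \<Rightarrow> ('w \<Rightarrow> real) set \<Rightarrow> nat \<Rightarrow> ('w \<Rightarrow> real) set" where
  "poly_closure M V n =
     {F \<in> L2 M. \<forall>e>0. \<exists>p \<in> polynomials_upto V n \<inter> L2 M. (\<integral>\<omega>. (F \<omega> - p \<omega>)\<^sup>2 \<partial>M) < e}"

text \<open>\<open>chaos M V 0\<close> consists of the (almost surely) constant functions.\<close>

definition chaos :: "'w measure \<Rightarrow> ('w \<Rightarrow> real) set \<Rightarrow> nat \<Rightarrow> ('w \<Rightarrow> real) set" where
  "chaos M V n =
     (case n of
        0 \<Rightarrow> {F \<in> borel_measurable M. \<exists>c. AE \<omega> in M. F \<omega> = c}
      | Suc m \<Rightarrow> {F \<in> poly_closure M V n. \<forall>G \<in> poly_closure M V m. (\<integral>\<omega>. F \<omega> * G \<omega> \<partial>M) = 0})"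

definition chaos_expansion ::
  "'w measure \<Rightarrow> ('w \<Rightarrow> real) set \<Rightarrow> ('w \<Rightarrow> real) \<Rightarrow> (nat \<Rightarrow> 'w \<Rightarrow> real) \<Rightarrow> bool" where
  "chaos_expansion M V F Fn \<longleftrightarrow>
     (\<forall>n. Fn n \<in> chaos M V n) \<and> tendsto_L2 M (\<lambda>m \<omega>. \<Sum>n<m. Fn n \<omega>) F sequentially"

text \<open>The expansion is unique up to null sets, so the existential quantifier below selects the
  chaos expansion of \<open>F\<close>.\<close>

definition D1 :: "'w measure \<Rightarrow> ('w \<Rightarrow> real) set \<Rightarrow> ('w \<Rightarrow> real) set" where
  "D1 M V =
     {F \<in> L2 M. \<exists>Fn. chaos_expansion M V F Fn \<and>
                   summable (\<lambda>n. real n * (\<integral>\<omega>. \<bar>Fn n \<omega>\<bar>\<^sup>2 \<partial>M))}"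


section \<open>Collision local time\<close>

definition heat_kernel :: "real \<Rightarrow> real ^ 'd \<Rightarrow> real" where
  "heat_kernel \<epsilon> x =
     (2 * pi * \<epsilon>) powr (- real CARD('d) / 2) * exp (- (norm x)\<^sup>2 / (2 * \<epsilon>))"

definition approx_collision_local_time ::
  "(real ^ 'n \<Rightarrow> 'w \<Rightarrow> real ^ 'd) \<Rightarrow> (real ^ 'n \<Rightarrow> 'w \<Rightarrow> real ^ 'd) \<Rightarrow> real \<Rightarrow> 'w \<Rightarrow> real" where
  "approx_collision_local_time X Y \<epsilon> \<omega> =
     (LINT s:unit_cube|lborel. heat_kernel \<epsilon> (X s \<omega> - Y s \<omega>))"

text \<open>\<open>L\<close> is (a version of) the collision local time of \<open>X\<close> and \<open>Y\<close>. It is a relation because the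
  \<open>L\<^sup>2\<close> limit need not exist and is determined only almost surely.\<close>

definition is_collision_local_time ::
  "'w measure \<Rightarrow> (real ^ 'n \<Rightarrow> 'w \<Rightarrow> real ^ 'd) \<Rightarrow> (real ^ 'n \<Rightarrow> 'w \<Rightarrow> real ^ 'd) \<Rightarrow>
   ('w \<Rightarrow> real) \<Rightarrow> bool" where
  "is_collision_local_time M X Y L \<longleftrightarrow>
     tendsto_L2 M (approx_collision_local_time X Y) L (at_right 0)"

text \<open>The underlying Gaussian variables: the coordinates of the values of the field \<open>Z = X - Y\<close>
  on the unit cube.\<close>

definition difference_variables ::
  "(real ^ 'n \<Rightarrow> 'w \<Rightarrow> real ^ 'd) \<Rightarrow> (real ^ 'n \<Rightarrow> 'w \<Rightarrow> real ^ 'd) \<Rightarrow> ('w \<Rightarrow> real) set" where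
  "difference_variables X Y = {(\<lambda>\<omega>. (X s \<omega> - Y s \<omega>) $ i) | s i. s \<in> unit_cube}"

end

theory Submission
  imports Defs
begin

text \<open>
  Let \<open>Z = X - Y\<close> be the difference of the two fields, \<open>R\<close> the covariance function of one of its
  coordinates and \<open>D s t = R s s * R t t - (R s t)\<^sup>2\<close> the Gram determinant of \<open>Z s\<close> and \<open>Z t\<close>.

  \<^emph>\<open>Fourier representation.\<close> Fourier inversion of the heat kernel turns the approximation with
  parameter \<open>\<epsilon>\<close> into \<open>\<integral> w \<epsilon> \<theta> * cos (U \<theta>) d\<theta>\<close>, where \<open>\<theta> = (s, \<xi>)\<close> consists of a point of the cube
  and a frequency, \<open>U \<theta> = \<xi> \<bullet> Z s\<close> is a centered Gaussian variable, and the positive weights \<open>w \<epsilon>\<close>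
  increase to a constant as \<open>\<epsilon>\<close> decreases to \<open>0\<close> (\<open>heat_kernel_fourier\<close>, \<open>local_time_eq\<close>).

  \<^emph>\<open>Existence.\<close> Let \<open>v\<close>, \<open>v'\<close> and \<open>C\<close> be the variances and the covariance of \<open>U \<theta>\<close> and \<open>U \<eta>\<close>. Then
  \<open>cos (U \<theta>)\<close> and \<open>cos (U \<eta>)\<close> have the inner product \<open>\<kappa> = exp (- (v + v') / 2) * cosh C\<close>, which is
  nonnegative. Hence all inner products of two approximations increase as the parameters decrease,
  and in such a family boundedness of the norms already implies convergence
  (\<open>L2_limit_of_monotone_gram\<close>). The local time exists if and only if the integral of \<open>\<kappa>\<close> against
  the limiting weights, its mass, is finite (\<open>local_time_exists_iff\<close>).

  \<^emph>\<open>Chaos components.\<close> The component of \<open>cos (U \<theta>)\<close> in the chaos of order \<open>2 * m\<close> is a multiple of a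
  Wick power of \<open>U \<theta>\<close>, and two of them have the inner product
  \<open>\<kappa>\<^sub>n m = exp (- (v + v') / 2) * C ^ (2 * m) / fact (2 * m)\<close>, again nonnegative. The same argument
  gives the components of the local time and their norms, and summing \<open>2 * m * \<kappa>\<^sub>n m\<close> over \<open>m\<close> yields
  \<open>\<kappa>' = exp (- (v + v') / 2) * C * sinh C\<close>. So the local time exists and belongs to \<open>D1\<close> if and only if
  \<open>\<kappa>\<close> and \<open>\<kappa>'\<close> both have finite mass (\<open>local_time_D1_iff\<close>).

  \<^emph>\<open>Integration over the frequencies.\<close> Here \<open>v = R s s * (norm \<xi>)\<^sup>2\<close>, \<open>v' = R t t * (norm \<eta>)\<^sup>2\<close> and
  \<open>C = R s t * (\<xi> \<bullet> \<eta>)\<close>. For frequencies in dimension \<open>d\<close>, the integral of \<open>\<kappa>\<close> is a multiple of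
  \<open>D s t powr (- d / 2)\<close> (\<open>pair_cosh_eq\<close>). The integral of \<open>\<kappa>'\<close> is \<open>R s t\<close> times the derivative of the
  former with respect to \<open>R s t\<close>; convexity of \<open>cosh\<close> bounds it on both sides by difference quotients,
  which near the diagonal are of the order \<open>D s t powr (- (d + 2) / 2)\<close> (\<open>pair_sinh_lower\<close>, \<open>pair_sinh_upper\<close>).

  \<^emph>\<open>Integration over the cube.\<close> The two conditions for both fields add up to the same conditions for
  \<open>R\<close> with the index \<open>\<alpha> j = min (H $ j) (K $ j)\<close>. They make \<open>D s t\<close> comparable to the anisotropic sum
  \<open>\<Sum>j. \<bar>s $ j - t $ j\<bar> powr (2 * \<alpha> j)\<close> away from the coordinate planes, and near them its lower bound
  degenerates only like the same sums at \<open>s\<close> and \<open>t\<close>. As a result \<open>D powr (- p / 2)\<close> is integrable over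
  the square of the cube if and only if \<open>p < (\<Sum>j. 1 / \<alpha> j)\<close> (\<open>cube_integral_finite\<close>,
  \<open>cube_integral_infinite\<close>). The two assertions are the cases \<open>p = d\<close> and
  \<open>p = d + 2\<close>.
\<close>

section \<open>Wick powers of jointly Gaussian variables\<close>

text \<open>
  The Taylor coefficients of \<open>\<lambda>x. exp (- x\<^sup>2 * v / 2)\<close>.
\<close>

definition gauss_coeff :: "real \<Rightarrow> nat \<Rightarrow> real" where
  "gauss_coeff v n = (if even n then (- v / 2) ^ (n div 2) / fact (n div 2) else 0)"

text \<open>
  The Hermite polynomial of degree \<open>n\<close> for the variance \<open>v\<close>, divided by \<open>fact n\<close>. It is built as a
  Cauchy product, so that its generating function is \<open>exp (x * u - x\<^sup>2 * v / 2)\<close>; negative \<open>v\<close> are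
  admitted because they give majorants.
\<close>

definition wick :: "nat \<Rightarrow> real \<Rightarrow> real \<Rightarrow> real" where
  "wick n v u = (\<Sum>i\<le>n. u ^ i / fact i * gauss_coeff v (n - i))"

lemma wick_0 [simp]: "wick 0 v u = 1"
  by (simp add: wick_def gauss_coeff_def)

lemma borel_measurable_wick [measurable (raw)]:
  assumes "f \<in> borel_measurable M" "g \<in> borel_measurable M"
  shows "(\<lambda>x. wick n (f x) (g x)) \<in> borel_measurable M"
  using assms unfolding wick_def gauss_coeff_def by measurable

lemma wick_generating:
  fixes x :: complex
  shows "(\<lambda>n. of_real (wick n v u) * x ^ n) sums exp (x * u - x\<^sup>2 * v / 2)"
proof -
  have ex: "(\<lambda>n. z ^ n / fact n) sums exp z" "summable (\<lambda>n. norm (z ^ n / fact n))" for z :: complex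
    using exp_converges[of z] summable_norm_exp[of z]
    by (simp_all add: scaleR_conv_of_real field_simps)
  define a where "a i = (x * u) ^ i / fact i" for i
  define b where "b i = of_real (gauss_coeff v i) * x ^ i" for i
  have a: "a sums exp (x * u)" "summable (\<lambda>n. norm (a n))"
    unfolding a_def[abs_def] by (rule ex)+
  define e where "e i = (- x\<^sup>2 * v / 2) ^ i / fact i" for i
  have b_e: "b n = (if even n then e (n div 2) else 0)" for n
    by (auto simp: b_def e_def gauss_coeff_def power_mult power_mult_distrib power_minus' power_divide elim!: evenE)
  have reindex: "(\<lambda>n. f (2 * n)) sums c \<longleftrightarrow> f sums c" if "\<And>n. odd n \<Longrightarrow> f n = 0"
    for f :: "nat \<Rightarrow> 'z::real_normed_vector" and c
    using that by (intro sums_mono_reindex) (auto simp: strict_mono_def elim!: evenE)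
  have e: "e sums exp (- x\<^sup>2 * v / 2)" "summable (\<lambda>n. norm (e n))"
    unfolding e_def[abs_def] by (rule ex)+
  have b: "b sums exp (- x\<^sup>2 * v / 2)"
    using e(1) by (subst reindex[symmetric]) (auto simp: b_e)
  have "(\<lambda>n. norm (b n)) sums (\<Sum>n. norm (e n))"
    using summable_sums[OF e(2)] by (subst reindex[symmetric]) (auto simp: b_e)
  then have bn: "summable (\<lambda>n. norm (b n))"
    by (rule sums_summable)
  have "(\<lambda>n. \<Sum>i\<le>n. a i * b (n - i)) sums ((\<Sum>n. a n) * (\<Sum>n. b n))"
    by (rule Cauchy_product_sums[OF a(2) bn])
  moreover have "(\<Sum>i\<le>n. a i * b (n - i)) = of_real (wick n v u) * x ^ n" for n
  proof -
    have "a i * b (n - i) = of_real (u ^ i / fact i * gauss_coeff v (n - i)) * x ^ n" if "i \<le> n" for i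
    proof -
      have "x ^ n = x ^ i * x ^ (n - i)" using that by (simp add: power_add[symmetric])
      then show ?thesis by (simp add: a_def b_def power_mult_distrib)
    qed
    then show ?thesis
      by (simp add: wick_def sum_distrib_right)
  qed
  moreover have "(\<Sum>n. a n) * (\<Sum>n. b n) = exp (x * u - x\<^sup>2 * v / 2)"
    using a(1) b by (simp add: sums_unique[symmetric] exp_add[symmetric])
  ultimately show ?thesis by simp
qed

lemma wick_abs: "\<bar>wick n v u\<bar> \<le> wick n (- \<bar>v\<bar>) \<bar>u\<bar>"
proof -
  have "\<bar>gauss_coeff v i\<bar> = gauss_coeff (- \<bar>v\<bar>) i" for i
    by (simp add: gauss_coeff_def power_abs abs_divide)
  then show ?thesis
    unfolding wick_def
    by (intro order_trans[OF sum_abs] sum_mono) (simp add: abs_mult power_abs)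
qed

text \<open>
  Replacing \<open>v\<close> by \<open>- \<bar>v\<bar>\<close> and \<open>u\<close> by \<open>\<bar>u\<bar>\<close> makes all terms of the generating series nonnegative. The
  bound is an integrable majorant that justifies exchanging the series with expectations.
\<close>

lemma wick_abs_sum_le:
  assumes "0 \<le> t"
  shows "(\<Sum>n<N. \<bar>wick n v u\<bar> * t ^ n) \<le> exp (t * \<bar>u\<bar> + t\<^sup>2 * \<bar>v\<bar> / 2)"
proof -
  let ?w = "\<lambda>n. wick n (- \<bar>v\<bar>) \<bar>u\<bar> * t ^ n"
  have "(\<lambda>n. complex_of_real (?w n)) sums complex_of_real (exp (t * \<bar>u\<bar> + t\<^sup>2 * \<bar>v\<bar> / 2))"
    using wick_generating[of "- \<bar>v\<bar>" "\<bar>u\<bar>" "of_real t"] by (simp flip: exp_of_real)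
  then have s: "?w sums exp (t * \<bar>u\<bar> + t\<^sup>2 * \<bar>v\<bar> / 2)"
    by (simp only: sums_of_real_iff)
  have "(\<Sum>n<N. \<bar>wick n v u\<bar> * t ^ n) \<le> (\<Sum>n<N. ?w n)"
    using assms by (intro sum_mono mult_right_mono wick_abs) auto
  also have "\<dots> \<le> exp (t * \<bar>u\<bar> + t\<^sup>2 * \<bar>v\<bar> / 2)"
    using s order_trans[OF abs_ge_zero wick_abs] assms
    by (intro sum_le_suminf[THEN order_trans[OF _ eq_refl[OF sums_unique[symmetric]]]])
       (auto simp: sums_iff)
  finally show ?thesis .
qed

text \<open>
  The coefficients vanish one after the other: the constant term is the limit at \<open>0\<close>, and the series
  divided by \<open>x\<close> again sums to \<open>0\<close>. Values at real points suffice, which lets expectations be compared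
  as functions of a real parameter.
\<close>

lemma power_series_zero_imp:
  fixes a :: "nat \<Rightarrow> real"
  assumes "\<And>x. (\<lambda>n. a n * x ^ n) sums 0"
  shows "a n = 0"
proof -
  have "a 0 = 0 \<and> (\<forall>x. x \<noteq> 0 \<longrightarrow> (\<lambda>n. a (Suc n) * x ^ n) sums 0)"
    if s: "\<And>x. x \<noteq> 0 \<Longrightarrow> (\<lambda>n. a n * x ^ n) sums 0" for a :: "nat \<Rightarrow> real"
  proof -
    have 0: "a 0 = 0"
      using powser_limit_0_strong[of 1 a "\<lambda>_. 0"] s
      by (metis LIM_const_eq zero_less_one)
    moreover have "(\<lambda>n. a (Suc n) * x ^ n) sums 0" if "x \<noteq> 0" for x
    proof -
      have "(\<lambda>n. a (Suc n) * x ^ Suc n) sums 0"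
        using s[OF that] 0 by (subst sums_Suc_iff) simp
      then have "(\<lambda>n. inverse x * (a (Suc n) * x ^ Suc n)) sums (inverse x * 0)"
        by (rule sums_mult)
      then show ?thesis using that by (simp add: field_simps)
    qed
    ultimately show ?thesis by simp
  qed
  note step = this
  have "\<forall>x. x \<noteq> 0 \<longrightarrow> (\<lambda>k. a (k + n) * x ^ k) sums 0" for n
  proof (induction n)
    case (Suc n)
    then show ?case using step[of "\<lambda>k. a (k + n)"] by simp
  qed (use assms in auto)
  then show ?thesis using step[of "\<lambda>k. a (k + n)"] by fastforce
qed

lemma complex_power_series_eq_imp:
  fixes a b :: "nat \<Rightarrow> complex"
  assumes "\<And>x::real. (\<lambda>n. a n * of_real x ^ n) sums f x" "\<And>x::real. (\<lambda>n. b n * of_real x ^ n) sums f x"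
  shows "a n = b n"
proof -
  have s: "(\<lambda>n. (a n - b n) * of_real x ^ n) sums 0" for x
    using sums_diff[OF assms[of x]] by (simp add: algebra_simps)
  have "Re (a n - b n) = 0"
    using sums_Re[OF s] by (intro power_series_zero_imp[of "\<lambda>n. Re (a n - b n)"]) (simp flip: of_real_power)
  moreover have "Im (a n - b n) = 0"
    using sums_Im[OF s] by (intro power_series_zero_imp[of "\<lambda>n. Im (a n - b n)"]) (simp flip: of_real_power)
  ultimately show ?thesis by (simp add: complex_eq_iff)
qed

lemma sums_integral_dominated:
  fixes f :: "nat \<Rightarrow> 'a \<Rightarrow> 'b::{banach, second_countable_topology}"
  assumes [measurable]: "\<And>n. f n \<in> borel_measurable M"
    and s: "\<And>x. (\<lambda>n. f n x) sums F x"
    and bd: "\<And>N x. (\<Sum>n<N. norm (f n x)) \<le> B x" and B: "integrable M B"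
  shows "integrable M (f n)" "integrable M F" "(\<lambda>n. \<integral>x. f n x \<partial>M) sums (\<integral>x. F x \<partial>M)"
proof -
  have 1: "norm (f n x) \<le> B x" for n x
    using bd[of x "Suc n"] sum_nonneg[of "{..<n}" "\<lambda>n. norm (f n x)"] by simp
  have i: "integrable M (f n)" for n
    by (intro Bochner_Integration.integrable_bound[OF B]) (auto intro: order_trans[OF 1 abs_ge_self])
  show "integrable M (f n)" by (rule i)
  have F: "F = (\<lambda>x. lim (\<lambda>N. \<Sum>n<N. f n x))"
    using s by (auto simp: sums_def fun_eq_iff intro!: limI[symmetric])
  have Fm[measurable]: "F \<in> borel_measurable M"
    unfolding F by measurable
  have "AE x in M. (\<lambda>N. \<Sum>n<N. f n x) \<longlonglongrightarrow> F x" "\<And>N. AE x in M. norm (\<Sum>n<N. f n x) \<le> B x"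
    using s order_trans[OF norm_sum bd] by (auto simp: sums_def)
  note * = Fm borel_measurable_sum[OF assms(1)] B this
  show "integrable M F"
    by (rule integrable_dominated_convergence[OF *]) 
  have "(\<lambda>N. \<integral>x. (\<Sum>n<N. f n x) \<partial>M) \<longlonglongrightarrow> (\<integral>x. F x \<partial>M)"
    by (rule integral_dominated_convergence[OF *]) 
  then show "(\<lambda>n. \<integral>x. f n x \<partial>M) sums (\<integral>x. F x \<partial>M)"
    using i by (simp add: sums_def)
qed

text \<open>
  A linear space of centered jointly Gaussian variables. The laws enter only through characteristic
  functions, so that variables that vanish almost surely need no separate treatment. Closure under
  linear combinations expresses that the elements are jointly Gaussian.
\<close>

locale gaussian_space = prob_space M for M :: "'w measure" +
  fixes S :: "('w \<Rightarrow> real) set"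
  assumes S_add: "U \<in> S \<Longrightarrow> W \<in> S \<Longrightarrow> (\<lambda>\<omega>. U \<omega> + W \<omega>) \<in> S"
    and S_scale: "W \<in> S \<Longrightarrow> (\<lambda>\<omega>. a * W \<omega>) \<in> S"
    and S_meas: "W \<in> S \<Longrightarrow> W \<in> borel_measurable M"
    and S_exp: "W \<in> S \<Longrightarrow> integrable M (\<lambda>\<omega>. exp \<bar>W \<omega>\<bar>)"
    and S_cf: "W \<in> S \<Longrightarrow> (\<integral>\<omega>. iexp (W \<omega>) \<partial>M) = of_real (exp (- (\<integral>\<omega>. (W \<omega>)\<^sup>2 \<partial>M) / 2))"
begin

abbreviation cov :: "('w \<Rightarrow> real) \<Rightarrow> ('w \<Rightarrow> real) \<Rightarrow> real" where
  "cov U W \<equiv> (\<integral>\<omega>. U \<omega> * W \<omega> \<partial>M)"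

lemma S_exp_scale: "W \<in> S \<Longrightarrow> integrable M (\<lambda>\<omega>. exp (t * \<bar>W \<omega>\<bar>))"
proof -
  assume W: "W \<in> S"
  note [measurable] = S_meas[OF W]
  have "integrable M (\<lambda>\<omega>. exp \<bar>t * W \<omega>\<bar>)"
    using S_exp[OF S_scale[OF W]] .
  then show ?thesis
    by (rule Bochner_Integration.integrable_bound)
       (auto simp: abs_mult mult_right_mono)
qed

lemma S_exp_mult:
  assumes U: "U \<in> S" and W: "W \<in> S"
  shows "integrable M (\<lambda>\<omega>. exp (a * \<bar>U \<omega>\<bar>) * exp (b * \<bar>W \<omega>\<bar>))"
proof -
  note [measurable] = S_meas[OF W] S_meas[OF U]
  have "integrable M (\<lambda>\<omega>. exp (2 * a * \<bar>U \<omega>\<bar>) + exp (2 * b * \<bar>W \<omega>\<bar>))"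
    by (intro Bochner_Integration.integrable_add S_exp_scale U W)
  then show ?thesis
  proof (rule Bochner_Integration.integrable_bound)
    have "exp x * exp y \<le> exp (2 * x) + exp (2 * y)" for x y :: real
      using sum_squares_bound[of "exp x" "exp y"] mult_pos_pos[OF exp_gt_zero exp_gt_zero, of x y]
      unfolding exp_double by linarith
    from this[of "a * \<bar>U \<omega>\<bar>" "b * \<bar>W \<omega>\<bar>" for \<omega>]
    have "exp (a * \<bar>U \<omega>\<bar>) * exp (b * \<bar>W \<omega>\<bar>) \<le> exp (2 * a * \<bar>U \<omega>\<bar>) + exp (2 * b * \<bar>W \<omega>\<bar>)" for \<omega>
      by (simp only: mult.assoc)
    then show "AE \<omega> in M. norm (exp (a * \<bar>U \<omega>\<bar>) * exp (b * \<bar>W \<omega>\<bar>)) \<le> norm (exp (2 * a * \<bar>U \<omega>\<bar>) + exp (2 * b * \<bar>W \<omega>\<bar>))"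
      by (simp add: abs_mult)
  qed measurable
qed

lemma power_le_exp: "0 \<le> x \<Longrightarrow> x ^ n \<le> fact n * exp (x::real)"
proof -
  assume x: "0 \<le> x"
  have "x ^ n / fact n \<le> (\<Sum>k. x ^ k / fact k)"
    using exp_converges[of x] x
    by (intro order_trans[OF _ sum_le_suminf[of _ "{n}"]]) (auto simp: sums_iff scaleR_conv_of_real field_simps)
  also have "\<dots> = exp x" using exp_converges[of x] by (simp add: sums_iff scaleR_conv_of_real field_simps)
  finally show ?thesis by (simp add: field_simps)
qed

lemma S_integrable_powers:
  assumes U: "U \<in> S" and W: "W \<in> S"
  shows "integrable M (\<lambda>\<omega>. U \<omega> ^ m * W \<omega> ^ n)"
proof -
  note [measurable] = S_meas[OF W] S_meas[OF U]
  have "integrable M (\<lambda>\<omega>. (fact m * fact n) * (exp (1 * \<bar>U \<omega>\<bar>) * exp (1 * \<bar>W \<omega>\<bar>)))"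
    by (intro integrable_mult_right S_exp_mult U W)
  then show ?thesis
  proof (rule Bochner_Integration.integrable_bound)
    have "\<bar>U \<omega>\<bar> ^ m * \<bar>W \<omega>\<bar> ^ n \<le> (fact m * exp \<bar>U \<omega>\<bar>) * (fact n * exp \<bar>W \<omega>\<bar>)" for \<omega>
      by (intro mult_mono power_le_exp) auto
    then show "AE \<omega> in M. norm (U \<omega> ^ m * W \<omega> ^ n) \<le> norm ((fact m * fact n) * (exp (1 * \<bar>U \<omega>\<bar>) * exp (1 * \<bar>W \<omega>\<bar>)))"
      by (simp add: abs_mult power_abs mult_ac)
  qed measurable
qed

lemma S_integrable_mult: "U \<in> S \<Longrightarrow> W \<in> S \<Longrightarrow> integrable M (\<lambda>\<omega>. U \<omega> * W \<omega>)"
  using S_integrable_powers[of U W 1 1] by simp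

lemma S_integrable_power: "U \<in> S \<Longrightarrow> integrable M (\<lambda>\<omega>. U \<omega> ^ n)"
  using S_integrable_powers[of U U n 0] by simp

lemma S_integrable_wick_wick:
  assumes U: "U \<in> S" and W: "W \<in> S"
  shows "integrable M (\<lambda>\<omega>. wick m v (U \<omega>) * wick n w (W \<omega>))"
proof -
  have "(U \<omega> ^ i / fact i * a) * (W \<omega> ^ j / fact j * b) = (a * b / (fact i * fact j)) * (U \<omega> ^ i * W \<omega> ^ j)" for i j a b \<omega>
    by simp
  then show ?thesis
    unfolding wick_def sum_product
    by (simp only:) (intro Bochner_Integration.integrable_sum integrable_mult_right S_integrable_powers U W)
qed

lemma cov_lincomb:
  assumes U: "U \<in> S" and W: "W \<in> S"
  shows "(\<integral>\<omega>. (x * U \<omega> + y * W \<omega>)\<^sup>2 \<partial>M) = x\<^sup>2 * cov U U + 2 * x * y * cov U W + y\<^sup>2 * cov W W"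
proof -
  note i = S_integrable_mult[OF U U] S_integrable_mult[OF U W] S_integrable_mult[OF W W]
  have "(\<integral>\<omega>. (x * U \<omega> + y * W \<omega>)\<^sup>2 \<partial>M) =
      (\<integral>\<omega>. x\<^sup>2 * (U \<omega> * U \<omega>) + (2 * x * y) * (U \<omega> * W \<omega>) + y\<^sup>2 * (W \<omega> * W \<omega>) \<partial>M)"
    by (intro Bochner_Integration.integral_cong) (auto simp: power2_eq_square algebra_simps)
  also have "\<dots> = x\<^sup>2 * cov U U + 2 * x * y * cov U W + y\<^sup>2 * cov W W"
    using i by simp
  finally show ?thesis .
qed

lemma cf_lincomb:
  assumes U: "U \<in> S" and W: "W \<in> S"
  shows "(\<integral>\<omega>. iexp (x * U \<omega> + y * W \<omega>) \<partial>M) =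
    of_real (exp (- (x\<^sup>2 * cov U U + 2 * x * y * cov U W + y\<^sup>2 * cov W W) / 2))"
  using S_cf[OF S_add[OF S_scale[OF U] S_scale[OF W]], of x y]
  by (simp only: cov_lincomb[OF U W])

text \<open>
  Multiplication by the powers of an imaginary parameter and summation turn the Wick powers into their
  generating function. The left-hand sides then add up to a joint characteristic function times a
  Gaussian factor; what remains after cancellation is an exponential series in the covariance.
\<close>

lemma wick_cf:
  assumes U: "U \<in> S" and W: "W \<in> S"
  shows "(\<integral>\<omega>. wick n (cov U U) (U \<omega>) * iexp (y * W \<omega>) \<partial>M) =
    (\<i> * y * cov U W) ^ n / fact n * exp (- (y\<^sup>2 * cov W W) / 2)"
proof -
  note [measurable] = S_meas[OF W] S_meas[OF U]
  define v where "v = cov U U"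
  define A where "A n = (\<integral>\<omega>. wick n v (U \<omega>) * iexp (y * W \<omega>) \<partial>M)" for n
  have "(\<lambda>n. (\<i> ^ n * A n) * of_real x ^ n) sums (exp (- (x * y * cov U W)) * exp (- (y\<^sup>2 * cov W W) / 2))" for x
  proof -
    \<comment> \<open>at the imaginary argument \<open>\<i> * x\<close> the factor \<open>exp (\<i> * x * U)\<close> is bounded\<close>
    define f where "f n \<omega> = (of_real (wick n v (U \<omega>)) * (\<i> * of_real x) ^ n) * iexp (y * W \<omega>)" for n \<omega>
    have s: "(\<lambda>n. f n \<omega>) sums (exp (\<i> * of_real x * U \<omega> - (\<i> * of_real x)\<^sup>2 * v / 2) * iexp (y * W \<omega>))" for \<omega>
      unfolding f_def by (intro sums_mult2 wick_generating)
    have bd: "(\<Sum>n<N. norm (f n \<omega>)) \<le> exp (x\<^sup>2 * \<bar>v\<bar> / 2) * exp (\<bar>x\<bar> * \<bar>U \<omega>\<bar>)" for N \<omega>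
      using wick_abs_sum_le[of "\<bar>x\<bar>" v "U \<omega>" N]
      by (simp add: f_def norm_mult norm_power norm_exp_eq_Re mult_exp_exp add_ac)
    have "(\<lambda>n. \<integral>\<omega>. f n \<omega> \<partial>M) sums (\<integral>\<omega>. exp (\<i> * of_real x * U \<omega> - (\<i> * of_real x)\<^sup>2 * v / 2) * iexp (y * W \<omega>) \<partial>M)"
      by (rule sums_integral_dominated(3)[OF _ s bd]) (auto simp: f_def intro!: integrable_mult_right S_exp_scale U)
    moreover have "(\<integral>\<omega>. f n \<omega> \<partial>M) = (\<i> ^ n * A n) * of_real x ^ n" for n
      unfolding A_def f_def
      by (subst integral_mult_right_zero[symmetric], subst integral_mult_left_zero[symmetric])
         (simp add: power_mult_distrib mult_ac)
    moreover have "(\<integral>\<omega>. exp (\<i> * of_real x * U \<omega> - (\<i> * of_real x)\<^sup>2 * v / 2) * iexp (y * W \<omega>) \<partial>M)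
       = of_real (exp (x\<^sup>2 * v / 2)) * (\<integral>\<omega>. iexp (x * U \<omega> + y * W \<omega>) \<partial>M)"
      by (subst integral_mult_right_zero[symmetric])
         (simp add: power_mult_distrib mult_exp_exp exp_of_real[symmetric] algebra_simps)
    moreover have "of_real (exp (x\<^sup>2 * v / 2)) * (\<integral>\<omega>. iexp (x * U \<omega> + y * W \<omega>) \<partial>M) = complex_of_real (exp (- (x * y * cov U W)) * exp (- (y\<^sup>2 * cov W W) / 2))"
      unfolding cf_lincomb[OF U W] v_def of_real_mult[symmetric] mult_exp_exp
      by (simp add: field_simps)
    ultimately show ?thesis by simp
  qed
  moreover have "(\<lambda>n. complex_of_real ((- (y * cov U W)) ^ n / fact n * exp (- (y\<^sup>2 * cov W W) / 2)) * of_real x ^ n) sums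
      complex_of_real (exp (- (x * y * cov U W)) * exp (- (y\<^sup>2 * cov W W) / 2))" for x
  proof -
    have "(\<lambda>n. (- (x * y * cov U W)) ^ n / fact n * exp (- (y\<^sup>2 * cov W W) / 2)) sums
      (exp (- (x * y * cov U W)) * exp (- (y\<^sup>2 * cov W W) / 2))"
      using exp_converges[of "- (x * y * cov U W)"] by (intro sums_mult2) (simp add: field_simps)
    then have "(\<lambda>n. complex_of_real ((- (x * y * cov U W)) ^ n / fact n * exp (- (y\<^sup>2 * cov W W) / 2))) sums
      complex_of_real (exp (- (x * y * cov U W)) * exp (- (y\<^sup>2 * cov W W) / 2))"
      by (simp only: sums_of_real_iff)
    then show ?thesis
      by (rule sums_cong[THEN iffD1, rotated])
         (simp add: power_mult_distrib power_minus[of "_ * _"] mult_ac)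
  qed
  ultimately have "\<i> ^ n * A n = complex_of_real ((- (y * cov U W)) ^ n / fact n * exp (- (y\<^sup>2 * cov W W) / 2))"
    by (intro complex_power_series_eq_imp) auto
  then have "(-\<i>) ^ n * (\<i> ^ n * A n) = (-\<i>) ^ n * complex_of_real ((- (y * cov U W)) ^ n / fact n * exp (- (y\<^sup>2 * cov W W) / 2))"
    by simp
  then show ?thesis
    unfolding A_def v_def by (simp add: mult.assoc[symmetric] power_mult_distrib[symmetric])
qed

text \<open>
  The generating function of the second factor reduces the inner products to \<open>wick_cf\<close>, in which its
  variance cancels; a single power of the parameter is left, which is orthogonality.
\<close>

lemma wick_wick:
  assumes U: "U \<in> S" and W: "W \<in> S"
  shows "(\<integral>\<omega>. wick n (cov U U) (U \<omega>) * wick k (cov W W) (W \<omega>) \<partial>M) =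
    (if k = n then cov U W ^ n / fact n else 0)"
proof -
  note [measurable] = S_meas[OF W] S_meas[OF U]
  define v where "v = cov U U"
  define w where "w = cov W W"
  define A where "A k = (\<integral>\<omega>. wick n v (U \<omega>) * wick k w (W \<omega>) \<partial>M)" for k
  have "(\<lambda>k. (\<i> ^ k * A k) * of_real y ^ k) sums ((\<i> * y * cov U W) ^ n / fact n)" for y
  proof -
    define f where "f k \<omega> = of_real (wick n v (U \<omega>)) * (of_real (wick k w (W \<omega>)) * (\<i> * of_real y) ^ k)" for k \<omega>
    have s: "(\<lambda>k. f k \<omega>) sums (of_real (wick n v (U \<omega>)) * exp (\<i> * of_real y * W \<omega> - (\<i> * of_real y)\<^sup>2 * w / 2))" for \<omega>
      unfolding f_def by (intro sums_mult wick_generating)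
    have bd: "(\<Sum>n<N. norm (f n \<omega>)) \<le> exp (\<bar>v\<bar> / 2 + y\<^sup>2 * \<bar>w\<bar> / 2) * (exp (1 * \<bar>U \<omega>\<bar>) * exp (\<bar>y\<bar> * \<bar>W \<omega>\<bar>))" for N \<omega>
    proof -
      have "(\<Sum>n<Suc n. \<bar>wick n v (U \<omega>)\<bar> * 1 ^ n) \<le> exp (1 * \<bar>U \<omega>\<bar> + 1\<^sup>2 * \<bar>v\<bar> / 2)"
        by (rule wick_abs_sum_le) simp
      moreover have "0 \<le> (\<Sum>i<n. \<bar>wick i v (U \<omega>)\<bar>)" by (simp add: sum_nonneg)
      ultimately have 1: "\<bar>wick n v (U \<omega>)\<bar> \<le> exp (1 * \<bar>U \<omega>\<bar> + 1\<^sup>2 * \<bar>v\<bar> / 2)"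
        unfolding sum.lessThan_Suc power_one mult_1_right by linarith
      have "(\<Sum>n<N. norm (f n \<omega>)) = \<bar>wick n v (U \<omega>)\<bar> * (\<Sum>k<N. \<bar>wick k w (W \<omega>)\<bar> * \<bar>y\<bar> ^ k)"
        by (simp add: f_def norm_mult norm_power sum_distrib_left)
      also have "\<dots> \<le> exp (1 * \<bar>U \<omega>\<bar> + 1\<^sup>2 * \<bar>v\<bar> / 2) * exp (\<bar>y\<bar> * \<bar>W \<omega>\<bar> + \<bar>y\<bar>\<^sup>2 * \<bar>w\<bar> / 2)"
        by (intro mult_mono 1 wick_abs_sum_le) (auto intro!: sum_nonneg)
      also have "\<dots> = exp (\<bar>v\<bar> / 2 + y\<^sup>2 * \<bar>w\<bar> / 2) * (exp (1 * \<bar>U \<omega>\<bar>) * exp (\<bar>y\<bar> * \<bar>W \<omega>\<bar>))"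
        by (simp add: mult_exp_exp add_ac)
      finally show ?thesis .
    qed
    have "(\<lambda>k. \<integral>\<omega>. f k \<omega> \<partial>M) sums (\<integral>\<omega>. of_real (wick n v (U \<omega>)) * exp (\<i> * of_real y * W \<omega> - (\<i> * of_real y)\<^sup>2 * w / 2) \<partial>M)"
      by (rule sums_integral_dominated(3)[OF _ s bd]) 
         (auto simp: f_def intro!: integrable_mult_right S_exp_mult[of _ _ 1, simplified] U W)
    moreover have "(\<integral>\<omega>. f k \<omega> \<partial>M) = (\<i> ^ k * A k) * of_real y ^ k" for k
      unfolding A_def f_def integral_complex_of_real[symmetric]
      by (subst integral_mult_right_zero[symmetric], subst integral_mult_left_zero[symmetric])
         (simp add: power_mult_distrib mult_ac)
    moreover have "(\<integral>\<omega>. of_real (wick n v (U \<omega>)) * exp (\<i> * of_real y * W \<omega> - (\<i> * of_real y)\<^sup>2 * w / 2) \<partial>M)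
       = of_real (exp (y\<^sup>2 * w / 2)) * (\<integral>\<omega>. wick n v (U \<omega>) * iexp (y * W \<omega>) \<partial>M)"
      by (subst integral_mult_right_zero[symmetric])
         (simp add: power_mult_distrib mult_exp_exp exp_of_real[symmetric] algebra_simps)
    moreover have "of_real (exp (y\<^sup>2 * w / 2)) * (\<integral>\<omega>. wick n v (U \<omega>) * iexp (y * W \<omega>) \<partial>M) = (\<i> * y * cov U W) ^ n / fact n"
      unfolding v_def w_def wick_cf[OF U W] by (simp add: mult_exp_exp exp_of_real[symmetric])
    ultimately show ?thesis by simp
  qed
  moreover have "(\<lambda>k. (if k = n then (\<i> * cov U W) ^ n / fact n else 0) * of_real y ^ k) sums ((\<i> * y * cov U W) ^ n / fact n)" for y
    using sums_single[of n "\<lambda>k. (\<i> * cov U W) ^ k / fact k * of_real y ^ k"]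
    by (rule sums_cong[THEN iffD1, rotated, THEN back_subst[of "(sums) _"]]) (auto simp: power_mult_distrib)
  ultimately have "\<i> ^ k * A k = (if k = n then (\<i> * cov U W) ^ n / fact n else 0)"
    by (intro complex_power_series_eq_imp) auto
  then have "(-\<i>) ^ k * (\<i> ^ k * A k) = (-\<i>) ^ k * (if k = n then (\<i> * cov U W) ^ n / fact n else 0)"
    by simp
  then have "complex_of_real (A k) = of_real (if k = n then cov U W ^ n / fact n else 0)"
    by (simp add: mult.assoc[symmetric] power_mult_distrib[symmetric] split: if_splits)
  then show ?thesis
    unfolding A_def v_def w_def of_real_eq_iff .
qed

text \<open>
  A power of \<open>W\<close> is, up to a constant factor, the Wick power of the same order plus lower powers.
\<close>

lemma wick_orth_power:
  assumes U: "U \<in> S" and W: "W \<in> S" and "k < n"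
  shows "(\<integral>\<omega>. wick n (cov U U) (U \<omega>) * W \<omega> ^ k \<partial>M) = 0"
  using \<open>k < n\<close>
proof (induction k rule: less_induct)
  case (less k)
  define B where "B \<omega> = wick n (cov U U) (U \<omega>)" for \<omega>
  have i: "integrable M (\<lambda>\<omega>. B \<omega> * W \<omega> ^ j)" for j
  proof -
    have "(U \<omega> ^ i / fact i * a) * W \<omega> ^ j = (a / fact i) * (U \<omega> ^ i * W \<omega> ^ j)" for i a \<omega>
      by simp
    then show ?thesis
      unfolding B_def wick_def sum_distrib_right
      by (simp only:) (intro Bochner_Integration.integrable_sum integrable_mult_right S_integrable_powers U W)
  qed
  have "0 = (\<integral>\<omega>. B \<omega> * wick k (cov W W) (W \<omega>) \<partial>M)"
    using wick_wick[OF U W, of n k] less.prems by (simp add: B_def)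
  also have "\<dots> = (\<integral>\<omega>. (\<Sum>i\<le>k. (1 / fact i * gauss_coeff (cov W W) (k - i)) * (B \<omega> * W \<omega> ^ i)) \<partial>M)"
    by (intro Bochner_Integration.integral_cong) (auto simp: wick_def sum_distrib_left intro!: sum.cong)
  also have "\<dots> = (\<Sum>i\<le>k. (1 / fact i * gauss_coeff (cov W W) (k - i)) * (\<integral>\<omega>. B \<omega> * W \<omega> ^ i \<partial>M))"
    using i by simp
  also have "\<dots> = (\<Sum>i\<in>{k}. (1 / fact i * gauss_coeff (cov W W) (k - i)) * (\<integral>\<omega>. B \<omega> * W \<omega> ^ i \<partial>M))"
    using less by (intro sum.mono_neutral_right) (auto simp: B_def)
  finally show ?case by (simp add: B_def gauss_coeff_def)
qed

lemma expectation_cos: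
  assumes "U \<in> S"
  shows "(\<integral>\<omega>. cos (U \<omega>) \<partial>M) = exp (- cov U U / 2)"
proof -
  note [measurable] = S_meas[OF assms]
  have i: "integrable M (\<lambda>\<omega>. iexp (U \<omega>))"
    by (intro integrable_const_bound[where B = 1]) auto
  have "(\<integral>\<omega>. cos (U \<omega>) \<partial>M) = (\<integral>\<omega>. Re (iexp (U \<omega>)) \<partial>M)"
    by (simp add: Re_exp)
  also have "\<dots> = Re (\<integral>\<omega>. iexp (U \<omega>) \<partial>M)" by (rule integral_Re[OF i])
  finally show ?thesis using S_cf[OF assms] by (simp add: power2_eq_square)
qed

text \<open>
  Product-to-sum formula and the characteristic functions of \<open>U + W\<close> and \<open>U - W\<close>.
\<close>

lemma expectation_cos_cos:
  assumes U: "U \<in> S" and W: "W \<in> S"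
  shows "(\<integral>\<omega>. cos (U \<omega>) * cos (W \<omega>) \<partial>M) = exp (- (cov U U + cov W W) / 2) * cosh (cov U W)"
proof -
  note [measurable] = S_meas[OF W] S_meas[OF U]
  have i: "integrable M (\<lambda>\<omega>. cos (1 * U \<omega> + y * W \<omega>))" for y
    by (intro integrable_const_bound[where B = 1]) auto
  have e: "(\<integral>\<omega>. cos (1 * U \<omega> + y * W \<omega>) \<partial>M) = exp (- (cov U U + 2 * y * cov U W + y\<^sup>2 * cov W W) / 2)" for y
    using expectation_cos[OF S_add[OF S_scale[OF U] S_scale[OF W]], of 1 y]
    unfolding power2_eq_square[symmetric] cov_lincomb[OF U W, of 1 y] by simp
  have "(\<integral>\<omega>. cos (U \<omega>) * cos (W \<omega>) \<partial>M) = (\<integral>\<omega>. (cos (1 * U \<omega> + 1 * W \<omega>) + cos (1 * U \<omega> + (-1) * W \<omega>)) / 2 \<partial>M)"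
    by (intro Bochner_Integration.integral_cong) (auto simp: cos_add cos_diff)
  also have "\<dots> = ((\<integral>\<omega>. cos (1 * U \<omega> + 1 * W \<omega>) \<partial>M) + (\<integral>\<omega>. cos (1 * U \<omega> + (-1) * W \<omega>) \<partial>M)) / 2"
    using i[of 1] i[of "-1"] by simp
  also have "\<dots> = exp (- (cov U U + cov W W) / 2) * cosh (cov U W)"
  proof -
    have "exp (- (cov U U + 2 * y * cov U W + y\<^sup>2 * cov W W) / 2) =
        exp (- (cov U U + cov W W) / 2) * exp (- y * cov U W)" if "y\<^sup>2 = 1" for y
      using that by (simp add: mult_exp_exp add_divide_distrib diff_divide_distrib)
    from this[of 1] this[of "-1"] show ?thesis
      unfolding e by (simp add: cosh_field_def algebra_simps)
  qed
  finally show ?thesis .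
qed

text \<open>
  Real part of \<open>wick_cf\<close> for \<open>y = 1\<close>. As the \<open>2 * m\<close>-th power of \<open>\<i>\<close> is the sign \<open>(-1) ^ m\<close>, the
  signs cancel.
\<close>

lemma expectation_cos_wick:
  assumes U: "U \<in> S" and W: "W \<in> S"
  shows "(\<integral>\<omega>. cos (W \<omega>) * ((-1) ^ m * wick (2 * m) (cov U U) (U \<omega>)) \<partial>M) =
    exp (- cov W W / 2) * (cov U W ^ (2 * m) / fact (2 * m))"
proof -
  note [measurable] = S_meas[OF W] S_meas[OF U]
  have "integrable M (\<lambda>\<omega>. wick (2*m) (cov U U) (U \<omega>))"
    using S_integrable_wick_wick[OF U W, of "2*m" "cov U U" 0] by simp
  then have i: "integrable M (\<lambda>\<omega>. wick (2 * m) (cov U U) (U \<omega>) * iexp (1 * W \<omega>))"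
    by (rule Bochner_Integration.integrable_bound) (auto simp: norm_mult)
  have "(\<integral>\<omega>. cos (W \<omega>) * ((-1) ^ m * wick (2 * m) (cov U U) (U \<omega>)) \<partial>M) =
      (\<integral>\<omega>. (-1) ^ m * Re (wick (2 * m) (cov U U) (U \<omega>) * iexp (1 * W \<omega>)) \<partial>M)"
    by (intro Bochner_Integration.integral_cong) (auto simp: Re_exp)
  also have "\<dots> = (-1) ^ m * Re (\<integral>\<omega>. wick (2 * m) (cov U U) (U \<omega>) * iexp (1 * W \<omega>) \<partial>M)"
    using integral_Re[OF i] by simp
  also have "(\<integral>\<omega>. wick (2 * m) (cov U U) (U \<omega>) * iexp (1 * W \<omega>) \<partial>M) =
      (\<i> * cov U W) ^ (2 * m) / fact (2 * m) * exp (- cov W W / 2)"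
    unfolding wick_cf[OF U W] by simp
  also have "\<dots> = complex_of_real ((-1) ^ m * (cov U W ^ (2 * m) / fact (2 * m) * exp (- cov W W / 2)))"
    by (simp add: power_mult_distrib power_mult) (metis power_minus)
  finally have "(\<integral>\<omega>. cos (W \<omega>) * ((-1) ^ m * wick (2 * m) (cov U U) (U \<omega>)) \<partial>M) =
     (-1) ^ m * ((-1) ^ m * (cov U W ^ (2 * m) / fact (2 * m) * exp (- cov W W / 2)))"
    by (simp only: Re_complex_of_real)
  then show ?thesis
    by (simp add: mult.assoc[symmetric] power_mult_distrib[symmetric])
qed

end

section \<open>Limits of square-integrable variables\<close>

context prob_space
begin

lemma L2_meas: "F \<in> L2 M \<Longrightarrow> F \<in> borel_measurable M"
  by (simp add: L2_def)

lemma L2_square_integrable: "F \<in> L2 M \<Longrightarrow> integrable M (\<lambda>\<omega>. (F \<omega>)\<^sup>2)"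
  by (simp add: L2_def)

lemma L2_mult_integrable:
  assumes "F \<in> L2 M" "G \<in> L2 M"
  shows "integrable M (\<lambda>\<omega>. F \<omega> * G \<omega>)"
proof (rule Bochner_Integration.integrable_bound)
  show "integrable M (\<lambda>\<omega>. (F \<omega>)\<^sup>2 + (G \<omega>)\<^sup>2)"
    using assms by (simp add: L2_def)
  have "\<bar>x * y\<bar> \<le> x\<^sup>2 + y\<^sup>2" for x y :: real
    using sum_squares_bound[of "\<bar>x\<bar>" "\<bar>y\<bar>"] abs_ge_zero[of "x * y"] unfolding abs_mult power2_abs
    by linarith
  then show "AE \<omega> in M. norm (F \<omega> * G \<omega>) \<le> norm ((F \<omega>)\<^sup>2 + (G \<omega>)\<^sup>2)"
    by simp
qed (use assms in \<open>auto simp: L2_def\<close>)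

lemma L2_const: "(\<lambda>_. c) \<in> L2 M"
  by (simp add: L2_def)

lemma L2_integrable: "F \<in> L2 M \<Longrightarrow> integrable M F"
  using L2_mult_integrable[OF _ L2_const[of 1]] by simp

lemma L2_scale: "F \<in> L2 M \<Longrightarrow> (\<lambda>\<omega>. c * F \<omega>) \<in> L2 M"
  by (auto simp: L2_def power_mult_distrib)

lemma L2_add:
  assumes "F \<in> L2 M" "G \<in> L2 M"
  shows "(\<lambda>\<omega>. F \<omega> + G \<omega>) \<in> L2 M"
  using assms L2_mult_integrable[OF assms]
  by (auto simp: L2_def power2_sum mult.assoc)

lemma L2_diff:
  assumes "F \<in> L2 M" "G \<in> L2 M"
  shows "(\<lambda>\<omega>. F \<omega> - G \<omega>) \<in> L2 M"
  using L2_add[OF assms(1) L2_scale[OF assms(2), of "-1"]] by simp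

lemma L2_sum: "(\<And>i. i \<in> I \<Longrightarrow> F i \<in> L2 M) \<Longrightarrow> (\<lambda>\<omega>. \<Sum>i\<in>I. F i \<omega>) \<in> L2 M"
  by (induction I rule: infinite_finite_induct) (auto intro: L2_add L2_const)

lemma integral_diff_square:
  assumes "F \<in> L2 M" "G \<in> L2 M"
  shows "(\<integral>\<omega>. (F \<omega> - G \<omega>)\<^sup>2 \<partial>M) = (\<integral>\<omega>. (F \<omega>)\<^sup>2 \<partial>M) - 2 * (\<integral>\<omega>. F \<omega> * G \<omega> \<partial>M) + (\<integral>\<omega>. (G \<omega>)\<^sup>2 \<partial>M)"
  using L2_mult_integrable[OF assms] assms[THEN L2_square_integrable]
  by (simp add: power2_diff mult.assoc)

lemma cauchy_schwarz:
  assumes "F \<in> L2 M" "G \<in> L2 M"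
  shows "(\<integral>\<omega>. F \<omega> * G \<omega> \<partial>M)\<^sup>2 \<le> (\<integral>\<omega>. (F \<omega>)\<^sup>2 \<partial>M) * (\<integral>\<omega>. (G \<omega>)\<^sup>2 \<partial>M)"
proof -
  define a b c where "a = (\<integral>\<omega>. (F \<omega>)\<^sup>2 \<partial>M)" "b = (\<integral>\<omega>. F \<omega> * G \<omega> \<partial>M)" "c = (\<integral>\<omega>. (G \<omega>)\<^sup>2 \<partial>M)"
  have q: "0 \<le> x\<^sup>2 * a - 2 * (x * y * b) + y\<^sup>2 * c" for x y
  proof -
    have "0 \<le> (\<integral>\<omega>. (x * F \<omega> - y * G \<omega>)\<^sup>2 \<partial>M)" by simp
    also have "\<dots> = x\<^sup>2 * a - 2 * (x * y * b) + y\<^sup>2 * c"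
      by (subst integral_diff_square[OF L2_scale[OF assms(1)] L2_scale[OF assms(2)]])
         (simp add: power_mult_distrib a_b_c_def flip: integral_mult_right_zero, simp add: mult_ac)
    finally show ?thesis .
  qed
  have "0 \<le> a" "0 \<le> c" by (auto simp: a_b_c_def)
  have "b\<^sup>2 \<le> a * c"
  proof (cases "c = 0")
    case True
    show ?thesis
    proof (cases "b = 0")
      case False
      have "0 \<le> a - 2 * ((a + 1) / b * b)"
        using q[of 1 "(a + 1) / b"] True by simp
      then show ?thesis using False \<open>0 \<le> a\<close> by simp
    qed (use \<open>0 \<le> a\<close> \<open>0 \<le> c\<close> in simp)
  next
    case False
    then have "0 < c" using \<open>0 \<le> c\<close> by simp
    have "0 \<le> c * (a * c - b\<^sup>2)" using q[of c b] by (simp add: power2_eq_square algebra_simps)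
    then show ?thesis using \<open>0 < c\<close> by (simp add: zero_le_mult_iff)
  qed
  then show ?thesis by (simp add: a_b_c_def)
qed

lemma square_integral_le:
  assumes "F \<in> L2 M"
  shows "(\<integral>\<omega>. F \<omega> \<partial>M)\<^sup>2 \<le> (\<integral>\<omega>. (F \<omega>)\<^sup>2 \<partial>M)"
  using cauchy_schwarz[OF assms L2_const[of 1]] by (simp add: prob_space)

lemma square_diff_triangle:
  assumes "F \<in> L2 M" "G \<in> L2 M" "L \<in> L2 M"
  shows "(\<integral>\<omega>. (F \<omega> - L \<omega>)\<^sup>2 \<partial>M) \<le> 2 * (\<integral>\<omega>. (F \<omega> - G \<omega>)\<^sup>2 \<partial>M) + 2 * (\<integral>\<omega>. (G \<omega> - L \<omega>)\<^sup>2 \<partial>M)"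
proof -
  note i = L2_square_integrable[OF L2_diff]
  have "(x - z)\<^sup>2 \<le> 2 * (x - y)\<^sup>2 + 2 * (y - z)\<^sup>2" for x y z :: real
    using zero_le_power2[of "(x - y) - (y - z)"] by (simp add: power2_eq_square algebra_simps)
  then have "(\<integral>\<omega>. (F \<omega> - L \<omega>)\<^sup>2 \<partial>M) \<le> (\<integral>\<omega>. 2 * (F \<omega> - G \<omega>)\<^sup>2 + 2 * (G \<omega> - L \<omega>)\<^sup>2 \<partial>M)"
    using assms i by (intro integral_mono) auto
  also have "\<dots> = 2 * (\<integral>\<omega>. (F \<omega> - G \<omega>)\<^sup>2 \<partial>M) + 2 * (\<integral>\<omega>. (G \<omega> - L \<omega>)\<^sup>2 \<partial>M)"
    using assms i by simp
  finally show ?thesis .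
qed

lemma tendsto_L2_in_L2: "tendsto_L2 M F L \<F> \<Longrightarrow> L \<in> L2 M"
  by (simp add: tendsto_L2_def)

lemma tendsto_L2_inner:
  assumes F: "tendsto_L2 M F L \<F>" and G: "G \<in> L2 M"
  shows "((\<lambda>i. \<integral>\<omega>. F i \<omega> * G \<omega> \<partial>M) \<longlongrightarrow> (\<integral>\<omega>. L \<omega> * G \<omega> \<partial>M)) \<F>"
proof -
  have L: "L \<in> L2 M" and ev: "\<forall>\<^sub>F i in \<F>. F i \<in> L2 M"
    and lim: "((\<lambda>i. \<integral>\<omega>. (F i \<omega> - L \<omega>)\<^sup>2 \<partial>M) \<longlongrightarrow> 0) \<F>"
    using F by (auto simp: tendsto_L2_def)
  have "((\<lambda>i. sqrt ((\<integral>\<omega>. (F i \<omega> - L \<omega>)\<^sup>2 \<partial>M) * (\<integral>\<omega>. (G \<omega>)\<^sup>2 \<partial>M))) \<longlongrightarrow> sqrt (0 * (\<integral>\<omega>. (G \<omega>)\<^sup>2 \<partial>M))) \<F>"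
    by (intro tendsto_intros lim)
  then have "((\<lambda>i. sqrt ((\<integral>\<omega>. (F i \<omega> - L \<omega>)\<^sup>2 \<partial>M) * (\<integral>\<omega>. (G \<omega>)\<^sup>2 \<partial>M))) \<longlongrightarrow> 0) \<F>"
    by simp
  then have "((\<lambda>i. (\<integral>\<omega>. F i \<omega> * G \<omega> \<partial>M) - (\<integral>\<omega>. L \<omega> * G \<omega> \<partial>M)) \<longlongrightarrow> 0) \<F>"
  proof (rule Lim_null_comparison[rotated])
    show "\<forall>\<^sub>F i in \<F>. norm ((\<integral>\<omega>. F i \<omega> * G \<omega> \<partial>M) - (\<integral>\<omega>. L \<omega> * G \<omega> \<partial>M))
        \<le> sqrt ((\<integral>\<omega>. (F i \<omega> - L \<omega>)\<^sup>2 \<partial>M) * (\<integral>\<omega>. (G \<omega>)\<^sup>2 \<partial>M))"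
      using ev
    proof eventually_elim
      case (elim i)
      have "(\<integral>\<omega>. F i \<omega> * G \<omega> \<partial>M) - (\<integral>\<omega>. L \<omega> * G \<omega> \<partial>M) = (\<integral>\<omega>. (F i \<omega> - L \<omega>) * G \<omega> \<partial>M)"
        using L2_mult_integrable[OF elim G] L2_mult_integrable[OF L G] by (simp add: left_diff_distrib)
      then show ?case
        using real_sqrt_le_mono[OF cauchy_schwarz[OF L2_diff[OF elim L] G]] by simp
    qed
  qed
  then show ?thesis by (simp add: LIM_zero_iff)
qed

lemma tendsto_L2_norm:
  assumes F: "tendsto_L2 M F L \<F>"
  shows "((\<lambda>i. \<integral>\<omega>. (F i \<omega>)\<^sup>2 \<partial>M) \<longlongrightarrow> (\<integral>\<omega>. (L \<omega>)\<^sup>2 \<partial>M)) \<F>"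
proof -
  have L: "L \<in> L2 M" and ev: "\<forall>\<^sub>F i in \<F>. F i \<in> L2 M"
    and lim: "((\<lambda>i. \<integral>\<omega>. (F i \<omega> - L \<omega>)\<^sup>2 \<partial>M) \<longlongrightarrow> 0) \<F>"
    using F by (auto simp: tendsto_L2_def)
  have "((\<lambda>i. (\<integral>\<omega>. (F i \<omega> - L \<omega>)\<^sup>2 \<partial>M) + 2 * (\<integral>\<omega>. F i \<omega> * L \<omega> \<partial>M) - (\<integral>\<omega>. (L \<omega>)\<^sup>2 \<partial>M)) \<longlongrightarrow>
      0 + 2 * (\<integral>\<omega>. L \<omega> * L \<omega> \<partial>M) - (\<integral>\<omega>. (L \<omega>)\<^sup>2 \<partial>M)) \<F>"
    by (intro tendsto_intros lim tendsto_L2_inner[OF F L])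
  moreover have "\<forall>\<^sub>F i in \<F>. (\<integral>\<omega>. (F i \<omega> - L \<omega>)\<^sup>2 \<partial>M) + 2 * (\<integral>\<omega>. F i \<omega> * L \<omega> \<partial>M) - (\<integral>\<omega>. (L \<omega>)\<^sup>2 \<partial>M) = (\<integral>\<omega>. (F i \<omega>)\<^sup>2 \<partial>M)"
    using ev by eventually_elim (simp add: integral_diff_square L)
  ultimately show ?thesis
    by (subst (asm) tendsto_cong) (auto simp: power2_eq_square)
qed

lemma tendsto_L2_compose: "tendsto_L2 M F L \<F> \<Longrightarrow> filterlim f \<F> \<G> \<Longrightarrow> tendsto_L2 M (\<lambda>i. F (f i)) L \<G>"
  unfolding tendsto_L2_def
  by (auto intro: filterlim_compose[where g = "\<lambda>i. \<integral>\<omega>. (F i \<omega> - L \<omega>)\<^sup>2 \<partial>M"] eventually_compose_filterlim)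

text \<open>
  The theorem of Riesz and Fischer. Along a rapidly converging subsequence the increments have finite
  total expectation, so it converges almost surely; Fatou's lemma carries the Cauchy bounds over to the
  distance from the almost sure limit.
\<close>

lemma L2_complete:
  assumes F: "\<And>n. F n \<in> L2 M"
    and Cauchy: "\<And>e. 0 < e \<Longrightarrow> \<exists>n0. \<forall>m\<ge>n0. \<forall>n\<ge>n0. (\<integral>\<omega>. (F m \<omega> - F n \<omega>)\<^sup>2 \<partial>M) < e"
  shows "\<exists>L. tendsto_L2 M F L sequentially"
proof -
  note [measurable] = L2_meas[OF F]
  have "\<forall>k. \<exists>n0. \<forall>m\<ge>n0. \<forall>n\<ge>n0. (\<integral>\<omega>. (F m \<omega> - F n \<omega>)\<^sup>2 \<partial>M) < (1 / 4) ^ k"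
    using Cauchy by simp
  from choice[OF this] obtain N
    where N: "\<And>k m n. N k \<le> m \<Longrightarrow> N k \<le> n \<Longrightarrow> (\<integral>\<omega>. (F m \<omega> - F n \<omega>)\<^sup>2 \<partial>M) < (1 / 4) ^ k"
    by blast
  \<comment> \<open>partial sums make the chosen indices monotone in \<open>k\<close>\<close>
  define r where "r k = (\<Sum>i\<le>k. N i)" for k
  have rN: "N k \<le> r k" for k unfolding r_def by (intro member_le_sum) auto
  have rk: "r k \<le> r (Suc k)" for k by (simp add: r_def)
  have r_mono: "r k \<le> r l" if "k \<le> l" for k l using lift_Suc_mono_le[of r, OF rk that] .
  define D where "D k \<omega> = \<bar>F (r (Suc k)) \<omega> - F (r k) \<omega>\<bar>" for k \<omega>
  have D_L2: "D k \<in> L2 M" for k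
    using L2_diff[OF F F] unfolding D_def L2_def by auto
  have ID: "(\<integral>\<omega>. D k \<omega> \<partial>M) \<le> (1 / 2) ^ k" for k
  proof -
    have "(\<integral>\<omega>. D k \<omega> \<partial>M)\<^sup>2 \<le> (\<integral>\<omega>. (D k \<omega>)\<^sup>2 \<partial>M)" by (rule square_integral_le[OF D_L2])
    also have "\<dots> \<le> (1 / 4) ^ k"
      unfolding D_def power2_abs using N[of k "r (Suc k)" "r k"] rN[of k] rk[of k] by simp
    also have "(1 / 4 :: real) ^ k = ((1 / 2) ^ k)\<^sup>2"
      by (simp add: power2_eq_square flip: power_mult_distrib)
    finally show ?thesis by (rule power2_le_imp_le) simp
  qed
  have D0: "0 \<le> D k \<omega>" for k \<omega> by (simp add: D_def)
  have [measurable]: "D k \<in> borel_measurable M" for k by (rule L2_meas[OF D_L2])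
  have "(\<integral>\<^sup>+\<omega>. (\<Sum>k. ennreal (D k \<omega>)) \<partial>M) = (\<Sum>k. \<integral>\<^sup>+\<omega>. ennreal (D k \<omega>) \<partial>M)"
    by (rule nn_integral_suminf) simp
  also have "\<dots> = (\<Sum>k. ennreal (\<integral>\<omega>. D k \<omega> \<partial>M))"
    using D0 L2_integrable[OF D_L2] by (intro suminf_cong nn_integral_eq_integral) auto
  also have "\<dots> \<le> (\<Sum>k. ennreal ((1 / 2) ^ k))"
    by (intro suminf_le ennreal_leI ID) auto
  also have "\<dots> = ennreal (\<Sum>k. (1 / 2) ^ k)"
    by (intro suminf_ennreal2) auto
  finally have "(\<integral>\<^sup>+\<omega>. (\<Sum>k. ennreal (D k \<omega>)) \<partial>M) \<noteq> \<infinity>"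
    by (auto simp: top_unique)
  then have "AE \<omega> in M. (\<Sum>k. ennreal (D k \<omega>)) \<noteq> \<infinity>"
    by (intro nn_integral_PInf_AE) auto
  then have conv: "AE \<omega> in M. (\<lambda>k. F (r k) \<omega>) \<longlonglongrightarrow> lim (\<lambda>k. F (r k) \<omega>)"
  proof eventually_elim
    case (elim \<omega>)
    then have "summable (\<lambda>k. D k \<omega>)"
      using D0 by (intro summable_suminf_not_top) auto
    then have "summable (\<lambda>k. F (r (Suc k)) \<omega> - F (r k) \<omega>)"
      unfolding D_def by (rule summable_rabs_cancel)
    then have "convergent (\<lambda>k. F (r k) \<omega> - F (r 0) \<omega>)"
      using sum_lessThan_telescope[of "\<lambda>k. F (r k) \<omega>"] by (simp add: summable_iff_convergent)
    then have "convergent (\<lambda>k. (F (r k) \<omega> - F (r 0) \<omega>) + F (r 0) \<omega>)"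
      by (rule convergent_add[OF _ convergent_const])
    then show ?case unfolding convergent_LIMSEQ_iff by simp
  qed
  define L where "L \<omega> = lim (\<lambda>k. F (r k) \<omega>)" for \<omega>
  have [measurable]: "L \<in> borel_measurable M" unfolding L_def by measurable
  have fatou: "integrable M (\<lambda>\<omega>. (F m \<omega> - L \<omega>)\<^sup>2)" "(\<integral>\<omega>. (F m \<omega> - L \<omega>)\<^sup>2 \<partial>M) \<le> (1 / 4) ^ j"
    if m: "N j \<le> m" for m j
  proof -
    have "(\<integral>\<^sup>+\<omega>. ennreal ((F m \<omega> - L \<omega>)\<^sup>2) \<partial>M) = (\<integral>\<^sup>+\<omega>. liminf (\<lambda>k. ennreal ((F m \<omega> - F (r k) \<omega>)\<^sup>2)) \<partial>M)"
    proof (rule nn_integral_cong_AE)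
      show "AE \<omega> in M. ennreal ((F m \<omega> - L \<omega>)\<^sup>2) = liminf (\<lambda>k. ennreal ((F m \<omega> - F (r k) \<omega>)\<^sup>2))"
        using conv
      proof eventually_elim
        case (elim \<omega>)
        then have "(\<lambda>k. ennreal ((F m \<omega> - F (r k) \<omega>)\<^sup>2)) \<longlonglongrightarrow> ennreal ((F m \<omega> - L \<omega>)\<^sup>2)"
          unfolding L_def by (intro tendsto_intros)
        then show ?case by (intro lim_imp_Liminf[symmetric]) auto
      qed
    qed
    also have "\<dots> \<le> liminf (\<lambda>k. \<integral>\<^sup>+\<omega>. ennreal ((F m \<omega> - F (r k) \<omega>)\<^sup>2) \<partial>M)"
      by (rule nn_integral_liminf) measurable
    also have "\<dots> \<le> ennreal ((1 / 4) ^ j)"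
    proof (rule Liminf_le)
      show "\<forall>\<^sub>F k in sequentially. (\<integral>\<^sup>+\<omega>. ennreal ((F m \<omega> - F (r k) \<omega>)\<^sup>2) \<partial>M) \<le> ennreal ((1 / 4) ^ j)"
        using eventually_ge_at_top[of j]
      proof eventually_elim
        case (elim k)
        have "N j \<le> r k" using rN[of j] r_mono[OF elim] by simp
        from N[OF m this] show ?case
          using L2_square_integrable[OF L2_diff[OF F F]]
          by (subst nn_integral_eq_integral) (auto intro!: ennreal_leI)
      qed
    qed simp
    finally have *: "(\<integral>\<^sup>+\<omega>. ennreal ((F m \<omega> - L \<omega>)\<^sup>2) \<partial>M) \<le> ennreal ((1 / 4) ^ j)" .
    then show i: "integrable M (\<lambda>\<omega>. (F m \<omega> - L \<omega>)\<^sup>2)"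
      by (intro integrableI_nonneg) (auto intro: le_less_trans)
    show "(\<integral>\<omega>. (F m \<omega> - L \<omega>)\<^sup>2 \<partial>M) \<le> (1 / 4) ^ j"
      using * by (subst (asm) nn_integral_eq_integral[OF i]) auto
  qed
  have "(\<lambda>\<omega>. F (N 0) \<omega> - L \<omega>) \<in> L2 M"
    using fatou(1)[of 0 "N 0"] by (simp add: L2_def)
  from L2_diff[OF F[of "N 0"] this] have L: "L \<in> L2 M" by simp
  have "(\<lambda>m. \<integral>\<omega>. (F m \<omega> - L \<omega>)\<^sup>2 \<partial>M) \<longlonglongrightarrow> 0"
  proof (rule LIMSEQ_I)
    fix e :: real assume "0 < e"
    then obtain j where "(1 / 4) ^ j < e" using real_arch_pow_inv[of e "1/4"] by auto
    then show "\<exists>no. \<forall>n\<ge>no. norm ((\<integral>\<omega>. (F n \<omega> - L \<omega>)\<^sup>2 \<partial>M) - 0) < e"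
      using fatou(2)[of j] by (intro exI[of _ "N j"]) force
  qed
  then show ?thesis using F L by (auto simp: tendsto_L2_def)
qed

text \<open>
  For \<open>\<epsilon>\<close> and \<open>\<delta>\<close> below \<open>\<eta>\<close>, expanding the square bounds the squared distance of \<open>F \<epsilon>\<close> and \<open>F \<delta>\<close> by
  \<open>2 * (s - J \<eta>)\<close>, where \<open>J \<eta>\<close> is the squared norm of \<open>F \<eta>\<close> and \<open>s\<close> the supremum of these. So bounded
  norms force the Cauchy property.
\<close>

lemma L2_limit_of_monotone_gram:
  fixes F :: "real \<Rightarrow> 'a \<Rightarrow> real"
  assumes F: "\<And>\<epsilon>. 0 < \<epsilon> \<Longrightarrow> F \<epsilon> \<in> L2 M"
    and mono: "\<And>\<epsilon> \<delta> \<eta>. 0 < \<epsilon> \<Longrightarrow> \<epsilon> \<le> \<eta> \<Longrightarrow> 0 < \<delta> \<Longrightarrow> \<delta> \<le> \<eta> \<Longrightarrow>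
       (\<integral>\<omega>. (F \<eta> \<omega>)\<^sup>2 \<partial>M) \<le> (\<integral>\<omega>. F \<epsilon> \<omega> * F \<delta> \<omega> \<partial>M)"
    and bounded: "\<And>\<epsilon>. 0 < \<epsilon> \<Longrightarrow> (\<integral>\<omega>. (F \<epsilon> \<omega>)\<^sup>2 \<partial>M) \<le> B"
  shows "\<exists>L. tendsto_L2 M F L (at_right 0)"
proof -
  define J where "J \<epsilon> = (\<integral>\<omega>. (F \<epsilon> \<omega>)\<^sup>2 \<partial>M)" for \<epsilon>
  define s where "s = (SUP \<epsilon>\<in>{0<..}. J \<epsilon>)"
  have bdd: "bdd_above (J ` {0<..})" using bounded by (auto simp: J_def bdd_above_def)
  have J_le: "J \<epsilon> \<le> s" if "0 < \<epsilon>" for \<epsilon>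
    unfolding s_def using that by (intro cSUP_upper bdd) auto
  have close: "\<exists>\<eta>>0. \<forall>\<epsilon> \<delta>. 0 < \<epsilon> \<and> \<epsilon> \<le> \<eta> \<and> 0 < \<delta> \<and> \<delta> \<le> \<eta> \<longrightarrow> (\<integral>\<omega>. (F \<epsilon> \<omega> - F \<delta> \<omega>)\<^sup>2 \<partial>M) < e"
    if "0 < e" for e
  proof -
    have "s - e / 2 < s" using that by simp
    then obtain \<eta> where \<eta>: "0 < \<eta>" "s - e / 2 < J \<eta>"
      unfolding s_def using bdd by (subst (asm) less_cSUP_iff) auto
    have "(\<integral>\<omega>. (F \<epsilon> \<omega> - F \<delta> \<omega>)\<^sup>2 \<partial>M) < e" if "0 < \<epsilon>" "\<epsilon> \<le> \<eta>" "0 < \<delta>" "\<delta> \<le> \<eta>" for \<epsilon> \<delta>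
      using mono[OF that] J_le[OF that(1)] J_le[OF that(3)] \<eta>(2)
      unfolding integral_diff_square[OF F[OF that(1)] F[OF that(3)]] J_def by linarith
    then show ?thesis using \<eta>(1) by blast
  qed
  define f where "f k = inverse (real (Suc k))" for k
  have f0: "0 < f k" for k by (simp add: f_def)
  have f_lim: "\<exists>n0. \<forall>n\<ge>n0. f n \<le> \<eta>" if "0 < \<eta>" for \<eta>
    using order_tendstoD(2)[OF LIMSEQ_inverse_real_of_nat that]
    unfolding f_def eventually_sequentially by (blast intro: less_imp_le)
  have "\<exists>L. tendsto_L2 M (\<lambda>k. F (f k)) L sequentially"
  proof (rule L2_complete)
    fix e :: real assume "0 < e"
    from close[OF this] obtain \<eta> where \<eta>: "0 < \<eta>"
      "\<And>\<epsilon> \<delta>. 0 < \<epsilon> \<Longrightarrow> \<epsilon> \<le> \<eta> \<Longrightarrow> 0 < \<delta> \<Longrightarrow> \<delta> \<le> \<eta> \<Longrightarrow> (\<integral>\<omega>. (F \<epsilon> \<omega> - F \<delta> \<omega>)\<^sup>2 \<partial>M) < e"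
      by blast
    obtain n0 where "\<forall>n\<ge>n0. f n \<le> \<eta>" using f_lim[OF \<eta>(1)] ..
    then show "\<exists>n0. \<forall>m\<ge>n0. \<forall>n\<ge>n0. (\<integral>\<omega>. (F (f m) \<omega> - F (f n) \<omega>)\<^sup>2 \<partial>M) < e"
      using \<eta>(2) f0 by (intro exI[of _ n0]) simp
  qed (rule F[OF f0])
  then obtain L where L: "tendsto_L2 M (\<lambda>k. F (f k)) L sequentially" ..
  then have LL2: "L \<in> L2 M" by (rule tendsto_L2_in_L2)
  have "((\<lambda>\<epsilon>. \<integral>\<omega>. (F \<epsilon> \<omega> - L \<omega>)\<^sup>2 \<partial>M) \<longlongrightarrow> 0) (at_right 0)"
  proof (rule tendstoI)
    fix e :: real assume "0 < e"
    then have "0 < e / 4" by simp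
    from close[OF this] obtain \<eta> where \<eta>: "0 < \<eta>"
      "\<And>\<epsilon> \<delta>. 0 < \<epsilon> \<Longrightarrow> \<epsilon> \<le> \<eta> \<Longrightarrow> 0 < \<delta> \<Longrightarrow> \<delta> \<le> \<eta> \<Longrightarrow> (\<integral>\<omega>. (F \<epsilon> \<omega> - F \<delta> \<omega>)\<^sup>2 \<partial>M) < e / 4"
      by blast
    obtain n0 where n0: "\<forall>n\<ge>n0. f n \<le> \<eta>" using f_lim[OF \<eta>(1)] ..
    have "(\<lambda>n. \<integral>\<omega>. (F (f n) \<omega> - L \<omega>)\<^sup>2 \<partial>M) \<longlonglongrightarrow> 0"
      using L by (simp add: tendsto_L2_def)
    from order_tendstoD(2)[OF this \<open>0 < e / 4\<close>]
    obtain n1 where n1: "\<forall>n\<ge>n1. (\<integral>\<omega>. (F (f n) \<omega> - L \<omega>)\<^sup>2 \<partial>M) < e / 4"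
      unfolding eventually_sequentially ..
    define n where "n = max n0 n1"
    have "(\<integral>\<omega>. (F \<epsilon> \<omega> - L \<omega>)\<^sup>2 \<partial>M) < e" if "0 < \<epsilon>" "\<epsilon> \<le> \<eta>" for \<epsilon>
    proof -
      have "f n \<le> \<eta>" "(\<integral>\<omega>. (F (f n) \<omega> - L \<omega>)\<^sup>2 \<partial>M) < e / 4"
        using n0 n1 by (simp_all add: n_def)
      then show ?thesis
        using square_diff_triangle[OF F[OF that(1)] F[OF f0[of n]] LL2] \<eta>(2)[OF that f0[of n]] by linarith
    qed
    then show "\<forall>\<^sub>F \<epsilon> in at_right 0. dist (\<integral>\<omega>. (F \<epsilon> \<omega> - L \<omega>)\<^sup>2 \<partial>M) 0 < e"
      using \<eta>(1) unfolding eventually_at_right_field by (auto intro!: exI[of _ \<eta>])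
  qed
  moreover have "\<forall>\<^sub>F \<epsilon> in at_right 0. F \<epsilon> \<in> L2 M"
    using F by (auto simp: eventually_at_right_field intro!: exI[of _ 1])
  ultimately show ?thesis using LL2 by (auto simp: tendsto_L2_def)
qed

end

section \<open>Polynomials and chaos\<close>

lemma polynomials_upto_mono: "m \<le> n \<Longrightarrow> polynomials_upto V m \<subseteq> polynomials_upto V n"
  unfolding polynomials_upto_def by (blast intro: order_trans)

lemma polynomials_upto_zero: "(\<lambda>_. 0) \<in> polynomials_upto V n"
  unfolding polynomials_upto_def by (auto intro!: exI[of _ "{}"])

lemma polynomials_upto_monomial:
  "set l \<subseteq> V \<Longrightarrow> length l \<le> n \<Longrightarrow> (\<lambda>\<omega>. c * (\<Prod>v\<leftarrow>l. v \<omega>)) \<in> polynomials_upto V n"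
  unfolding polynomials_upto_def by (auto intro!: exI[of _ "{l}"] exI[of _ "\<lambda>_. c"])

lemma polynomials_upto_const: "(\<lambda>_. c) \<in> polynomials_upto V n"
  using polynomials_upto_monomial[of "[]" V n c] by simp

lemma polynomials_upto_add:
  assumes "p \<in> polynomials_upto V n" "q \<in> polynomials_upto V n"
  shows "(\<lambda>\<omega>. p \<omega> + q \<omega>) \<in> polynomials_upto V n"
proof -
  obtain A c where p: "p = (\<lambda>\<omega>. \<Sum>l\<in>A. c l * (\<Prod>v\<leftarrow>l. v \<omega>))" "finite A" "\<forall>l\<in>A. set l \<subseteq> V \<and> length l \<le> n"
    using assms(1) unfolding polynomials_upto_def by blast
  obtain B d where q: "q = (\<lambda>\<omega>. \<Sum>l\<in>B. d l * (\<Prod>v\<leftarrow>l. v \<omega>))" "finite B" "\<forall>l\<in>B. set l \<subseteq> V \<and> length l \<le> n"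
    using assms(2) unfolding polynomials_upto_def by blast
  have *: "(\<Sum>l\<in>A'. c l * m l) = (\<Sum>l\<in>A' \<union> B'. (if l \<in> A' then c l else 0) * m l)"
    if "finite A'" "finite B'" for c m :: "'b \<Rightarrow> real" and A' B'
    using that by (intro sum.mono_neutral_cong_left) auto
  have "(\<lambda>\<omega>. p \<omega> + q \<omega>) = (\<lambda>\<omega>. \<Sum>l\<in>A \<union> B. ((if l \<in> A then c l else 0) + (if l \<in> B then d l else 0)) * (\<Prod>v\<leftarrow>l. v \<omega>))"
    unfolding p q distrib_right sum.distrib
    using *[OF p(2) q(2)] *[OF q(2) p(2)] by (simp add: Un_commute)
  then show ?thesis
    unfolding polynomials_upto_def using p(2,3) q(2,3)
    by (intro CollectI exI[of _ "A \<union> B"] exI conjI) auto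
qed

lemma polynomials_upto_sum:
  "(\<And>i. i \<in> I \<Longrightarrow> p i \<in> polynomials_upto V n) \<Longrightarrow> (\<lambda>\<omega>. \<Sum>i\<in>I. p i \<omega>) \<in> polynomials_upto V n"
  by (induction I rule: infinite_finite_induct) (auto intro: polynomials_upto_add polynomials_upto_zero)

lemma polynomials_upto_mult:
  assumes "p \<in> polynomials_upto V m" "q \<in> polynomials_upto V n"
  shows "(\<lambda>\<omega>. p \<omega> * q \<omega>) \<in> polynomials_upto V (m + n)"
proof -
  obtain A c where p: "p = (\<lambda>\<omega>. \<Sum>l\<in>A. c l * (\<Prod>v\<leftarrow>l. v \<omega>))" "finite A" "\<forall>l\<in>A. set l \<subseteq> V \<and> length l \<le> m"
    using assms(1) unfolding polynomials_upto_def by blast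
  obtain B d where q: "q = (\<lambda>\<omega>. \<Sum>l\<in>B. d l * (\<Prod>v\<leftarrow>l. v \<omega>))" "finite B" "\<forall>l\<in>B. set l \<subseteq> V \<and> length l \<le> n"
    using assms(2) unfolding polynomials_upto_def by blast
  have "(\<lambda>\<omega>. \<Sum>l\<in>A. \<Sum>k\<in>B. (c l * d k) * (\<Prod>v\<leftarrow>l @ k. v \<omega>)) \<in> polynomials_upto V (m + n)"
    using p(3) q(3) by (intro polynomials_upto_sum polynomials_upto_monomial) (auto intro: add_mono)
  then show ?thesis unfolding p q sum_product by (simp add: mult_ac)
qed

lemma polynomials_upto_scale: "p \<in> polynomials_upto V n \<Longrightarrow> (\<lambda>\<omega>. c * p \<omega>) \<in> polynomials_upto V n"
  using polynomials_upto_mult[OF polynomials_upto_const[where n = 0]] by simp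

lemma polynomials_upto_power:
  assumes "p \<in> polynomials_upto V 1"
  shows "(\<lambda>\<omega>. p \<omega> ^ k) \<in> polynomials_upto V k"
proof (induction k)
  case (Suc k)
  then show ?case using polynomials_upto_mult[OF assms Suc] by simp
qed (simp add: polynomials_upto_const)

context prob_space
begin

lemma poly_closure_L2: "F \<in> poly_closure M V n \<Longrightarrow> F \<in> L2 M"
  by (simp add: poly_closure_def)

lemma poly_closure_mono: "m \<le> n \<Longrightarrow> poly_closure M V m \<subseteq> poly_closure M V n"
  unfolding poly_closure_def using polynomials_upto_mono by blast

lemma polynomial_in_poly_closure: "p \<in> polynomials_upto V n \<Longrightarrow> p \<in> L2 M \<Longrightarrow> p \<in> poly_closure M V n"
  unfolding poly_closure_def by (auto intro!: bexI[of _ p])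

lemma poly_closure_limit:
  assumes lim: "tendsto_L2 M F L \<F>" and ev: "\<forall>\<^sub>F i in \<F>. F i \<in> poly_closure M V n" and "\<F> \<noteq> bot"
  shows "L \<in> poly_closure M V n"
  unfolding poly_closure_def
proof (intro CollectI conjI allI impI)
  show L: "L \<in> L2 M" using lim by (rule tendsto_L2_in_L2)
  fix e :: real assume "0 < e"
  have "((\<lambda>i. \<integral>\<omega>. (F i \<omega> - L \<omega>)\<^sup>2 \<partial>M) \<longlongrightarrow> 0) \<F>"
    using lim by (simp add: tendsto_L2_def)
  from order_tendstoD(2)[OF this, of "e / 4"]
  have "\<forall>\<^sub>F i in \<F>. (\<integral>\<omega>. (F i \<omega> - L \<omega>)\<^sup>2 \<partial>M) < e / 4"
    using \<open>0 < e\<close> by simp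
  from eventually_happens'[OF \<open>\<F> \<noteq> bot\<close> eventually_conj[OF this ev]]
  obtain i where i: "(\<integral>\<omega>. (F i \<omega> - L \<omega>)\<^sup>2 \<partial>M) < e / 4" "F i \<in> poly_closure M V n" by blast
  then obtain p where p: "p \<in> polynomials_upto V n \<inter> L2 M" "(\<integral>\<omega>. (F i \<omega> - p \<omega>)\<^sup>2 \<partial>M) < e / 4"
    using \<open>0 < e\<close> unfolding poly_closure_def by (auto dest!: spec[of _ "e / 4"])
  have "(\<integral>\<omega>. (L \<omega> - p \<omega>)\<^sup>2 \<partial>M) \<le> 2 * (\<integral>\<omega>. (L \<omega> - F i \<omega>)\<^sup>2 \<partial>M) + 2 * (\<integral>\<omega>. (F i \<omega> - p \<omega>)\<^sup>2 \<partial>M)"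
    using square_diff_triangle[OF L poly_closure_L2[OF i(2)], of p] p by auto
  then have "(\<integral>\<omega>. (L \<omega> - p \<omega>)\<^sup>2 \<partial>M) < e"
    using i p by (simp add: power2_commute)
  then show "\<exists>p\<in>polynomials_upto V n \<inter> L2 M. (\<integral>\<omega>. (L \<omega> - p \<omega>)\<^sup>2 \<partial>M) < e"
    using p(1) by blast
qed

text \<open>
  Orthogonality passes to limits by the Cauchy--Schwarz inequality.
\<close>

lemma poly_closure_orthogonal:
  assumes G: "G \<in> L2 M" and orth: "\<And>p. p \<in> polynomials_upto V n \<Longrightarrow> p \<in> L2 M \<Longrightarrow> (\<integral>\<omega>. G \<omega> * p \<omega> \<partial>M) = 0"
    and F: "F \<in> poly_closure M V n"
  shows "(\<integral>\<omega>. G \<omega> * F \<omega> \<partial>M) = 0"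
proof -
  have FL: "F \<in> L2 M" by (rule poly_closure_L2[OF F])
  have "(\<integral>\<omega>. G \<omega> * F \<omega> \<partial>M)\<^sup>2 \<le> e * (\<integral>\<omega>. (G \<omega>)\<^sup>2 \<partial>M)" if e: "0 < e" for e
  proof -
    obtain p where p: "p \<in> polynomials_upto V n" "p \<in> L2 M" "(\<integral>\<omega>. (F \<omega> - p \<omega>)\<^sup>2 \<partial>M) < e"
      using F e unfolding poly_closure_def by blast
    have "(\<integral>\<omega>. G \<omega> * F \<omega> \<partial>M) = (\<integral>\<omega>. G \<omega> * F \<omega> \<partial>M) - (\<integral>\<omega>. G \<omega> * p \<omega> \<partial>M)"
      using orth[OF p(1,2)] by simp
    also have "\<dots> = (\<integral>\<omega>. G \<omega> * F \<omega> - G \<omega> * p \<omega> \<partial>M)"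
      using L2_mult_integrable[OF G FL] L2_mult_integrable[OF G p(2)] by simp
    also have "\<dots> = (\<integral>\<omega>. (F \<omega> - p \<omega>) * G \<omega> \<partial>M)"
      by (simp add: algebra_simps)
    also have "\<dots>\<^sup>2 \<le> (\<integral>\<omega>. (F \<omega> - p \<omega>)\<^sup>2 \<partial>M) * (\<integral>\<omega>. (G \<omega>)\<^sup>2 \<partial>M)"
      by (rule cauchy_schwarz[OF L2_diff[OF FL p(2)] G])
    also have "\<dots> \<le> e * (\<integral>\<omega>. (G \<omega>)\<^sup>2 \<partial>M)"
      using p(3) by (intro mult_right_mono) auto
    finally show ?thesis .
  qed
  note * = this
  have "(\<integral>\<omega>. G \<omega> * F \<omega> \<partial>M)\<^sup>2 \<le> 0"
  proof (rule field_le_epsilon)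
    fix e :: real assume "0 < e"
    define g where "g = (\<integral>\<omega>. (G \<omega>)\<^sup>2 \<partial>M)"
    have "0 \<le> g" by (simp add: g_def)
    then have "e / (g + 1) * g \<le> e" using \<open>0 < e\<close> by (simp add: field_simps)
    with *[of "e / (g + 1)"] \<open>0 < e\<close> \<open>0 \<le> g\<close> show "(\<integral>\<omega>. G \<omega> * F \<omega> \<partial>M)\<^sup>2 \<le> 0 + e"
      by (simp add: g_def[symmetric])
  qed
  then show ?thesis by simp
qed

lemma chaos_subset_poly_closure: "chaos M V n \<subseteq> poly_closure M V n"
proof (cases n)
  case 0
  show ?thesis
  proof
    fix F assume "F \<in> chaos M V n"
    then obtain c where [measurable]: "F \<in> borel_measurable M" and c: "AE \<omega> in M. F \<omega> = c"
      by (auto simp: chaos_def 0)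
    have "integrable M (\<lambda>\<omega>. (F \<omega>)\<^sup>2) \<longleftrightarrow> integrable M (\<lambda>\<omega>. c\<^sup>2)"
      using c by (intro integrable_cong_AE) auto
    then have F: "F \<in> L2 M" by (simp add: L2_def)
    have "(\<integral>\<omega>. (F \<omega> - c)\<^sup>2 \<partial>M) = (\<integral>\<omega>. 0 \<partial>M)"
      using c by (intro integral_cong_AE) auto
    then show "F \<in> poly_closure M V n"
      using F polynomials_upto_const[of c V n] L2_const[of c]
      unfolding poly_closure_def by (auto intro!: bexI[of _ "\<lambda>_. c"])
  qed
qed (auto simp: chaos_def)

lemma chaos_L2: "F \<in> chaos M V n \<Longrightarrow> F \<in> L2 M"
  using chaos_subset_poly_closure poly_closure_L2 by blast

lemma chaos_orthogonal_lower:
  assumes "F \<in> chaos M V n" "G \<in> chaos M V k" "k < n"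
  shows "(\<integral>\<omega>. F \<omega> * G \<omega> \<partial>M) = 0"
proof (cases n)
  case (Suc m)
  have "G \<in> poly_closure M V m"
    using assms(2,3) chaos_subset_poly_closure[of V k] poly_closure_mono[of k m V] Suc by auto
  then show ?thesis using assms(1) by (auto simp: chaos_def Suc)
qed (use assms in simp)

lemma chaos_orthogonal:
  assumes "F \<in> chaos M V n" "G \<in> chaos M V k" "k \<noteq> n"
  shows "(\<integral>\<omega>. F \<omega> * G \<omega> \<partial>M) = 0"
proof (cases "k < n")
  case False
  then show ?thesis using chaos_orthogonal_lower[OF assms(2,1)] assms(3) by (simp add: mult.commute)
qed (use chaos_orthogonal_lower[OF assms(1,2)] in simp)

text \<open>
  For positive orders both defining properties pass to limits. The almost surely constant variables
  are closed because the distance to constants is smallest at the expectation, which makes the variance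
  of the limit vanish.
\<close>

lemma chaos_limit:
  assumes lim: "tendsto_L2 M F L \<F>" and ev: "\<forall>\<^sub>F i in \<F>. F i \<in> chaos M V n" and "\<F> \<noteq> bot"
  shows "L \<in> chaos M V n"
proof (cases n)
  case (Suc m)
  have "L \<in> poly_closure M V n"
    using ev chaos_subset_poly_closure[of V n]
    by (intro poly_closure_limit[OF lim _ \<open>\<F> \<noteq> bot\<close>]) (auto elim!: eventually_mono)
  moreover have "(\<integral>\<omega>. L \<omega> * G \<omega> \<partial>M) = 0" if G: "G \<in> poly_closure M V m" for G
  proof -
    have "\<forall>\<^sub>F i in \<F>. (\<integral>\<omega>. F i \<omega> * G \<omega> \<partial>M) = 0"
      using ev by eventually_elim (use G in \<open>auto simp: chaos_def Suc\<close>)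
    then have "((\<lambda>i. \<integral>\<omega>. F i \<omega> * G \<omega> \<partial>M) \<longlongrightarrow> 0) \<F>"
      by (rule tendsto_eventually)
    with tendsto_L2_inner[OF lim poly_closure_L2[OF G]] show ?thesis
      using tendsto_unique[OF \<open>\<F> \<noteq> bot\<close>] by blast
  qed
  ultimately show ?thesis by (simp add: chaos_def Suc)
next
  case 0
  have L: "L \<in> L2 M" using lim by (rule tendsto_L2_in_L2)
  have int: "integrable M (\<lambda>\<omega>. (L \<omega> - c)\<^sup>2)" for c
    using L2_square_integrable[OF L2_diff[OF L L2_const]] .
  have var: "(\<integral>\<omega>. (L \<omega> - (\<integral>\<omega>. L \<omega> \<partial>M))\<^sup>2 \<partial>M) \<le> (\<integral>\<omega>. (L \<omega> - c)\<^sup>2 \<partial>M)" for c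
    using zero_le_power2[of "(\<integral>\<omega>. L \<omega> \<partial>M) - c"]
    unfolding integral_diff_square[OF L L2_const] by (simp add: prob_space power2_eq_square algebra_simps)
  have "\<forall>\<^sub>F i in \<F>. (\<integral>\<omega>. (L \<omega> - (\<integral>\<omega>. L \<omega> \<partial>M))\<^sup>2 \<partial>M) \<le> (\<integral>\<omega>. (F i \<omega> - L \<omega>)\<^sup>2 \<partial>M)"
    using ev
  proof eventually_elim
    case (elim i)
    then obtain c where c: "F i \<in> borel_measurable M" "AE \<omega> in M. F i \<omega> = c"
      by (auto simp: chaos_def 0)
    have "(\<integral>\<omega>. (F i \<omega> - L \<omega>)\<^sup>2 \<partial>M) = (\<integral>\<omega>. (L \<omega> - c)\<^sup>2 \<partial>M)"
      using c L by (intro integral_cong_AE) (auto simp: L2_def power2_commute)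
    then show ?case using var by simp
  qed
  then have "(\<integral>\<omega>. (L \<omega> - (\<integral>\<omega>. L \<omega> \<partial>M))\<^sup>2 \<partial>M) \<le> 0"
    using lim tendsto_lowerbound[OF _ _ \<open>\<F> \<noteq> bot\<close>] by (auto simp: tendsto_L2_def)
  moreover have "0 \<le> (\<integral>\<omega>. (L \<omega> - (\<integral>\<omega>. L \<omega> \<partial>M))\<^sup>2 \<partial>M)" by simp
  ultimately have "AE \<omega> in M. (L \<omega> - (\<integral>\<omega>. L \<omega> \<partial>M))\<^sup>2 = 0"
    using integral_nonneg_eq_0_iff_AE[OF int] by fastforce
  then show ?thesis using L by (auto simp: chaos_def 0 L2_def)
qed

lemma zero_in_chaos: "(\<lambda>_. 0) \<in> chaos M V n"
  by (cases n) (auto simp: chaos_def intro!: polynomial_in_poly_closure polynomials_upto_zero L2_const)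

end

section \<open>Finite moments\<close>

text \<open>
  Polynomials in Gaussian variables live here; unlike \<open>L2\<close> this space is closed under products.
\<close>

definition finite_moments :: "'w measure \<Rightarrow> ('w \<Rightarrow> real) set" where
  "finite_moments M = {f \<in> borel_measurable M. \<forall>k. integrable M (\<lambda>\<omega>. \<bar>f \<omega>\<bar> ^ k)}"

context prob_space
begin

lemma finite_moments_mult:
  assumes "f \<in> finite_moments M" "g \<in> finite_moments M"
  shows "(\<lambda>\<omega>. f \<omega> * g \<omega>) \<in> finite_moments M"
proof -
  have [measurable]: "f \<in> borel_measurable M" "g \<in> borel_measurable M"
    using assms by (auto simp: finite_moments_def)
  have "integrable M (\<lambda>\<omega>. \<bar>f \<omega> * g \<omega>\<bar> ^ k)" for k
  proof (rule Bochner_Integration.integrable_bound)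
    show "integrable M (\<lambda>\<omega>. \<bar>f \<omega>\<bar> ^ (2 * k) + \<bar>g \<omega>\<bar> ^ (2 * k))"
      using assms unfolding finite_moments_def by auto
    have "x * y \<le> x\<^sup>2 + y\<^sup>2" if "0 \<le> x" "0 \<le> y" for x y :: real
      using sum_squares_bound[of x y] mult_nonneg_nonneg[OF that] by linarith
    from this[of "\<bar>f \<omega>\<bar> ^ k" "\<bar>g \<omega>\<bar> ^ k" for \<omega>]
    show "AE \<omega> in M. norm (\<bar>f \<omega> * g \<omega>\<bar> ^ k) \<le> norm (\<bar>f \<omega>\<bar> ^ (2 * k) + \<bar>g \<omega>\<bar> ^ (2 * k))"
      by (simp add: abs_mult power_mult_distrib power_mult[symmetric] mult.commute[of _ 2])
  qed measurable
  then show ?thesis by (simp add: finite_moments_def)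
qed

lemma finite_moments_add:
  assumes "f \<in> finite_moments M" "g \<in> finite_moments M"
  shows "(\<lambda>\<omega>. f \<omega> + g \<omega>) \<in> finite_moments M"
proof -
  have [measurable]: "f \<in> borel_measurable M" "g \<in> borel_measurable M"
    using assms by (auto simp: finite_moments_def)
  have "integrable M (\<lambda>\<omega>. \<bar>f \<omega> + g \<omega>\<bar> ^ k)" for k
  proof (rule Bochner_Integration.integrable_bound)
    show "integrable M (\<lambda>\<omega>. 2 ^ k * (\<bar>f \<omega>\<bar> ^ k + \<bar>g \<omega>\<bar> ^ k))"
      using assms unfolding finite_moments_def by auto
    have "\<bar>x + y\<bar> ^ k \<le> 2 ^ k * (\<bar>x\<bar> ^ k + \<bar>y\<bar> ^ k)" for x y :: real
    proof -
      have "\<bar>x + y\<bar> ^ k \<le> (2 * max \<bar>x\<bar> \<bar>y\<bar>) ^ k" by (intro power_mono) auto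
      also have "\<dots> = 2 ^ k * max \<bar>x\<bar> \<bar>y\<bar> ^ k" by (simp add: power_mult_distrib)
      also have "\<dots> \<le> 2 ^ k * (\<bar>x\<bar> ^ k + \<bar>y\<bar> ^ k)" by (intro mult_left_mono) (auto simp: max_def)
      finally show ?thesis .
    qed
    then show "AE \<omega> in M. norm (\<bar>f \<omega> + g \<omega>\<bar> ^ k) \<le> norm (2 ^ k * (\<bar>f \<omega>\<bar> ^ k + \<bar>g \<omega>\<bar> ^ k))"
      by simp
  qed measurable
  then show ?thesis by (simp add: finite_moments_def)
qed

lemma finite_moments_const: "(\<lambda>_. c) \<in> finite_moments M"
  by (simp add: finite_moments_def)

lemma finite_moments_power: "f \<in> finite_moments M \<Longrightarrow> (\<lambda>\<omega>. f \<omega> ^ k) \<in> finite_moments M"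
  by (induction k) (auto intro: finite_moments_mult finite_moments_const)

lemma finite_moments_sum:
  "(\<And>i. i \<in> I \<Longrightarrow> f i \<in> finite_moments M) \<Longrightarrow> (\<lambda>\<omega>. \<Sum>i\<in>I. f i \<omega>) \<in> finite_moments M"
  by (induction I rule: infinite_finite_induct) (auto intro: finite_moments_add finite_moments_const)

lemma finite_moments_prod_list:
  "set l \<subseteq> finite_moments M \<Longrightarrow> (\<lambda>\<omega>. \<Prod>v\<leftarrow>l. v \<omega>) \<in> finite_moments M"
  by (induction l) (auto intro: finite_moments_mult finite_moments_const)

lemma finite_moments_integrable:
  assumes "f \<in> finite_moments M"
  shows "integrable M f"
proof -
  have "integrable M (\<lambda>\<omega>. \<bar>f \<omega>\<bar> ^ 1)" "f \<in> borel_measurable M"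
    using assms unfolding finite_moments_def by blast+
  then show ?thesis by (simp add: integrable_abs_iff)
qed

lemma finite_moments_L2:
  assumes "f \<in> finite_moments M"
  shows "f \<in> L2 M"
proof -
  have "integrable M (\<lambda>\<omega>. \<bar>f \<omega>\<bar> ^ 2)" "f \<in> borel_measurable M"
    using assms unfolding finite_moments_def by blast+
  then show ?thesis by (simp add: L2_def)
qed

lemma polynomials_finite_moments:
  assumes "V \<subseteq> finite_moments M" "p \<in> polynomials_upto V n"
  shows "p \<in> finite_moments M"
  using assms unfolding polynomials_upto_def
  by (auto intro!: finite_moments_sum finite_moments_mult[OF finite_moments_const] finite_moments_prod_list)

lemma finite_moments_wick: "f \<in> finite_moments M \<Longrightarrow> (\<lambda>\<omega>. wick n v (f \<omega>)) \<in> finite_moments M"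
proof -
  assume f: "f \<in> finite_moments M"
  have "(\<lambda>\<omega>. \<Sum>i\<le>n. (gauss_coeff v (n - i) / fact i) * f \<omega> ^ i) \<in> finite_moments M"
    by (intro finite_moments_sum finite_moments_mult[OF finite_moments_const] finite_moments_power f)
  then show ?thesis by (simp add: wick_def mult.commute)
qed

end

lemma wick_in_polynomials_upto:
  assumes "p \<in> polynomials_upto V 1"
  shows "(\<lambda>\<omega>. wick n v (p \<omega>)) \<in> polynomials_upto V n"
proof -
  have "(\<lambda>\<omega>. \<Sum>i\<le>n. (gauss_coeff v (n - i) / fact i) * p \<omega> ^ i) \<in> polynomials_upto V n"
    using polynomials_upto_power[OF assms] polynomials_upto_mono
    by (intro polynomials_upto_sum polynomials_upto_scale) blast
  then show ?thesis by (simp add: wick_def mult.commute)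
qed

context gaussian_space
begin

lemma S_finite_moments: "W \<in> S \<Longrightarrow> W \<in> finite_moments M"
proof -
  assume W: "W \<in> S"
  have "integrable M (\<lambda>\<omega>. \<bar>W \<omega>\<bar> ^ k)" for k
    using integrable_norm[OF S_integrable_power[OF W, of k]] by (simp add: power_abs)
  then show ?thesis using S_meas[OF W] by (simp add: finite_moments_def)
qed

text \<open>
  Polarisation: with \<open>t * x + W\<close> in place of \<open>W\<close> the integral vanishes for all \<open>t\<close>, and the coefficient of
  \<open>t\<close> has one power of \<open>W\<close> replaced by the factor \<open>x\<close>. Keeping a power of one variable \<open>W\<close> next to the
  list of factors gives the induction its start in the case of a single variable.
\<close>

lemma wick_orth_monomial:
  assumes U: "U \<in> S"
  shows "set l \<subseteq> S \<Longrightarrow> W \<in> S \<Longrightarrow> k + length l < n \<Longrightarrow>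
    (\<integral>\<omega>. wick n (cov U U) (U \<omega>) * (W \<omega> ^ k * (\<Prod>v\<leftarrow>l. v \<omega>)) \<partial>M) = 0"
proof (induction l arbitrary: k W)
  case Nil
  then show ?case using wick_orth_power[OF U] by simp
next
  case (Cons x l)
  define B where "B \<omega> = wick n (cov U U) (U \<omega>)" for \<omega>
  define P where "P \<omega> = (\<Prod>v\<leftarrow>l. v \<omega>)" for \<omega>
  define a where "a i = (\<integral>\<omega>. B \<omega> * (x \<omega> ^ i * W \<omega> ^ (Suc k - i) * P \<omega>) \<partial>M)" for i
  have x: "x \<in> S" and l: "set l \<subseteq> S" using Cons.prems by auto
  have fm: "B \<in> finite_moments M" "P \<in> finite_moments M" "x \<in> finite_moments M" "W \<in> finite_moments M"
    using S_finite_moments U x l Cons.prems(2) unfolding B_def[abs_def] P_def[abs_def]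
    by (auto intro!: finite_moments_wick finite_moments_prod_list)
  have int: "integrable M (\<lambda>\<omega>. B \<omega> * (x \<omega> ^ i * W \<omega> ^ j * P \<omega>))" for i j
    by (intro finite_moments_integrable finite_moments_mult finite_moments_power fm)
  have "(\<Sum>i\<le>Suc k. (of_nat (Suc k choose i) * a i) * t ^ i) = 0" for t
  proof -
    have "(\<integral>\<omega>. B \<omega> * ((t * x \<omega> + W \<omega>) ^ Suc k * P \<omega>) \<partial>M) = 0"
      unfolding B_def P_def using Cons.prems
      by (intro Cons.IH S_add[OF S_scale]) auto
    moreover have "(\<integral>\<omega>. B \<omega> * ((t * x \<omega> + W \<omega>) ^ Suc k * P \<omega>) \<partial>M) =
      (\<integral>\<omega>. (\<Sum>i\<le>Suc k. (of_nat (Suc k choose i) * t ^ i) * (B \<omega> * (x \<omega> ^ i * W \<omega> ^ (Suc k - i) * P \<omega>))) \<partial>M)"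
      unfolding binomial_ring sum_distrib_left sum_distrib_right
      by (intro Bochner_Integration.integral_cong sum.cong refl) (simp add: power_mult_distrib)
    moreover have "\<dots> = (\<Sum>i\<le>Suc k. (of_nat (Suc k choose i) * t ^ i) * a i)"
      unfolding a_def using int by (subst Bochner_Integration.integral_sum) auto
    ultimately show ?thesis by (simp add: mult_ac)
  qed
  then have "\<forall>i\<le>Suc k. of_nat (Suc k choose i) * a i = 0"
    using polyfun_eq_0[of "\<lambda>i. of_nat (Suc k choose i) * a i" "Suc k"] by blast
  then have "of_nat (Suc k choose 1) * a 1 = 0" by (metis Suc_le_mono One_nat_def le0)
  then have "a 1 = 0" by simp
  then show ?case by (simp add: a_def B_def P_def mult_ac)
qed

lemma wick_orth_polynomial:
  assumes U: "U \<in> S" and V: "V \<subseteq> S" and p: "p \<in> polynomials_upto V k" and "k < n"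
  shows "(\<integral>\<omega>. wick n (cov U U) (U \<omega>) * p \<omega> \<partial>M) = 0"
proof -
  obtain A c where A: "p = (\<lambda>\<omega>. \<Sum>l\<in>A. c l * (\<Prod>v\<leftarrow>l. v \<omega>))" "finite A" "\<forall>l\<in>A. set l \<subseteq> V \<and> length l \<le> k"
    using p unfolding polynomials_upto_def by blast
  have "(\<integral>\<omega>. wick n (cov U U) (U \<omega>) * p \<omega> \<partial>M) =
      (\<integral>\<omega>. (\<Sum>l\<in>A. c l * (wick n (cov U U) (U \<omega>) * (\<Prod>v\<leftarrow>l. v \<omega>))) \<partial>M)"
    unfolding A(1) sum_distrib_left by (intro Bochner_Integration.integral_cong sum.cong refl) simp
  also have "\<dots> = (\<Sum>l\<in>A. c l * (\<integral>\<omega>. wick n (cov U U) (U \<omega>) * (\<Prod>v\<leftarrow>l. v \<omega>) \<partial>M))"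
  proof (subst Bochner_Integration.integral_sum)
    fix l assume "l \<in> A"
    then have "(\<lambda>\<omega>. \<Prod>v\<leftarrow>l. v \<omega>) \<in> finite_moments M"
      using A(3) V S_finite_moments by (intro finite_moments_prod_list) blast
    then show "integrable M (\<lambda>\<omega>. c l * (wick n (cov U U) (U \<omega>) * (\<Prod>v\<leftarrow>l. v \<omega>)))"
      by (intro integrable_mult_right finite_moments_integrable finite_moments_mult finite_moments_wick S_finite_moments[OF U])
  qed simp
  also have "\<dots> = 0"
  proof (intro sum.neutral ballI)
    fix l assume l: "l \<in> A"
    then have "set l \<subseteq> S" "0 + length l < n" using A(3) V \<open>k < n\<close> by force+
    from wick_orth_monomial[OF U this(1) U this(2)]
    show "c l * (\<integral>\<omega>. wick n (cov U U) (U \<omega>) * (\<Prod>v\<leftarrow>l. v \<omega>) \<partial>M) = 0" by simp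
  qed
  finally show ?thesis .
qed

end

section \<open>Weighted integrals of second-order families\<close>

locale weighted_family = prob_space M + sigma_finite_measure \<nu> for M :: "'w measure" and \<nu> :: "'p measure"
begin

sublocale M\<nu>: pair_sigma_finite M \<nu> ..
sublocale \<nu>\<nu>: pair_sigma_finite \<nu> \<nu> ..

text \<open>
  A uniform bound on the second moments is what makes all exchanges of integrals below legitimate for
  integrable weights.
\<close>

definition second_order :: "real \<Rightarrow> ('p \<Rightarrow> 'w \<Rightarrow> real) \<Rightarrow> bool" where
  "second_order c A \<longleftrightarrow> (\<lambda>(\<theta>, \<omega>). A \<theta> \<omega>) \<in> borel_measurable (\<nu> \<Otimes>\<^sub>M M) \<and>
     (\<forall>\<theta>\<in>space \<nu>. A \<theta> \<in> L2 M \<and> (\<integral>\<omega>. (A \<theta> \<omega>)\<^sup>2 \<partial>M) \<le> c)"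

lemma second_order_measurable:
  assumes "second_order c A"
  shows "(\<lambda>x. A (fst x) (snd x)) \<in> borel_measurable (\<nu> \<Otimes>\<^sub>M M)"
  using assms by (simp add: second_order_def case_prod_beta')

lemma mean_abs_mult_le:
  assumes "F \<in> L2 M" "G \<in> L2 M" "(\<integral>\<omega>. (F \<omega>)\<^sup>2 \<partial>M) \<le> c" "(\<integral>\<omega>. (G \<omega>)\<^sup>2 \<partial>M) \<le> d"
  shows "(\<integral>\<omega>. \<bar>F \<omega> * G \<omega>\<bar> \<partial>M) \<le> (c + d) / 2"
proof -
  have "\<bar>x * y\<bar> \<le> (x\<^sup>2 + y\<^sup>2) / 2" for x y :: real
    using sum_squares_bound[of "\<bar>x\<bar>" "\<bar>y\<bar>"] by (simp add: abs_mult)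
  then have "(\<integral>\<omega>. \<bar>F \<omega> * G \<omega>\<bar> \<partial>M) \<le> (\<integral>\<omega>. ((F \<omega>)\<^sup>2 + (G \<omega>)\<^sup>2) / 2 \<partial>M)"
    using assms(1,2) L2_mult_integrable[OF assms(1,2)] L2_square_integrable
    by (intro integral_mono) auto
  also have "\<dots> = ((\<integral>\<omega>. (F \<omega>)\<^sup>2 \<partial>M) + (\<integral>\<omega>. (G \<omega>)\<^sup>2 \<partial>M)) / 2"
    using assms(1,2) L2_square_integrable by simp
  finally show ?thesis using assms(3,4) by simp
qed

lemma weighted_integrable_mult:
  assumes A: "second_order c A" and a: "integrable \<nu> a" "\<And>\<theta>. 0 \<le> a \<theta>" and Q: "Q \<in> L2 M"
  shows "integrable (M \<Otimes>\<^sub>M \<nu>) (\<lambda>x. a (snd x) * (A (snd x) (fst x) * Q (fst x)))"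
proof -
  note [measurable] = second_order_measurable[OF A] L2_meas[OF Q] borel_measurable_integrable[OF a(1)]
  have [measurable]: "(\<lambda>x. A (snd x) (fst x)) \<in> borel_measurable (M \<Otimes>\<^sub>M \<nu>)"
    using measurable_compose[OF measurable_Pair[OF measurable_snd measurable_fst] second_order_measurable[OF A]] by simp
  define q where "q = (\<integral>\<omega>. (Q \<omega>)\<^sup>2 \<partial>M)"
  define f where "f x = a (snd x) * (A (snd x) (fst x) * Q (fst x))" for x
  have [measurable]: "f \<in> borel_measurable (M \<Otimes>\<^sub>M \<nu>)" unfolding f_def by measurable
  have "integrable (M \<Otimes>\<^sub>M \<nu>) f"
  proof (rule integrableI_bounded)
    have "(\<integral>\<^sup>+x. ennreal (norm (f x)) \<partial>(M \<Otimes>\<^sub>M \<nu>)) = (\<integral>\<^sup>+\<theta>. \<integral>\<^sup>+\<omega>. ennreal (norm (f (\<omega>, \<theta>))) \<partial>M \<partial>\<nu>)"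
      by (rule M\<nu>.nn_integral_snd[symmetric]) measurable
    also have "\<dots> \<le> (\<integral>\<^sup>+\<theta>. ennreal (a \<theta> * ((c + q) / 2)) \<partial>\<nu>)"
    proof (rule nn_integral_mono)
      fix \<theta> assume "\<theta> \<in> space \<nu>"
      then have \<theta>: "A \<theta> \<in> L2 M" "(\<integral>\<omega>. (A \<theta> \<omega>)\<^sup>2 \<partial>M) \<le> c" using A by (auto simp: second_order_def)
      have "(\<integral>\<^sup>+\<omega>. ennreal (norm (f (\<omega>, \<theta>))) \<partial>M) = ennreal (\<integral>\<omega>. norm (f (\<omega>, \<theta>)) \<partial>M)"
        unfolding f_def fst_conv snd_conv
        by (intro nn_integral_eq_integral integrable_norm integrable_mult_right L2_mult_integrable \<theta> Q) auto
      also have "(\<integral>\<omega>. norm (f (\<omega>, \<theta>)) \<partial>M) = a \<theta> * (\<integral>\<omega>. \<bar>A \<theta> \<omega> * Q \<omega>\<bar> \<partial>M)"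
        by (simp add: f_def abs_mult a(2))
      also have "ennreal \<dots> \<le> ennreal (a \<theta> * ((c + q) / 2))"
        using mean_abs_mult_le[OF \<theta>(1) Q \<theta>(2), of q] by (intro ennreal_leI mult_left_mono a) (simp add: q_def)
      finally show "(\<integral>\<^sup>+\<omega>. ennreal (norm (f (\<omega>, \<theta>))) \<partial>M) \<le> ennreal (a \<theta> * ((c + q) / 2))" .
    qed
    also have "\<dots> < \<infinity>"
      using integrableD(2)[OF integrable_mult_left[OF a(1), of "(c + q) / 2"]] by (simp add: less_top)
    finally show "(\<integral>\<^sup>+x. ennreal (norm (f x)) \<partial>(M \<Otimes>\<^sub>M \<nu>)) < \<infinity>" .
  qed measurable
  then show ?thesis by (simp add: f_def[abs_def])
qed

lemma weighted_integrable:
  assumes A: "second_order c A" and a: "integrable \<nu> a" "\<And>\<theta>. 0 \<le> a \<theta>"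
  shows "integrable (M \<Otimes>\<^sub>M \<nu>) (\<lambda>x. a (snd x) * A (snd x) (fst x))"
  using weighted_integrable_mult[OF A a L2_const[of 1]] by simp

lemma weighted_inner:
  assumes A: "second_order c A" and a: "integrable \<nu> a" "\<And>\<theta>. 0 \<le> a \<theta>" and Q: "Q \<in> L2 M"
  shows "(\<integral>\<omega>. (\<integral>\<theta>. a \<theta> * A \<theta> \<omega> \<partial>\<nu>) * Q \<omega> \<partial>M) = (\<integral>\<theta>. a \<theta> * (\<integral>\<omega>. A \<theta> \<omega> * Q \<omega> \<partial>M) \<partial>\<nu>)"
proof -
  define f where "f x = a (snd x) * (A (snd x) (fst x) * Q (fst x))" for x
  have int: "integrable (M \<Otimes>\<^sub>M \<nu>) f"
    unfolding f_def by (rule weighted_integrable_mult[OF A a Q])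
  have "(\<integral>\<omega>. (\<integral>\<theta>. a \<theta> * A \<theta> \<omega> \<partial>\<nu>) * Q \<omega> \<partial>M) = (\<integral>\<omega>. (\<integral>\<theta>. f (\<omega>, \<theta>) \<partial>\<nu>) \<partial>M)"
    by (intro Bochner_Integration.integral_cong refl) (simp add: f_def mult.assoc flip: integral_mult_left_zero)
  also have "\<dots> = (\<integral>\<theta>. (\<integral>\<omega>. f (\<omega>, \<theta>) \<partial>M) \<partial>\<nu>)"
    using M\<nu>.Fubini_integral[of "\<lambda>\<omega> \<theta>. f (\<omega>, \<theta>)"] int by simp
  finally show ?thesis by (simp add: f_def)
qed

lemma weighted_gram:
  assumes A: "second_order c A" and B: "second_order d B"
    and a: "integrable \<nu> a" "\<And>\<theta>. 0 \<le> a \<theta>" and b: "integrable \<nu> b" "\<And>\<theta>. 0 \<le> b \<theta>"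
  defines "F \<equiv> \<lambda>\<omega>. \<integral>\<theta>. a \<theta> * A \<theta> \<omega> \<partial>\<nu>" and "G \<equiv> \<lambda>\<omega>. \<integral>\<theta>. b \<theta> * B \<theta> \<omega> \<partial>\<nu>"
  shows "integrable M (\<lambda>\<omega>. F \<omega> * G \<omega>)"
    and "(\<integral>\<omega>. F \<omega> * G \<omega> \<partial>M) = (\<integral>x. a (fst x) * b (snd x) * (\<integral>\<omega>. A (fst x) \<omega> * B (snd x) \<omega> \<partial>M) \<partial>(\<nu> \<Otimes>\<^sub>M \<nu>))"
proof -
  interpret MN: pair_sigma_finite M "\<nu> \<Otimes>\<^sub>M \<nu>"
    by (intro pair_sigma_finite.intro sigma_finite_pair_measure) unfold_locales
  note [measurable] = borel_measurable_integrable[OF a(1)] borel_measurable_integrable[OF b(1)]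
  have m: "(\<lambda>x. X (snd x) (fst x)) \<in> borel_measurable (M \<Otimes>\<^sub>M \<nu>)" if "second_order e X" for e X
    using measurable_compose[OF measurable_Pair[OF measurable_snd measurable_fst] second_order_measurable[OF that]] by simp
  note [measurable] = m[OF A] m[OF B]
  have [measurable]: "(\<lambda>x. A (fst (snd x)) (fst x)) \<in> borel_measurable (M \<Otimes>\<^sub>M (\<nu> \<Otimes>\<^sub>M \<nu>))"
    using measurable_compose[OF _ m[OF A], of "\<lambda>x. (fst x, fst (snd x))" "M \<Otimes>\<^sub>M (\<nu> \<Otimes>\<^sub>M \<nu>)"] by simp
  have [measurable]: "(\<lambda>x. B (snd (snd x)) (fst x)) \<in> borel_measurable (M \<Otimes>\<^sub>M (\<nu> \<Otimes>\<^sub>M \<nu>))"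
    using measurable_compose[OF _ m[OF B], of "\<lambda>x. (fst x, snd (snd x))" "M \<Otimes>\<^sub>M (\<nu> \<Otimes>\<^sub>M \<nu>)"] by simp
  have sf: "sigma_finite_measure \<nu>" ..
  define f where "f x = (a (fst (snd x)) * A (fst (snd x)) (fst x)) * (b (snd (snd x)) * B (snd (snd x)) (fst x))" for x
  have [measurable]: "f \<in> borel_measurable (M \<Otimes>\<^sub>M (\<nu> \<Otimes>\<^sub>M \<nu>))" unfolding f_def by measurable
  have fin: "(\<integral>\<^sup>+\<theta>. ennreal (a' \<theta>) \<partial>\<nu>) < \<infinity>" if "integrable \<nu> a'" for a'
    using integrableD(2)[OF that] by (simp add: less_top)
  have int: "integrable (M \<Otimes>\<^sub>M (\<nu> \<Otimes>\<^sub>M \<nu>)) f"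
  proof (rule integrableI_bounded)
    have "(\<integral>\<^sup>+x. ennreal (norm (f x)) \<partial>(M \<Otimes>\<^sub>M (\<nu> \<Otimes>\<^sub>M \<nu>))) = (\<integral>\<^sup>+y. \<integral>\<^sup>+\<omega>. ennreal (norm (f (\<omega>, y))) \<partial>M \<partial>(\<nu> \<Otimes>\<^sub>M \<nu>))"
      by (rule MN.nn_integral_snd[symmetric]) measurable
    also have "\<dots> \<le> (\<integral>\<^sup>+y. ennreal (a (fst y) * ((c + d) / 2)) * ennreal (b (snd y)) \<partial>(\<nu> \<Otimes>\<^sub>M \<nu>))"
    proof (rule nn_integral_mono)
      fix y assume "y \<in> space (\<nu> \<Otimes>\<^sub>M \<nu>)"
      then have \<theta>: "A (fst y) \<in> L2 M" "(\<integral>\<omega>. (A (fst y) \<omega>)\<^sup>2 \<partial>M) \<le> c"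
        "B (snd y) \<in> L2 M" "(\<integral>\<omega>. (B (snd y) \<omega>)\<^sup>2 \<partial>M) \<le> d"
        using A B by (auto simp: second_order_def space_pair_measure)
      have f': "f (\<omega>, y) = (a (fst y) * b (snd y)) * (A (fst y) \<omega> * B (snd y) \<omega>)" for \<omega>
        by (simp add: f_def)
      have "(\<integral>\<^sup>+\<omega>. ennreal (norm (f (\<omega>, y))) \<partial>M) = ennreal (\<integral>\<omega>. norm (f (\<omega>, y)) \<partial>M)"
        unfolding f'
        by (intro nn_integral_eq_integral integrable_norm integrable_mult_right L2_mult_integrable \<theta>) auto
      also have "(\<integral>\<omega>. norm (f (\<omega>, y)) \<partial>M) = (a (fst y) * b (snd y)) * (\<integral>\<omega>. \<bar>A (fst y) \<omega> * B (snd y) \<omega>\<bar> \<partial>M)"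
        unfolding f' by (simp add: abs_mult a(2) b(2))
      also have "ennreal \<dots> \<le> ennreal ((a (fst y) * b (snd y)) * ((c + d) / 2))"
        using mean_abs_mult_le[OF \<theta>(1,3,2,4)] a(2) b(2) by (intro ennreal_leI mult_left_mono) auto
      also have "\<dots> = ennreal (a (fst y) * ((c + d) / 2)) * ennreal (b (snd y))"
        by (subst ennreal_mult''[symmetric]) (simp_all add: b(2) mult_ac)
      finally show "(\<integral>\<^sup>+\<omega>. ennreal (norm (f (\<omega>, y))) \<partial>M) \<le> ennreal (a (fst y) * ((c + d) / 2)) * ennreal (b (snd y))" .
    qed
    also have "\<dots> = (\<integral>\<^sup>+\<theta>. \<integral>\<^sup>+\<eta>. ennreal (a \<theta> * ((c + d) / 2)) * ennreal (b \<eta>) \<partial>\<nu> \<partial>\<nu>)"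
    proof -
      have "(\<lambda>y. ennreal (a (fst y) * ((c + d) / 2)) * ennreal (b (snd y))) \<in> borel_measurable (\<nu> \<Otimes>\<^sub>M \<nu>)"
        by measurable
      from sigma_finite_measure.nn_integral_fst[OF sf this] show ?thesis by simp
    qed
    also have "\<dots> = (\<integral>\<^sup>+\<theta>. ennreal (a \<theta> * ((c + d) / 2)) \<partial>\<nu>) * (\<integral>\<^sup>+\<eta>. ennreal (b \<eta>) \<partial>\<nu>)"
      by (simp add: nn_integral_cmult nn_integral_multc)
    also have "\<dots> < \<infinity>"
      using fin[OF integrable_mult_left[OF a(1)], of "(c + d) / 2"] fin[OF b(1)] by (simp add: ennreal_mult_less_top)
    finally show "(\<integral>\<^sup>+x. ennreal (norm (f x)) \<partial>(M \<Otimes>\<^sub>M (\<nu> \<Otimes>\<^sub>M \<nu>))) < \<infinity>" .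
  qed measurable
  have "AE \<omega> in M. integrable (\<nu> \<Otimes>\<^sub>M \<nu>) (\<lambda>y. f (\<omega>, y))"
    using MN.AE_integrable_fst[of "\<lambda>\<omega> y. f (\<omega>, y)"] int by simp
  then have eq: "AE \<omega> in M. (\<integral>y. f (\<omega>, y) \<partial>(\<nu> \<Otimes>\<^sub>M \<nu>)) = F \<omega> * G \<omega>"
  proof eventually_elim
    case (elim \<omega>)
    have "(\<integral>y. f (\<omega>, y) \<partial>(\<nu> \<Otimes>\<^sub>M \<nu>)) = (\<integral>\<theta>. (\<integral>\<eta>. f (\<omega>, \<theta>, \<eta>) \<partial>\<nu>) \<partial>\<nu>)"
      using \<nu>\<nu>.integral_fst'[OF elim] by simp
    also have "\<dots> = F \<omega> * G \<omega>" by (simp add: f_def F_def G_def)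
    finally show ?case .
  qed
  have i: "integrable M (\<lambda>\<omega>. \<integral>y. f (\<omega>, y) \<partial>(\<nu> \<Otimes>\<^sub>M \<nu>))"
    using MN.integrable_fst'[OF int] .
  have [measurable]: "F \<in> borel_measurable M" "G \<in> borel_measurable M"
    unfolding F_def G_def by measurable
  show "integrable M (\<lambda>\<omega>. F \<omega> * G \<omega>)"
    by (rule integrable_cong_AE_imp[OF i _ eq]) measurable
  have "(\<integral>\<omega>. F \<omega> * G \<omega> \<partial>M) = (\<integral>\<omega>. (\<integral>y. f (\<omega>, y) \<partial>(\<nu> \<Otimes>\<^sub>M \<nu>)) \<partial>M)"
    using eq by (intro integral_cong_AE) (auto simp: eq_commute)
  also have "\<dots> = (\<integral>y. (\<integral>\<omega>. f (\<omega>, y) \<partial>M) \<partial>(\<nu> \<Otimes>\<^sub>M \<nu>))"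
    using MN.Fubini_integral[of "\<lambda>\<omega> y. f (\<omega>, y)"] int by simp
  also have "\<dots> = (\<integral>x. a (fst x) * b (snd x) * (\<integral>\<omega>. A (fst x) \<omega> * B (snd x) \<omega> \<partial>M) \<partial>(\<nu> \<Otimes>\<^sub>M \<nu>))"
    by (intro Bochner_Integration.integral_cong refl) (simp add: f_def mult_ac flip: integral_mult_right_zero)
  finally show "(\<integral>\<omega>. F \<omega> * G \<omega> \<partial>M) = (\<integral>x. a (fst x) * b (snd x) * (\<integral>\<omega>. A (fst x) \<omega> * B (snd x) \<omega> \<partial>M) \<partial>(\<nu> \<Otimes>\<^sub>M \<nu>))" .
qed

lemma weighted_L2:
  assumes A: "second_order c A" and a: "integrable \<nu> a" "\<And>\<theta>. 0 \<le> a \<theta>"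
  shows "(\<lambda>\<omega>. \<integral>\<theta>. a \<theta> * A \<theta> \<omega> \<partial>\<nu>) \<in> L2 M"
proof -
  have [measurable]: "(\<lambda>x. A (snd x) (fst x)) \<in> borel_measurable (M \<Otimes>\<^sub>M \<nu>)"
    using measurable_compose[OF measurable_Pair[OF measurable_snd measurable_fst] second_order_measurable[OF A]] by simp
  note [measurable] = borel_measurable_integrable[OF a(1)]
  have "(\<lambda>\<omega>. \<integral>\<theta>. a \<theta> * A \<theta> \<omega> \<partial>\<nu>) \<in> borel_measurable M"
    by measurable
  then show ?thesis
    using weighted_gram(1)[OF A A a a] by (simp add: L2_def power2_eq_square)
qed

text \<open>
  The Cauchy--Schwarz inequality with respect to the measure with density \<open>a\<close>, in the sharp form: it is
  applied to differences that are small on average over the parameter.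
\<close>

lemma weighted_norm_le:
  assumes A: "second_order c A" and a: "integrable \<nu> a" "\<And>\<theta>. 0 \<le> a \<theta>"
  shows "(\<integral>\<omega>. (\<integral>\<theta>. a \<theta> * A \<theta> \<omega> \<partial>\<nu>)\<^sup>2 \<partial>M) \<le> (\<integral>\<theta>. a \<theta> \<partial>\<nu>) * (\<integral>\<theta>. a \<theta> * (\<integral>\<omega>. (A \<theta> \<omega>)\<^sup>2 \<partial>M) \<partial>\<nu>)"
proof -
  note [measurable] = second_order_measurable[OF A] borel_measurable_integrable[OF a(1)]
  define F where "F \<omega> = (\<integral>\<theta>. a \<theta> * A \<theta> \<omega> \<partial>\<nu>)" for \<omega>
  define N where "N = (\<integral>\<omega>. (F \<omega>)\<^sup>2 \<partial>M)"
  define q where "q \<theta> = (\<integral>\<omega>. (A \<theta> \<omega>)\<^sup>2 \<partial>M)" for \<theta>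
  have FL: "F \<in> L2 M" unfolding F_def[abs_def] by (rule weighted_L2[OF A a])
  have [measurable]: "q \<in> borel_measurable \<nu>" unfolding q_def by measurable
  have q: "0 \<le> q \<theta>" "\<theta> \<in> space \<nu> \<Longrightarrow> q \<theta> \<le> c" for \<theta> using A by (auto simp: q_def second_order_def)
  have iq: "integrable \<nu> (\<lambda>\<theta>. a \<theta> * q \<theta>)"
    by (rule Bochner_Integration.integrable_bound[OF integrable_mult_left[OF a(1), of c]])
       (use a(2) q in \<open>auto intro!: AE_I2 mult_mono order_trans[OF _ abs_ge_self[of c]] simp: abs_mult\<close>)
  show ?thesis
  proof (cases "space \<nu> = {}")
    case True
    then show ?thesis by (simp add: Bochner_Integration.integral_empty)
  next
    case False
    define T where "T = (\<integral>\<theta>. a \<theta> \<partial>\<nu>)"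
    have N_eq: "N = (\<integral>\<theta>. a \<theta> * (\<integral>\<omega>. A \<theta> \<omega> * F \<omega> \<partial>M) \<partial>\<nu>)"
      using weighted_inner[OF A a FL] by (simp add: N_def F_def power2_eq_square)
    have T0: "0 \<le> T" unfolding T_def by (rule integral_nonneg_AE) (simp add: a)
    \<comment> \<open>\<open>2 * T * x * y \<le> T\<^sup>2 * x\<^sup>2 + y\<^sup>2\<close>; the factor \<open>T\<close> lets half of the left-hand side absorb \<open>N * T\<close>\<close>
    have "2 * N * T \<le> T\<^sup>2 * (\<integral>\<theta>. a \<theta> * q \<theta> \<partial>\<nu>) + N * T"
    proof -
      have "a \<theta> * (\<integral>\<omega>. A \<theta> \<omega> * F \<omega> \<partial>M) * (2 * T) \<le> T\<^sup>2 * (a \<theta> * q \<theta>) + N * a \<theta>" if "\<theta> \<in> space \<nu>" for \<theta>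
      proof -
        have AL: "A \<theta> \<in> L2 M" using A that by (simp add: second_order_def)
        have "0 \<le> (\<integral>\<omega>. (T * A \<theta> \<omega> - F \<omega>)\<^sup>2 \<partial>M)" by simp
        also have "\<dots> = T\<^sup>2 * q \<theta> - 2 * (T * (\<integral>\<omega>. A \<theta> \<omega> * F \<omega> \<partial>M)) + N"
          unfolding integral_diff_square[OF L2_scale[OF AL] FL] by (simp add: power_mult_distrib q_def N_def mult.assoc)
        finally have "2 * (T * (\<integral>\<omega>. A \<theta> \<omega> * F \<omega> \<partial>M)) \<le> T\<^sup>2 * q \<theta> + N" by simp
        from mult_left_mono[OF this a(2)[of \<theta>]] show ?thesis by (simp add: algebra_simps)
      qed
      moreover have "integrable \<nu> (\<lambda>\<theta>. a \<theta> * (\<integral>\<omega>. A \<theta> \<omega> * F \<omega> \<partial>M))"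
      proof (rule Bochner_Integration.integrable_bound[OF integrable_mult_left[OF a(1), of "(c + N) / 2"]])
        note [measurable] = L2_meas[OF FL]
        show "(\<lambda>\<theta>. a \<theta> * (\<integral>\<omega>. A \<theta> \<omega> * F \<omega> \<partial>M)) \<in> borel_measurable \<nu>" by measurable
        have "\<bar>\<integral>\<omega>. A \<theta> \<omega> * F \<omega> \<partial>M\<bar> \<le> (c + N) / 2" if "\<theta> \<in> space \<nu>" for \<theta>
        proof (rule order_trans[OF integral_abs_bound mean_abs_mult_le])
        qed (use A that FL in \<open>auto simp: second_order_def N_def\<close>)
        then show "AE \<theta> in \<nu>. norm (a \<theta> * (\<integral>\<omega>. A \<theta> \<omega> * F \<omega> \<partial>M)) \<le> norm (a \<theta> * ((c + N) / 2))"
          unfolding real_norm_def abs_mult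
          by (intro AE_I2 mult_left_mono order_trans[OF _ abs_ge_self[of "(c + N) / 2"]]) auto
      qed
      ultimately have "(\<integral>\<theta>. a \<theta> * (\<integral>\<omega>. A \<theta> \<omega> * F \<omega> \<partial>M) * (2 * T) \<partial>\<nu>) \<le> (\<integral>\<theta>. T\<^sup>2 * (a \<theta> * q \<theta>) + N * a \<theta> \<partial>\<nu>)"
        using iq a(1) by (intro integral_mono) auto
      then show ?thesis
        using iq a(1) N_eq[symmetric] by (simp add: T_def[symmetric])
    qed
    then have *: "N * T \<le> T * (T * (\<integral>\<theta>. a \<theta> * q \<theta> \<partial>\<nu>))" by (simp add: power2_eq_square)
    show ?thesis
    proof (cases "T = 0")
      case True
      then have "AE \<theta> in \<nu>. a \<theta> = 0"
        using integral_nonneg_eq_0_iff_AE[OF a(1)] a(2) by (simp add: T_def)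
      then have "(\<integral>\<theta>. a \<theta> * A \<theta> \<omega> \<partial>\<nu>) = 0" if "\<omega> \<in> space M" for \<omega>
        using that by (intro integral_eq_zero_AE) auto
      then have "(\<integral>\<omega>. (\<integral>\<theta>. a \<theta> * A \<theta> \<omega> \<partial>\<nu>)\<^sup>2 \<partial>M) = (\<integral>\<omega>. 0 \<partial>M)"
        by (intro Bochner_Integration.integral_cong) auto
      then show ?thesis using True by (simp add: T_def)
    next
      case False
      then have "N \<le> T * (\<integral>\<theta>. a \<theta> * q \<theta> \<partial>\<nu>)"
        using * T0 by (simp add: mult.commute[of N])
      then show ?thesis by (simp add: N_def F_def T_def q_def)
    qed
  qed
qed

end

section \<open>The local time of a Gaussian family and its chaos expansion\<close>

lemma filterlim_inverse_Suc_at_right: "filterlim (\<lambda>k. inverse (real (Suc k))) (at_right 0) sequentially"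
  unfolding filterlim_at using LIMSEQ_inverse_real_of_nat by auto

text \<open>
  Gaussian variables \<open>U \<theta>\<close> indexed by a measure space, with weights \<open>w \<epsilon>\<close> that are integrable for positive
  \<open>\<epsilon>\<close> and increase to \<open>w 0\<close>, whose integral may be infinite. The maps \<open>approx k\<close> replace the index by one
  of finitely many; they turn integrals over the index into linear combinations of polynomials in the
  variables \<open>V\<close>, and have to reproduce covariances only in the limit and where the weight does not vanish.
\<close>

locale gaussian_family = gaussian_space M S + weighted_family M \<nu>
  for M :: "'w measure" and S :: "('w \<Rightarrow> real) set" and \<nu> :: "'p measure" +
  fixes U :: "'p \<Rightarrow> 'w \<Rightarrow> real" and w :: "real \<Rightarrow> 'p \<Rightarrow> real" and V :: "('w \<Rightarrow> real) set"
    and approx :: "nat \<Rightarrow> 'p \<Rightarrow> 'p"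
  assumes U_S: "U \<theta> \<in> S"
    and U_meas [measurable]: "(\<lambda>x. U (fst x) (snd x)) \<in> borel_measurable (\<nu> \<Otimes>\<^sub>M M)"
    and w_nonneg: "0 \<le> w \<epsilon> \<theta>"
    and w_meas [measurable]: "w 0 \<in> borel_measurable \<nu>"
    and w_int: "0 < \<epsilon> \<Longrightarrow> integrable \<nu> (w \<epsilon>)"
    and w_antimono: "0 \<le> \<epsilon> \<Longrightarrow> \<epsilon> \<le> \<delta> \<Longrightarrow> w \<delta> \<theta> \<le> w \<epsilon> \<theta>"
    and w_lim: "(\<lambda>k. w (inverse (real (Suc k))) \<theta>) \<longlonglongrightarrow> w 0 \<theta>"
    and V_S: "V \<subseteq> S"
    and U_poly: "U \<theta> \<in> polynomials_upto V 1"
    and approx_finite: "finite (range (approx k))"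
    and approx_meas: "approx k -` {p} \<inter> space \<nu> \<in> sets \<nu>"
    and approx_meas' [measurable]: "approx k \<in> measurable \<nu> \<nu>"
    and approx_lim: "w 0 \<theta> \<noteq> 0 \<Longrightarrow> (\<lambda>k. cov (U (approx k \<theta>)) (U (approx k \<theta>))) \<longlonglongrightarrow> cov (U \<theta>) (U \<theta>)"
      "w 0 \<theta> \<noteq> 0 \<Longrightarrow> (\<lambda>k. cov (U (approx k \<theta>)) (U \<theta>)) \<longlonglongrightarrow> cov (U \<theta>) (U \<theta>)"
begin

definition v :: "'p \<Rightarrow> real" where "v \<theta> = cov (U \<theta>) (U \<theta>)"

definition C :: "'p \<Rightarrow> 'p \<Rightarrow> real" where "C \<theta> \<eta> = cov (U \<theta>) (U \<eta>)"

text \<open>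
  The covariance function of \<open>\<theta> \<mapsto> cos (U \<theta>)\<close>, see \<open>cov_cos_cos\<close>, and then that of its components of
  order \<open>2 * m\<close>, see \<open>cov_chaos_chaos\<close>.
\<close>

definition \<kappa> :: "'p \<times> 'p \<Rightarrow> real" where
  "\<kappa> x = exp (- (v (fst x) + v (snd x)) / 2) * cosh (C (fst x) (snd x))"

definition \<kappa>\<^sub>n :: "nat \<Rightarrow> 'p \<times> 'p \<Rightarrow> real" where
  "\<kappa>\<^sub>n m x = exp (- (v (fst x) + v (snd x)) / 2) * (C (fst x) (snd x) ^ (2 * m) / fact (2 * m))"

text \<open>
  The component of \<open>cos (U \<theta>)\<close> in the chaos of order \<open>2 * m\<close>. The components of odd order vanish since the
  cosine is even.
\<close>

definition cos_chaos :: "nat \<Rightarrow> 'p \<Rightarrow> 'w \<Rightarrow> real" where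
  "cos_chaos m \<theta> \<omega> = exp (- v \<theta> / 2) * ((-1) ^ m * wick (2 * m) (v \<theta>) (U \<theta> \<omega>))"

definition local_time :: "real \<Rightarrow> 'w \<Rightarrow> real" where
  "local_time \<epsilon> \<omega> = (\<integral>\<theta>. w \<epsilon> \<theta> * cos (U \<theta> \<omega>) \<partial>\<nu>)"

definition local_time_chaos :: "nat \<Rightarrow> real \<Rightarrow> 'w \<Rightarrow> real" where
  "local_time_chaos m \<epsilon> \<omega> = (\<integral>\<theta>. w \<epsilon> \<theta> * cos_chaos m \<theta> \<omega> \<partial>\<nu>)"

text \<open>
  The limit of the squared norms of \<open>\<integral> w \<epsilon> \<theta> * A \<theta> d\<theta>\<close> as \<open>\<epsilon>\<close> decreases to \<open>0\<close>, for a family \<open>A\<close> with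
  covariance function \<open>k\<close>; it may be infinite.
\<close>

definition mass :: "('p \<times> 'p \<Rightarrow> real) \<Rightarrow> ennreal" where
  "mass k = (\<integral>\<^sup>+x. ennreal (w 0 (fst x) * w 0 (snd x) * k x) \<partial>(\<nu> \<Otimes>\<^sub>M \<nu>))"

lemma C_sym: "C \<theta> \<eta> = C \<eta> \<theta>" by (simp add: C_def mult.commute)

lemma C_self: "C \<theta> \<theta> = v \<theta>" by (simp add: C_def v_def)

lemma v_meas [measurable]: "v \<in> borel_measurable \<nu>"
  unfolding v_def by measurable

lemma C_meas [measurable]: "(\<lambda>x. C (fst x) (snd x)) \<in> borel_measurable (\<nu> \<Otimes>\<^sub>M \<nu>)"
proof -
  have [measurable]: "(\<lambda>y. U (fst (fst y)) (snd y)) \<in> borel_measurable ((\<nu> \<Otimes>\<^sub>M \<nu>) \<Otimes>\<^sub>M M)"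
    using measurable_compose[OF _ U_meas, of "\<lambda>y. (fst (fst y), snd y)" "(\<nu> \<Otimes>\<^sub>M \<nu>) \<Otimes>\<^sub>M M"] by simp
  have [measurable]: "(\<lambda>y. U (snd (fst y)) (snd y)) \<in> borel_measurable ((\<nu> \<Otimes>\<^sub>M \<nu>) \<Otimes>\<^sub>M M)"
    using measurable_compose[OF _ U_meas, of "\<lambda>y. (snd (fst y), snd y)" "(\<nu> \<Otimes>\<^sub>M \<nu>) \<Otimes>\<^sub>M M"] by simp
  show ?thesis unfolding C_def by measurable
qed

lemma \<kappa>_meas [measurable]: "\<kappa> \<in> borel_measurable (\<nu> \<Otimes>\<^sub>M \<nu>)"
  unfolding \<kappa>_def cosh_field_def by measurable

lemma \<kappa>\<^sub>n_meas [measurable]: "\<kappa>\<^sub>n m \<in> borel_measurable (\<nu> \<Otimes>\<^sub>M \<nu>)"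
  unfolding \<kappa>\<^sub>n_def by measurable

lemma abs_C_le: "\<bar>C \<theta> \<eta>\<bar> \<le> (v \<theta> + v \<eta>) / 2"
proof -
  have "\<bar>C \<theta> \<eta>\<bar> \<le> (\<integral>\<omega>. \<bar>U \<theta> \<omega> * U \<eta> \<omega>\<bar> \<partial>M)"
    unfolding C_def by (rule integral_abs_bound)
  also have "\<dots> \<le> (v \<theta> + v \<eta>) / 2"
    using U_S by (intro mean_abs_mult_le finite_moments_L2 S_finite_moments) (auto simp: v_def power2_eq_square)
  finally show ?thesis .
qed

lemma sums_cosh_even: "(\<lambda>m. x ^ (2 * m) / fact (2 * m)) sums cosh (x :: real)"
proof -
  have "(\<lambda>n. if even n then x ^ n /\<^sub>R fact n else 0) sums cosh x" by (rule cosh_converges)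
  then have "(\<lambda>m. (\<lambda>n. if even n then x ^ n /\<^sub>R fact n else 0) (2 * m)) sums cosh x"
    by (subst sums_mono_reindex) (auto simp: strict_mono_def elim!: evenE)
  then show ?thesis by (simp add: divide_inverse mult.commute)
qed

lemma \<kappa>_le_1: "\<kappa> x \<le> 1"
proof -
  have "cosh (C (fst x) (snd x)) \<le> exp \<bar>C (fst x) (snd x)\<bar>"
    by (simp add: cosh_field_def abs_if)
  also have "\<dots> \<le> exp ((v (fst x) + v (snd x)) / 2)" using abs_C_le by simp
  finally have "\<kappa> x \<le> exp (- (v (fst x) + v (snd x)) / 2) * exp ((v (fst x) + v (snd x)) / 2)"
    unfolding \<kappa>_def by (intro mult_left_mono) auto
  also have "\<dots> = 1" by (simp add: mult_exp_exp flip: add_divide_distrib)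
  finally show ?thesis .
qed

lemma \<kappa>\<^sub>n_nonneg: "0 \<le> \<kappa>\<^sub>n m x"
  by (simp add: \<kappa>\<^sub>n_def power_mult)

lemma sums_\<kappa>: "(\<lambda>m. \<kappa>\<^sub>n m x) sums \<kappa> x"
  unfolding \<kappa>_def \<kappa>\<^sub>n_def by (intro sums_mult sums_cosh_even)

lemma \<kappa>_nonneg: "0 \<le> \<kappa> x"
  by (simp add: \<kappa>_def)

lemma \<kappa>\<^sub>n_le_1: "\<kappa>\<^sub>n m x \<le> 1"
proof -
  have "\<kappa>\<^sub>n m x = (\<Sum>i\<in>{m}. \<kappa>\<^sub>n i x)" by simp
  also have "\<dots> \<le> (\<Sum>i. \<kappa>\<^sub>n i x)"
    using sums_\<kappa>[of x] \<kappa>\<^sub>n_nonneg by (intro sum_le_suminf) (auto simp: sums_iff)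
  also have "\<dots> = \<kappa> x" using sums_\<kappa>[of x] by (simp add: sums_iff)
  finally show ?thesis using \<kappa>_le_1[of x] by simp
qed

lemma exp_half_add: "exp (- (a + b) / 2) = exp (- a / 2) * exp (- b / 2 :: real)"
  by (simp add: mult_exp_exp add_divide_distrib diff_divide_distrib)

lemma cov_cos_cos: "(\<integral>\<omega>. cos (U \<theta> \<omega>) * cos (U \<eta> \<omega>) \<partial>M) = \<kappa> (\<theta>, \<eta>)"
  using expectation_cos_cos[OF U_S U_S] by (simp add: \<kappa>_def v_def C_def)

lemma cov_cos_chaos: "(\<integral>\<omega>. cos (U \<theta> \<omega>) * cos_chaos m \<eta> \<omega> \<partial>M) = \<kappa>\<^sub>n m (\<theta>, \<eta>)"
proof -
  have "(\<integral>\<omega>. cos (U \<theta> \<omega>) * cos_chaos m \<eta> \<omega> \<partial>M) =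
      (\<integral>\<omega>. exp (- v \<eta> / 2) * (cos (U \<theta> \<omega>) * ((-1) ^ m * wick (2 * m) (v \<eta>) (U \<eta> \<omega>))) \<partial>M)"
    by (intro Bochner_Integration.integral_cong) (auto simp: cos_chaos_def mult_ac)
  also have "\<dots> = exp (- v \<eta> / 2) * (exp (- v \<theta> / 2) * (C \<eta> \<theta> ^ (2 * m) / fact (2 * m)))"
    unfolding v_def[of \<eta>] using expectation_cos_wick[OF U_S U_S, of \<theta> m \<eta>]
    by (simp add: v_def C_def)
  also have "\<dots> = \<kappa>\<^sub>n m (\<theta>, \<eta>)"
    unfolding \<kappa>\<^sub>n_def exp_half_add fst_conv snd_conv C_sym[of \<eta>] by (simp only: mult_ac)
  finally show ?thesis .
qed

lemma cov_chaos_chaos: "(\<integral>\<omega>. cos_chaos m \<theta> \<omega> * cos_chaos m \<eta> \<omega> \<partial>M) = \<kappa>\<^sub>n m (\<theta>, \<eta>)"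
proof -
  have "(\<integral>\<omega>. cos_chaos m \<theta> \<omega> * cos_chaos m \<eta> \<omega> \<partial>M) =
      (\<integral>\<omega>. (exp (- v \<theta> / 2) * exp (- v \<eta> / 2)) * (wick (2 * m) (v \<theta>) (U \<theta> \<omega>) * wick (2 * m) (v \<eta>) (U \<eta> \<omega>)) \<partial>M)"
  proof (intro Bochner_Integration.integral_cong refl)
    fix \<omega>
    have "e * (s * x) * (e' * (s * y)) = (s * s) * ((e * e') * (x * y))" for e e' s x y :: real
      by (simp only: mult_ac)
    then show "cos_chaos m \<theta> \<omega> * cos_chaos m \<eta> \<omega> =
       (exp (- v \<theta> / 2) * exp (- v \<eta> / 2)) * (wick (2 * m) (v \<theta>) (U \<theta> \<omega>) * wick (2 * m) (v \<eta>) (U \<eta> \<omega>))"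
      unfolding cos_chaos_def by (simp flip: power_mult_distrib)
  qed
  also have "\<dots> = (exp (- v \<theta> / 2) * exp (- v \<eta> / 2)) * (C \<theta> \<eta> ^ (2 * m) / fact (2 * m))"
    using wick_wick[OF U_S U_S, of "2 * m" \<theta> "2 * m" \<eta>] by (simp add: v_def C_def)
  also have "\<dots> = \<kappa>\<^sub>n m (\<theta>, \<eta>)"
    unfolding \<kappa>\<^sub>n_def exp_half_add by simp
  finally show ?thesis .
qed

lemma cos_chaos_finite_moments: "cos_chaos m \<theta> \<in> finite_moments M"
  unfolding cos_chaos_def[abs_def]
  by (intro finite_moments_mult[OF finite_moments_const] finite_moments_wick S_finite_moments U_S)

lemma second_order_cos: "second_order 1 (\<lambda>\<theta> \<omega>. cos (U \<theta> \<omega>))"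
proof -
  have [measurable]: "U \<theta> \<in> borel_measurable M" for \<theta> by (rule S_meas[OF U_S])
  have "(\<lambda>\<omega>. cos (U \<theta> \<omega>)) \<in> L2 M" for \<theta>
    by (auto simp: L2_def abs_square_le_1 intro!: integrable_const_bound[where B = 1])
  then show ?thesis
    using cov_cos_cos \<kappa>_le_1 by (simp add: second_order_def case_prod_beta' power2_eq_square)
qed

lemma cos_chaos_meas [measurable]: "(\<lambda>x. cos_chaos m (fst x) (snd x)) \<in> borel_measurable (\<nu> \<Otimes>\<^sub>M M)"
  unfolding cos_chaos_def by measurable

lemma second_order_chaos: "second_order 1 (cos_chaos m)"
  using cov_chaos_chaos \<kappa>\<^sub>n_le_1 finite_moments_L2[OF cos_chaos_finite_moments]
  by (simp add: second_order_def case_prod_beta' power2_eq_square)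

lemma local_time_L2: "0 < \<epsilon> \<Longrightarrow> local_time \<epsilon> \<in> L2 M"
  unfolding local_time_def[abs_def] by (intro weighted_L2[OF second_order_cos] w_int w_nonneg)

lemma local_time_chaos_L2: "0 < \<epsilon> \<Longrightarrow> local_time_chaos m \<epsilon> \<in> L2 M"
  unfolding local_time_chaos_def[abs_def] by (intro weighted_L2[OF second_order_chaos] w_int w_nonneg)

lemma gram_local_time:
  assumes "0 < \<epsilon>" "0 < \<delta>"
  shows "(\<integral>\<omega>. local_time \<epsilon> \<omega> * local_time \<delta> \<omega> \<partial>M) = (\<integral>x. w \<epsilon> (fst x) * w \<delta> (snd x) * \<kappa> x \<partial>(\<nu> \<Otimes>\<^sub>M \<nu>))"
  unfolding local_time_def
  by (subst weighted_gram(2)[OF second_order_cos second_order_cos]) (use assms in \<open>auto intro: w_int w_nonneg simp: cov_cos_cos\<close>)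

lemma gram_chaos:
  assumes "0 < \<epsilon>" "0 < \<delta>"
  shows "(\<integral>\<omega>. local_time_chaos m \<epsilon> \<omega> * local_time_chaos m \<delta> \<omega> \<partial>M) = (\<integral>x. w \<epsilon> (fst x) * w \<delta> (snd x) * \<kappa>\<^sub>n m x \<partial>(\<nu> \<Otimes>\<^sub>M \<nu>))"
  unfolding local_time_chaos_def
  by (subst weighted_gram(2)[OF second_order_chaos second_order_chaos]) (use assms in \<open>auto intro: w_int w_nonneg simp: cov_chaos_chaos\<close>)

lemma gram_local_time_chaos:
  assumes "0 < \<epsilon>" "0 < \<delta>"
  shows "(\<integral>\<omega>. local_time \<epsilon> \<omega> * local_time_chaos m \<delta> \<omega> \<partial>M) = (\<integral>\<omega>. local_time_chaos m \<epsilon> \<omega> * local_time_chaos m \<delta> \<omega> \<partial>M)"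
  unfolding gram_chaos[OF assms] unfolding local_time_def local_time_chaos_def
  by (subst weighted_gram(2)[OF second_order_cos second_order_chaos]) (use assms in \<open>auto intro: w_int w_nonneg simp: cov_cos_chaos\<close>)

text \<open>
  The following argument serves both the local time and each of its components. It uses only that
  the inner products are weighted integrals of one kernel with values between \<open>0\<close> and \<open>1\<close>: by the
  monotonicity of the weights they increase as the parameters decrease, and the squared norms
  increase to the mass of the kernel.
\<close>

context
  fixes F :: "real \<Rightarrow> 'w \<Rightarrow> real" and k :: "'p \<times> 'p \<Rightarrow> real"
  assumes F: "\<And>\<epsilon>. 0 < \<epsilon> \<Longrightarrow> F \<epsilon> \<in> L2 M"
    and gram: "\<And>\<epsilon> \<delta>. 0 < \<epsilon> \<Longrightarrow> 0 < \<delta> \<Longrightarrow> (\<integral>\<omega>. F \<epsilon> \<omega> * F \<delta> \<omega> \<partial>M) = (\<integral>x. w \<epsilon> (fst x) * w \<delta> (snd x) * k x \<partial>(\<nu> \<Otimes>\<^sub>M \<nu>))"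
    and k_meas [measurable]: "k \<in> borel_measurable (\<nu> \<Otimes>\<^sub>M \<nu>)"
    and k: "\<And>x. 0 \<le> k x" "\<And>x. k x \<le> 1"
begin

lemma gram_integrable:
  assumes "0 < \<epsilon>" "0 < \<delta>"
  shows "integrable (\<nu> \<Otimes>\<^sub>M \<nu>) (\<lambda>x. w \<epsilon> (fst x) * w \<delta> (snd x) * k x)"
proof (rule Bochner_Integration.integrable_bound)
  note [measurable] = borel_measurable_integrable[OF w_int[OF assms(1)]] borel_measurable_integrable[OF w_int[OF assms(2)]]
  show "integrable (\<nu> \<Otimes>\<^sub>M \<nu>) (\<lambda>(x, y). w \<epsilon> x * w \<delta> y)"
    using assms by (intro \<nu>\<nu>.Fubini_integrable) (auto intro!: integrable_mult_left integrable_mult_right w_int simp: abs_mult w_nonneg)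
  show "AE x in \<nu> \<Otimes>\<^sub>M \<nu>. norm (w \<epsilon> (fst x) * w \<delta> (snd x) * k x) \<le> norm (case x of (x, y) \<Rightarrow> w \<epsilon> x * w \<delta> y)"
    using k by (intro AE_I2) (auto simp: abs_mult w_nonneg intro!: mult_left_le)
  show "(\<lambda>x. w \<epsilon> (fst x) * w \<delta> (snd x) * k x) \<in> borel_measurable (\<nu> \<Otimes>\<^sub>M \<nu>)" by measurable
qed

lemma gram_mono:
  assumes "0 < \<epsilon>" "\<epsilon> \<le> \<eta>" "0 < \<delta>" "\<delta> \<le> \<eta>"
  shows "(\<integral>\<omega>. (F \<eta> \<omega>)\<^sup>2 \<partial>M) \<le> (\<integral>\<omega>. F \<epsilon> \<omega> * F \<delta> \<omega> \<partial>M)"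
proof -
  have "0 < \<eta>" using assms by simp
  have "(\<integral>x. w \<eta> (fst x) * w \<eta> (snd x) * k x \<partial>(\<nu> \<Otimes>\<^sub>M \<nu>)) \<le> (\<integral>x. w \<epsilon> (fst x) * w \<delta> (snd x) * k x \<partial>(\<nu> \<Otimes>\<^sub>M \<nu>))"
    using assms \<open>0 < \<eta>\<close> by (intro integral_mono gram_integrable mult_right_mono mult_mono w_antimono k w_nonneg) auto
  then show ?thesis
    unfolding gram[OF assms(1,3)] power2_eq_square gram[OF \<open>0 < \<eta>\<close> \<open>0 < \<eta>\<close>] .
qed

lemma gram_nn: 
  assumes "0 < \<epsilon>"
  shows "ennreal (\<integral>\<omega>. (F \<epsilon> \<omega>)\<^sup>2 \<partial>M) = (\<integral>\<^sup>+x. ennreal (w \<epsilon> (fst x) * w \<epsilon> (snd x) * k x) \<partial>(\<nu> \<Otimes>\<^sub>M \<nu>))"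
  unfolding power2_eq_square gram[OF assms assms]
  by (rule nn_integral_eq_integral[symmetric, OF gram_integrable[OF assms assms]]) (simp add: w_nonneg k)

lemma gram_le_mass:
  assumes "0 < \<epsilon>"
  shows "ennreal (\<integral>\<omega>. (F \<epsilon> \<omega>)\<^sup>2 \<partial>M) \<le> mass k"
  unfolding gram_nn[OF assms] mass_def using assms
  by (intro nn_integral_mono ennreal_leI mult_right_mono mult_mono w_antimono w_nonneg k) auto

lemma gram_SUP: "(SUP j. ennreal (\<integral>\<omega>. (F (inverse (real (Suc j))) \<omega>)\<^sup>2 \<partial>M)) = mass k"
proof -
  let ?e = "\<lambda>j. inverse (real (Suc j))"
  let ?f = "\<lambda>j x. ennreal (w (?e j) (fst x) * w (?e j) (snd x) * k x)"
  note [measurable] = borel_measurable_integrable[OF w_int]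
  have inc: "incseq ?f"
    by (intro incseq_SucI le_funI ennreal_leI mult_right_mono mult_mono w_antimono w_nonneg k) (auto simp: field_simps)
  have "(SUP j. ennreal (\<integral>\<omega>. (F (?e j) \<omega>)\<^sup>2 \<partial>M)) = (SUP j. \<integral>\<^sup>+x. ?f j x \<partial>(\<nu> \<Otimes>\<^sub>M \<nu>))"
    by (simp add: gram_nn)
  also have "\<dots> = (\<integral>\<^sup>+x. (SUP j. ?f j x) \<partial>(\<nu> \<Otimes>\<^sub>M \<nu>))"
    using inc by (intro nn_integral_monotone_convergence_SUP[symmetric]) measurable
  also have "\<dots> = mass k"
    unfolding mass_def
  proof (intro nn_integral_cong)
    fix x
    have "(\<lambda>j. ?f j x) \<longlonglongrightarrow> ennreal (w 0 (fst x) * w 0 (snd x) * k x)"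
      by (intro tendsto_intros w_lim)
    moreover have "incseq (\<lambda>j. ?f j x)"
      using inc unfolding incseq_def le_fun_def by blast
    then have "(\<lambda>j. ?f j x) \<longlonglongrightarrow> (SUP j. ?f j x)"
      by (rule LIMSEQ_SUP)
    ultimately show "(SUP j. ?f j x) = ennreal (w 0 (fst x) * w 0 (snd x) * k x)"
      by (rule LIMSEQ_unique[symmetric])
  qed
  finally show ?thesis .
qed

lemma limit_exists:
  assumes "mass k < \<infinity>"
  shows "\<exists>L. tendsto_L2 M F L (at_right 0)"
proof (rule L2_limit_of_monotone_gram[OF F gram_mono])
  fix \<epsilon> :: real assume "0 < \<epsilon>"
  then show "(\<integral>\<omega>. (F \<epsilon> \<omega>)\<^sup>2 \<partial>M) \<le> enn2real (mass k)"
    using gram_le_mass[of \<epsilon>] assms by (cases "mass k") auto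
qed

lemma limit_norm:
  assumes "tendsto_L2 M F L (at_right 0)"
  shows "ennreal (\<integral>\<omega>. (L \<omega>)\<^sup>2 \<partial>M) = mass k"
proof -
  let ?e = "\<lambda>j. inverse (real (Suc j))"
  have "(\<lambda>j. ennreal (\<integral>\<omega>. (F (?e j) \<omega>)\<^sup>2 \<partial>M)) \<longlonglongrightarrow> ennreal (\<integral>\<omega>. (L \<omega>)\<^sup>2 \<partial>M)"
    by (intro tendsto_ennrealI tendsto_L2_norm tendsto_L2_compose[OF assms] filterlim_inverse_Suc_at_right)
  moreover have "(\<lambda>j. ennreal (\<integral>\<omega>. (F (?e j) \<omega>)\<^sup>2 \<partial>M)) \<longlonglongrightarrow> (SUP j. ennreal (\<integral>\<omega>. (F (?e j) \<omega>)\<^sup>2 \<partial>M))"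
  proof (intro LIMSEQ_SUP incseq_SucI ennreal_leI)
    fix j
    have "0 < ?e (Suc j)" "?e (Suc j) \<le> ?e j" by (auto simp: field_simps)
    from gram_mono[OF this this] show "(\<integral>\<omega>. (F (?e j) \<omega>)\<^sup>2 \<partial>M) \<le> (\<integral>\<omega>. (F (?e (Suc j)) \<omega>)\<^sup>2 \<partial>M)"
      by (simp add: power2_eq_square)
  qed
  ultimately show ?thesis unfolding gram_SUP by (rule LIMSEQ_unique)
qed

end

lemma local_time_limit_exists: "mass \<kappa> < \<infinity> \<Longrightarrow> \<exists>L. tendsto_L2 M local_time L (at_right 0)"
  by (rule limit_exists[of local_time \<kappa>])
     (assumption | rule local_time_L2 gram_local_time \<kappa>_meas \<kappa>_nonneg \<kappa>_le_1)+

lemma local_time_limit_norm: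
  "tendsto_L2 M local_time L (at_right 0) \<Longrightarrow> ennreal (\<integral>\<omega>. (L \<omega>)\<^sup>2 \<partial>M) = mass \<kappa>"
  by (rule limit_norm[of local_time \<kappa>])
     (assumption | rule local_time_L2 gram_local_time \<kappa>_meas \<kappa>_nonneg \<kappa>_le_1)+

lemma chaos_limit_exists: "mass (\<kappa>\<^sub>n m) < \<infinity> \<Longrightarrow> \<exists>L. tendsto_L2 M (local_time_chaos m) L (at_right 0)"
  by (rule limit_exists[of "local_time_chaos m" "\<kappa>\<^sub>n m"])
     (assumption | rule local_time_chaos_L2 gram_chaos \<kappa>\<^sub>n_meas \<kappa>\<^sub>n_nonneg \<kappa>\<^sub>n_le_1)+

lemma chaos_limit_norm:
  "tendsto_L2 M (local_time_chaos m) L (at_right 0) \<Longrightarrow> ennreal (\<integral>\<omega>. (L \<omega>)\<^sup>2 \<partial>M) = mass (\<kappa>\<^sub>n m)"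
  by (rule limit_norm[of "local_time_chaos m" "\<kappa>\<^sub>n m"])
     (assumption | rule local_time_chaos_L2 gram_chaos \<kappa>\<^sub>n_meas \<kappa>\<^sub>n_nonneg \<kappa>\<^sub>n_le_1)+

lemma chaos_SUP:
  "(SUP j. ennreal (\<integral>\<omega>. (local_time_chaos m (inverse (real (Suc j))) \<omega>)\<^sup>2 \<partial>M)) = mass (\<kappa>\<^sub>n m)"
  by (rule gram_SUP[of "local_time_chaos m" "\<kappa>\<^sub>n m"])
     (assumption | rule local_time_chaos_L2 gram_chaos \<kappa>\<^sub>n_meas \<kappa>\<^sub>n_nonneg \<kappa>\<^sub>n_le_1)+

lemma chaos_gram_mono:
  assumes "0 < \<epsilon>" "\<epsilon> \<le> \<eta>" "0 < \<delta>" "\<delta> \<le> \<eta>"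
  shows "(\<integral>\<omega>. (local_time_chaos m \<eta> \<omega>)\<^sup>2 \<partial>M) \<le> (\<integral>\<omega>. local_time_chaos m \<epsilon> \<omega> * local_time_chaos m \<delta> \<omega> \<partial>M)"
  by (rule gram_mono[of "local_time_chaos m" "\<kappa>\<^sub>n m"])
     (assumption | rule assms local_time_chaos_L2 gram_chaos \<kappa>\<^sub>n_meas \<kappa>\<^sub>n_nonneg \<kappa>\<^sub>n_le_1)+

text \<open>
  A limit has finite squared norm, and this norm is the mass of \<open>\<kappa>\<close>; conversely a finite mass bounds the
  norms of the approximations, which suffices for their convergence.
\<close>

theorem local_time_exists_iff: "(\<exists>L. tendsto_L2 M local_time L (at_right 0)) \<longleftrightarrow> mass \<kappa> < \<infinity>"
  using local_time_limit_exists local_time_limit_norm by (metis ennreal_less_top infinity_ennreal_def)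

lemma cos_chaos_approx_tendsto:
  assumes "w 0 \<theta> \<noteq> 0"
  shows "(\<lambda>k. \<integral>\<omega>. (cos_chaos m \<theta> \<omega> - cos_chaos m (approx k \<theta>) \<omega>)\<^sup>2 \<partial>M) \<longlonglongrightarrow> 0"
proof -
  note L = finite_moments_L2[OF cos_chaos_finite_moments]
  have lim_v: "(\<lambda>k. v (approx k \<theta>)) \<longlonglongrightarrow> v \<theta>" and "(\<lambda>k. C (approx k \<theta>) \<theta>) \<longlonglongrightarrow> v \<theta>"
    using approx_lim[OF assms] by (simp_all add: C_def v_def)
  then have lim_C: "(\<lambda>k. C \<theta> (approx k \<theta>)) \<longlonglongrightarrow> v \<theta>"
    by (subst C_sym)
  have "(\<lambda>k. \<kappa>\<^sub>n m (\<theta>, \<theta>) - 2 * \<kappa>\<^sub>n m (\<theta>, approx k \<theta>) + \<kappa>\<^sub>n m (approx k \<theta>, approx k \<theta>)) \<longlonglongrightarrow>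
      \<kappa>\<^sub>n m (\<theta>, \<theta>) - 2 * \<kappa>\<^sub>n m (\<theta>, \<theta>) + \<kappa>\<^sub>n m (\<theta>, \<theta>)"
    unfolding \<kappa>\<^sub>n_def fst_conv snd_conv C_self
    by (intro tendsto_intros lim_v lim_C) auto
  then show ?thesis
    unfolding integral_diff_square[OF L L] by (simp add: cov_chaos_chaos power2_eq_square)
qed

lemma cos_chaos_diff_bound: "(\<integral>\<omega>. (cos_chaos m \<theta> \<omega> - cos_chaos m \<eta> \<omega>)\<^sup>2 \<partial>M) \<le> 2"
  unfolding integral_diff_square[OF finite_moments_L2 finite_moments_L2, OF cos_chaos_finite_moments cos_chaos_finite_moments]
  using \<kappa>\<^sub>n_nonneg[of m "(\<theta>, \<eta>)"] \<kappa>\<^sub>n_le_1[of m "(\<theta>, \<theta>)"] \<kappa>\<^sub>n_le_1[of m "(\<eta>, \<eta>)"]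
  by (simp add: cov_chaos_chaos power2_eq_square)

text \<open>
  Discretising the index changes the integral by little, since \<open>\<theta> \<mapsto> cos_chaos m \<theta>\<close> is continuous in
  mean square along \<open>approx\<close> and the squared distances are dominated.
\<close>

lemma local_time_chaos_approx:
  assumes \<epsilon>: "0 < \<epsilon>"
  shows "tendsto_L2 M (\<lambda>k \<omega>. \<integral>\<theta>. w \<epsilon> \<theta> * cos_chaos m (approx k \<theta>) \<omega> \<partial>\<nu>) (local_time_chaos m \<epsilon>) sequentially"
    (is "tendsto_L2 M ?F _ _")
proof -
  note [measurable] = borel_measurable_integrable[OF w_int[OF \<epsilon>]]
  have m[measurable]: "(\<lambda>x. cos_chaos m (approx k (fst x)) (snd x)) \<in> borel_measurable (\<nu> \<Otimes>\<^sub>M M)" for k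
    using measurable_compose[OF _ cos_chaos_meas, of "\<lambda>x. (approx k (fst x), snd x)" "\<nu> \<Otimes>\<^sub>M M"] by simp
  have so: "second_order 1 (\<lambda>\<theta>. cos_chaos m (approx k \<theta>))" for k
    using m second_order_chaos[of m] measurable_space[OF approx_meas'[of k]]
    by (auto simp: second_order_def case_prod_beta')
  have so2: "second_order 2 (\<lambda>\<theta> \<omega>. cos_chaos m (approx k \<theta>) \<omega> - cos_chaos m \<theta> \<omega>)" for k
    using m cos_chaos_diff_bound L2_diff[OF finite_moments_L2 finite_moments_L2, OF cos_chaos_finite_moments cos_chaos_finite_moments]
    by (auto simp: second_order_def case_prod_beta')
  have FL: "?F k \<in> L2 M" for k by (intro weighted_L2[OF so] w_int w_nonneg \<epsilon>)
  define q where "q k \<theta> = (\<integral>\<omega>. (cos_chaos m (approx k \<theta>) \<omega> - cos_chaos m \<theta> \<omega>)\<^sup>2 \<partial>M)" for k \<theta>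
  have [measurable]: "q k \<in> borel_measurable \<nu>" for k unfolding q_def by measurable
  have q: "0 \<le> q k \<theta>" "q k \<theta> \<le> 2" for k \<theta>
    unfolding q_def using cos_chaos_diff_bound by auto
  have "(\<lambda>k. \<integral>\<theta>. w \<epsilon> \<theta> * q k \<theta> \<partial>\<nu>) \<longlonglongrightarrow> (\<integral>\<theta>. 0 \<partial>\<nu>)"
  proof (rule integral_dominated_convergence[where w = "\<lambda>\<theta>. w \<epsilon> \<theta> * 2"])
    show "AE \<theta> in \<nu>. (\<lambda>k. w \<epsilon> \<theta> * q k \<theta>) \<longlonglongrightarrow> 0"
    proof (rule AE_I2)
      fix \<theta>
      show "(\<lambda>k. w \<epsilon> \<theta> * q k \<theta>) \<longlonglongrightarrow> 0"
      proof (cases "w 0 \<theta> = 0")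
        case True
        then have "w \<epsilon> \<theta> = 0" using w_antimono[of 0 \<epsilon> \<theta>] w_nonneg[of \<epsilon> \<theta>] \<epsilon> by simp
        then show ?thesis by simp
      next
        case False
        then show ?thesis
          using tendsto_mult_right_zero[OF cos_chaos_approx_tendsto[OF False]]
          unfolding q_def by (simp add: power2_commute)
      qed
    qed
    show "AE \<theta> in \<nu>. norm (w \<epsilon> \<theta> * q k \<theta>) \<le> w \<epsilon> \<theta> * 2" for k
      using q w_nonneg by (intro AE_I2) (auto simp: abs_mult intro!: mult_left_mono)
  qed (use w_int[OF \<epsilon>] in auto)
  then have lim: "(\<lambda>k. (\<integral>\<theta>. w \<epsilon> \<theta> \<partial>\<nu>) * (\<integral>\<theta>. w \<epsilon> \<theta> * q k \<theta> \<partial>\<nu>)) \<longlonglongrightarrow> 0"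
    by (intro tendsto_mult_right_zero) simp
  have "(\<integral>\<omega>. (?F k \<omega> - local_time_chaos m \<epsilon> \<omega>)\<^sup>2 \<partial>M) \<le> (\<integral>\<theta>. w \<epsilon> \<theta> \<partial>\<nu>) * (\<integral>\<theta>. w \<epsilon> \<theta> * q k \<theta> \<partial>\<nu>)" for k
  proof -
    have ae: "AE \<omega> in M. integrable \<nu> (\<lambda>\<theta>. w \<epsilon> \<theta> * X \<theta> \<omega>)" if X: "second_order 1 X" for X
    proof -
      have [measurable]: "(\<lambda>x. X (snd x) (fst x)) \<in> borel_measurable (M \<Otimes>\<^sub>M \<nu>)"
        using measurable_compose[OF measurable_Pair[OF measurable_snd measurable_fst] second_order_measurable[OF X]] by simp
      have "integrable (M \<Otimes>\<^sub>M \<nu>) (\<lambda>x. w \<epsilon> (snd x) * X (snd x) (fst x))"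
        by (rule weighted_integrable[OF X w_int[OF \<epsilon>] w_nonneg])
      then show ?thesis using M\<nu>.AE_integrable_fst'[of "\<lambda>x. w \<epsilon> (snd x) * X (snd x) (fst x)"] by simp
    qed
    have "(\<integral>\<omega>. (?F k \<omega> - local_time_chaos m \<epsilon> \<omega>)\<^sup>2 \<partial>M) =
        (\<integral>\<omega>. (\<integral>\<theta>. w \<epsilon> \<theta> * (cos_chaos m (approx k \<theta>) \<omega> - cos_chaos m \<theta> \<omega>) \<partial>\<nu>)\<^sup>2 \<partial>M)"
    proof (rule integral_cong_AE)
      show "AE \<omega> in M. (?F k \<omega> - local_time_chaos m \<epsilon> \<omega>)\<^sup>2 = (\<integral>\<theta>. w \<epsilon> \<theta> * (cos_chaos m (approx k \<theta>) \<omega> - cos_chaos m \<theta> \<omega>) \<partial>\<nu>)\<^sup>2"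
        using ae[OF so[of k]] ae[OF second_order_chaos[of m]]
        by eventually_elim (simp add: local_time_chaos_def right_diff_distrib)
    qed (use L2_meas[OF FL[of k]] L2_meas[OF local_time_chaos_L2[OF \<epsilon>]] L2_meas[OF weighted_L2[OF so2 w_int[OF \<epsilon>] w_nonneg, of k]] in auto)
    also have "\<dots> \<le> (\<integral>\<theta>. w \<epsilon> \<theta> \<partial>\<nu>) * (\<integral>\<theta>. w \<epsilon> \<theta> * q k \<theta> \<partial>\<nu>)"
      unfolding q_def by (rule weighted_norm_le[OF so2 w_int[OF \<epsilon>] w_nonneg])
    finally show ?thesis .
  qed
  then have "(\<lambda>k. \<integral>\<omega>. (?F k \<omega> - local_time_chaos m \<epsilon> \<omega>)\<^sup>2 \<partial>M) \<longlonglongrightarrow> 0"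
    by (intro tendsto_sandwich[OF _ _ tendsto_const lim]) auto
  then show ?thesis using FL local_time_chaos_L2[OF \<epsilon>] by (simp add: tendsto_L2_def)
qed

lemma cos_chaos_polynomial: "cos_chaos m \<theta> \<in> polynomials_upto V (2 * m)"
  unfolding cos_chaos_def[abs_def] by (intro polynomials_upto_scale wick_in_polynomials_upto U_poly)

text \<open>
  As \<open>approx k\<close> takes finitely many values, the integral is a finite linear combination of Wick powers.
\<close>

lemma simple_integral_polynomial:
  assumes "0 < \<epsilon>"
  shows "(\<lambda>\<omega>. \<integral>\<theta>. w \<epsilon> \<theta> * cos_chaos m (approx k \<theta>) \<omega> \<partial>\<nu>) \<in> polynomials_upto V (2 * m)"
proof -
  define A where "A p = approx k -` {p} \<inter> space \<nu>" for p
  have A[measurable]: "A p \<in> sets \<nu>" for p unfolding A_def by (rule approx_meas)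
  have i: "integrable \<nu> (\<lambda>\<theta>. indicator (A p) \<theta> * w \<epsilon> \<theta>)" for p
    using integrable_mult_indicator[OF A w_int[OF assms]] by simp
  have "(\<integral>\<theta>. w \<epsilon> \<theta> * cos_chaos m (approx k \<theta>) \<omega> \<partial>\<nu>) =
      (\<Sum>p\<in>range (approx k). (\<integral>\<theta>. indicator (A p) \<theta> * w \<epsilon> \<theta> \<partial>\<nu>) * cos_chaos m p \<omega>)" for \<omega>
  proof -
    have "(\<integral>\<theta>. w \<epsilon> \<theta> * cos_chaos m (approx k \<theta>) \<omega> \<partial>\<nu>) =
       (\<integral>\<theta>. (\<Sum>p\<in>range (approx k). (indicator (A p) \<theta> * w \<epsilon> \<theta>) * cos_chaos m p \<omega>) \<partial>\<nu>)"
    proof (intro Bochner_Integration.integral_cong refl)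
      fix \<theta> assume \<theta>: "\<theta> \<in> space \<nu>"
      have "(\<Sum>p\<in>range (approx k). (indicator (A p) \<theta> * w \<epsilon> \<theta>) * cos_chaos m p \<omega>) =
         (\<Sum>p\<in>{approx k \<theta>}. (indicator (A p) \<theta> * w \<epsilon> \<theta>) * cos_chaos m p \<omega>)"
        using approx_finite \<theta> by (intro sum.mono_neutral_right) (auto simp: A_def)
      then show "w \<epsilon> \<theta> * cos_chaos m (approx k \<theta>) \<omega> = (\<Sum>p\<in>range (approx k). (indicator (A p) \<theta> * w \<epsilon> \<theta>) * cos_chaos m p \<omega>)"
        using \<theta> by (simp add: A_def)
    qed
    then show ?thesis using i by (simp add: integrable_mult_left)
  qed
  then show ?thesis
    by (simp only:) (intro polynomials_upto_sum polynomials_upto_scale cos_chaos_polynomial)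
qed

text \<open>
  The component is a mean-square limit of polynomials of degree \<open>2 * m\<close>, and it is orthogonal to all
  polynomials of smaller degree because each Wick power is.
\<close>

lemma local_time_chaos_in_chaos:
  assumes "0 < \<epsilon>"
  shows "local_time_chaos m \<epsilon> \<in> chaos M V (2 * m)"
proof (cases m)
  case 0
  then show ?thesis by (auto simp: chaos_def local_time_chaos_def[abs_def] cos_chaos_def)
next
  case (Suc j)
  have V_fm: "V \<subseteq> finite_moments M" using V_S S_finite_moments by blast
  have "local_time_chaos m \<epsilon> \<in> poly_closure M V (2 * m)"
  proof (rule poly_closure_limit[OF local_time_chaos_approx[OF assms]])
    show "\<forall>\<^sub>F k in sequentially. (\<lambda>\<omega>. \<integral>\<theta>. w \<epsilon> \<theta> * cos_chaos m (approx k \<theta>) \<omega> \<partial>\<nu>) \<in> poly_closure M V (2 * m)"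
      using polynomials_finite_moments[OF V_fm simple_integral_polynomial[OF assms]]
      by (intro always_eventually allI polynomial_in_poly_closure simple_integral_polynomial[OF assms] finite_moments_L2) auto
  qed simp
  moreover have "(\<integral>\<omega>. local_time_chaos m \<epsilon> \<omega> * G \<omega> \<partial>M) = 0" if "G \<in> poly_closure M V (Suc (2 * j))" for G
  proof (rule poly_closure_orthogonal[OF local_time_chaos_L2[OF assms] _ that])
    fix p assume p: "p \<in> polynomials_upto V (Suc (2 * j))" "p \<in> L2 M"
    have "(\<integral>\<omega>. cos_chaos m \<theta> \<omega> * p \<omega> \<partial>M) = 0" for \<theta>
    proof -
      have "(\<integral>\<omega>. wick (2 * m) (v \<theta>) (U \<theta> \<omega>) * p \<omega> \<partial>M) = 0"
        unfolding v_def by (rule wick_orth_polynomial[OF U_S V_S p(1)]) (simp add: Suc)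
      then show ?thesis by (simp add: cos_chaos_def mult.assoc)
    qed
    then show "(\<integral>\<omega>. local_time_chaos m \<epsilon> \<omega> * p \<omega> \<partial>M) = 0"
      unfolding local_time_chaos_def
      by (subst weighted_inner[OF second_order_chaos w_int[OF assms] w_nonneg p(2)]) simp
  qed
  ultimately show ?thesis using Suc by (auto simp: chaos_def)
qed

end

context gaussian_family
begin

text \<open>
  The sum of \<open>real (2 * m) * \<kappa>\<^sub>n m\<close> over \<open>m\<close>, by the power series of \<open>x * sinh x\<close>. So its mass is
  the series that decides membership in \<open>D1\<close>.
\<close>

definition \<kappa>' :: "'p \<times> 'p \<Rightarrow> real" where
  "\<kappa>' x = exp (- (v (fst x) + v (snd x)) / 2) * (C (fst x) (snd x) * sinh (C (fst x) (snd x)))"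

lemma sums_sinh_odd: "(\<lambda>m. real (2 * m) * (x ^ (2 * m) / fact (2 * m))) sums (x * sinh x)"
proof -
  have "(\<lambda>n. if even n then 0 else x ^ n /\<^sub>R fact n) sums sinh x" by (rule sinh_converges)
  then have "(\<lambda>m. (\<lambda>n. if even n then 0 else x ^ n /\<^sub>R fact n) (2 * m + 1)) sums sinh x"
    by (subst sums_mono_reindex) (auto simp: strict_mono_def elim!: oddE)
  then have "(\<lambda>m. x ^ (2 * m + 1) / fact (2 * m + 1)) sums sinh x"
    by (simp add: divide_inverse mult.commute)
  then have "(\<lambda>m. x * (x ^ (2 * m + 1) / fact (2 * m + 1))) sums (x * sinh x)"
    by (rule sums_mult)
  moreover have "x * (x ^ (2 * m + 1) / fact (2 * m + 1)) = real (2 * Suc m) * (x ^ (2 * Suc m) / fact (2 * Suc m))" for m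
    by (simp add: fact_reduce[of "2 * Suc m"] field_simps del: of_nat_Suc)
  ultimately have "(\<lambda>m. real (2 * Suc m) * (x ^ (2 * Suc m) / fact (2 * Suc m))) sums (x * sinh x)"
    by simp
  then show ?thesis by (subst (asm) sums_Suc_iff) simp
qed

lemma sums_\<kappa>': "(\<lambda>m. real (2 * m) * \<kappa>\<^sub>n m x) sums \<kappa>' x"
proof -
  have "(\<lambda>m. exp (- (v (fst x) + v (snd x)) / 2) * (real (2 * m) * (C (fst x) (snd x) ^ (2 * m) / fact (2 * m)))) sums \<kappa>' x"
    unfolding \<kappa>'_def by (intro sums_mult sums_sinh_odd)
  then show ?thesis by (simp add: \<kappa>\<^sub>n_def mult_ac)
qed

lemma mass_suminf:
  assumes s: "\<And>x. (\<lambda>m. a m * \<kappa>\<^sub>n m x) sums k x" and a: "\<And>m. 0 \<le> (a m :: real)"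
  shows "(\<Sum>m. ennreal (a m) * mass (\<kappa>\<^sub>n m)) = mass k"
proof -
  have "(\<Sum>m. ennreal (a m) * mass (\<kappa>\<^sub>n m)) =
      (\<Sum>m. \<integral>\<^sup>+x. ennreal (a m) * ennreal (w 0 (fst x) * w 0 (snd x) * \<kappa>\<^sub>n m x) \<partial>(\<nu> \<Otimes>\<^sub>M \<nu>))"
    unfolding mass_def by (intro suminf_cong nn_integral_cmult[symmetric]) measurable
  also have "\<dots> = (\<integral>\<^sup>+x. (\<Sum>m. ennreal (a m) * ennreal (w 0 (fst x) * w 0 (snd x) * \<kappa>\<^sub>n m x)) \<partial>(\<nu> \<Otimes>\<^sub>M \<nu>))"
    by (rule nn_integral_suminf[symmetric]) measurable
  also have "\<dots> = mass k"
    unfolding mass_def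
  proof (intro nn_integral_cong)
    fix x
    have "(\<lambda>m. w 0 (fst x) * w 0 (snd x) * (a m * \<kappa>\<^sub>n m x)) sums (w 0 (fst x) * w 0 (snd x) * k x)"
      by (intro sums_mult s)
    moreover have "ennreal (a m) * ennreal (w 0 (fst x) * w 0 (snd x) * \<kappa>\<^sub>n m x) = ennreal (w 0 (fst x) * w 0 (snd x) * (a m * \<kappa>\<^sub>n m x))" for m
      using a w_nonneg \<kappa>\<^sub>n_nonneg by (simp add: mult_ac flip: ennreal_mult)
    ultimately show "(\<Sum>m. ennreal (a m) * ennreal (w 0 (fst x) * w 0 (snd x) * \<kappa>\<^sub>n m x)) = ennreal (w 0 (fst x) * w 0 (snd x) * k x)"
      by (simp only:) (intro suminf_ennreal_eq mult_nonneg_nonneg a w_nonneg \<kappa>\<^sub>n_nonneg)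
  qed
  finally show ?thesis .
qed

lemma mass_\<kappa>\<^sub>n_le: "mass (\<kappa>\<^sub>n m) \<le> mass \<kappa>"
proof -
  have "\<kappa>\<^sub>n m x \<le> \<kappa> x" for x
    using sums_\<kappa>[of x] \<kappa>\<^sub>n_nonneg sum_le_suminf[of "\<lambda>m. \<kappa>\<^sub>n m x" "{m}"] by (simp add: sums_iff)
  then show ?thesis
    unfolding mass_def by (intro nn_integral_mono ennreal_leI mult_left_mono mult_nonneg_nonneg w_nonneg)
qed

text \<open>
  The approximate local time may be replaced by its component of order \<open>2 * m\<close> in an inner product with
  such a component; the limit is taken in one of the two parameters only.
\<close>

lemma gram_local_time_limit:
  assumes L: "tendsto_L2 M local_time L (at_right 0)" and \<delta>: "0 < \<delta>"
  shows "((\<lambda>\<epsilon>. \<integral>\<omega>. local_time_chaos m \<epsilon> \<omega> * local_time_chaos m \<delta> \<omega> \<partial>M) \<longlongrightarrow>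
      (\<integral>\<omega>. L \<omega> * local_time_chaos m \<delta> \<omega> \<partial>M)) (at_right 0)"
proof (rule Lim_transform_eventually[OF tendsto_L2_inner[OF L local_time_chaos_L2[OF \<delta>]]])
  show "\<forall>\<^sub>F \<epsilon> in at_right 0. (\<integral>\<omega>. local_time \<epsilon> \<omega> * local_time_chaos m \<delta> \<omega> \<partial>M) = (\<integral>\<omega>. local_time_chaos m \<epsilon> \<omega> * local_time_chaos m \<delta> \<omega> \<partial>M)"
    using gram_local_time_chaos[OF _ \<delta>] by (auto simp: eventually_at_right_field intro!: exI[of _ 1])
qed

text \<open>
  The approximate component \<open>P\<close> satisfies \<open>\<parallel>P\<parallel>\<^sup>2 \<le> \<langle>L, P\<rangle> = \<langle>Fn (2 * m), P\<rangle> \<le> \<parallel>Fn (2 * m)\<parallel> * \<parallel>P\<parallel>\<close>: the first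
  inequality is monotonicity of the inner products in the parameter, and the equality holds because \<open>P\<close>
  is orthogonal to all other terms of the expansion.
\<close>

lemma chaos_component_norm_ge:
  assumes L: "tendsto_L2 M local_time L (at_right 0)" and exp: "chaos_expansion M V L Fn"
  shows "mass (\<kappa>\<^sub>n m) \<le> ennreal (\<integral>\<omega>. (Fn (2 * m) \<omega>)\<^sup>2 \<partial>M)"
proof -
  let ?P = "local_time_chaos m"
  have Fn: "Fn n \<in> chaos M V n" for n using exp by (simp add: chaos_expansion_def)
  have lim: "tendsto_L2 M (\<lambda>N \<omega>. \<Sum>n<N. Fn n \<omega>) L sequentially"
    using exp by (simp add: chaos_expansion_def)
  have "(\<integral>\<omega>. (?P \<epsilon> \<omega>)\<^sup>2 \<partial>M) \<le> (\<integral>\<omega>. (Fn (2 * m) \<omega>)\<^sup>2 \<partial>M)" if \<epsilon>: "0 < \<epsilon>" for \<epsilon>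
  proof -
    note P = local_time_chaos_in_chaos[OF \<epsilon>, of m] and PL = local_time_chaos_L2[OF \<epsilon>, of m]
    have "\<forall>\<^sub>F \<delta> in at_right 0. (\<integral>\<omega>. (?P \<epsilon> \<omega>)\<^sup>2 \<partial>M) \<le> (\<integral>\<omega>. ?P \<delta> \<omega> * ?P \<epsilon> \<omega> \<partial>M)"
      using \<epsilon> chaos_gram_mono[of _ \<epsilon> \<epsilon> m] by (auto simp: eventually_at_right_field intro!: exI[of _ \<epsilon>])
    then have 1: "(\<integral>\<omega>. (?P \<epsilon> \<omega>)\<^sup>2 \<partial>M) \<le> (\<integral>\<omega>. L \<omega> * ?P \<epsilon> \<omega> \<partial>M)"
      by (rule tendsto_lowerbound[OF gram_local_time_limit[OF L \<epsilon>]]) simp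
    have lim_LP: "(\<lambda>N. \<integral>\<omega>. (\<Sum>n<N. Fn n \<omega>) * ?P \<epsilon> \<omega> \<partial>M) \<longlonglongrightarrow> (\<integral>\<omega>. L \<omega> * ?P \<epsilon> \<omega> \<partial>M)"
      by (rule tendsto_L2_inner[OF lim PL])
    have ev: "\<forall>\<^sub>F N in sequentially. (\<integral>\<omega>. (\<Sum>n<N. Fn n \<omega>) * ?P \<epsilon> \<omega> \<partial>M) = (\<integral>\<omega>. Fn (2 * m) \<omega> * ?P \<epsilon> \<omega> \<partial>M)"
      using eventually_gt_at_top[of "2 * m"]
    proof eventually_elim
      case (elim N)
      have "(\<integral>\<omega>. (\<Sum>n<N. Fn n \<omega>) * ?P \<epsilon> \<omega> \<partial>M) = (\<Sum>n<N. \<integral>\<omega>. Fn n \<omega> * ?P \<epsilon> \<omega> \<partial>M)"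
        unfolding sum_distrib_right by (intro Bochner_Integration.integral_sum L2_mult_integrable chaos_L2[OF Fn] PL)
      also have "\<dots> = (\<Sum>n\<in>{2 * m}. \<integral>\<omega>. Fn n \<omega> * ?P \<epsilon> \<omega> \<partial>M)"
        using elim chaos_orthogonal[OF Fn P] by (intro sum.mono_neutral_right) auto
      finally show ?case by simp
    qed
    have 2: "(\<integral>\<omega>. L \<omega> * ?P \<epsilon> \<omega> \<partial>M) = (\<integral>\<omega>. Fn (2 * m) \<omega> * ?P \<epsilon> \<omega> \<partial>M)"
      by (rule LIMSEQ_unique[OF lim_LP tendsto_eventually[OF ev]])
    define a where "a = (\<integral>\<omega>. (?P \<epsilon> \<omega>)\<^sup>2 \<partial>M)"
    define b where "b = (\<integral>\<omega>. (Fn (2 * m) \<omega>)\<^sup>2 \<partial>M)"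
    have "0 \<le> a" "0 \<le> b" by (auto simp: a_def b_def)
    have "a \<le> (\<integral>\<omega>. Fn (2 * m) \<omega> * ?P \<epsilon> \<omega> \<partial>M)" using 1 2 by (simp add: a_def)
    then have "a\<^sup>2 \<le> (\<integral>\<omega>. Fn (2 * m) \<omega> * ?P \<epsilon> \<omega> \<partial>M)\<^sup>2" using \<open>0 \<le> a\<close> by (rule power_mono)
    also have "\<dots> \<le> b * a" unfolding a_def b_def by (rule cauchy_schwarz[OF chaos_L2[OF Fn] PL])
    finally show ?thesis
      using \<open>0 \<le> a\<close> \<open>0 \<le> b\<close> unfolding a_def[symmetric] b_def[symmetric]
      by (cases "a = 0") (auto simp: power2_eq_square)
  qed
  then show ?thesis
    by (subst chaos_SUP[symmetric], intro SUP_least ennreal_leI) simp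
qed

text \<open>
  For any chaos expansion, the squared norms of its terms bound the masses of the kernels \<open>\<kappa>\<^sub>n m\<close>, which
  sum with the factors \<open>2 * m\<close> to the mass of \<open>\<kappa>'\<close>. Conversely, the components have orthogonal limits
  \<open>P m\<close>, whose inner product with the local time \<open>L\<close> is their own squared norm. These squared norms add up
  to the mass of \<open>\<kappa>\<close>, that is to the squared norm of \<open>L\<close>, so by Pythagoras the sum of the \<open>P m\<close> is \<open>L\<close>.
\<close>

theorem local_time_D1_iff:
  "(\<exists>L. tendsto_L2 M local_time L (at_right 0) \<and> L \<in> D1 M V) \<longleftrightarrow> mass \<kappa> < \<infinity> \<and> mass \<kappa>' < \<infinity>"
proof
  assume "\<exists>L. tendsto_L2 M local_time L (at_right 0) \<and> L \<in> D1 M V"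
  then obtain L Fn where L: "tendsto_L2 M local_time L (at_right 0)" and exp: "chaos_expansion M V L Fn"
    and sm: "summable (\<lambda>n. real n * (\<integral>\<omega>. \<bar>Fn n \<omega>\<bar>\<^sup>2 \<partial>M))"
    unfolding D1_def by blast
  have "mass \<kappa>' = (\<Sum>m. ennreal (real (2 * m)) * mass (\<kappa>\<^sub>n m))"
    by (rule mass_suminf[OF sums_\<kappa>', symmetric]) simp
  also have "\<dots> \<le> (\<Sum>m. ennreal (real (2 * m) * (\<integral>\<omega>. (Fn (2 * m) \<omega>)\<^sup>2 \<partial>M)))"
    using chaos_component_norm_ge[OF L exp] by (intro suminf_le) (auto simp: ennreal_mult intro!: mult_left_mono)
  also have "\<dots> = ennreal (\<Sum>m. real (2 * m) * (\<integral>\<omega>. (Fn (2 * m) \<omega>)\<^sup>2 \<partial>M))"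
  proof (rule suminf_ennreal2)
    have "summable ((\<lambda>n. real n * (\<integral>\<omega>. \<bar>Fn n \<omega>\<bar>\<^sup>2 \<partial>M)) \<circ> (\<lambda>m. 2 * m))"
      by (rule summable_reindex[OF sm]) (auto simp: inj_on_def)
    then show "summable (\<lambda>m. real (2 * m) * (\<integral>\<omega>. (Fn (2 * m) \<omega>)\<^sup>2 \<partial>M))" by (simp add: o_def)
  qed simp
  also have "\<dots> < \<infinity>" by simp
  finally show "mass \<kappa> < \<infinity> \<and> mass \<kappa>' < \<infinity>" using local_time_exists_iff L by blast
next
  assume fin: "mass \<kappa> < \<infinity> \<and> mass \<kappa>' < \<infinity>"
  then obtain L where L: "tendsto_L2 M local_time L (at_right 0)" using local_time_limit_exists by blast
  have LL: "L \<in> L2 M" by (rule tendsto_L2_in_L2[OF L])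
  have "\<forall>m. \<exists>P. tendsto_L2 M (local_time_chaos m) P (at_right 0)"
    using chaos_limit_exists mass_\<kappa>\<^sub>n_le fin by (metis le_less_trans)
  then obtain P where P: "\<And>m. tendsto_L2 M (local_time_chaos m) (P m) (at_right 0)" by metis
  have PL: "P m \<in> L2 M" for m by (rule tendsto_L2_in_L2[OF P])
  have P_chaos: "P m \<in> chaos M V (2 * m)" for m
    using local_time_chaos_in_chaos[of _ m]
    by (intro chaos_limit[OF P]) (auto simp: eventually_at_right_field intro!: exI[of _ 1])
  have P_norm: "ennreal (\<integral>\<omega>. (P m \<omega>)\<^sup>2 \<partial>M) = mass (\<kappa>\<^sub>n m)" for m
    by (rule chaos_limit_norm[OF P])
  have LP: "(\<integral>\<omega>. L \<omega> * P m \<omega> \<partial>M) = (\<integral>\<omega>. (P m \<omega>)\<^sup>2 \<partial>M)" for m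
  proof -
    have "(\<integral>\<omega>. L \<omega> * local_time_chaos m \<delta> \<omega> \<partial>M) = (\<integral>\<omega>. P m \<omega> * local_time_chaos m \<delta> \<omega> \<partial>M)" if "0 < \<delta>" for \<delta>
      by (rule tendsto_unique[OF _ gram_local_time_limit[OF L that] tendsto_L2_inner[OF P local_time_chaos_L2[OF that]]]) simp
    then have "\<forall>\<^sub>F \<delta> in at_right 0. (\<integral>\<omega>. local_time_chaos m \<delta> \<omega> * L \<omega> \<partial>M) = (\<integral>\<omega>. local_time_chaos m \<delta> \<omega> * P m \<omega> \<partial>M)"
      by (auto simp: eventually_at_right_field mult.commute intro!: exI[of _ 1])
    from Lim_transform_eventually[OF tendsto_L2_inner[OF P LL] this]
    have "(\<integral>\<omega>. P m \<omega> * L \<omega> \<partial>M) = (\<integral>\<omega>. P m \<omega> * P m \<omega> \<partial>M)"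
      by (intro tendsto_unique[OF _ _ tendsto_L2_inner[OF P PL]]) auto
    then show ?thesis by (simp add: power2_eq_square mult.commute)
  qed
  have norm_sums: "(\<lambda>m. \<integral>\<omega>. (P m \<omega>)\<^sup>2 \<partial>M) sums (\<integral>\<omega>. (L \<omega>)\<^sup>2 \<partial>M)"
  proof -
    have "(\<Sum>m. ennreal (\<integral>\<omega>. (P m \<omega>)\<^sup>2 \<partial>M)) = (\<Sum>m. ennreal 1 * mass (\<kappa>\<^sub>n m))"
      by (simp add: P_norm)
    also have "\<dots> = mass \<kappa>" by (rule mass_suminf) (use sums_\<kappa> in auto)
    also have "\<dots> = ennreal (\<integral>\<omega>. (L \<omega>)\<^sup>2 \<partial>M)" using local_time_limit_norm[OF L] by simp
    finally have *: "(\<Sum>m. ennreal (\<integral>\<omega>. (P m \<omega>)\<^sup>2 \<partial>M)) = ennreal (\<integral>\<omega>. (L \<omega>)\<^sup>2 \<partial>M)" .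
    then have "summable (\<lambda>m. \<integral>\<omega>. (P m \<omega>)\<^sup>2 \<partial>M)"
      by (intro summable_suminf_not_top) auto
    with * show ?thesis by (simp add: suminf_ennreal2 sums_iff suminf_nonneg)
  qed
  define Fn where "Fn n = (if even n then P (n div 2) else (\<lambda>_. 0))" for n
  have Fn_chaos: "Fn n \<in> chaos M V n" for n
    using P_chaos[of "n div 2"] by (auto simp: Fn_def zero_in_chaos)
  have PP: "(\<integral>\<omega>. P m \<omega> * P j \<omega> \<partial>M) = (if m = j then (\<integral>\<omega>. (P m \<omega>)\<^sup>2 \<partial>M) else 0)" for m j
    using chaos_orthogonal[OF P_chaos P_chaos, of j m] by (auto simp: power2_eq_square)
  have dist: "(\<integral>\<omega>. ((\<Sum>m<N. P m \<omega>) - L \<omega>)\<^sup>2 \<partial>M) = (\<integral>\<omega>. (L \<omega>)\<^sup>2 \<partial>M) - (\<Sum>m<N. \<integral>\<omega>. (P m \<omega>)\<^sup>2 \<partial>M)" for N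
  proof -
    have "(\<integral>\<omega>. (\<Sum>m<N. P m \<omega>)\<^sup>2 \<partial>M) = (\<integral>\<omega>. (\<Sum>m<N. \<Sum>j<N. P m \<omega> * P j \<omega>) \<partial>M)"
      by (simp add: power2_eq_square sum_product)
    also have "\<dots> = (\<Sum>m<N. \<Sum>j<N. \<integral>\<omega>. P m \<omega> * P j \<omega> \<partial>M)"
      using L2_mult_integrable[OF PL PL] by simp
    also have "\<dots> = (\<Sum>m<N. \<integral>\<omega>. (P m \<omega>)\<^sup>2 \<partial>M)"
      by (simp add: PP)
    finally have 1: "(\<integral>\<omega>. (\<Sum>m<N. P m \<omega>)\<^sup>2 \<partial>M) = (\<Sum>m<N. \<integral>\<omega>. (P m \<omega>)\<^sup>2 \<partial>M)" .
    have "(\<integral>\<omega>. (\<Sum>m<N. P m \<omega>) * L \<omega> \<partial>M) = (\<Sum>m<N. \<integral>\<omega>. P m \<omega> * L \<omega> \<partial>M)"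
      unfolding sum_distrib_right using L2_mult_integrable[OF PL LL] by simp
    also have "\<dots> = (\<Sum>m<N. \<integral>\<omega>. (P m \<omega>)\<^sup>2 \<partial>M)"
      using LP by (simp add: mult.commute)
    finally show ?thesis
      unfolding integral_diff_square[OF L2_sum[OF PL] LL] 1 by simp
  qed
  have "tendsto_L2 M (\<lambda>N \<omega>. \<Sum>m<N. P m \<omega>) L sequentially"
  proof -
    have "(\<lambda>N. (\<integral>\<omega>. (L \<omega>)\<^sup>2 \<partial>M) - (\<Sum>m<N. \<integral>\<omega>. (P m \<omega>)\<^sup>2 \<partial>M)) \<longlonglongrightarrow> (\<integral>\<omega>. (L \<omega>)\<^sup>2 \<partial>M) - (\<integral>\<omega>. (L \<omega>)\<^sup>2 \<partial>M)"
      using norm_sums unfolding sums_def by (intro tendsto_intros)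
    then show ?thesis by (simp add: tendsto_L2_def LL dist L2_sum[OF PL])
  qed
  \<comment> \<open>among the first \<open>N\<close> orders, \<open>(N + 1) div 2\<close> are even\<close>
  moreover have "filterlim (\<lambda>N::nat. (N + 1) div 2) at_top sequentially"
    unfolding filterlim_at_top eventually_sequentially
  proof
    fix Z :: nat
    show "\<exists>N. \<forall>n\<ge>N. Z \<le> (n + 1) div 2" by (rule exI[of _ "2 * Z"]) auto
  qed
  ultimately have "tendsto_L2 M (\<lambda>N \<omega>. \<Sum>m<(N + 1) div 2. P m \<omega>) L sequentially"
    by (rule tendsto_L2_compose)
  moreover have "(\<Sum>m<(N + 1) div 2. P m \<omega>) = (\<Sum>n<N. Fn n \<omega>)" for N \<omega>
  proof (induction N)
    case (Suc N)
    then show ?case by (cases "even N") (auto simp: Fn_def elim!: evenE oddE)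
  qed simp
  ultimately have "chaos_expansion M V L Fn"
    using Fn_chaos by (simp add: chaos_expansion_def)
  moreover have "summable (\<lambda>n. real n * (\<integral>\<omega>. \<bar>Fn n \<omega>\<bar>\<^sup>2 \<partial>M))"
  proof -
    have "(\<Sum>m. ennreal (real (2 * m) * (\<integral>\<omega>. (P m \<omega>)\<^sup>2 \<partial>M))) = (\<Sum>m. ennreal (real (2 * m)) * mass (\<kappa>\<^sub>n m))"
      by (intro suminf_cong) (simp add: ennreal_mult P_norm del: of_nat_mult)
    also have "\<dots> = mass \<kappa>'" by (rule mass_suminf[OF sums_\<kappa>']) simp
    finally have "(\<Sum>m. ennreal (real (2 * m) * (\<integral>\<omega>. (P m \<omega>)\<^sup>2 \<partial>M))) \<noteq> \<top>" using fin by auto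
    then have "summable (\<lambda>m. real (2 * m) * (\<integral>\<omega>. (P m \<omega>)\<^sup>2 \<partial>M))"
      by (intro summable_suminf_not_top) auto
    then have "summable (\<lambda>m. (\<lambda>n. real n * (\<integral>\<omega>. \<bar>Fn n \<omega>\<bar>\<^sup>2 \<partial>M)) (2 * m))"
      by (simp add: Fn_def)
    then show ?thesis
      by (subst (asm) summable_mono_reindex) (auto simp: strict_mono_def Fn_def elim!: evenE)
  qed
  ultimately have "L \<in> D1 M V" using LL by (auto simp: D1_def)
  with L show "\<exists>L. tendsto_L2 M local_time L (at_right 0) \<and> L \<in> D1 M V" by blast
qed

end

section \<open>Gaussian integrals\<close>

lemma gaussian_nn_integral_1:
  fixes a b :: real
  assumes a: "0 < a"
  shows "(\<integral>\<^sup>+x. ennreal (exp (- (a * x\<^sup>2) / 2 + b * x)) \<partial>lborel) = ennreal (sqrt (2 * pi / a) * exp (b\<^sup>2 / (2 * a)))"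
proof -
  define \<sigma> where "\<sigma> = 1 / sqrt a"
  have \<sigma>: "0 < \<sigma>" "\<sigma>\<^sup>2 = 1 / a" using a by (auto simp: \<sigma>_def power_divide)
  have "exp (- (a * x\<^sup>2) / 2 + b * x) = (sqrt (2 * pi / a) * exp (b\<^sup>2 / (2 * a))) * normal_density (b / a) \<sigma> x" for x
  proof -
    have "- (a * x\<^sup>2) / 2 + b * x = b\<^sup>2 / (2 * a) + - (x - b / a)\<^sup>2 / (2 * \<sigma>\<^sup>2)"
      using a by (simp add: \<sigma>(2)) (simp add: power2_eq_square field_simps)
    then have "exp (- (a * x\<^sup>2) / 2 + b * x) = exp (b\<^sup>2 / (2 * a)) * exp (- (x - b / a)\<^sup>2 / (2 * \<sigma>\<^sup>2))"
      by (simp only: exp_add)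
    moreover have "sqrt (2 * pi / a) * (1 / sqrt (2 * pi * \<sigma>\<^sup>2)) = 1"
      using a by (simp add: \<sigma>)
    ultimately show ?thesis using a by (simp add: normal_density_def)
  qed
  then have "(\<integral>\<^sup>+x. ennreal (exp (- (a * x\<^sup>2) / 2 + b * x)) \<partial>lborel) =
      (\<integral>\<^sup>+x. ennreal (sqrt (2 * pi / a) * exp (b\<^sup>2 / (2 * a))) * ennreal (normal_density (b / a) \<sigma> x) \<partial>lborel)"
    using a by (simp add: ennreal_mult)
  also have "\<dots> = ennreal (sqrt (2 * pi / a) * exp (b\<^sup>2 / (2 * a))) * (\<integral>\<^sup>+x. ennreal (normal_density (b / a) \<sigma> x) \<partial>lborel)"
    by (rule nn_integral_cmult) measurable
  also have "(\<integral>\<^sup>+x. ennreal (normal_density (b / a) \<sigma> x) \<partial>lborel) = 1"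
    using \<sigma> by (subst nn_integral_eq_integral) auto
  finally show ?thesis by simp
qed

lemma gaussian_nn_integral:
  fixes \<zeta> :: "'a::euclidean_space"
  assumes a: "0 < a"
  shows "(\<integral>\<^sup>+\<xi>. ennreal (exp (- (a * (norm \<xi>)\<^sup>2) / 2 + b * (\<xi> \<bullet> \<zeta>))) \<partial>lborel) =
    ennreal (sqrt (2 * pi / a) ^ DIM('a) * exp (b\<^sup>2 * (norm \<zeta>)\<^sup>2 / (2 * a)))"
proof -
  have n: "(norm x)\<^sup>2 = (\<Sum>i\<in>Basis. (x \<bullet> i)\<^sup>2)" for x :: 'a
    unfolding power2_norm_eq_inner by (subst euclidean_inner) (simp add: power2_eq_square)
  have "exp (- (a * (norm \<xi>)\<^sup>2) / 2 + b * (\<xi> \<bullet> \<zeta>)) =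
      (\<Prod>i\<in>Basis. exp (- (a * (\<xi> \<bullet> i)\<^sup>2) / 2 + (b * (\<zeta> \<bullet> i)) * (\<xi> \<bullet> i)))" for \<xi>
    unfolding n euclidean_inner[of \<xi> \<zeta>]
    by (simp add: exp_sum[symmetric] sum.distrib sum_subtractf sum_distrib_left sum_negf sum_divide_distrib mult_ac)
  then have "(\<integral>\<^sup>+\<xi>. ennreal (exp (- (a * (norm \<xi>)\<^sup>2) / 2 + b * (\<xi> \<bullet> \<zeta>))) \<partial>lborel) =
      (\<integral>\<^sup>+\<xi>. (\<Prod>i\<in>Basis. (\<lambda>i x. ennreal (exp (- (a * x\<^sup>2) / 2 + (b * (\<zeta> \<bullet> i)) * x))) i (\<xi> \<bullet> i)) \<partial>lborel)"
    by (simp add: prod_ennreal)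
  also have "\<dots> = (\<Prod>i\<in>Basis. \<integral>\<^sup>+x. ennreal (exp (- (a * x\<^sup>2) / 2 + (b * (\<zeta> \<bullet> i)) * x)) \<partial>lborel)"
    by (subst nn_integral_lborel_prod) auto
  also have "\<dots> = ennreal (\<Prod>i\<in>Basis. sqrt (2 * pi / a) * exp ((b * (\<zeta> \<bullet> i))\<^sup>2 / (2 * a)))"
    unfolding gaussian_nn_integral_1[OF a] using a by (simp add: prod_ennreal)
  also have "(\<Prod>i\<in>(Basis :: 'a set). sqrt (2 * pi / a) * exp ((b * (\<zeta> \<bullet> i))\<^sup>2 / (2 * a))) =
      sqrt (2 * pi / a) ^ DIM('a) * exp (b\<^sup>2 * (norm \<zeta>)\<^sup>2 / (2 * a))"
    unfolding n by (simp add: prod.distrib exp_sum[symmetric] power_mult_distrib sum_distrib_left sum_divide_distrib)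
  finally show ?thesis .
qed

lemma integral_lborel_prod:
  fixes f :: "'a::euclidean_space \<Rightarrow> real \<Rightarrow> 'b::{real_normed_field,banach,second_countable_topology}"
  assumes f: "\<And>b. b \<in> Basis \<Longrightarrow> integrable lborel (f b)"
  shows "(\<integral>x. (\<Prod>b\<in>Basis. f b (x \<bullet> b)) \<partial>lborel) = (\<Prod>b\<in>Basis. \<integral>x. f b x \<partial>lborel)"
proof -
  interpret product_sigma_finite "\<lambda>_::'a. lborel :: real measure" ..
  have m: "(\<lambda>x. \<Prod>b\<in>Basis. f b (x \<bullet> b)) \<in> borel_measurable (borel :: 'a measure)"
  proof (rule borel_measurable_prod)
    fix b :: 'a assume "b \<in> Basis"
    then have [measurable]: "f b \<in> borel_measurable borel" using borel_measurable_integrable[OF f] by simp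
    show "(\<lambda>x. f b (x \<bullet> b)) \<in> borel_measurable borel" by measurable
  qed
  have "(\<integral>x. (\<Prod>b\<in>Basis. f b (x \<bullet> b)) \<partial>lborel) =
      (\<integral>x. (\<Prod>b\<in>Basis. f b ((\<Sum>c\<in>Basis. x c *\<^sub>R c) \<bullet> b)) \<partial>(\<Pi>\<^sub>M b\<in>(Basis::'a set). lborel))"
    by (subst lborel_eq, rule integral_distr) (use m in measurable)
  also have "\<dots> = (\<integral>x. (\<Prod>b\<in>Basis. f b (x b)) \<partial>(\<Pi>\<^sub>M b\<in>(Basis::'a set). lborel))"
    by (intro Bochner_Integration.integral_cong refl prod.cong) simp
  also have "\<dots> = (\<Prod>b\<in>Basis. \<integral>x. f b x \<partial>lborel)"
    by (rule product_integral_prod) (use f in auto)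
  finally show ?thesis .
qed

lemma gaussian_integrable_1:
  assumes "0 < (a::real)"
  shows "integrable lborel (\<lambda>x. exp (- (a * x\<^sup>2) / 2))"
  using gaussian_nn_integral_1[OF assms, of 0] by (intro integrableI_nonneg) auto

lemma gaussian_integrable:
  assumes "0 < (a::real)"
  shows "integrable lborel (\<lambda>\<xi>::'a::euclidean_space. exp (- (a * (norm \<xi>)\<^sup>2) / 2))"
  using gaussian_nn_integral[OF assms, of 0 "0::'a"] by (intro integrableI_nonneg) auto

lemma gaussian_fourier_1:
  fixes a z :: real
  assumes a: "0 < a"
  shows "(\<integral>x. of_real (exp (- (a * x\<^sup>2) / 2)) * iexp (x * z) \<partial>lborel) = of_real (sqrt (2 * pi / a) * exp (- z\<^sup>2 / (2 * a)))"
proof -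
  define t where "t = z / sqrt a"
  have sa: "0 < sqrt a" "sqrt a * sqrt a = a" using a by auto
  have "(\<integral>x. of_real (exp (- (a * x\<^sup>2) / 2)) * iexp (x * z) \<partial>lborel) =
      \<bar>1 / sqrt a\<bar> *\<^sub>R (\<integral>x. of_real (exp (- (a * (0 + 1 / sqrt a * x)\<^sup>2) / 2)) * iexp ((0 + 1 / sqrt a * x) * z) \<partial>lborel)"
    using a by (intro lborel_integral_real_affine) simp
  also have "(\<integral>x. of_real (exp (- (a * (0 + 1 / sqrt a * x)\<^sup>2) / 2)) * iexp ((0 + 1 / sqrt a * x) * z) \<partial>lborel) =
     (\<integral>x. of_real (sqrt (2 * pi)) * (std_normal_density x *\<^sub>R iexp (t * x)) \<partial>lborel)"
    using a by (intro Bochner_Integration.integral_cong refl)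
      (simp add: t_def power_divide std_normal_density_def scaleR_conv_of_real field_simps)
  also have "\<dots> = of_real (sqrt (2 * pi)) * (\<integral>x. std_normal_density x *\<^sub>R iexp (t * x) \<partial>lborel)"
    by (rule integral_mult_right_zero)
  also have "(\<integral>x. std_normal_density x *\<^sub>R iexp (t * x) \<partial>lborel) = char std_normal_distribution t"
    unfolding char_def by (subst integral_density) auto
  also have "\<dots> = of_real (exp (- (t\<^sup>2) / 2))"
    by (simp add: char_std_normal_distribution)
  also have "t\<^sup>2 = z\<^sup>2 / a" using a by (simp add: t_def power_divide)
  finally show ?thesis
    using a by (simp add: scaleR_conv_of_real real_sqrt_divide field_simps)
qed

lemma gaussian_fourier:
  fixes z :: "'a::euclidean_space"
  assumes a: "0 < a"
  shows "(\<integral>\<xi>. exp (- (a * (norm \<xi>)\<^sup>2) / 2) * cos (\<xi> \<bullet> z) \<partial>lborel) = sqrt (2 * pi / a) ^ DIM('a) * exp (- (norm z)\<^sup>2 / (2 * a))"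
proof -
  have n: "(norm x)\<^sup>2 = (\<Sum>i\<in>Basis. (x \<bullet> i)\<^sup>2)" for x :: 'a
    unfolding power2_norm_eq_inner by (subst euclidean_inner) (simp add: power2_eq_square)
  define f where "f b x = of_real (exp (- (a * x\<^sup>2) / 2)) * iexp (x * (z \<bullet> b))" for b :: 'a and x :: real
  have fi: "integrable lborel (f b)" for b
    unfolding f_def by (rule Bochner_Integration.integrable_bound[OF gaussian_integrable_1[OF a]]) (auto simp: norm_mult)
  have prod_f: "(\<Prod>b\<in>Basis. f b (\<xi> \<bullet> b)) = of_real (exp (- (a * (norm \<xi>)\<^sup>2) / 2)) * iexp (\<xi> \<bullet> z)" for \<xi>
    unfolding f_def n euclidean_inner[of \<xi> z]
    by (simp add: prod.distrib exp_sum[symmetric] sum_distrib_left sum_negf sum_divide_distrib of_real_prod[symmetric] flip: exp_of_real)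
  have i: "integrable lborel (\<lambda>\<xi>. of_real (exp (- (a * (norm \<xi>)\<^sup>2) / 2)) * iexp (\<xi> \<bullet> z))"
    by (rule Bochner_Integration.integrable_bound[OF gaussian_integrable[OF a]]) (auto simp: norm_mult)
  have "(\<integral>\<xi>. exp (- (a * (norm \<xi>)\<^sup>2) / 2) * cos (\<xi> \<bullet> z) \<partial>lborel) =
     (\<integral>\<xi>. Re (of_real (exp (- (a * (norm \<xi>)\<^sup>2) / 2)) * iexp (\<xi> \<bullet> z)) \<partial>lborel)"
    by (simp add: Re_exp)
  also have "\<dots> = Re (\<integral>\<xi>. of_real (exp (- (a * (norm \<xi>)\<^sup>2) / 2)) * iexp (\<xi> \<bullet> z) \<partial>lborel)"
    by (rule integral_Re[OF i])
  also have "(\<integral>\<xi>. of_real (exp (- (a * (norm \<xi>)\<^sup>2) / 2)) * iexp (\<xi> \<bullet> z) \<partial>lborel) = (\<Prod>b\<in>Basis. \<integral>x. f b x \<partial>lborel)"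
    unfolding prod_f[symmetric] by (rule integral_lborel_prod[OF fi])
  also have "\<dots> = of_real (\<Prod>b\<in>Basis. sqrt (2 * pi / a) * exp (- (z \<bullet> b)\<^sup>2 / (2 * a)))"
    unfolding f_def gaussian_fourier_1[OF a] by simp
  also have "(\<Prod>b\<in>(Basis::'a set). sqrt (2 * pi / a) * exp (- (z \<bullet> b)\<^sup>2 / (2 * a))) = sqrt (2 * pi / a) ^ DIM('a) * exp (- (norm z)\<^sup>2 / (2 * a))"
    unfolding n by (simp add: prod.distrib exp_sum[symmetric] sum_negf sum_divide_distrib)
  finally show ?thesis by simp
qed

text \<open>
  The integrals of the kernels \<open>\<kappa>\<close> and \<open>\<kappa>'\<close> over both frequencies, where \<open>a\<close> and \<open>b\<close> are the variances of
  two real Gaussian variables and \<open>r\<close> is their covariance. The type argument fixes the dimension.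
\<close>

definition pair_cosh :: "'a::euclidean_space itself \<Rightarrow> real \<Rightarrow> real \<Rightarrow> real \<Rightarrow> ennreal" where
  "pair_cosh _ a b r = (\<integral>\<^sup>+\<xi>. \<integral>\<^sup>+\<eta>. ennreal (exp (- (a * (norm \<xi>)\<^sup>2 + b * (norm \<eta>)\<^sup>2) / 2) * cosh (r * (\<xi> \<bullet> \<eta>))) \<partial>lborel \<partial>(lborel :: 'a measure))"

definition pair_sinh :: "'a::euclidean_space itself \<Rightarrow> real \<Rightarrow> real \<Rightarrow> real \<Rightarrow> ennreal" where
  "pair_sinh _ a b r = (\<integral>\<^sup>+\<xi>. \<integral>\<^sup>+\<eta>. ennreal (exp (- (a * (norm \<xi>)\<^sup>2 + b * (norm \<eta>)\<^sup>2) / 2) * (r * (\<xi> \<bullet> \<eta>) * sinh (r * (\<xi> \<bullet> \<eta>)))) \<partial>lborel \<partial>(lborel :: 'a measure))"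

text \<open>
  The two exponentials in \<open>cosh\<close> contribute equally. For each of them, integrating over \<open>\<eta>\<close> first
  leaves a Gaussian integral with the parameter \<open>c = a - r\<^sup>2 / b\<close>, and \<open>c * b\<close> is the determinant.
\<close>

lemma pair_cosh_eq:
  fixes a b r :: real
  assumes a: "0 < a" and b: "0 < b" and D: "0 < a * b - r\<^sup>2"
  shows "pair_cosh TYPE('a::euclidean_space) a b r = ennreal ((2 * pi) ^ DIM('a) * (a * b - r\<^sup>2) powr (- real DIM('a) / 2))"
proof -
  define c where "c = a - r\<^sup>2 / b"
  have c: "0 < c" using D b by (simp add: c_def field_simps)
  have cb: "c * b = a * b - r\<^sup>2" using b by (simp add: c_def field_simps)
  have half: "(\<integral>\<^sup>+\<xi>. \<integral>\<^sup>+\<eta>. ennreal (exp (- (a * (norm \<xi>)\<^sup>2 + b * (norm \<eta>)\<^sup>2) / 2 + q * (\<xi> \<bullet> \<eta>))) \<partial>lborel \<partial>(lborel :: 'a measure)) =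
     ennreal ((2 * pi) ^ DIM('a) * (a * b - r\<^sup>2) powr (- real DIM('a) / 2))" if q: "q\<^sup>2 = r\<^sup>2" for q
  proof -
    have "(\<integral>\<^sup>+\<eta>. ennreal (exp (- (a * (norm \<xi>)\<^sup>2 + b * (norm \<eta>)\<^sup>2) / 2 + q * (\<xi> \<bullet> \<eta>))) \<partial>lborel) =
       ennreal (sqrt (2 * pi / b) ^ DIM('a)) * ennreal (exp (- (c * (norm \<xi>)\<^sup>2) / 2 + 0 * (\<xi> \<bullet> (0::'a))))" for \<xi> :: 'a
    proof -
      have "(\<integral>\<^sup>+\<eta>. ennreal (exp (- (a * (norm \<xi>)\<^sup>2 + b * (norm \<eta>)\<^sup>2) / 2 + q * (\<xi> \<bullet> \<eta>))) \<partial>lborel) =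
        (\<integral>\<^sup>+\<eta>. ennreal (exp (- (a * (norm \<xi>)\<^sup>2) / 2)) * ennreal (exp (- (b * (norm \<eta>)\<^sup>2) / 2 + q * (\<eta> \<bullet> \<xi>))) \<partial>lborel)"
        by (intro nn_integral_cong) (simp add: ennreal_mult[symmetric] mult_exp_exp add_divide_distrib diff_divide_distrib inner_commute)
      also have "\<dots> = ennreal (exp (- (a * (norm \<xi>)\<^sup>2) / 2)) * ennreal (sqrt (2 * pi / b) ^ DIM('a) * exp (q\<^sup>2 * (norm \<xi>)\<^sup>2 / (2 * b)))"
        by (subst nn_integral_cmult, measurable) (simp only: gaussian_nn_integral[OF b])
      also have "\<dots> = ennreal (sqrt (2 * pi / b) ^ DIM('a)) * ennreal (exp (- (c * (norm \<xi>)\<^sup>2) / 2 + 0 * (\<xi> \<bullet> (0::'a))))"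
      proof -
        have "exp (- (a * (norm \<xi>)\<^sup>2) / 2) * exp (q\<^sup>2 * (norm \<xi>)\<^sup>2 / (2 * b)) = exp (- (c * (norm \<xi>)\<^sup>2) / 2)"
          using b unfolding q mult_exp_exp by (simp add: c_def field_simps)
        then show ?thesis using b by (simp add: mult.left_commute flip: ennreal_mult)
      qed
      finally show ?thesis .
    qed
    then have "(\<integral>\<^sup>+\<xi>. \<integral>\<^sup>+\<eta>. ennreal (exp (- (a * (norm \<xi>)\<^sup>2 + b * (norm \<eta>)\<^sup>2) / 2 + q * (\<xi> \<bullet> \<eta>))) \<partial>lborel \<partial>(lborel :: 'a measure)) =
       ennreal (sqrt (2 * pi / b) ^ DIM('a)) * (\<integral>\<^sup>+\<xi>. ennreal (exp (- (c * (norm \<xi>)\<^sup>2) / 2 + 0 * (\<xi> \<bullet> (0::'a)))) \<partial>lborel)"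
      by (simp add: nn_integral_cmult)
    also have "\<dots> = ennreal (sqrt (2 * pi / b) ^ DIM('a) * sqrt (2 * pi / c) ^ DIM('a))"
      using b c by (subst gaussian_nn_integral[OF c]) (simp add: ennreal_mult)
    also have "sqrt (2 * pi / b) ^ DIM('a) * sqrt (2 * pi / c) ^ DIM('a) = (2 * pi) ^ DIM('a) * (a * b - r\<^sup>2) powr (- real DIM('a) / 2)"
    proof -
      have "sqrt (2 * pi / b) * sqrt (2 * pi / c) = 2 * pi * (c * b) powr (- (1 / 2))"
        using b c by (simp add: real_sqrt_mult[symmetric] powr_minus powr_half_sqrt real_sqrt_divide field_simps)
      moreover have "((c * b) powr (- (1 / 2))) ^ DIM('a) = (c * b) powr (- real DIM('a) / 2)"
        using b c by (subst powr_realpow[symmetric]) (auto simp: powr_powr)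
      ultimately show ?thesis
        by (simp only: power_mult_distrib[symmetric]) (simp only: power_mult_distrib cb)
    qed
    finally show ?thesis .
  qed
  have halves: "ennreal (1 / 2 * x + 1 / 2 * y) = ennreal (1 / 2) * ennreal x + ennreal (1 / 2) * ennreal y"
    if "0 \<le> x" "0 \<le> y" for x y :: real
  proof -
    have "ennreal (1 / 2 * x + 1 / 2 * y) = ennreal (1 / 2 * x) + ennreal (1 / 2 * y)"
      by (rule ennreal_plus) (use that in auto)
    also have "\<dots> = ennreal (1 / 2) * ennreal x + ennreal (1 / 2) * ennreal y"
      by (intro arg_cong2[where f = "(+)"] ennreal_mult') auto
    finally show ?thesis .
  qed
  have "pair_cosh TYPE('a) a b r =
     (\<integral>\<^sup>+\<xi>. \<integral>\<^sup>+\<eta>. ennreal (1 / 2) * ennreal (exp (- (a * (norm \<xi>)\<^sup>2 + b * (norm \<eta>)\<^sup>2) / 2 + r * (\<xi> \<bullet> \<eta>))) +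
        ennreal (1 / 2) * ennreal (exp (- (a * (norm \<xi>)\<^sup>2 + b * (norm \<eta>)\<^sup>2) / 2 + (- r) * (\<xi> \<bullet> \<eta>))) \<partial>lborel \<partial>(lborel :: 'a measure))"
    unfolding pair_cosh_def
  proof (intro nn_integral_cong)
    fix \<xi> \<eta> :: 'a
    let ?n = "- (a * (norm \<xi>)\<^sup>2 + b * (norm \<eta>)\<^sup>2) / 2"
    have "exp ?n * cosh (r * (\<xi> \<bullet> \<eta>)) = 1 / 2 * exp (?n + r * (\<xi> \<bullet> \<eta>)) + 1 / 2 * exp (?n + (- r) * (\<xi> \<bullet> \<eta>))"
      unfolding exp_add by (simp add: cosh_field_def distrib_left)
    then show "ennreal (exp ?n * cosh (r * (\<xi> \<bullet> \<eta>))) = ennreal (1 / 2) * ennreal (exp (?n + r * (\<xi> \<bullet> \<eta>))) + ennreal (1 / 2) * ennreal (exp (?n + (- r) * (\<xi> \<bullet> \<eta>)))"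
      using halves[of "exp (?n + r * (\<xi> \<bullet> \<eta>))" "exp (?n + (- r) * (\<xi> \<bullet> \<eta>))"] by (simp only: exp_ge_zero simp_thms)
  qed
  also have "\<dots> = ennreal (1 / 2) * ennreal ((2 * pi) ^ DIM('a) * (a * b - r\<^sup>2) powr (- real DIM('a) / 2)) + ennreal (1 / 2) * ennreal ((2 * pi) ^ DIM('a) * (a * b - r\<^sup>2) powr (- real DIM('a) / 2))"
    using half[of r] half[of "- r"] by (simp add: nn_integral_add nn_integral_cmult)
  also have "\<dots> = ennreal ((2 * pi) ^ DIM('a) * (a * b - r\<^sup>2) powr (- real DIM('a) / 2))"
    by (subst halves[symmetric]) (simp_all only: mult_nonneg_nonneg powr_ge_zero zero_le_power pi_ge_zero zero_le_numeral, simp)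
  finally show ?thesis .
qed

text \<open>
  Convexity: the graph lies above its tangent at \<open>x\<close>. It follows from \<open>1 + y \<le> exp y\<close>.
\<close>

lemma cosh_tangent: "cosh x + (y - x) * sinh x \<le> cosh (y :: real)"
proof -
  have "exp x * (1 + (y - x)) \<le> exp x * exp (y - x)"
    by (intro mult_left_mono exp_ge_add_one_self) simp
  moreover have "exp (- x) * (1 + (- (y - x))) \<le> exp (- x) * exp (- (y - x))"
    by (intro mult_left_mono exp_ge_add_one_self) simp
  ultimately show ?thesis
    by (simp add: cosh_field_def sinh_field_def mult_exp_exp field_simps)
qed

lemma mult_sinh_nonneg: "0 \<le> x * sinh (x :: real)"
  by (cases "0 \<le> x") (auto simp: zero_le_mult_iff)

text \<open>
  The tangent at \<open>r * x\<close>, evaluated at \<open>u * r * x\<close>, compares \<open>pair_sinh\<close> with a difference quotient of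
  \<open>pair_cosh\<close> in its last argument, from below for \<open>u \<le> 1\<close> and, in the next lemma, from above for
  \<open>u \<ge> 1\<close>.
\<close>

lemma pair_cosh_le:
  assumes u: "u \<le> 1"
  shows "pair_cosh TYPE('a::euclidean_space) a b r \<le> pair_cosh TYPE('a) a b (u * r) + ennreal (1 - u) * pair_sinh TYPE('a) a b r"
proof -
  have "pair_cosh TYPE('a) a b r \<le> (\<integral>\<^sup>+\<xi>. \<integral>\<^sup>+\<eta>. ennreal (exp (- (a * (norm \<xi>)\<^sup>2 + b * (norm \<eta>)\<^sup>2) / 2) * cosh (u * r * (\<xi> \<bullet> \<eta>))) +
     ennreal (1 - u) * ennreal (exp (- (a * (norm \<xi>)\<^sup>2 + b * (norm \<eta>)\<^sup>2) / 2) * (r * (\<xi> \<bullet> \<eta>) * sinh (r * (\<xi> \<bullet> \<eta>)))) \<partial>lborel \<partial>(lborel :: 'a measure))"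
    unfolding pair_cosh_def
  proof (intro nn_integral_mono)
    fix \<xi> \<eta> :: 'a
    let ?e = "exp (- (a * (norm \<xi>)\<^sup>2 + b * (norm \<eta>)\<^sup>2) / 2)" and ?x = "r * (\<xi> \<bullet> \<eta>)"
    have "cosh ?x \<le> cosh (u * ?x) + (1 - u) * (?x * sinh ?x)"
      using cosh_tangent[of ?x "u * ?x"] by (simp add: algebra_simps)
    then have "?e * cosh ?x \<le> ?e * (cosh (u * ?x) + (1 - u) * (?x * sinh ?x))"
      by (rule mult_left_mono) simp
    also have "\<dots> = ?e * cosh (u * r * (\<xi> \<bullet> \<eta>)) + (1 - u) * (?e * (?x * sinh ?x))"
      by (simp add: algebra_simps)
    finally show "ennreal (?e * cosh ?x) \<le> ennreal (?e * cosh (u * r * (\<xi> \<bullet> \<eta>))) + ennreal (1 - u) * ennreal (?e * (?x * sinh ?x))"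
      using u mult_sinh_nonneg[of ?x] by (simp flip: ennreal_mult ennreal_plus)
  qed
  also have "\<dots> = pair_cosh TYPE('a) a b (u * r) + ennreal (1 - u) * pair_sinh TYPE('a) a b r"
    unfolding pair_cosh_def pair_sinh_def cosh_field_def sinh_field_def by (simp add: nn_integral_add nn_integral_cmult)
  finally show ?thesis .
qed

lemma pair_sinh_le:
  assumes u: "1 \<le> u"
  shows "ennreal (u - 1) * pair_sinh TYPE('a::euclidean_space) a b r \<le> pair_cosh TYPE('a) a b (u * r)"
proof -
  have "ennreal (u - 1) * pair_sinh TYPE('a) a b r =
    (\<integral>\<^sup>+\<xi>. \<integral>\<^sup>+\<eta>. ennreal (u - 1) * ennreal (exp (- (a * (norm \<xi>)\<^sup>2 + b * (norm \<eta>)\<^sup>2) / 2) * (r * (\<xi> \<bullet> \<eta>) * sinh (r * (\<xi> \<bullet> \<eta>)))) \<partial>lborel \<partial>(lborel :: 'a measure))"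
    unfolding pair_sinh_def sinh_field_def by (simp add: nn_integral_cmult)
  also have "\<dots> \<le> pair_cosh TYPE('a) a b (u * r)"
    unfolding pair_cosh_def
  proof (intro nn_integral_mono)
    fix \<xi> \<eta> :: 'a
    let ?e = "exp (- (a * (norm \<xi>)\<^sup>2 + b * (norm \<eta>)\<^sup>2) / 2)" and ?x = "r * (\<xi> \<bullet> \<eta>)"
    have "(u - 1) * (?x * sinh ?x) = (u * ?x - ?x) * sinh ?x" by (simp add: algebra_simps)
    then have "(u - 1) * (?x * sinh ?x) \<le> cosh (u * ?x)"
      using cosh_tangent[of ?x "u * ?x"] cosh_real_nonneg[of ?x] by linarith
    then have "?e * ((u - 1) * (?x * sinh ?x)) \<le> ?e * cosh (u * ?x)"
      by (rule mult_left_mono) simp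
    then have "(u - 1) * (?e * (?x * sinh ?x)) \<le> ?e * cosh (u * r * (\<xi> \<bullet> \<eta>))"
      by (simp add: mult_ac)
    then show "ennreal (u - 1) * ennreal (?e * (?x * sinh ?x)) \<le> ennreal (?e * cosh (u * r * (\<xi> \<bullet> \<eta>)))"
      using u mult_sinh_nonneg[of ?x] by (simp add: ennreal_leI flip: ennreal_mult)
  qed
  finally show ?thesis .
qed

text \<open>
  The difference quotient is taken between \<open>r\<close> and a point where the determinant is twice as large.
\<close>

lemma pair_sinh_lower:
  fixes a b r :: real
  assumes a: "0 < a" and b: "0 < b" and D: "0 < a * b - r\<^sup>2" "a * b - r\<^sup>2 \<le> r\<^sup>2"
  shows "ennreal ((2 * pi) ^ DIM('a) * (1 - 2 powr (- real DIM('a) / 2)) * r\<^sup>2 * (a * b - r\<^sup>2) powr (- real (DIM('a) + 2) / 2))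
    \<le> pair_sinh TYPE('a::euclidean_space) a b r"
proof (cases "pair_sinh TYPE('a) a b r")
  case (real y)
  define d where "d = real DIM('a)"
  define \<Delta> where "\<Delta> = a * b - r\<^sup>2"
  define p where "p = (2 * pi) ^ DIM('a)"
  \<comment> \<open>chosen such that \<open>a * b - (u * r)\<^sup>2 = 2 * \<Delta>\<close>\<close>
  define u where "u = sqrt (1 - \<Delta> / r\<^sup>2)"
  have p: "0 < p" by (simp add: p_def)
  have \<Delta>: "0 < \<Delta>" "\<Delta> \<le> r\<^sup>2" using D by (auto simp: \<Delta>_def)
  then have r: "0 < r\<^sup>2" by linarith
  have u2: "u\<^sup>2 = 1 - \<Delta> / r\<^sup>2" using \<Delta> r by (simp add: u_def)
  have u: "0 \<le> u" "u < 1" using \<Delta> r by (auto simp: u_def)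
  have "u\<^sup>2 \<le> u" using u by (simp add: power2_eq_square mult_left_le)
  then have u1: "1 - u \<le> \<Delta> / r\<^sup>2" using u2 by simp
  have "(u * r)\<^sup>2 = r\<^sup>2 - \<Delta>" unfolding power_mult_distrib u2 using r by (simp add: field_simps)
  then have \<Delta>2: "a * b - (u * r)\<^sup>2 = 2 * \<Delta>" by (simp add: \<Delta>_def)
  have "ennreal (p * \<Delta> powr (- d / 2)) \<le> ennreal (p * (2 * \<Delta>) powr (- d / 2)) + ennreal (1 - u) * ennreal y"
    using pair_cosh_le[of u a b r, where 'a = 'a] u \<Delta> pair_cosh_eq[OF a b D(1), where 'a = 'a]
      pair_cosh_eq[OF a b, of "u * r", where 'a = 'a]
    by (simp add: real(2) \<Delta>2 p_def d_def \<Delta>_def)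
  also have "\<dots> = ennreal (p * (2 * \<Delta>) powr (- d / 2) + (1 - u) * y)"
    using u real p by (simp add: ennreal_mult ennreal_plus)
  finally have "p * \<Delta> powr (- d / 2) \<le> p * (2 * \<Delta>) powr (- d / 2) + (1 - u) * y"
    using u real p by (subst (asm) ennreal_le_iff) auto
  also have "\<dots> \<le> p * (2 * \<Delta>) powr (- d / 2) + \<Delta> / r\<^sup>2 * y"
    using mult_right_mono[OF u1 real(1)] by simp
  finally have "p * (1 - 2 powr (- d / 2)) * \<Delta> powr (- d / 2) \<le> \<Delta> / r\<^sup>2 * y"
    using \<Delta> by (simp add: powr_mult algebra_simps)
  then have "p * (1 - 2 powr (- d / 2)) * \<Delta> powr (- d / 2) * r\<^sup>2 / \<Delta> \<le> y"
    using \<Delta> r by (simp add: field_simps)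
  moreover have "\<Delta> powr (- (d + 2) / 2) = \<Delta> powr (- d / 2) / \<Delta>"
  proof -
    have "- (d + 2) / 2 = - d / 2 - 1" by simp
    then show ?thesis using \<Delta> by (simp only: powr_diff) simp
  qed
  ultimately have "p * (1 - 2 powr (- d / 2)) * r\<^sup>2 * \<Delta> powr (- (d + 2) / 2) \<le> y"
    by (simp add: mult_ac)
  then show ?thesis
    unfolding real(2) p_def d_def \<Delta>_def of_nat_add of_nat_numeral by (rule ennreal_leI)
qed simp

text \<open>
  The difference quotient is taken between \<open>r\<close> and a point where the determinant is still at least
  half as large.
\<close>

lemma pair_sinh_upper:
  fixes a b r B :: real
  assumes a: "0 < a" "a \<le> B" and b: "0 < b" "b \<le> B" and D: "0 < a * b - r\<^sup>2"
  shows "pair_sinh TYPE('a::euclidean_space) a b r \<le>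
    ennreal (6 * B\<^sup>2 * (2 * pi) ^ DIM('a) * 2 powr (real DIM('a) / 2) * (a * b - r\<^sup>2) powr (- real (DIM('a) + 2) / 2))"
proof -
  define d where "d = real DIM('a)"
  define \<Delta> where "\<Delta> = a * b - r\<^sup>2"
  define p where "p = (2 * pi) ^ DIM('a)"
  \<comment> \<open>\<open>(u * r)\<^sup>2 - r\<^sup>2\<close> is at most \<open>3 * B\<^sup>2 * (u - 1)\<close>, and must not exceed \<open>\<Delta> / 2\<close>\<close>
  define u where "u = 1 + \<Delta> / (6 * B\<^sup>2)"
  have lin: "(z - y) / 2 \<le> z - x" if "x \<le> y + (z - y) / 2" for x y z :: real
    using that by (simp add: field_simps)
  have B: "0 < B" using a by simp
  have \<Delta>: "0 < \<Delta>" using D by (simp add: \<Delta>_def)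
  have "a * b \<le> B * B" using a b by (intro mult_mono) auto
  then have \<Delta>B: "\<Delta> \<le> B\<^sup>2" "r\<^sup>2 \<le> B\<^sup>2"
    using \<Delta> zero_le_square[of r] unfolding \<Delta>_def power2_eq_square by linarith+
  define t where "t = \<Delta> / (6 * B\<^sup>2)"
  have t: "0 < t" "t \<le> 1" "6 * B\<^sup>2 * t = \<Delta>" using \<Delta> \<Delta>B B by (auto simp: t_def field_simps)
  have "(u * r)\<^sup>2 = r\<^sup>2 + r\<^sup>2 * (t * (2 + t))"
    unfolding u_def t_def[symmetric] by (simp add: power_mult_distrib power2_eq_square algebra_simps)
  also have "\<dots> \<le> r\<^sup>2 + B\<^sup>2 * (t * 3)"
    using t \<Delta>B by (intro add_left_mono mult_mono) auto
  also have "\<dots> = r\<^sup>2 + \<Delta> / 2" using t(3) by simp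
  finally have \<Delta>u: "\<Delta> / 2 \<le> a * b - (u * r)\<^sup>2" unfolding \<Delta>_def by (rule lin)
  have "ennreal t * pair_sinh TYPE('a) a b r \<le> pair_cosh TYPE('a) a b (u * r)"
    using pair_sinh_le[of u a b r, where 'a = 'a] t by (simp add: u_def t_def)
  also have "\<dots> = ennreal (p * (a * b - (u * r)\<^sup>2) powr (- d / 2))"
    using \<Delta>u \<Delta> pair_cosh_eq[OF a(1) b(1), of "u * r", where 'a = 'a] by (simp add: p_def d_def)
  also have "\<dots> \<le> ennreal (p * (\<Delta> / 2) powr (- d / 2))"
    using \<Delta> \<Delta>u by (intro ennreal_leI mult_left_mono powr_mono2') (auto simp: p_def d_def)
  finally have "ennreal (1 / t) * (ennreal t * pair_sinh TYPE('a) a b r) \<le> ennreal (1 / t) * ennreal (p * (\<Delta> / 2) powr (- d / 2))"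
    by (rule mult_left_mono) simp
  moreover have "ennreal (1 / t) * (ennreal t * pair_sinh TYPE('a) a b r) = pair_sinh TYPE('a) a b r"
    using t by (simp add: mult.assoc[symmetric] flip: ennreal_mult)
  moreover have "ennreal (1 / t) * ennreal (p * (\<Delta> / 2) powr (- d / 2)) =
     ennreal (6 * B\<^sup>2 * p * 2 powr (d / 2) * \<Delta> powr (- (d + 2) / 2))"
  proof -
    have "- (d + 2) / 2 = - d / 2 - 1" by simp
    then have 1: "\<Delta> powr (- (d + 2) / 2) = \<Delta> powr (- d / 2) / \<Delta>" using \<Delta> by (simp only: powr_diff) simp
    have 2: "(\<Delta> / 2) powr (- d / 2) = 2 powr (d / 2) * \<Delta> powr (- d / 2)"
      using \<Delta> by (simp add: powr_divide powr_minus field_simps)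
    have "1 / t * (p * (\<Delta> / 2) powr (- d / 2)) = 6 * B\<^sup>2 * p * 2 powr (d / 2) * \<Delta> powr (- (d + 2) / 2)"
      unfolding 1 2 t_def by (simp add: field_simps)
    then show ?thesis using t by (simp add: p_def flip: ennreal_mult)
  qed
  ultimately have "pair_sinh TYPE('a) a b r \<le> ennreal (6 * B\<^sup>2 * p * 2 powr (d / 2) * \<Delta> powr (- (d + 2) / 2))"
    by simp
  then show ?thesis unfolding p_def d_def \<Delta>_def of_nat_add of_nat_numeral .
qed

section \<open>Anisotropic integrals over the cube\<close>

lemma nn_integral_cart_prod:
  fixes f :: "'n::finite \<Rightarrow> real \<Rightarrow> ennreal"
  assumes [measurable]: "\<And>i. f i \<in> borel_measurable borel"
  shows "(\<integral>\<^sup>+x. (\<Prod>i\<in>UNIV. f i (x $ i)) \<partial>(lborel :: (real ^ 'n) measure)) = (\<Prod>i\<in>UNIV. \<integral>\<^sup>+x. f i x \<partial>lborel)"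
proof -
  define ix where "ix b = (THE i. b = axis i (1::real))" for b :: "real ^ 'n"
  have ix: "ix (axis i 1) = i" for i unfolding ix_def by (rule the_equality) (auto simp: axis_eq_axis)
  have B: "(Basis :: (real ^ 'n) set) = (\<lambda>i. axis i 1) ` UNIV" by (auto simp: Basis_vec_def)
  have inj: "inj (\<lambda>i::'n. axis i (1::real))" by (auto simp: inj_on_def axis_eq_axis)
  have "(\<integral>\<^sup>+x. (\<Prod>i\<in>UNIV. f i (x $ i)) \<partial>(lborel :: (real ^ 'n) measure)) =
      (\<integral>\<^sup>+x. (\<Prod>b\<in>Basis. f (ix b) (x \<bullet> b)) \<partial>(lborel :: (real ^ 'n) measure))"
    unfolding B by (simp add: prod.reindex[OF inj] ix inner_axis)
  also have "\<dots> = (\<Prod>b\<in>(Basis :: (real ^ 'n) set). \<integral>\<^sup>+x. f (ix b) x \<partial>lborel)"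
    by (rule nn_integral_lborel_prod) auto
  also have "\<dots> = (\<Prod>i\<in>UNIV. \<integral>\<^sup>+x. f i x \<partial>lborel)"
    unfolding B by (simp add: prod.reindex[OF inj] ix)
  finally show ?thesis .
qed

lemma AE_lborel_coordinate_neq: "AE x in (lborel :: (real ^ 'n) measure). x $ j \<noteq> c"
proof -
  have "negligible {x :: real ^ 'n. x $ j = c}"
    using negligible_standard_hyperplane[of "axis j 1 :: real ^ 'n" c] by (simp add: inner_axis axis_in_Basis_iff)
  then have "AE x in lebesgue. x \<notin> {x :: real ^ 'n. x $ j = c}"
    unfolding negligible_iff_null_sets by (rule AE_not_in)
  then show ?thesis by (simp add: AE_completion_iff)
qed

lemma singular_integral_finite:
  assumes "\<beta> < 1"
  shows "(\<integral>\<^sup>+x. ennreal (\<bar>x\<bar> powr - \<beta>) * indicator {-1..1} x \<partial>lborel) < \<infinity>"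
proof -
  define g where "g x = ennreal (\<bar>x\<bar> powr - \<beta>) * indicator {0..1} x" for x :: real
  have [measurable]: "g \<in> borel_measurable borel" unfolding g_def by measurable
  have "((\<lambda>x. x powr - \<beta>) has_integral (1 powr (- \<beta> + 1) / (- \<beta> + 1))) {0..1}"
    using assms by (intro has_integral_powr_from_0) auto
  then have "(\<integral>\<^sup>+x. ennreal (indicator {0..1} x * x powr - \<beta>) \<partial>lborel) = ennreal (1 powr (- \<beta> + 1) / (- \<beta> + 1))"
  proof (intro nn_integral_has_integral_lborel)
    have "(\<lambda>x. indicator {0..1} x * x powr - \<beta>) = (\<lambda>x::real. if x \<in> {0..1} then x powr - \<beta> else 0)"
      by (auto simp: indicator_def)
    then show "((\<lambda>x. indicator {0..1} x * x powr - \<beta>) has_integral 1 powr (- \<beta> + 1) / (- \<beta> + 1)) UNIV"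
      if "((\<lambda>x. x powr - \<beta>) has_integral (1 powr (- \<beta> + 1) / (- \<beta> + 1))) {0..1}"
      using that by (simp only: has_integral_restrict_UNIV)
  qed auto
  moreover have "(\<integral>\<^sup>+x. ennreal (indicator {0..1} x * x powr - \<beta>) \<partial>lborel) = (\<integral>\<^sup>+x. g x \<partial>lborel)"
    by (intro nn_integral_cong) (auto simp: g_def indicator_def)
  ultimately have fin: "(\<integral>\<^sup>+x. g x \<partial>lborel) < \<infinity>" by simp
  have "(\<integral>\<^sup>+x. g x \<partial>lborel) = ennreal \<bar>- 1\<bar> * (\<integral>\<^sup>+x. g (0 + (- 1) * x) \<partial>lborel)"
    by (rule nn_integral_real_affine) auto
  then have refl: "(\<integral>\<^sup>+x. g (- x) \<partial>lborel) = (\<integral>\<^sup>+x. g x \<partial>lborel)" by simp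
  have "(\<integral>\<^sup>+x. ennreal (\<bar>x\<bar> powr - \<beta>) * indicator {-1..1} x \<partial>lborel) \<le> (\<integral>\<^sup>+x. g x + g (- x) \<partial>lborel)"
    by (intro nn_integral_mono) (auto simp: g_def indicator_def)
  also have "\<dots> = (\<integral>\<^sup>+x. g x \<partial>lborel) + (\<integral>\<^sup>+x. g x \<partial>lborel)"
    by (simp add: nn_integral_add refl)
  finally show ?thesis using fin by (simp add: less_top order_le_less_trans)
qed

text \<open>
  Each \<open>x j powr (2 * \<alpha> j)\<close> is at most the sum, hence \<open>x j powr (2 / Q)\<close> is at most the sum to the power
  \<open>1 / (\<alpha> j * Q)\<close>, and these exponents add up to \<open>1\<close>. This replaces polar coordinates adapted to the
  anisotropy: integrals of negative powers of the sum reduce to one-dimensional ones.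
\<close>

lemma anisotropic_sum_ge_prod:
  fixes x \<alpha> :: "'n::finite \<Rightarrow> real"
  assumes x: "\<And>j. 0 < x j" and \<alpha>: "\<And>j. 0 < \<alpha> j"
  defines "Q \<equiv> \<Sum>j\<in>UNIV. 1 / \<alpha> j"
  shows "(\<Prod>j\<in>UNIV. x j powr (2 / Q)) \<le> (\<Sum>j\<in>UNIV. x j powr (2 * \<alpha> j))"
proof -
  define S where "S = (\<Sum>j\<in>UNIV. x j powr (2 * \<alpha> j))"
  have Q: "0 < Q" unfolding Q_def using \<alpha> by (intro sum_pos) auto
  have xn: "x j \<noteq> 0" for j using x[of j] by simp
  have S: "0 < S" unfolding S_def by (intro sum_pos) (auto simp: xn)
  have "x j powr (2 / Q) \<le> S powr (1 / \<alpha> j / Q)" for j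
  proof -
    have "x j powr (2 * \<alpha> j) \<le> S" unfolding S_def by (intro member_le_sum) auto
    then have "(x j powr (2 * \<alpha> j)) powr (1 / \<alpha> j / Q) \<le> S powr (1 / \<alpha> j / Q)"
      using \<alpha>[of j] Q by (intro powr_mono2) auto
    then show ?thesis using \<alpha>[of j] by (simp add: powr_powr)
  qed
  then have "(\<Prod>j\<in>UNIV. x j powr (2 / Q)) \<le> (\<Prod>j\<in>UNIV. S powr (1 / \<alpha> j / Q))"
    by (intro prod_mono) auto
  also have "\<dots> = S powr (\<Sum>j\<in>UNIV. 1 / \<alpha> j / Q)" using S by (simp add: powr_sum)
  also have "(\<Sum>j\<in>UNIV. 1 / \<alpha> j / Q) = Q / Q" unfolding Q_def by (rule sum_divide_distrib[symmetric])
  also have "Q / Q = 1" using Q by simp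
  finally show ?thesis using S by (simp add: S_def)
qed

lemma anisotropic_power_le_prod:
  fixes x \<alpha> :: "'n::finite \<Rightarrow> real"
  assumes x: "\<And>j. 0 < x j" and \<alpha>: "\<And>j. 0 < \<alpha> j" and p: "0 \<le> p"
  defines "Q \<equiv> \<Sum>j\<in>UNIV. 1 / \<alpha> j"
  shows "(\<Sum>j\<in>UNIV. x j powr (2 * \<alpha> j)) powr (- p / 2) \<le> (\<Prod>j\<in>UNIV. x j powr - (p / Q))"
proof -
  have Q: "0 < Q" unfolding Q_def using \<alpha> by (intro sum_pos) auto
  have "(\<Sum>j\<in>UNIV. x j powr (2 * \<alpha> j)) powr (- p / 2) \<le> (\<Prod>j\<in>UNIV. x j powr (2 / Q)) powr (- p / 2)"
    using p x anisotropic_sum_ge_prod[OF x \<alpha>]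
    by (intro powr_mono2') (auto simp: Q_def intro!: prod_pos less_imp_neq[symmetric])
  also have "\<dots> = (\<Prod>j\<in>UNIV. (x j powr (2 / Q)) powr (- p / 2))"
    by (rule prod_powr_distrib)
  also have "\<dots> = (\<Prod>j\<in>UNIV. x j powr - (p / Q))"
    using Q by (simp add: powr_powr field_simps)
  finally show ?thesis .
qed

text \<open>
  After the comparison with products the integral factors into one-dimensional integrals of
  \<open>\<lambda>x. \<bar>x\<bar> powr - \<beta>\<close> with \<open>\<beta> = p / Q < 1\<close>. The minima in the assumption vanish both on \<open>t $ j = s $ j\<close> and on
  \<open>t $ j = 0\<close>; the sum of the two singular functions majorises the negative power of the minimum.
\<close>

lemma anisotropic_integral_finite:
  fixes \<alpha> :: "'n::finite \<Rightarrow> real" and D :: "real ^ 'n \<Rightarrow> real ^ 'n \<Rightarrow> real"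
  assumes \<alpha>: "\<And>j. 0 < \<alpha> j" and p: "0 < p" "p < (\<Sum>j\<in>UNIV. 1 / \<alpha> j)" and c: "0 < c"
    and D: "\<And>s t. s \<in> unit_cube \<Longrightarrow> t \<in> unit_cube \<Longrightarrow>
      c * (\<Sum>j\<in>UNIV. \<bar>s $ j\<bar> powr (2 * \<alpha> j)) * (\<Sum>j\<in>UNIV. min (\<bar>s $ j - t $ j\<bar> powr (2 * \<alpha> j)) (\<bar>t $ j\<bar> powr (2 * \<alpha> j))) \<le> D s t"
  shows "(\<integral>\<^sup>+s. indicator unit_cube s * (\<integral>\<^sup>+t. indicator unit_cube t * ennreal (D s t powr (- p / 2)) \<partial>lborel) \<partial>lborel) < \<infinity>"
proof -
  define Q where "Q = (\<Sum>j\<in>UNIV. 1 / \<alpha> j)"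
  define \<beta> where "\<beta> = p / Q"
  have Q: "0 < Q" using p by (simp add: Q_def)
  have \<beta>: "0 \<le> \<beta>" "\<beta> < 1" using p Q by (auto simp: \<beta>_def Q_def[symmetric])
  define g where "g x = ennreal (\<bar>x\<bar> powr - \<beta>) * indicator {-1..1} x" for x :: real
  define A where "A = (\<integral>\<^sup>+x. g x \<partial>lborel)"
  have [measurable]: "g \<in> borel_measurable borel" unfolding g_def by measurable
  have A: "A < \<infinity>" unfolding A_def g_def by (rule singular_integral_finite[OF \<beta>(2)])
  have shift: "(\<integral>\<^sup>+x. g (a - x) \<partial>lborel) = A" for a
    unfolding A_def using nn_integral_real_affine[of g "- 1" a] by simp
  have ae: "AE x in (lborel :: (real ^ 'n) measure). \<forall>j. x $ j \<noteq> a j" for a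
    by (simp add: AE_all_countable AE_lborel_coordinate_neq)
  have cube: "0 \<le> x $ j" "x $ j \<le> 1" if "x \<in> unit_cube" for x :: "real ^ 'n" and j
    using that by (auto simp: mem_box_cart)
  have inner: "(\<integral>\<^sup>+t. indicator unit_cube t * ennreal (D s t powr (- p / 2)) \<partial>lborel) \<le>
      ennreal (c powr (- p / 2)) * (\<Prod>j\<in>UNIV. g (s $ j)) * (2 * A) ^ CARD('n)"
    if s: "s \<in> unit_cube" "\<forall>j. s $ j \<noteq> 0" for s
  proof -
    have s0: "0 < \<bar>s $ j\<bar>" for j using s by simp
    have "(\<integral>\<^sup>+t. indicator unit_cube t * ennreal (D s t powr (- p / 2)) \<partial>lborel) \<le>
       (\<integral>\<^sup>+t. ennreal (c powr (- p / 2)) * (\<Prod>j\<in>UNIV. g (s $ j)) * (\<Prod>j\<in>UNIV. g (s $ j - t $ j) + g (t $ j)) \<partial>lborel)"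
    proof (rule nn_integral_mono_AE)
      show "AE t in lborel. indicator unit_cube t * ennreal (D s t powr (- p / 2)) \<le>
          ennreal (c powr (- p / 2)) * (\<Prod>j\<in>UNIV. g (s $ j)) * (\<Prod>j\<in>UNIV. g (s $ j - t $ j) + g (t $ j))"
        using ae[of "\<lambda>j. s $ j"] ae[of "\<lambda>_. 0"]
      proof eventually_elim
        case (elim t)
        show ?case
        proof (cases "t \<in> unit_cube")
          case True
          define m where "m j = min \<bar>s $ j - t $ j\<bar> \<bar>t $ j\<bar>" for j
          have m: "0 < m j" for j
            using elim(1)[rule_format, of j] elim(2)[rule_format, of j] by (auto simp: m_def)
          then have mn: "m j \<noteq> 0" for j by (metis less_irrefl)
          have mp: "min (\<bar>s $ j - t $ j\<bar> powr (2 * \<alpha> j)) (\<bar>t $ j\<bar> powr (2 * \<alpha> j)) = m j powr (2 * \<alpha> j)" for j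
            using \<alpha>[of j] powr_mono2[of "2 * \<alpha> j" "\<bar>s $ j - t $ j\<bar>" "\<bar>t $ j\<bar>"]
              powr_mono2[of "2 * \<alpha> j" "\<bar>t $ j\<bar>" "\<bar>s $ j - t $ j\<bar>"]
            by (auto simp: m_def min_def)
          let ?S = "\<Sum>j\<in>UNIV. \<bar>s $ j\<bar> powr (2 * \<alpha> j)" and ?T = "\<Sum>j\<in>UNIV. m j powr (2 * \<alpha> j)"
          have ST: "0 < ?S" "0 < ?T" using s(2) by (auto intro!: sum_pos simp: mn)
          have "c * ?S * ?T \<le> D s t" using D[OF s(1) True] by (simp add: mp)
          then have "D s t powr (- p / 2) \<le> (c * ?S * ?T) powr (- p / 2)"
            using p c ST by (intro powr_mono2') auto
          also have "\<dots> = c powr (- p / 2) * ?S powr (- p / 2) * ?T powr (- p / 2)"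
            using c ST by (simp add: powr_mult)
          also have "\<dots> \<le> c powr (- p / 2) * (\<Prod>j\<in>UNIV. \<bar>s $ j\<bar> powr - \<beta>) * (\<Prod>j\<in>UNIV. m j powr - \<beta>)"
            unfolding \<beta>_def Q_def using p
            by (intro mult_mono anisotropic_power_le_prod s0 m \<alpha> mult_nonneg_nonneg prod_nonneg) auto
          finally have "ennreal (D s t powr (- p / 2)) \<le>
              ennreal (c powr (- p / 2)) * (\<Prod>j\<in>UNIV. ennreal (\<bar>s $ j\<bar> powr - \<beta>)) * (\<Prod>j\<in>UNIV. ennreal (m j powr - \<beta>))"
            by (simp add: prod_ennreal ennreal_mult'[symmetric] prod_nonneg ennreal_leI)
          also have "\<dots> \<le> ennreal (c powr (- p / 2)) * (\<Prod>j\<in>UNIV. g (s $ j)) * (\<Prod>j\<in>UNIV. g (s $ j - t $ j) + g (t $ j))"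
          proof (intro mult_mono prod_mono_ennreal)
            fix j
            have s1: "s $ j \<in> {-1..1}" "t $ j \<in> {-1..1}" "s $ j - t $ j \<in> {-1..1}"
              using cube[OF s(1), of j] cube[OF True, of j] by auto
            show "ennreal (\<bar>s $ j\<bar> powr - \<beta>) \<le> g (s $ j)" using s1 by (simp add: g_def)
            show "ennreal (m j powr - \<beta>) \<le> g (s $ j - t $ j) + g (t $ j)"
              using s1 by (auto simp: g_def m_def min_def)
          qed auto
          finally show ?thesis using True by simp
        qed simp
      qed
    qed
    also have "\<dots> = ennreal (c powr (- p / 2)) * (\<Prod>j\<in>UNIV. g (s $ j)) * (\<Prod>j\<in>UNIV. \<integral>\<^sup>+x. (g (s $ j - x) + g x) \<partial>lborel)"
      by (subst nn_integral_cmult, measurable) (subst nn_integral_cart_prod[of "\<lambda>j x. g (s $ j - x) + g x"], auto)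
    also have "(\<Prod>j\<in>UNIV. \<integral>\<^sup>+x. (g (s $ j - x) + g x) \<partial>lborel) = (2 * A) ^ CARD('n)"
      by (simp add: nn_integral_add shift A_def[symmetric] mult_2)
    finally show ?thesis .
  qed
  have "(\<integral>\<^sup>+s. indicator unit_cube s * (\<integral>\<^sup>+t. indicator unit_cube t * ennreal (D s t powr (- p / 2)) \<partial>lborel) \<partial>lborel) \<le>
     (\<integral>\<^sup>+s. ennreal (c powr (- p / 2)) * (2 * A) ^ CARD('n) * (\<Prod>j\<in>UNIV. g (s $ j)) \<partial>(lborel :: (real ^ 'n) measure))"
  proof (rule nn_integral_mono_AE)
    show "AE s in lborel. indicator unit_cube s * (\<integral>\<^sup>+t. indicator unit_cube t * ennreal (D s t powr (- p / 2)) \<partial>lborel) \<le>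
        ennreal (c powr (- p / 2)) * (2 * A) ^ CARD('n) * (\<Prod>j\<in>UNIV. g (s $ j))"
      using ae[of "\<lambda>_. 0"]
    proof eventually_elim
      case (elim s)
      then show ?case using inner[of s] by (cases "s \<in> unit_cube") (auto simp: mult_ac)
    qed
  qed
  also have "\<dots> = ennreal (c powr (- p / 2)) * (2 * A) ^ CARD('n) * A ^ CARD('n)"
    by (subst nn_integral_cmult, measurable) (subst nn_integral_cart_prod, auto simp: A_def)
  also have "\<dots> < \<infinity>"
    using A by (simp add: ennreal_mult_less_top power_less_top_ennreal)
  finally show ?thesis .
qed

text \<open>
  Near \<open>0\<close> the integrand is homogeneous with respect to the dilations that scale the \<open>j\<close>-th coordinate by
  \<open>2 powr (- 1 / \<alpha> j)\<close>. The \<open>k\<close>-th image \<open>A k\<close> of a box has the volume \<open>2 powr (- k * Q)\<close>, and the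
  integrand is at least a multiple of \<open>2 powr (k * p)\<close> on it. So the integrals over the boxes \<open>A k\<close> are
  bounded below when \<open>Q \<le> p\<close>, although the boxes shrink to a point; this excludes a finite integral.
\<close>

lemma anisotropic_integral_infinite:
  fixes \<alpha> :: "'n::finite \<Rightarrow> real"
  assumes \<alpha>: "\<And>j. 0 < \<alpha> j" and p: "(\<Sum>j\<in>UNIV. 1 / \<alpha> j) \<le> p" and r: "0 < r"
  shows "(\<integral>\<^sup>+u. indicator (cbox 0 (\<chi> j. r)) u * ennreal ((\<Sum>j\<in>UNIV. \<bar>u $ j\<bar> powr (2 * \<alpha> j)) powr (- p / 2)) \<partial>(lborel :: (real ^ 'n) measure)) = \<infinity>"
proof (rule ccontr)
  define Q where "Q = (\<Sum>j\<in>UNIV. 1 / \<alpha> j)"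
  have Q: "0 < Q" unfolding Q_def using \<alpha> by (intro sum_pos) auto
  define S where "S u = (\<Sum>j\<in>UNIV. \<bar>u $ j\<bar> powr (2 * \<alpha> j))" for u :: "real ^ 'n"
  define f where "f u = indicator (cbox 0 (\<chi> j. r)) u * ennreal (S u powr (- p / 2))" for u :: "real ^ 'n"
  have [measurable]: "S \<in> borel_measurable borel" unfolding S_def by measurable
  have [measurable]: "f \<in> borel_measurable borel" unfolding f_def by measurable
  assume "\<not> ?thesis"
  then have fin: "(\<integral>\<^sup>+u. f u \<partial>lborel) < \<infinity>" by (simp add: f_def S_def less_top)
  define e where "e k j = 2 powr (- real k / \<alpha> j)" for k :: nat and j :: 'n
  define A where "A k = cbox (0 :: real ^ 'n) (\<chi> j. e k j)" for k
  have e_lim: "(\<lambda>k. e k j) \<longlonglongrightarrow> 0" for j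
  proof -
    have "e k j = (2 powr (- 1 / \<alpha> j)) ^ k" for k
      by (simp add: e_def powr_realpow[symmetric] powr_powr)
    moreover have "2 powr (- 1 / \<alpha> j) < 1"
      using \<alpha>[of j] by (simp add: powr_less_one)
    ultimately show ?thesis by (simp add: LIMSEQ_realpow_zero)
  qed
  have [measurable]: "A k \<in> sets borel" for k by (simp add: A_def)
  have "(\<lambda>k. \<integral>\<^sup>+u. indicator (A k) u * f u \<partial>lborel) \<longlonglongrightarrow> (\<integral>\<^sup>+u. 0 \<partial>(lborel :: (real ^ 'n) measure))"
  proof (rule nn_integral_dominated_convergence[where w = f])
    show "AE u in lborel. (\<lambda>k. indicator (A k) u * f u) \<longlonglongrightarrow> 0"
    proof (rule AE_I2)
      fix u :: "real ^ 'n"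
      show "(\<lambda>k. indicator (A k) u * f u) \<longlonglongrightarrow> 0"
      proof (cases "u = 0")
        case True
        then have "f u = 0" by (simp add: f_def S_def)
        then show ?thesis by simp
      next
        case False
        then obtain j where j: "u $ j \<noteq> 0" by (auto simp: vec_eq_iff)
        then have "\<forall>\<^sub>F k in sequentially. e k j < \<bar>u $ j\<bar>"
          using order_tendstoD(2)[OF e_lim[of j], of "\<bar>u $ j\<bar>"] by simp
        then have "\<forall>\<^sub>F k in sequentially. indicator (A k) u * f u = 0"
        proof eventually_elim
          case (elim k)
          then have "u \<notin> A k" unfolding A_def mem_box_cart by (auto intro!: exI[of _ j])
          then show ?case by simp
        qed
        then show ?thesis by (rule tendsto_eventually)
      qed
    qed
    show "AE u in lborel. indicator (A k) u * f u \<le> f u" for k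
      by (intro AE_I2) (auto simp: indicator_def)
  qed (use fin in auto)
  then have lim: "(\<lambda>k. \<integral>\<^sup>+u. indicator (A k) u * f u \<partial>lborel) \<longlonglongrightarrow> 0" by simp
  define b where "b = real CARD('n) powr (- p / 2)"
  have b: "0 < b" by (simp add: b_def)
  have "\<forall>\<^sub>F k in sequentially. \<forall>j. e k j < r"
    using order_tendstoD(2)[OF e_lim r] by (intro eventually_all_finite) auto
  then have "\<forall>\<^sub>F k in sequentially. ennreal b \<le> (\<integral>\<^sup>+u. indicator (A k) u * f u \<partial>lborel)"
  proof eventually_elim
    case (elim k)
    have "ennreal (b * 2 powr (real k * p)) * emeasure lborel (A k) = (\<integral>\<^sup>+u. ennreal (b * 2 powr (real k * p)) * indicator (A k) u \<partial>lborel)"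
      by (rule nn_integral_cmult_indicator[symmetric]) (simp add: A_def)
    also have "\<dots> \<le> (\<integral>\<^sup>+u. indicator (A k) u * f u \<partial>lborel)"
    proof (rule nn_integral_mono_AE)
      show "AE u in lborel. ennreal (b * 2 powr (real k * p)) * indicator (A k) u \<le> indicator (A k) u * f u"
        using AE_lborel_singleton[of 0]
      proof eventually_elim
        case (elim u)
        show ?case
        proof (cases "u \<in> A k")
          case True
          then have u: "0 \<le> u $ j" "u $ j \<le> e k j" for j by (auto simp: A_def mem_box_cart)
          have "u \<in> cbox 0 (\<chi> j. r)"
            using u \<open>\<forall>j. e k j < r\<close> by (auto simp: mem_box_cart) (meson less_imp_le order_trans)
          obtain j where j: "u $ j \<noteq> 0" using elim by (auto simp: vec_eq_iff)
          have "0 < \<bar>u $ j\<bar> powr (2 * \<alpha> j)" using j by simp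
          also have "\<dots> \<le> S u" unfolding S_def by (intro member_le_sum) auto
          finally have S0: "0 < S u" .
          have "S u \<le> (\<Sum>j\<in>(UNIV :: 'n set). 2 powr (- 2 * real k))"
            unfolding S_def
          proof (rule sum_mono)
            fix j
            have "\<bar>u $ j\<bar> powr (2 * \<alpha> j) \<le> e k j powr (2 * \<alpha> j)"
              using u[of j] \<alpha>[of j] by (intro powr_mono2) auto
            then show "\<bar>u $ j\<bar> powr (2 * \<alpha> j) \<le> 2 powr (- 2 * real k)"
              using \<alpha>[of j] by (simp add: e_def powr_powr mult.commute)
          qed
          then have "S u \<le> real CARD('n) * 2 powr (- 2 * real k)" by simp
          then have "(real CARD('n) * 2 powr (- 2 * real k)) powr (- p / 2) \<le> S u powr (- p / 2)"
            using S0 p Q by (intro powr_mono2') (auto simp: Q_def)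
          moreover have "(real CARD('n) * 2 powr (- 2 * real k)) powr (- p / 2) = b * 2 powr (real k * p)"
            by (simp add: powr_mult b_def powr_powr)
          ultimately show ?thesis
            using True \<open>u \<in> cbox 0 (\<chi> j. r)\<close> by (simp add: f_def ennreal_leI)
        qed simp
      qed
    qed
    finally have 1: "ennreal (b * 2 powr (real k * p)) * emeasure lborel (A k) \<le> (\<integral>\<^sup>+u. indicator (A k) u * f u \<partial>lborel)" .
    have "measure lborel (A k) = (\<Prod>j\<in>UNIV. e k j)"
      unfolding A_def by (subst content_cbox_cart) (auto simp: interval_ne_empty_cart e_def)
    also have "\<dots> = 2 powr (\<Sum>j\<in>UNIV. - real k / \<alpha> j)" by (simp add: e_def powr_sum)
    also have "(\<Sum>j\<in>UNIV. - real k / \<alpha> j) = - real k * Q" by (simp add: Q_def sum_distrib_left sum_negf)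
    finally have "emeasure lborel (A k) = ennreal (2 powr (- real k * Q))"
      using emeasure_eq_ennreal_measure[of lborel "A k"] emeasure_lborel_cbox_finite[of 0 "\<chi> j. e k j"]
      by (simp add: A_def less_top)
    then have "ennreal (b * 2 powr (real k * p)) * emeasure lborel (A k) = ennreal (b * 2 powr (real k * (p - Q)))"
      using b by (simp add: powr_add[symmetric] algebra_simps flip: ennreal_mult)
    moreover have "b \<le> b * 2 powr (real k * (p - Q))"
      using b p by (simp add: Q_def ge_one_powr_ge_zero)
    ultimately show ?case using 1 by (metis ennreal_leI order_trans)
  qed
  from tendsto_lowerbound[OF lim this] show False using b by (simp add: ennreal_le_iff2)
qed

text \<open>
  It suffices to let \<open>s\<close> range over a box inside the cube, with \<open>t = s + u\<close> for small \<open>u\<close> with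
  nonnegative coordinates.
\<close>

lemma anisotropic_double_integral_infinite:
  fixes \<alpha> :: "'n::finite \<Rightarrow> real" and F :: "real ^ 'n \<Rightarrow> real ^ 'n \<Rightarrow> ennreal"
  assumes \<alpha>: "\<And>j. 0 < \<alpha> j" and p: "(\<Sum>j\<in>UNIV. 1 / \<alpha> j) \<le> p" and r: "0 < r" "r \<le> 1 / 4" and c: "0 < c"
    and F: "\<And>s t. s \<in> cbox (\<chi> j. 1 / 2) (\<chi> j. 3 / 4) \<Longrightarrow> t - s \<in> cbox 0 (\<chi> j. r) \<Longrightarrow>
       ennreal (c * (\<Sum>j\<in>UNIV. \<bar>s $ j - t $ j\<bar> powr (2 * \<alpha> j)) powr (- p / 2)) \<le> F s t"
  shows "(\<integral>\<^sup>+s. indicator unit_cube s * (\<integral>\<^sup>+t. indicator unit_cube t * F s t \<partial>lborel) \<partial>lborel) = \<infinity>"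
proof -
  let ?C = "cbox (\<chi> j. 1 / 2) (\<chi> j. 3 / 4) :: (real ^ 'n) set"
  define h where "h u = indicator (cbox 0 (\<chi> j. r)) u * ennreal ((\<Sum>j\<in>UNIV. \<bar>u $ j\<bar> powr (2 * \<alpha> j)) powr (- p / 2))" for u :: "real ^ 'n"
  have [measurable]: "h \<in> borel_measurable borel" unfolding h_def by measurable
  have inner: "(\<integral>\<^sup>+t. indicator unit_cube t * F s t \<partial>lborel) = \<infinity>" if s: "s \<in> ?C" for s
  proof -
    have "\<infinity> = ennreal c * (\<integral>\<^sup>+u. h u \<partial>lborel)"
      using anisotropic_integral_infinite[OF \<alpha> p r(1)] c by (simp add: h_def ennreal_mult_top)
    also have "(\<integral>\<^sup>+u. h u \<partial>lborel) = (\<integral>\<^sup>+u. h u \<partial>(distr lborel borel ((+) (- s))))"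
      by (simp add: lborel_distr_plus)
    also have "\<dots> = (\<integral>\<^sup>+t. h (- s + t) \<partial>lborel)"
      by (subst nn_integral_distr) auto
    also have "ennreal c * \<dots> = (\<integral>\<^sup>+t. ennreal c * h (- s + t) \<partial>lborel)"
      by (rule nn_integral_cmult[symmetric]) measurable
    also have "\<dots> \<le> (\<integral>\<^sup>+t. indicator unit_cube t * F s t \<partial>lborel)"
    proof (intro nn_integral_mono)
      fix t :: "real ^ 'n"
      show "ennreal c * h (- s + t) \<le> indicator unit_cube t * F s t"
      proof (cases "t - s \<in> cbox 0 (\<chi> j. r)")
        case True
        have "0 \<le> t $ j \<and> t $ j \<le> 1" for j
        proof -
          have "0 \<le> (t - s) $ j" "(t - s) $ j \<le> r" "1 / 2 \<le> s $ j" "s $ j \<le> 3 / 4"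
            using True s by (auto simp: mem_box_cart)
          then show ?thesis using r by simp
        qed
        then have "t \<in> unit_cube" by (simp add: mem_box_cart)
        moreover have "ennreal c * h (- s + t) = ennreal (c * (\<Sum>j\<in>UNIV. \<bar>s $ j - t $ j\<bar> powr (2 * \<alpha> j)) powr (- p / 2))"
          using True c by (simp add: h_def abs_minus_commute ennreal_mult)
        ultimately show ?thesis using F[OF s True] by simp
      qed (simp add: h_def)
    qed
    finally show ?thesis by (simp add: top_unique)
  qed
  have "?C \<subseteq> unit_cube"
  proof
    fix x assume "x \<in> ?C"
    then have 1: "1 / 2 \<le> x $ i \<and> x $ i \<le> 3 / 4" for i by (auto simp: mem_box_cart)
    have "0 \<le> x $ i \<and> x $ i \<le> 1" for i using 1[of i] by linarith
    then show "x \<in> unit_cube" by (auto simp: mem_box_cart)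
  qed
  have "\<infinity> = \<infinity> * emeasure lborel ?C"
  proof -
    have "measure lborel ?C = (1 / 4) ^ CARD('n)"
      by (subst content_cbox_cart) (auto simp: interval_ne_empty_cart)
    then have "emeasure lborel ?C \<noteq> 0" by (auto simp: measure_def)
    then show ?thesis by (simp add: ennreal_top_mult)
  qed
  also have "\<dots> = (\<integral>\<^sup>+s. \<infinity> * indicator ?C s \<partial>lborel)"
    by (rule nn_integral_cmult_indicator[symmetric]) simp
  also have "\<dots> \<le> (\<integral>\<^sup>+s. indicator unit_cube s * (\<integral>\<^sup>+t. indicator unit_cube t * F s t \<partial>lborel) \<partial>lborel)"
  proof (intro nn_integral_mono)
    fix s :: "real ^ 'n"
    show "\<infinity> * indicator ?C s \<le> indicator unit_cube s * (\<integral>\<^sup>+t. indicator unit_cube t * F s t \<partial>lborel)"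
    proof (cases "s \<in> ?C")
      case True
      with \<open>?C \<subseteq> unit_cube\<close> have "s \<in> unit_cube" by blast
      then show ?thesis using inner[OF True] by simp
    qed simp
  qed
  finally show ?thesis by (simp add: top_unique)
qed

section \<open>Conditional variance and residuals\<close>

text \<open>
  The conditional expectation of \<open>Y\<close> is the best approximation of \<open>Y\<close> by functions of \<open>V\<close>, hence at
  least as good as the linear one. This turns bounds for conditional variances into bounds that involve
  only covariances.
\<close>

lemma (in prob_space) residual_ge_of_cond_variance:
  assumes Y: "Y \<in> L2 M" and V: "V \<in> L2 M" and q: "AE \<omega> in M. q \<le> cond_variance M Y V \<omega>"
  shows "q \<le> (\<integral>\<omega>. (Y \<omega> - a * V \<omega>)\<^sup>2 \<partial>M)"
proof -
  define G where "G = vimage_algebra (space M) V borel"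
  note [measurable] = L2_meas[OF Y] L2_meas[OF V]
  have "subalgebra M G"
    unfolding subalgebra_def G_def by (simp add: sets_image_in_sets L2_meas[OF V])
  then interpret finite_measure_subalgebra M G by unfold_locales
  have VG: "V \<in> borel_measurable G"
    unfolding G_def by (rule measurable_vimage_algebra1) simp
  define P where "P = real_cond_exp M G Y"
  have PG: "P \<in> borel_measurable G" unfolding P_def by simp
  have "integrable M (\<lambda>\<omega>. (P \<omega>)\<^sup>2)"
    unfolding P_def using L2_integrable[OF Y] L2_square_integrable[OF Y]
    by (intro integrable_convex_cond_exp[where I = UNIV]) (auto intro: convex_power2)
  moreover have "P \<in> borel_measurable M" unfolding P_def by simp
  ultimately have PL: "P \<in> L2 M" by (simp add: L2_def)
  have "q = (\<integral>\<omega>. q \<partial>M)" by (simp add: prob_space)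
  also have "\<dots> \<le> (\<integral>\<omega>. real_cond_exp M G (\<lambda>\<omega>. (Y \<omega> - P \<omega>)\<^sup>2) \<omega> \<partial>M)"
    using q real_cond_exp_int(1)[OF L2_square_integrable[OF L2_diff[OF Y PL]]]
    by (intro integral_mono_AE) (auto simp: cond_variance_def Let_def G_def P_def)
  also have "\<dots> = (\<integral>\<omega>. (Y \<omega> - P \<omega>)\<^sup>2 \<partial>M)"
    using L2_square_integrable[OF L2_diff[OF Y PL]] by (rule real_cond_exp_int(2))
  also have "\<dots> \<le> (\<integral>\<omega>. (Y \<omega> - a * V \<omega>)\<^sup>2 \<partial>M)"
  proof -
    define E where "E \<omega> = P \<omega> - a * V \<omega>" for \<omega>
    have EL: "E \<in> L2 M" unfolding E_def[abs_def] by (intro L2_diff PL L2_scale V)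
    have EG: "E \<in> borel_measurable G" unfolding E_def[abs_def] using PG VG by measurable
    have "(\<integral>\<omega>. E \<omega> * P \<omega> \<partial>M) = (\<integral>\<omega>. E \<omega> * Y \<omega> \<partial>M)"
      unfolding P_def by (rule real_cond_exp_intg(2)[OF L2_mult_integrable[OF EL Y] EG]) simp
    then have cross: "(\<integral>\<omega>. (Y \<omega> - P \<omega>) * E \<omega> \<partial>M) = 0"
      using L2_mult_integrable[OF EL PL] L2_mult_integrable[OF EL Y]
      by (simp add: mult.commute[of _ "E _"] right_diff_distrib)
    have "(\<integral>\<omega>. (Y \<omega> - a * V \<omega>)\<^sup>2 \<partial>M) = (\<integral>\<omega>. ((Y \<omega> - P \<omega>) - (- 1) * E \<omega>)\<^sup>2 \<partial>M)"
      by (simp add: E_def)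
    also have "\<dots> = (\<integral>\<omega>. (Y \<omega> - P \<omega>)\<^sup>2 \<partial>M) + (\<integral>\<omega>. (E \<omega>)\<^sup>2 \<partial>M)"
      unfolding integral_diff_square[OF L2_diff[OF Y PL] L2_scale[OF EL]] using cross by simp
    finally show ?thesis by simp
  qed
  finally show ?thesis .
qed

section \<open>Centered Gaussian variables and fields\<close>

context prob_space
begin

text \<open>
  The properties that hold alike for normal densities and for the degenerate law.
\<close>

lemma centered_gaussian_properties:
  assumes "centered_gaussian M W"
  shows "(\<integral>\<omega>. iexp (W \<omega>) \<partial>M) = of_real (exp (- (\<integral>\<omega>. (W \<omega>)\<^sup>2 \<partial>M) / 2))"
    and "integrable M (\<lambda>\<omega>. exp \<bar>W \<omega>\<bar>)"
    and "(\<integral>\<omega>. W \<omega> \<partial>M) = 0"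
proof -
  have [measurable]: "W \<in> borel_measurable M" using assms by (simp add: centered_gaussian_def)
  consider \<sigma> where "\<sigma> > 0" "distributed M lborel W (\<lambda>x. ennreal (normal_density 0 \<sigma> x))" | "AE \<omega> in M. W \<omega> = 0"
    using assms by (auto simp: centered_gaussian_def)
  then have "(\<integral>\<omega>. iexp (W \<omega>) \<partial>M) = of_real (exp (- (\<integral>\<omega>. (W \<omega>)\<^sup>2 \<partial>M) / 2)) \<and> integrable M (\<lambda>\<omega>. exp \<bar>W \<omega>\<bar>) \<and> (\<integral>\<omega>. W \<omega> \<partial>M) = 0"
  proof cases
    case 1
    note \<sigma> = 1(1)
    have N: "distributed M lborel (\<lambda>\<omega>. W \<omega> / \<sigma>) (\<lambda>x. ennreal (std_normal_density x))"
      using normal_standard_normal_convert[OF \<sigma>, of W 0] 1(2) by simp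
    define N where "N \<omega> = W \<omega> / \<sigma>" for \<omega>
    have [measurable]: "N \<in> borel_measurable M" unfolding N_def[abs_def] by measurable
    have dN: "distr M lborel N = std_normal_distribution"
      using N by (simp add: N_def[abs_def] distributed_def)
    have W: "W \<omega> = \<sigma> * N \<omega>" for \<omega> using \<sigma> by (simp add: N_def)
    have "(\<integral>\<omega>. iexp (W \<omega>) \<partial>M) = (\<integral>x. iexp (\<sigma> * x) \<partial>(distr M lborel N))"
      unfolding W by (subst integral_distr) auto
    also have "\<dots> = char std_normal_distribution \<sigma>" by (simp add: dN char_def)
    finally have 1: "(\<integral>\<omega>. iexp (W \<omega>) \<partial>M) = of_real (exp (- \<sigma>\<^sup>2 / 2))"
      by (simp add: char_std_normal_distribution)
    have "(\<integral>\<omega>. (N \<omega>) ^ k \<partial>M) = (\<integral>x. std_normal_density x * x ^ k \<partial>lborel)" for k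
      using distributed_integral[OF N, of "\<lambda>x. x ^ k"] by (simp add: N_def normal_density_nonneg)
    from this[of 2] this[of 1] have 2: "(\<integral>\<omega>. (W \<omega>)\<^sup>2 \<partial>M) = \<sigma>\<^sup>2" "(\<integral>\<omega>. W \<omega> \<partial>M) = 0"
      using integral_std_normal_moment_even[of 1] has_bochner_integral_integral_eq[OF std_normal_moment_odd[of 0]]
      unfolding W by (simp_all add: power_mult_distrib)
    have "integrable M (\<lambda>\<omega>. exp (t * W \<omega>))" for t
    proof -
      have "integrable lborel (\<lambda>x. normal_density 0 \<sigma> x * exp (t * x))"
      proof -
        \<comment> \<open>completing the square: an exponential factor shifts the mean\<close>
        have "normal_density 0 \<sigma> x * exp (t * x) = exp (t\<^sup>2 * \<sigma>\<^sup>2 / 2) * normal_density (t * \<sigma>\<^sup>2) \<sigma> x" for x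
        proof -
          have "- (x - 0)\<^sup>2 / (2 * \<sigma>\<^sup>2) + t * x = t\<^sup>2 * \<sigma>\<^sup>2 / 2 + - (x - t * \<sigma>\<^sup>2)\<^sup>2 / (2 * \<sigma>\<^sup>2)"
            using \<sigma> by (simp add: power2_eq_square field_simps)
          then have "exp (- (x - 0)\<^sup>2 / (2 * \<sigma>\<^sup>2)) * exp (t * x) = exp (t\<^sup>2 * \<sigma>\<^sup>2 / 2) * exp (- (x - t * \<sigma>\<^sup>2)\<^sup>2 / (2 * \<sigma>\<^sup>2))"
            by (simp only: mult_exp_exp)
          then show ?thesis by (simp add: normal_density_def)
        qed
        then show ?thesis using \<sigma> by simp
      qed
      then show ?thesis
        using distributed_integrable[OF \<open>distributed M lborel W _\<close>, of "\<lambda>x. exp (t * x)"] by (simp add: normal_density_nonneg)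
    qed
    note e = this
    have isum: "integrable M (\<lambda>\<omega>. exp (1 * W \<omega>) + exp ((- 1) * W \<omega>))"
      by (rule Bochner_Integration.integrable_add[OF e e])
    have le: "norm (exp \<bar>x\<bar>) \<le> norm (exp (1 * x) + exp ((- 1) * x))" for x :: real
    proof -
      have "exp \<bar>x\<bar> \<le> exp x + exp (- x)" by (cases "0 \<le> x") auto
      then show ?thesis by simp
    qed
    have "integrable M (\<lambda>\<omega>. exp \<bar>W \<omega>\<bar>)"
      by (rule Bochner_Integration.integrable_bound[OF isum _ AE_I2[OF le]]) measurable
    with 1 2 show ?thesis by simp
  next
    case 2
    have "(\<integral>\<omega>. iexp (W \<omega>) \<partial>M) = (\<integral>\<omega>. 1 \<partial>M)" using 2 by (intro integral_cong_AE) auto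
    moreover have "(\<integral>\<omega>. (W \<omega>)\<^sup>2 \<partial>M) = (\<integral>\<omega>. 0 \<partial>M)" using 2 by (intro integral_cong_AE) auto
    moreover have "(\<integral>\<omega>. W \<omega> \<partial>M) = (\<integral>\<omega>. 0 \<partial>M)" using 2 by (intro integral_cong_AE) auto
    moreover have "integrable M (\<lambda>\<omega>. exp \<bar>W \<omega>\<bar>) \<longleftrightarrow> integrable M (\<lambda>\<omega>. 1::real)" using 2 by (intro integrable_cong_AE) auto
    ultimately show ?thesis by (simp add: prob_space)
  qed
  then show "(\<integral>\<omega>. iexp (W \<omega>) \<partial>M) = of_real (exp (- (\<integral>\<omega>. (W \<omega>)\<^sup>2 \<partial>M) / 2))"
    and "integrable M (\<lambda>\<omega>. exp \<bar>W \<omega>\<bar>)" and "(\<integral>\<omega>. W \<omega> \<partial>M) = 0" by auto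
qed

lemma exp_integrable_L2:
  assumes [measurable]: "W \<in> borel_measurable M" and "integrable M (\<lambda>\<omega>. exp \<bar>W \<omega>\<bar>)"
  shows "W \<in> L2 M"
proof -
  have "x\<^sup>2 \<le> 2 * exp \<bar>x\<bar>" for x :: real
    using exp_lower_Taylor_quadratic[of "\<bar>x\<bar>"] by simp
  then have "integrable M (\<lambda>\<omega>. (W \<omega>)\<^sup>2)"
    by (intro Bochner_Integration.integrable_bound[OF integrable_mult_right[OF assms(2), of 2]]) auto
  then show ?thesis by (simp add: L2_def)
qed

lemma exp_abs_add_integrable:
  fixes U W :: "'a \<Rightarrow> real"
  assumes [measurable]: "U \<in> borel_measurable M" "W \<in> borel_measurable M"
    and "integrable M (\<lambda>\<omega>. exp \<bar>2 * U \<omega>\<bar>)" "integrable M (\<lambda>\<omega>. exp \<bar>2 * W \<omega>\<bar>)"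
  shows "integrable M (\<lambda>\<omega>. exp \<bar>U \<omega> + W \<omega>\<bar>)"
proof (rule Bochner_Integration.integrable_bound)
  show "integrable M (\<lambda>\<omega>. exp \<bar>2 * U \<omega>\<bar> + exp \<bar>2 * W \<omega>\<bar>)" using assms by simp
  have "exp \<bar>x + y\<bar> \<le> exp \<bar>2 * x\<bar> + exp \<bar>2 * y\<bar>" for x y :: real
  proof -
    have "exp \<bar>x + y\<bar> \<le> exp (max \<bar>2 * x\<bar> \<bar>2 * y\<bar>)" by simp
    also have "\<dots> \<le> exp \<bar>2 * x\<bar> + exp \<bar>2 * y\<bar>" by (simp add: max_def)
    finally show ?thesis .
  qed
  then show "AE \<omega> in M. norm (exp \<bar>U \<omega> + W \<omega>\<bar>) \<le> norm (exp \<bar>2 * U \<omega>\<bar> + exp \<bar>2 * W \<omega>\<bar>)" by simp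
qed measurable

lemma exp_integrable_sum:
  fixes W :: "'i \<Rightarrow> 'a \<Rightarrow> real" and t :: real
  assumes "finite I" and m: "\<And>i. i \<in> I \<Longrightarrow> W i \<in> borel_measurable M"
    and "\<And>i t. i \<in> I \<Longrightarrow> integrable M (\<lambda>\<omega>. exp \<bar>t * W i \<omega>\<bar>)"
  shows "integrable M (\<lambda>\<omega>. exp \<bar>t * (\<Sum>i\<in>I. W i \<omega>)\<bar>)"
  using assms
proof (induction I arbitrary: t rule: finite_induct)
  case (insert i I)
  have "integrable M (\<lambda>\<omega>. exp \<bar>t * W i \<omega> + t * (\<Sum>i\<in>I. W i \<omega>)\<bar>)"
    using insert.prems insert.IH[of "2 * t"]
    by (intro exp_abs_add_integrable) (auto simp flip: mult.assoc)
  then show ?case using insert by (simp add: distrib_left)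
qed simp

end

section \<open>Gaussian random fields\<close>

locale gaussian_vector_field = prob_space M for M :: "'w measure" +
  fixes X :: "real ^ 'n \<Rightarrow> 'w \<Rightarrow> real ^ 'd" and X0 :: "real ^ 'n \<Rightarrow> 'w \<Rightarrow> real"
  assumes field: "gaussian_random_field M X X0"
begin

definition R :: "real ^ 'n \<Rightarrow> real ^ 'n \<Rightarrow> real" where
  "R s t = (\<integral>\<omega>. X0 s \<omega> * X0 t \<omega> \<partial>M)"

text \<open>
  The coefficients for all coordinates come in one family \<open>b\<close>, so that the sum over \<open>i\<close> is a general
  linear combination of coordinates of values of \<open>X\<close>.
\<close>

definition component :: "('d \<Rightarrow> real ^ 'n \<Rightarrow> real) \<Rightarrow> (real ^ 'n) set \<Rightarrow> 'd \<Rightarrow> 'w \<Rightarrow> real" where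
  "component b T i \<omega> = (\<Sum>t\<in>T. b i t * X t \<omega> $ i)"

lemma X0_gaussian: "finite T \<Longrightarrow> centered_gaussian M (\<lambda>\<omega>. \<Sum>t\<in>T. a t * X0 t \<omega>)"
  using field unfolding gaussian_random_field_def centered_gaussian_field_def by blast

lemma X0_meas [measurable]: "X0 t \<in> borel_measurable M"
  using X0_gaussian[of "{t}" "\<lambda>_. 1"] by (simp add: centered_gaussian_def)

lemma X0_L2: "X0 t \<in> L2 M"
  using X0_gaussian[of "{t}" "\<lambda>_. 1"] centered_gaussian_properties(2)[of "X0 t"] by (intro exp_integrable_L2) auto

lemma R_continuous: "continuous_on UNIV (\<lambda>(s, t). R s t)"
  using field by (simp add: gaussian_random_field_def continuous_covariance_def R_def)

lemma path_indep: "indep_vars (\<lambda>_. Pi\<^sub>M UNIV (\<lambda>_. borel)) (\<lambda>i \<omega> t. X t \<omega> $ i) UNIV"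
  using field by (simp add: gaussian_random_field_def)

lemma path_meas: "(\<lambda>\<omega> t. X t \<omega> $ i) \<in> measurable M (Pi\<^sub>M UNIV (\<lambda>_. borel))"
  using path_indep by (auto simp: indep_vars_def)

lemma X_meas [measurable]: "(\<lambda>\<omega>. X t \<omega> $ i) \<in> borel_measurable M"
  using measurable_compose[OF path_meas measurable_component_singleton[of t UNIV "\<lambda>_. borel"]] by simp

lemma X0_path_meas: "(\<lambda>\<omega> t. X0 t \<omega>) \<in> measurable M (Pi\<^sub>M UNIV (\<lambda>_. borel))"
  by (rule measurable_PiM_single') (auto simp: PiE_def)

lemma path_distr: "distr M (Pi\<^sub>M UNIV (\<lambda>_. borel)) (\<lambda>\<omega> t. X t \<omega> $ i) = distr M (Pi\<^sub>M UNIV (\<lambda>_. borel)) (\<lambda>\<omega> t. X0 t \<omega>)"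
  using field by (simp add: gaussian_random_field_def)

text \<open>
  Equality in law of whole paths transfers finite-dimensional facts from the associated real field to
  every coordinate.
\<close>

lemma integral_path:
  fixes f :: "(real ^ 'n \<Rightarrow> real) \<Rightarrow> 'b::{banach, second_countable_topology}"
  assumes f: "f \<in> borel_measurable (Pi\<^sub>M UNIV (\<lambda>_. borel))"
  shows "(\<integral>\<omega>. f (\<lambda>t. X t \<omega> $ i) \<partial>M) = (\<integral>\<omega>. f (\<lambda>t. X0 t \<omega>) \<partial>M)"
    and "integrable M (\<lambda>\<omega>. f (\<lambda>t. X t \<omega> $ i)) \<longleftrightarrow> integrable M (\<lambda>\<omega>. f (\<lambda>t. X0 t \<omega>))"
  using integral_distr[OF path_meas f, of i] integral_distr[OF X0_path_meas f]
    integrable_distr_eq[OF path_meas f, of i] integrable_distr_eq[OF X0_path_meas f]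
  by (simp_all add: path_distr)

lemma lin_meas [measurable]:
  fixes a :: "real ^ 'n \<Rightarrow> real"
  assumes "finite T"
  shows "(\<lambda>p. \<Sum>t\<in>T. a t * p t) \<in> borel_measurable (Pi\<^sub>M UNIV (\<lambda>_. borel))"
  by (intro borel_measurable_sum borel_measurable_times borel_measurable_const measurable_component_singleton) simp

lemma component_cf:
  assumes "finite T"
  shows "(\<integral>\<omega>. iexp (component b T i \<omega>) \<partial>M) = of_real (exp (- (\<integral>\<omega>. (component b T i \<omega>)\<^sup>2 \<partial>M) / 2))"
    and "integrable M (\<lambda>\<omega>. exp \<bar>component b T i \<omega>\<bar>)"
    and "(\<integral>\<omega>. component b T i \<omega> \<partial>M) = 0"
proof -
  note g = centered_gaussian_properties[OF X0_gaussian[OF assms], of "b i"]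
  note [measurable] = lin_meas[OF assms, of "b i"]
  let ?l = "\<lambda>p. \<Sum>t\<in>T. b i t * p t"
  have 1: "(\<integral>\<omega>. iexp (?l (\<lambda>t. X t \<omega> $ i)) \<partial>M) = (\<integral>\<omega>. iexp (?l (\<lambda>t. X0 t \<omega>)) \<partial>M)"
    by (rule integral_path(1)[of "\<lambda>p. iexp (?l p)"]) measurable
  have 2: "(\<integral>\<omega>. (?l (\<lambda>t. X t \<omega> $ i))\<^sup>2 \<partial>M) = (\<integral>\<omega>. (?l (\<lambda>t. X0 t \<omega>))\<^sup>2 \<partial>M)"
    by (rule integral_path(1)[of "\<lambda>p. (?l p)\<^sup>2"]) measurable
  have 3: "integrable M (\<lambda>\<omega>. exp \<bar>?l (\<lambda>t. X t \<omega> $ i)\<bar>) \<longleftrightarrow> integrable M (\<lambda>\<omega>. exp \<bar>?l (\<lambda>t. X0 t \<omega>)\<bar>)"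
    by (rule integral_path(2)[of "\<lambda>p. exp \<bar>?l p\<bar>"]) measurable
  have 4: "(\<integral>\<omega>. ?l (\<lambda>t. X t \<omega> $ i) \<partial>M) = (\<integral>\<omega>. ?l (\<lambda>t. X0 t \<omega>) \<partial>M)"
    by (rule integral_path(1)[of ?l]) measurable
  show "(\<integral>\<omega>. iexp (component b T i \<omega>) \<partial>M) = of_real (exp (- (\<integral>\<omega>. (component b T i \<omega>)\<^sup>2 \<partial>M) / 2))"
    "integrable M (\<lambda>\<omega>. exp \<bar>component b T i \<omega>\<bar>)" "(\<integral>\<omega>. component b T i \<omega> \<partial>M) = 0"
    unfolding component_def using g 1 2 3 4 by simp_all
qed

lemma component_meas [measurable]: "component b T i \<in> borel_measurable M"
  unfolding component_def[abs_def] by measurable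

lemma component_L2: "finite T \<Longrightarrow> component b T i \<in> L2 M"
  by (intro exp_integrable_L2 component_meas component_cf)

lemma component_indep: "finite T \<Longrightarrow> indep_vars (\<lambda>_. borel) (component b T) UNIV"
  using indep_vars_compose2[OF path_indep, of "\<lambda>i p. \<Sum>t\<in>T. b i t * p t" "\<lambda>_. borel"]
  by (simp add: component_def[abs_def])

lemma component_uncorrelated:
  assumes "finite T" "finite T'" "i \<noteq> j"
  shows "(\<integral>\<omega>. component b T i \<omega> * component b' T' j \<omega> \<partial>M) = 0"
proof -
  define Y where "Y k = (if k = i then component b T i else component b' T' k)" for k
  have eq: "(\<lambda>k \<omega>. (\<lambda>k p. if k = i then (\<Sum>t\<in>T. b i t * p t) else (\<Sum>t\<in>T'. b' k t * p t)) k (\<lambda>t. X t \<omega> $ k)) = Y"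
    by (auto simp: Y_def component_def fun_eq_iff)
  have "indep_vars (\<lambda>_. borel) Y UNIV"
    unfolding eq[symmetric] using assms by (intro indep_vars_compose2[OF path_indep]) auto
  then have ind: "indep_vars (\<lambda>_. borel) Y {i, j}" by (rule indep_vars_subset) auto
  have "(\<integral>\<omega>. (\<Prod>k\<in>{i, j}. Y k \<omega>) \<partial>M) = (\<Prod>k\<in>{i, j}. \<integral>\<omega>. Y k \<omega> \<partial>M)"
    by (rule indep_vars_lebesgue_integral[OF _ ind])
       (use assms in \<open>auto simp: Y_def intro!: L2_integrable component_L2\<close>)
  then show ?thesis using assms component_cf(3)[OF assms(1), of b i] by (simp add: Y_def)
qed

lemma X_L2: "(\<lambda>\<omega>. X s \<omega> $ i) \<in> L2 M"
  using component_L2[of "{s}" "\<lambda>_ _. 1" i] by (simp add: component_def[abs_def])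

lemma X_cov: "(\<integral>\<omega>. X s \<omega> $ i * X t \<omega> $ j \<partial>M) = (if i = j then R s t else 0)"
proof (cases "i = j")
  case True
  have "(\<integral>\<omega>. X s \<omega> $ i * X t \<omega> $ i \<partial>M) = (\<integral>\<omega>. X0 s \<omega> * X0 t \<omega> \<partial>M)"
    by (rule integral_path(1)[of "\<lambda>p. p s * p t"]) measurable
  then show ?thesis using True by (simp add: R_def)
next
  case False
  then show ?thesis
    using component_uncorrelated[of "{s}" "{t}" i j "\<lambda>_ _. 1" "\<lambda>_ _. 1"] by (simp add: component_def)
qed

definition combination :: "('d \<Rightarrow> real ^ 'n \<Rightarrow> real) \<Rightarrow> (real ^ 'n) set \<Rightarrow> 'w \<Rightarrow> real" where
  "combination b T \<omega> = (\<Sum>i\<in>UNIV. component b T i \<omega>)"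

lemma combination_meas [measurable]: "combination b T \<in> borel_measurable M"
  unfolding combination_def[abs_def] by measurable

lemma combination_L2: "finite T \<Longrightarrow> combination b T \<in> L2 M"
  unfolding combination_def[abs_def] by (intro L2_sum component_L2)

lemma combination_mean: "finite T \<Longrightarrow> (\<integral>\<omega>. combination b T \<omega> \<partial>M) = 0"
  unfolding combination_def using component_L2 L2_integrable component_cf(3) by simp

lemma combination_exp:
  assumes T: "finite T"
  shows "integrable M (\<lambda>\<omega>. exp \<bar>t * combination b T \<omega>\<bar>)"
  unfolding combination_def
proof (rule exp_integrable_sum)
  fix i t
  have "integrable M (\<lambda>\<omega>. exp \<bar>component (\<lambda>i s. t * b i s) T i \<omega>\<bar>)" by (rule component_cf(2)[OF T])
  then show "integrable M (\<lambda>\<omega>. exp \<bar>t * component b T i \<omega>\<bar>)" by (simp add: component_def sum_distrib_left mult.assoc)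
qed auto

text \<open>
  The coordinates are independent: characteristic functions multiply and variances add.
\<close>

lemma combination_cf:
  assumes T: "finite T"
  shows "(\<integral>\<omega>. iexp (combination b T \<omega>) \<partial>M) = of_real (exp (- (\<integral>\<omega>. (combination b T \<omega>)\<^sup>2 \<partial>M) / 2))"
proof -
  have "(\<integral>\<omega>. (combination b T \<omega>)\<^sup>2 \<partial>M) = (\<Sum>i\<in>UNIV. \<Sum>j\<in>UNIV. \<integral>\<omega>. component b T i \<omega> * component b T j \<omega> \<partial>M)"
    unfolding combination_def power2_eq_square sum_product
    using L2_mult_integrable[OF component_L2[OF T] component_L2[OF T]] by simp
  also have "\<dots> = (\<Sum>i\<in>UNIV. \<Sum>j\<in>UNIV. if i = j then (\<integral>\<omega>. (component b T i \<omega>)\<^sup>2 \<partial>M) else 0)"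
    using component_uncorrelated[OF T T] by (intro sum.cong refl) (auto simp: power2_eq_square)
  also have "\<dots> = (\<Sum>i\<in>UNIV. \<integral>\<omega>. (component b T i \<omega>)\<^sup>2 \<partial>M)" by simp
  finally have var: "(\<integral>\<omega>. (combination b T \<omega>)\<^sup>2 \<partial>M) = (\<Sum>i\<in>UNIV. \<integral>\<omega>. (component b T i \<omega>)\<^sup>2 \<partial>M)" .
  have ind: "indep_vars (\<lambda>_. borel) (\<lambda>i \<omega>. iexp (component b T i \<omega>)) UNIV"
    using indep_vars_compose2[OF component_indep[OF T], of "\<lambda>_ x. iexp x" "\<lambda>_. borel"] by simp
  have "(\<integral>\<omega>. iexp (combination b T \<omega>) \<partial>M) = (\<integral>\<omega>. (\<Prod>i\<in>UNIV. iexp (component b T i \<omega>)) \<partial>M)"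
    by (simp add: combination_def exp_sum sum_distrib_left)
  also have "\<dots> = (\<Prod>i\<in>UNIV. \<integral>\<omega>. iexp (component b T i \<omega>) \<partial>M)"
    by (rule indep_vars_lebesgue_integral[OF _ ind]) (auto intro!: integrable_const_bound[where B = 1])
  also have "\<dots> = of_real (\<Prod>i\<in>UNIV. exp (- (\<integral>\<omega>. (component b T i \<omega>)\<^sup>2 \<partial>M) / 2))"
    by (simp add: component_cf(1)[OF T])
  also have "(\<Prod>i\<in>UNIV. exp (- (\<integral>\<omega>. (component b T i \<omega>)\<^sup>2 \<partial>M) / 2)) = exp (- (\<integral>\<omega>. (combination b T \<omega>)\<^sup>2 \<partial>M) / 2)"
    unfolding var by (simp add: exp_sum[symmetric] sum_negf sum_divide_distrib)
  finally show ?thesis .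
qed

end

section \<open>Integrability of the two kernels\<close>

text \<open>
  The two conditions, expressed by the covariance function. The second one bounds the squared distance
  of the value at \<open>t\<close> from \<open>a\<close> times the value at \<open>s\<close>, for every coefficient \<open>a\<close>; in this form the
  conditions for independent fields can be added.
\<close>

locale anisotropic_covariance =
  fixes R :: "real ^ 'n \<Rightarrow> real ^ 'n \<Rightarrow> real" and \<alpha> :: "'n \<Rightarrow> real" and c\<^sub>1 c\<^sub>2 :: real
  assumes \<alpha>: "0 < \<alpha> j" "\<alpha> j < 1" and c: "0 < c\<^sub>1" "0 < c\<^sub>2"
    and cont: "continuous_on UNIV (\<lambda>(s, t). R s t)"
    and C1: "s \<in> unit_cube \<Longrightarrow> t \<in> unit_cube \<Longrightarrow>
      R s s - 2 * R s t + R t t \<le> c\<^sub>1 * (\<Sum>j\<in>UNIV. \<bar>s $ j - t $ j\<bar> powr (2 * \<alpha> j))"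
    and C2: "s \<in> unit_cube \<Longrightarrow> t \<in> unit_cube \<Longrightarrow>
      c\<^sub>2 * (\<Sum>j\<in>UNIV. min (\<bar>s $ j - t $ j\<bar> powr (2 * \<alpha> j)) (\<bar>t $ j\<bar> powr (2 * \<alpha> j))) \<le> R t t - 2 * a * R s t + a\<^sup>2 * R s s"
begin

definition D :: "real ^ 'n \<Rightarrow> real ^ 'n \<Rightarrow> real" where "D s t = R s s * R t t - (R s t)\<^sup>2"

text \<open>
  The second condition at \<open>s = 0\<close> and \<open>a = 0\<close>, where both terms of the minimum coincide.
\<close>

lemma variance_lower: 
  assumes "t \<in> unit_cube"
  shows "c\<^sub>2 * (\<Sum>j\<in>UNIV. \<bar>t $ j\<bar> powr (2 * \<alpha> j)) \<le> R t t"
proof -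
  have "(0 :: real ^ 'n) \<in> unit_cube" by (simp add: mem_box_cart)
  from C2[OF this assms, of 0] show ?thesis by simp
qed

lemma variance_pos:
  assumes "t \<in> unit_cube" "t \<noteq> 0"
  shows "0 < R t t"
proof -
  obtain j where j: "t $ j \<noteq> 0" using assms(2) by (auto simp: vec_eq_iff)
  have "0 < \<bar>t $ j\<bar> powr (2 * \<alpha> j)" using j by simp
  also have "\<dots> \<le> (\<Sum>j\<in>UNIV. \<bar>t $ j\<bar> powr (2 * \<alpha> j))" by (intro member_le_sum) auto
  finally show ?thesis using variance_lower[OF assms(1)] c(2) by (smt (verit) mult_pos_pos)
qed

lemma variance_nonneg: "t \<in> unit_cube \<Longrightarrow> 0 \<le> R t t"
  using variance_lower[of t] c(2) sum_nonneg[of UNIV "\<lambda>j. \<bar>t $ j\<bar> powr (2 * \<alpha> j)"]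
  by (smt (verit) mult_nonneg_nonneg powr_ge_zero)

text \<open>
  The optimal coefficient is \<open>a = R s t / R s s\<close>. If \<open>R s s = 0\<close>, then \<open>R s t = 0\<close> as well, because
  otherwise the residual would be unbounded below in \<open>a\<close>.
\<close>

lemma determinant_ge_residual:
  assumes s: "s \<in> unit_cube" and t: "t \<in> unit_cube"
  shows "R s s * (c\<^sub>2 * (\<Sum>j\<in>UNIV. min (\<bar>s $ j - t $ j\<bar> powr (2 * \<alpha> j)) (\<bar>t $ j\<bar> powr (2 * \<alpha> j)))) \<le> D s t"
proof (cases "R s s = 0")
  case True
  have "R s t = 0"
  proof (rule ccontr)
    assume nz: "R s t \<noteq> 0"
    let ?m = "c\<^sub>2 * (\<Sum>j\<in>UNIV. min (\<bar>s $ j - t $ j\<bar> powr (2 * \<alpha> j)) (\<bar>t $ j\<bar> powr (2 * \<alpha> j)))"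
    have "0 \<le> ?m" using c by (intro mult_nonneg_nonneg sum_nonneg) auto
    define a where "a = (R t t + 1) / (2 * R s t)"
    have "2 * a * R s t = R t t + 1" using nz by (simp add: a_def)
    moreover have "?m \<le> R t t - 2 * a * R s t" using C2[OF s t, of a] True by simp
    ultimately show False using \<open>0 \<le> ?m\<close> by linarith
  qed
  then show ?thesis using True by (simp add: D_def)
next
  case False
  then have pos: "0 < R s s" using variance_nonneg[OF s] by simp
  have "R s s * (R t t - 2 * (R s t / R s s) * R s t + (R s t / R s s)\<^sup>2 * R s s) = D s t"
    using pos by (simp add: D_def power2_eq_square field_simps)
  then show ?thesis using mult_left_mono[OF C2[OF s t, of "R s t / R s s"], of "R s s"] pos by simp
qed

lemma determinant_lower:
  assumes s: "s \<in> unit_cube" and t: "t \<in> unit_cube"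
  shows "c\<^sub>2\<^sup>2 * (\<Sum>j\<in>UNIV. \<bar>s $ j\<bar> powr (2 * \<alpha> j)) * (\<Sum>j\<in>UNIV. min (\<bar>s $ j - t $ j\<bar> powr (2 * \<alpha> j)) (\<bar>t $ j\<bar> powr (2 * \<alpha> j))) \<le> D s t"
proof -
  let ?S = "\<Sum>j\<in>UNIV. \<bar>s $ j\<bar> powr (2 * \<alpha> j)"
  let ?m = "c\<^sub>2 * (\<Sum>j\<in>UNIV. min (\<bar>s $ j - t $ j\<bar> powr (2 * \<alpha> j)) (\<bar>t $ j\<bar> powr (2 * \<alpha> j)))"
  have "0 \<le> ?m" using c by (intro mult_nonneg_nonneg sum_nonneg) auto
  then have "(c\<^sub>2 * ?S) * ?m \<le> R s s * ?m" using variance_lower[OF s] by (intro mult_right_mono)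
  also have "\<dots> \<le> D s t" by (rule determinant_ge_residual[OF s t])
  finally show ?thesis by (simp add: power2_eq_square mult_ac)
qed

lemma determinant_pos:
  assumes s: "s \<in> unit_cube" "s \<noteq> 0" and t: "t \<in> unit_cube" "t \<noteq> s" "\<And>j. t $ j \<noteq> 0"
  shows "0 < D s t"
proof -
  let ?m = "\<lambda>j. min (\<bar>s $ j - t $ j\<bar> powr (2 * \<alpha> j)) (\<bar>t $ j\<bar> powr (2 * \<alpha> j))"
  obtain j where j: "t $ j \<noteq> s $ j" using t(2) by (auto simp: vec_eq_iff)
  have "0 < ?m j" using j t(3)[of j] by simp
  also have "\<dots> \<le> (\<Sum>j\<in>UNIV. ?m j)" by (intro member_le_sum) auto
  finally have "0 < R s s * (c\<^sub>2 * (\<Sum>j\<in>UNIV. ?m j))" using variance_pos[OF s] c by simp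
  also have "\<dots> \<le> D s t" by (rule determinant_ge_residual[OF s(1) t(1)])
  finally show ?thesis .
qed

text \<open>
  The coefficient \<open>a = 1\<close> is not better than the optimal one.
\<close>

lemma determinant_upper:
  assumes s: "s \<in> unit_cube" and t: "t \<in> unit_cube"
  shows "D s t \<le> R s s * (c\<^sub>1 * (\<Sum>j\<in>UNIV. \<bar>s $ j - t $ j\<bar> powr (2 * \<alpha> j)))"
proof -
  have "D s t \<le> R s s * (R s s - 2 * R s t + R t t)"
    using zero_le_power2[of "R s s - R s t"] by (simp add: D_def power2_eq_square algebra_simps)
  also have "\<dots> \<le> R s s * (c\<^sub>1 * (\<Sum>j\<in>UNIV. \<bar>s $ j - t $ j\<bar> powr (2 * \<alpha> j)))"
    using C1[OF s t] variance_nonneg[OF s] by (intro mult_left_mono)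
  finally show ?thesis .
qed

lemma variance_bounded: obtains B where "1 \<le> B" "\<And>s. s \<in> unit_cube \<Longrightarrow> R s s \<le> B"
proof -
  have "continuous_on unit_cube (\<lambda>s. (\<lambda>(s, t). R s t) (s, s))"
    by (rule continuous_on_compose2[OF cont]) (auto intro!: continuous_intros)
  then have "compact ((\<lambda>s. R s s) ` unit_cube)"
    by (intro compact_continuous_image) auto
  then obtain b where "\<And>x. x \<in> (\<lambda>s. R s s) ` unit_cube \<Longrightarrow> \<bar>x\<bar> \<le> b"
    using compact_imp_bounded bounded_real by metis
  then show ?thesis by (intro that[of "max 1 b"]) force+
qed

text \<open>
  The homogeneous dimension of the cube with respect to the distance \<open>\<Sum>j. \<bar>s $ j - t $ j\<bar> powr \<alpha> j\<close>: a ball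
  of small radius \<open>r\<close> has a volume of the order \<open>r powr Q\<close>.
\<close>

definition Q :: real where "Q = (\<Sum>j\<in>UNIV. 1 / \<alpha> j)"

definition cube_integral :: "(real ^ 'n \<Rightarrow> real ^ 'n \<Rightarrow> ennreal) \<Rightarrow> ennreal" where
  "cube_integral F = (\<integral>\<^sup>+s. indicator unit_cube s * (\<integral>\<^sup>+t. indicator unit_cube t * F s t \<partial>lborel) \<partial>lborel)"

lemma D_meas: "(\<lambda>(s, t). D s t) \<in> borel_measurable (borel \<Otimes>\<^sub>M borel)"
proof -
  have "continuous_on UNIV (\<lambda>x. (\<lambda>(s, t). R s t) (fst x, fst x) * (\<lambda>(s, t). R s t) (snd x, snd x) - ((\<lambda>(s, t). R s t) (fst x, snd x))\<^sup>2)"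
    by (intro continuous_intros continuous_on_compose2[OF cont]) auto
  then show ?thesis
    using borel_measurable_continuous_onI by (simp add: borel_prod D_def case_prod_beta')
qed

text \<open>
  A bound outside a null set suffices; it excludes the zeros of \<open>D\<close>, which include the diagonal.
\<close>

lemma cube_integral_finite:
  assumes p: "0 < p" "p < Q"
    and F: "\<And>s t. s \<in> unit_cube \<Longrightarrow> t \<in> unit_cube \<Longrightarrow> s \<noteq> 0 \<Longrightarrow> t \<noteq> 0 \<Longrightarrow> 0 < D s t \<Longrightarrow> F s t \<le> ennreal (k * D s t powr (- p / 2))"
    and k: "0 \<le> k"
  shows "cube_integral F < \<infinity>"
proof -
  note [measurable] = D_meas
  have "(\<integral>\<^sup>+t. indicator unit_cube t * F s t \<partial>lborel) \<le> ennreal k * (\<integral>\<^sup>+t. indicator unit_cube t * ennreal (D s t powr (- p / 2)) \<partial>lborel)"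
    if s: "s \<in> unit_cube" "s \<noteq> 0" for s
  proof -
    have "(\<integral>\<^sup>+t. indicator unit_cube t * F s t \<partial>lborel) \<le> (\<integral>\<^sup>+t. ennreal k * (indicator unit_cube t * ennreal (D s t powr (- p / 2))) \<partial>lborel)"
    proof (rule nn_integral_mono_AE)
      have "AE t in (lborel :: (real ^ 'n) measure). \<forall>j. t $ j \<noteq> 0"
        by (simp add: AE_all_countable AE_lborel_coordinate_neq)
      then show "AE t in lborel. indicator unit_cube t * F s t \<le> ennreal k * (indicator unit_cube t * ennreal (D s t powr (- p / 2)))"
        using AE_lborel_singleton[of s]
      proof eventually_elim
        case (elim t)
        show ?case
        proof (cases "t \<in> unit_cube")
          case True
          have "t \<noteq> 0" using elim(1) by auto
          moreover have "0 < D s t" using elim by (intro determinant_pos s True) auto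
          ultimately show ?thesis using F[OF s(1) True s(2)] k True by (simp add: ennreal_mult)
        qed simp
      qed
    qed
    also have "\<dots> = ennreal k * (\<integral>\<^sup>+t. indicator unit_cube t * ennreal (D s t powr (- p / 2)) \<partial>lborel)"
    proof (rule nn_integral_cmult)
      have "(\<lambda>t. (\<lambda>(s, t). D s t) (s, t)) \<in> borel_measurable borel" by measurable
      then have [measurable]: "D s \<in> borel_measurable borel" by simp
      show "(\<lambda>t. indicator unit_cube t * ennreal (D s t powr (- p / 2))) \<in> borel_measurable lborel" by measurable
    qed
    finally show ?thesis .
  qed
  note inner = this
  have "cube_integral F \<le> (\<integral>\<^sup>+s. ennreal k * (indicator unit_cube s * (\<integral>\<^sup>+t. indicator unit_cube t * ennreal (D s t powr (- p / 2)) \<partial>lborel)) \<partial>lborel)"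
    unfolding cube_integral_def
  proof (rule nn_integral_mono_AE)
    show "AE s in lborel. indicator unit_cube s * (\<integral>\<^sup>+t. indicator unit_cube t * F s t \<partial>lborel) \<le>
       ennreal k * (indicator unit_cube s * (\<integral>\<^sup>+t. indicator unit_cube t * ennreal (D s t powr (- p / 2)) \<partial>lborel))"
      using AE_lborel_singleton[of 0]
    proof eventually_elim
      case (elim s)
      then show ?case using inner[of s] by (cases "s \<in> unit_cube") auto
    qed
  qed
  also have "\<dots> = ennreal k * (\<integral>\<^sup>+s. indicator unit_cube s * (\<integral>\<^sup>+t. indicator unit_cube t * ennreal (D s t powr (- p / 2)) \<partial>lborel) \<partial>lborel)"
  proof (rule nn_integral_cmult)
    have "(\<lambda>x. D (fst x) (snd x)) \<in> borel_measurable (borel \<Otimes>\<^sub>M borel)" using D_meas by (simp add: case_prod_beta')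
    then have [measurable]: "(\<lambda>x. D (fst x) (snd x)) \<in> borel_measurable (borel \<Otimes>\<^sub>M lborel)" by (simp cong: measurable_cong_sets)
    have [measurable]: "(\<lambda>x. indicator unit_cube (snd x) * ennreal (D (fst x) (snd x) powr (- p / 2))) \<in> borel_measurable (borel \<Otimes>\<^sub>M lborel)"
      by measurable
    have "(\<lambda>s. \<integral>\<^sup>+t. indicator unit_cube t * ennreal (D s t powr (- p / 2)) \<partial>lborel) \<in> borel_measurable borel"
      by (rule sigma_finite_measure.borel_measurable_nn_integral) (auto simp: case_prod_beta' sigma_finite_lborel)
    then show "(\<lambda>s. indicator unit_cube s * (\<integral>\<^sup>+t. indicator unit_cube t * ennreal (D s t powr (- p / 2)) \<partial>lborel)) \<in> borel_measurable lborel"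
      by simp
  qed
  also have "\<dots> < \<infinity>"
    using anisotropic_integral_finite[OF \<alpha>(1) p[unfolded Q_def] _ determinant_lower] c
    by (simp add: ennreal_mult_less_top)
  finally show ?thesis .
qed

text \<open>
  The divergence comes from the diagonal alone, so that the lower bound for \<open>F\<close> is demanded only for
  nearby points with coordinates bounded away from \<open>0\<close>.
\<close>

lemma cube_integral_infinite:
  assumes p: "0 < p" "Q \<le> p" and k: "0 < k"
    and r0: "0 < r\<^sub>0"
    and F: "\<And>s t. s \<in> unit_cube \<Longrightarrow> t \<in> unit_cube \<Longrightarrow> s \<noteq> 0 \<Longrightarrow> t \<noteq> 0 \<Longrightarrow> 0 < D s t \<Longrightarrow>
       (\<And>j. 1 / 2 \<le> s $ j) \<Longrightarrow> (\<And>j. 1 / 2 \<le> t $ j) \<Longrightarrow> (\<And>j. \<bar>s $ j - t $ j\<bar> \<le> r\<^sub>0) \<Longrightarrow>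
       ennreal (k * D s t powr (- p / 2)) \<le> F s t"
  shows "cube_integral F = \<infinity>"
proof -
  obtain B where B: "1 \<le> B" "\<And>s. s \<in> unit_cube \<Longrightarrow> R s s \<le> B" using variance_bounded by blast
  define r where "r = min r\<^sub>0 (1 / 4)"
  have r: "0 < r" "r \<le> 1 / 4" "r \<le> r\<^sub>0" using r0 by (auto simp: r_def)
  define k' where "k' = k * (B * c\<^sub>1) powr (- p / 2)"
  have k': "0 < k'" using k B c by (simp add: k'_def)
  show ?thesis
    unfolding cube_integral_def
  proof (rule anisotropic_double_integral_infinite[OF \<alpha>(1) p(2)[unfolded Q_def] r(1,2) k'])
    fix s t :: "real ^ 'n" assume st: "s \<in> cbox (\<chi> j. 1 / 2) (\<chi> j. 3 / 4)" "t - s \<in> cbox 0 (\<chi> j. r)"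
    let ?S = "\<Sum>j\<in>UNIV. \<bar>s $ j - t $ j\<bar> powr (2 * \<alpha> j)"
    have co: "1 / 2 \<le> s $ j" "s $ j \<le> 3 / 4" "0 \<le> t $ j - s $ j" "t $ j - s $ j \<le> r" for j
      using st by (auto simp: mem_box_cart)
    have co': "0 \<le> s $ j" "s $ j \<le> 1" "0 \<le> t $ j" "t $ j \<le> 1" "1 / 2 \<le> t $ j" "t $ j \<noteq> 0" "\<bar>s $ j - t $ j\<bar> \<le> r\<^sub>0" for j
      using co[of j] r by auto
    have cube: "s \<in> unit_cube" "t \<in> unit_cube" using co' by (auto simp: mem_box_cart)
    show "ennreal (k' * ?S powr (- p / 2)) \<le> F s t"
    proof (cases "s = t")
      case True
      then show ?thesis by simp
    next
      case False
      have nz: "s \<noteq> 0" "t \<noteq> 0"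
        using co(1) co'(5) by (metis zero_index not_le half_gt_zero zero_less_one)+
      have Dp: "0 < D s t" using False nz co'(6) by (intro determinant_pos cube) auto
      have "0 \<le> ?S" by (intro sum_nonneg) auto
      then have "R s s * (c\<^sub>1 * ?S) \<le> B * (c\<^sub>1 * ?S)" using B(2)[OF cube(1)] c by (intro mult_right_mono) auto
      then have "D s t \<le> B * c\<^sub>1 * ?S" using determinant_upper[OF cube] by simp
      then have "(B * c\<^sub>1 * ?S) powr (- p / 2) \<le> D s t powr (- p / 2)"
        using Dp p by (intro powr_mono2') auto
      then have "k' * ?S powr (- p / 2) \<le> k * D s t powr (- p / 2)"
        using k B(1) c \<open>0 \<le> ?S\<close> by (simp add: k'_def powr_mult mult_ac)
      then have "ennreal (k' * ?S powr (- p / 2)) \<le> ennreal (k * D s t powr (- p / 2))" by (rule ennreal_leI)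
      also have "\<dots> \<le> F s t" using F[OF cube nz Dp] co(1) co'(5,7) by blast
      finally show ?thesis .
    qed
  qed
qed

lemma cosh_kernel_finite_iff:
  assumes k: "0 < k"
  shows "cube_integral (\<lambda>s t. ennreal k * pair_cosh TYPE('a::euclidean_space) (R s s) (R t t) (R s t)) < \<infinity> \<longleftrightarrow> real DIM('a) < Q"
proof
  let ?F = "\<lambda>s t. ennreal k * pair_cosh TYPE('a) (R s s) (R t t) (R s t)"
  have F: "?F s t = ennreal (k * (2 * pi) ^ DIM('a) * D s t powr (- real DIM('a) / 2))"
    if "s \<in> unit_cube" "t \<in> unit_cube" "s \<noteq> 0" "t \<noteq> 0" "0 < D s t" for s t
    using pair_cosh_eq[of "R s s" "R t t" "R s t", where 'a = 'a] variance_pos that k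
    by (simp add: D_def ennreal_mult[symmetric] mult.assoc)
  show "cube_integral ?F < \<infinity>" if "real DIM('a) < Q"
    by (rule cube_integral_finite[OF _ that, of _ "k * (2 * pi) ^ DIM('a)"]) (use k F in auto)
  show "real DIM('a) < Q" if "cube_integral ?F < \<infinity>"
  proof (rule ccontr)
    assume "\<not> real DIM('a) < Q"
    then have "cube_integral ?F = \<infinity>"
      by (intro cube_integral_infinite[of "real DIM('a)" "k * (2 * pi) ^ DIM('a)" 1]) (use k F in auto)
    with that show False by simp
  qed
qed

text \<open>
  Away from the coordinate planes the variances are at least \<open>c\<^sub>2 / 4\<close>, since \<open>\<alpha> j < 1\<close> gives
  \<open>1 / 4 \<le> (1 / 2) powr (2 * \<alpha> j)\<close>. For small increments the covariance is then at least half of this, and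
  the determinant is as small as desired. This gives the upper bound for the determinant that
  \<open>pair_sinh_lower\<close> assumes, and bounds the factor \<open>r\<^sup>2\<close> in that lemma from below.
\<close>

lemma near_diagonal:
  obtains r where "0 < r" "\<And>s t. s \<in> unit_cube \<Longrightarrow> t \<in> unit_cube \<Longrightarrow> (\<And>j. 1 / 2 \<le> s $ j) \<Longrightarrow> (\<And>j. 1 / 2 \<le> t $ j) \<Longrightarrow>
     (\<And>j. \<bar>s $ j - t $ j\<bar> \<le> r) \<Longrightarrow> D s t \<le> (R s t)\<^sup>2 \<and> (c\<^sub>2 / 8)\<^sup>2 \<le> (R s t)\<^sup>2"
proof -
  obtain B where B: "1 \<le> B" "\<And>s. s \<in> unit_cube \<Longrightarrow> R s s \<le> B" using variance_bounded by blast
  define m where "m = c\<^sub>2 / 4"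
  have m: "0 < m" using c by (simp add: m_def)
  have "(\<lambda>k. \<Sum>j\<in>UNIV. inverse (real (Suc k)) powr (2 * \<alpha> j)) \<longlonglongrightarrow> (\<Sum>j\<in>(UNIV :: 'n set). 0)"
    using \<alpha>(1) by (intro tendsto_sum tendsto_zero_powrI LIMSEQ_inverse_real_of_nat tendsto_const) auto
  then have "(\<lambda>k. c\<^sub>1 * (\<Sum>j\<in>UNIV. inverse (real (Suc k)) powr (2 * \<alpha> j))) \<longlonglongrightarrow> 0"
    by (intro tendsto_mult_right_zero) simp
  moreover have "0 < min m (m\<^sup>2 / (4 * B))" using m B by simp
  ultimately have "\<forall>\<^sub>F k in sequentially. c\<^sub>1 * (\<Sum>j\<in>UNIV. inverse (real (Suc k)) powr (2 * \<alpha> j)) < min m (m\<^sup>2 / (4 * B))"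
    by (rule order_tendstoD(2))
  then obtain k where k: "c\<^sub>1 * (\<Sum>j\<in>UNIV. inverse (real (Suc k)) powr (2 * \<alpha> j)) < min m (m\<^sup>2 / (4 * B))"
    unfolding eventually_sequentially by blast
  define r where "r = inverse (real (Suc k))"
  have r: "0 < r" by (simp add: r_def)
  show ?thesis
  proof (rule that[OF r])
    fix s t :: "real ^ 'n"
    assume s: "s \<in> unit_cube" and t: "t \<in> unit_cube" and s2: "\<And>j. 1 / 2 \<le> s $ j" and t2: "\<And>j. 1 / 2 \<le> t $ j"
      and st: "\<And>j. \<bar>s $ j - t $ j\<bar> \<le> r"
    let ?E = "c\<^sub>1 * (\<Sum>j\<in>UNIV. \<bar>s $ j - t $ j\<bar> powr (2 * \<alpha> j))"
    have "?E \<le> c\<^sub>1 * (\<Sum>j\<in>UNIV. r powr (2 * \<alpha> j))"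
      using c \<alpha>(1) st by (intro mult_left_mono sum_mono powr_mono2) (auto intro: less_imp_le)
    then have E: "?E \<le> m" "?E \<le> m\<^sup>2 / (4 * B)" using k by (auto simp: r_def)
    have ge: "m \<le> R u u" if u: "u \<in> unit_cube" "\<And>j. 1 / 2 \<le> u $ j" for u
    proof -
      fix j :: 'n
      have "(1 / 4 :: real) = (1 / 2) powr 2" by (simp add: power_divide)
      also have "\<dots> \<le> (1 / 2) powr (2 * \<alpha> j)" using \<alpha>(2)[of j] by (intro powr_mono') auto
      also have "\<dots> \<le> \<bar>u $ j\<bar> powr (2 * \<alpha> j)" using u(2)[of j] \<alpha>(1)[of j] by (intro powr_mono2) auto
      also have "\<dots> \<le> (\<Sum>j\<in>UNIV. \<bar>u $ j\<bar> powr (2 * \<alpha> j))" by (intro member_le_sum) auto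
      finally have "c\<^sub>2 * (1 / 4) \<le> c\<^sub>2 * (\<Sum>j\<in>UNIV. \<bar>u $ j\<bar> powr (2 * \<alpha> j))" using c by (intro mult_left_mono) auto
      then show "m \<le> R u u" using variance_lower[OF u(1)] by (simp add: m_def)
    qed
    have "m / 2 \<le> R s t" using ge[OF s s2] ge[OF t t2] C1[OF s t] E(1) by linarith
    then have 1: "(m / 2)\<^sup>2 \<le> (R s t)\<^sup>2" using m by (intro power_mono) auto
    have E0: "0 \<le> ?E" using c by (intro mult_nonneg_nonneg sum_nonneg) auto
    have "D s t \<le> B * (m\<^sup>2 / (4 * B))"
      using order_trans[OF determinant_upper[OF s t] mult_mono[OF B(2)[OF s] E(2)]] B(1) E0 by simp
    also have "\<dots> = (m / 2)\<^sup>2" using B(1) by (simp add: power2_eq_square)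
    finally show "D s t \<le> (R s t)\<^sup>2 \<and> (c\<^sub>2 / 8)\<^sup>2 \<le> (R s t)\<^sup>2" using 1 by (simp add: m_def)
  qed
qed

lemma sinh_kernel_finite_iff:
  assumes k: "0 < k"
  shows "cube_integral (\<lambda>s t. ennreal k * pair_sinh TYPE('a::euclidean_space) (R s s) (R t t) (R s t)) < \<infinity> \<longleftrightarrow> real (DIM('a) + 2) < Q"
proof
  let ?F = "\<lambda>s t. ennreal k * pair_sinh TYPE('a) (R s s) (R t t) (R s t)"
  let ?p = "real (DIM('a) + 2)"
  obtain B where B: "1 \<le> B" "\<And>s. s \<in> unit_cube \<Longrightarrow> R s s \<le> B" using variance_bounded by blast
  define K where "K = 6 * B\<^sup>2 * (2 * pi) ^ DIM('a) * 2 powr (real DIM('a) / 2)"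
  have K: "0 \<le> K" by (simp add: K_def)
  have up: "?F s t \<le> ennreal (k * K * D s t powr (- ?p / 2))"
    if "s \<in> unit_cube" "t \<in> unit_cube" "s \<noteq> 0" "t \<noteq> 0" "0 < D s t" for s t
  proof -
    have "pair_sinh TYPE('a) (R s s) (R t t) (R s t) \<le> ennreal (K * D s t powr (- ?p / 2))"
      unfolding K_def D_def using that variance_pos B(2) by (intro pair_sinh_upper) (auto simp: D_def)
    from mult_left_mono[OF this, of "ennreal k"] show ?thesis
      using k K by (simp add: ennreal_mult[symmetric] mult.assoc)
  qed
  show "cube_integral ?F < \<infinity>" if "?p < Q"
    by (rule cube_integral_finite[OF _ that, of _ "k * K"]) (use k K up in auto)
  show "?p < Q" if fin: "cube_integral ?F < \<infinity>"
  proof (rule ccontr)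
    assume "\<not> ?p < Q"
    then have p: "Q \<le> ?p" by simp
    obtain r where r: "0 < r" "\<And>s t. s \<in> unit_cube \<Longrightarrow> t \<in> unit_cube \<Longrightarrow> (\<And>j. 1 / 2 \<le> s $ j) \<Longrightarrow> (\<And>j. 1 / 2 \<le> t $ j) \<Longrightarrow>
     (\<And>j. \<bar>s $ j - t $ j\<bar> \<le> r) \<Longrightarrow> D s t \<le> (R s t)\<^sup>2 \<and> (c\<^sub>2 / 8)\<^sup>2 \<le> (R s t)\<^sup>2"
      using near_diagonal by blast
    define L where "L = (2 * pi) ^ DIM('a) * (1 - 2 powr (- real DIM('a) / 2))"
    have "2 powr (- real DIM('a) / 2) < 1" by (simp add: powr_less_one)
    then have L: "0 < L" by (simp add: L_def)
    have "cube_integral ?F = \<infinity>"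
    proof (rule cube_integral_infinite[OF _ p _ r(1)])
      show "0 < k * (L * (c\<^sub>2 / 8)\<^sup>2)" using k L c by simp
      fix s t :: "real ^ 'n"
      assume st: "s \<in> unit_cube" "t \<in> unit_cube" "s \<noteq> 0" "t \<noteq> 0" "0 < D s t"
        and near: "\<And>j. 1 / 2 \<le> s $ j" "\<And>j. 1 / 2 \<le> t $ j" "\<And>j. \<bar>s $ j - t $ j\<bar> \<le> r"
      have n: "D s t \<le> (R s t)\<^sup>2" "(c\<^sub>2 / 8)\<^sup>2 \<le> (R s t)\<^sup>2" using r(2)[OF st(1,2) near] by auto
      have "ennreal (L * (R s t)\<^sup>2 * D s t powr (- ?p / 2)) \<le> pair_sinh TYPE('a) (R s s) (R t t) (R s t)"
        unfolding L_def D_def using st variance_pos n by (intro pair_sinh_lower) (auto simp: D_def)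
      from mult_left_mono[OF this, of "ennreal k"]
      have "ennreal (k * (L * (R s t)\<^sup>2 * D s t powr (- ?p / 2))) \<le> ?F s t"
        using k by (simp add: ennreal_mult')
      moreover have "k * (L * (c\<^sub>2 / 8)\<^sup>2) * D s t powr (- ?p / 2) \<le> k * (L * (R s t)\<^sup>2 * D s t powr (- ?p / 2))"
        unfolding mult.assoc using n(2) k L by (intro mult_left_mono mult_right_mono) auto
      ultimately show "ennreal (k * (L * (c\<^sub>2 / 8)\<^sup>2) * D s t powr (- ?p / 2)) \<le> ?F s t"
        by (meson ennreal_leI order_trans)
    qed simp
    with fin show False by simp
  qed
qed

end

section \<open>The difference of two independent fields\<close>

text \<open>
  Rounding down to multiples of \<open>1 / Suc k\<close>. Numbers of large modulus are sent to \<open>0\<close>, so that only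
  finitely many values occur. The unit interval is mapped into itself.
\<close>

definition grid :: "nat \<Rightarrow> real \<Rightarrow> real" where
  "grid k x = (if \<bar>x\<bar> \<le> real (Suc k) then of_int \<lfloor>real (Suc k) * x\<rfloor> / real (Suc k) else 0)"

lemma grid_meas [measurable]: "grid k \<in> borel_measurable borel"
  unfolding grid_def by measurable

lemma grid_close: "\<bar>x\<bar> \<le> real (Suc k) \<Longrightarrow> \<bar>grid k x - x\<bar> \<le> inverse (real (Suc k))"
proof -
  assume x: "\<bar>x\<bar> \<le> real (Suc k)"
  have "\<bar>of_int \<lfloor>real (Suc k) * x\<rfloor> - real (Suc k) * x\<bar> \<le> 1" by linarith
  then have "\<bar>of_int \<lfloor>real (Suc k) * x\<rfloor> - real (Suc k) * x\<bar> / real (Suc k) \<le> 1 / real (Suc k)"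
    by (intro divide_right_mono) auto
  moreover have "grid k x - x = (of_int \<lfloor>real (Suc k) * x\<rfloor> - real (Suc k) * x) / real (Suc k)"
    using x by (simp add: grid_def diff_divide_distrib del: of_nat_Suc)
  then have "\<bar>of_int \<lfloor>real (Suc k) * x\<rfloor> - real (Suc k) * x\<bar> / real (Suc k) = \<bar>grid k x - x\<bar>"
    by (simp only: abs_divide abs_of_nat)
  ultimately show ?thesis by (simp add: inverse_eq_divide)
qed

lemma grid_tendsto: "(\<lambda>k. grid k x) \<longlonglongrightarrow> x"
proof -
  have "(\<lambda>k. grid k x - x) \<longlonglongrightarrow> 0"
  proof (rule Lim_null_comparison[OF _ LIMSEQ_inverse_real_of_nat])
    show "\<forall>\<^sub>F k in sequentially. norm (grid k x - x) \<le> inverse (real (Suc k))"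
      using eventually_ge_at_top[of "nat \<lceil>\<bar>x\<bar>\<rceil>"]
    proof eventually_elim
      case (elim k)
      then have "\<bar>x\<bar> \<le> real (Suc k)" by linarith
      then show ?case using grid_close by simp
    qed
  qed
  then show ?thesis by (simp add: LIM_zero_iff)
qed

lemma grid_unit: "0 \<le> x \<Longrightarrow> x \<le> 1 \<Longrightarrow> 0 \<le> grid k x \<and> grid k x \<le> 1"
proof -
  assume x: "0 \<le> x" "x \<le> 1"
  have "of_int \<lfloor>real (Suc k) * x\<rfloor> \<le> real (Suc k) * x" by linarith
  also have "\<dots> \<le> real (Suc k)" using x by (intro mult_left_le) auto
  finally have "of_int \<lfloor>real (Suc k) * x\<rfloor> \<le> real (Suc k)" .
  moreover have "0 \<le> \<lfloor>real (Suc k) * x\<rfloor>" using x by (simp del: of_nat_Suc)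
  ultimately show ?thesis by (simp add: grid_def del: of_nat_Suc)
qed

lemma finite_range_grid: "finite (range (grid k))"
proof -
  have "grid k x \<in> insert 0 ((\<lambda>m. of_int m / real (Suc k)) ` {- int (Suc k * Suc k)..int (Suc k * Suc k)})" for x
  proof (cases "\<bar>x\<bar> \<le> real (Suc k)")
    case True
    have "\<bar>real (Suc k) * x\<bar> \<le> real (Suc k) * real (Suc k)"
      unfolding abs_mult using True by (intro mult_mono) auto
    then have "real (Suc k) * x \<le> of_int (int (Suc k * Suc k)) \<and> of_int (- int (Suc k * Suc k)) \<le> real (Suc k) * x"
      unfolding of_int_minus of_nat_mult of_int_mult of_int_of_nat_eq by linarith
    then have "\<lfloor>real (Suc k) * x\<rfloor> \<in> {- int (Suc k * Suc k)..int (Suc k * Suc k)}"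
      unfolding atLeastAtMost_iff le_floor_iff floor_le_iff by linarith
    then show ?thesis using True by (simp add: grid_def del: of_nat_Suc)
  qed (simp add: grid_def)
  then show ?thesis
    by (intro finite_subset[of "range (grid k)" "insert 0 ((\<lambda>m. of_int m / real (Suc k)) ` {- int (Suc k * Suc k)..int (Suc k * Suc k)})"]) auto
qed

definition vec_grid :: "nat \<Rightarrow> real ^ 'k::finite \<Rightarrow> real ^ 'k" where
  "vec_grid k x = (\<chi> j. grid k (x $ j))"

lemma vec_grid_meas [measurable]: "(vec_grid k :: real ^ 'k::finite \<Rightarrow> real ^ 'k) \<in> borel_measurable borel"
proof -
  have "(\<lambda>x. vec_grid k x \<bullet> b) \<in> borel_measurable borel" if b: "b \<in> Basis" for b :: "real ^ 'k"
  proof -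
    obtain j where "b = axis j 1" using b by (auto simp: Basis_vec_def)
    then show ?thesis by (simp add: vec_grid_def inner_axis)
  qed
  then show ?thesis by (subst borel_measurable_euclidean_space) auto
qed

lemma vec_grid_tendsto: "(\<lambda>k. vec_grid k x) \<longlonglongrightarrow> x"
  by (rule vec_tendstoI) (simp add: vec_grid_def grid_tendsto)

lemma vec_grid_cube: "x \<in> unit_cube \<Longrightarrow> vec_grid k x \<in> unit_cube"
  by (simp add: mem_box_cart vec_grid_def grid_unit)

lemma finite_range_vec_grid: "finite (range (vec_grid k :: real ^ 'k::finite \<Rightarrow> real ^ 'k))"
proof (rule finite_subset)
  show "range (vec_grid k) \<subseteq> (\<lambda>f. \<chi> j. f j) ` (PiE (UNIV :: 'k set) (\<lambda>_. range (grid k)))"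
    by (auto simp: vec_grid_def intro!: image_eqI[where f = "\<lambda>f. \<chi> j. f j"])
  show "finite ((\<lambda>f. \<chi> j. f j) ` (PiE (UNIV :: 'k set) (\<lambda>_. range (grid k))))"
    by (rule finite_imageI, rule finite_PiE) (auto simp: finite_range_grid)
qed

lemma heat_kernel_fourier:
  fixes z :: "real ^ 'd"
  assumes "0 < \<epsilon>"
  shows "heat_kernel \<epsilon> z = (\<integral>\<xi>. 1 / (2 * pi) ^ CARD('d) * exp (- (\<epsilon> * (norm \<xi>)\<^sup>2) / 2) * cos (\<xi> \<bullet> z) \<partial>lborel)"
proof -
  have "(\<integral>\<xi>. 1 / (2 * pi) ^ CARD('d) * exp (- (\<epsilon> * (norm \<xi>)\<^sup>2) / 2) * cos (\<xi> \<bullet> z) \<partial>lborel) =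
      1 / (2 * pi) ^ CARD('d) * (\<integral>\<xi>. exp (- (\<epsilon> * (norm \<xi>)\<^sup>2) / 2) * cos (\<xi> \<bullet> z) \<partial>lborel)"
    by (simp add: mult.assoc)
  also have "\<dots> = 1 / (2 * pi) ^ CARD('d) * (sqrt (2 * pi / \<epsilon>) ^ CARD('d) * exp (- (norm z)\<^sup>2 / (2 * \<epsilon>)))"
    using gaussian_fourier[OF assms, of z] by simp
  also have "1 / (2 * pi) ^ CARD('d) * (sqrt (2 * pi / \<epsilon>) ^ CARD('d) * exp (- (norm z)\<^sup>2 / (2 * \<epsilon>))) = heat_kernel \<epsilon> z"
  proof -
    have "1 / (2 * pi) * sqrt (2 * pi / \<epsilon>) = (2 * pi * \<epsilon>) powr (- 1 / 2)"
    proof -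
      have "sqrt (2 * pi) * sqrt (2 * pi) = 2 * pi" by simp
      then have "1 / (2 * pi) * sqrt (2 * pi / \<epsilon>) = 1 / (sqrt (2 * pi) * sqrt \<epsilon>)"
        using assms by (simp add: real_sqrt_divide real_sqrt_mult field_simps)
      also have "\<dots> = (2 * pi * \<epsilon>) powr (- 1 / 2)"
        using assms by (simp add: powr_minus powr_half_sqrt real_sqrt_mult inverse_eq_divide)
      finally show ?thesis .
    qed
    then have "(1 / (2 * pi) * sqrt (2 * pi / \<epsilon>)) ^ CARD('d) = ((2 * pi * \<epsilon>) powr (- 1 / 2)) ^ CARD('d)" by simp
    also have "\<dots> = (2 * pi * \<epsilon>) powr (- real CARD('d) / 2)"
      using assms by (subst powr_realpow[symmetric]) (auto simp: powr_powr)
    finally have "1 / (2 * pi) ^ CARD('d) * sqrt (2 * pi / \<epsilon>) ^ CARD('d) = (2 * pi * \<epsilon>) powr (- real CARD('d) / 2)"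
      by (simp only: power_mult_distrib power_one_over)
    then show ?thesis by (simp add: heat_kernel_def mult.assoc[symmetric])
  qed
  finally show ?thesis by simp
qed

locale independent_gaussian_fields =
  A: gaussian_vector_field M X X0 + B: gaussian_vector_field M Y Y0
  for M :: "'w measure" and X :: "real ^ 'n \<Rightarrow> 'w \<Rightarrow> real ^ 'd" and X0 and Y :: "real ^ 'n \<Rightarrow> 'w \<Rightarrow> real ^ 'd" and Y0 +
  assumes indep: "independent_fields M X Y"
begin

definition R :: "real ^ 'n \<Rightarrow> real ^ 'n \<Rightarrow> real" where "R s t = A.R s t + B.R s t"

definition Z :: "real ^ 'n \<Rightarrow> 'w \<Rightarrow> real ^ 'd" where "Z s \<omega> = X s \<omega> - Y s \<omega>"

definition comb :: "('d \<Rightarrow> real ^ 'n \<Rightarrow> real) \<Rightarrow> (real ^ 'n) set \<Rightarrow> 'w \<Rightarrow> real" where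
  "comb b T \<omega> = (\<Sum>i\<in>UNIV. \<Sum>t\<in>T. b i t * Z t \<omega> $ i)"

text \<open>
  The linear span of the coordinates of the values of \<open>Z\<close>.
\<close>

definition S :: "('w \<Rightarrow> real) set" where "S = {comb b T | b T. finite T}"

lemma comb_eq: "comb b T \<omega> = A.combination b T \<omega> - B.combination b T \<omega>"
  by (simp add: comb_def Z_def A.combination_def B.combination_def A.component_def B.component_def right_diff_distrib sum_subtractf)

lemma fields_indep:
  assumes "f \<in> borel_measurable (Pi\<^sub>M UNIV (\<lambda>_. borel))" "g \<in> borel_measurable (Pi\<^sub>M UNIV (\<lambda>_. borel))"
  shows "A.indep_var borel (\<lambda>\<omega>. f (\<lambda>t. X t \<omega>)) borel (\<lambda>\<omega>. g (\<lambda>t. Y t \<omega>))"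
  using A.indep_var_compose[OF indep[unfolded independent_fields_def] assms] by (simp add: comp_def)

lemma combination_functional_meas [measurable]:
  fixes b :: "'d \<Rightarrow> real ^ 'n \<Rightarrow> real"
  shows "(\<lambda>p. \<Sum>i\<in>UNIV. \<Sum>t\<in>T. b i t * p t $ i) \<in> borel_measurable (Pi\<^sub>M UNIV (\<lambda>_. borel :: (real ^ 'd) measure))"
proof -
  have "(\<lambda>p. p t $ i) \<in> borel_measurable (Pi\<^sub>M UNIV (\<lambda>_. borel :: (real ^ 'd) measure))" for t :: "real ^ 'n" and i
    by (rule measurable_compose[OF measurable_component_singleton]) auto
  then show ?thesis by (intro borel_measurable_sum borel_measurable_times borel_measurable_const)
qed

lemma combinations_uncorrelated:
  assumes "finite T" "finite T'"
  shows "(\<integral>\<omega>. A.combination b T \<omega> * B.combination b' T' \<omega> \<partial>M) = 0"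
proof -
  have "A.indep_var borel (A.combination b T) borel (B.combination b' T')"
    using fields_indep[OF combination_functional_meas[of b T] combination_functional_meas[of b' T']]
    by (simp add: A.combination_def[abs_def] B.combination_def[abs_def] A.component_def B.component_def)
  then have "(\<integral>\<omega>. A.combination b T \<omega> * B.combination b' T' \<omega> \<partial>M) = (\<integral>\<omega>. A.combination b T \<omega> \<partial>M) * (\<integral>\<omega>. B.combination b' T' \<omega> \<partial>M)"
    using assms by (intro A.indep_var_lebesgue_integral A.L2_integrable A.combination_L2 B.combination_L2)
  then show ?thesis using A.combination_mean[OF assms(1)] by simp
qed

lemma comb_cf:
  assumes T: "finite T"
  shows "(\<integral>\<omega>. iexp (comb b T \<omega>) \<partial>M) = of_real (exp (- (\<integral>\<omega>. (comb b T \<omega>)\<^sup>2 \<partial>M) / 2))"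
proof -
  let ?F = "A.combination b T" and ?G = "B.combination b T"
  have var: "(\<integral>\<omega>. (comb b T \<omega>)\<^sup>2 \<partial>M) = (\<integral>\<omega>. (?F \<omega>)\<^sup>2 \<partial>M) + (\<integral>\<omega>. (?G \<omega>)\<^sup>2 \<partial>M)"
    unfolding comb_eq A.integral_diff_square[OF A.combination_L2[OF T] B.combination_L2[OF T]]
    using combinations_uncorrelated[OF T T] by simp
  have neg: "- B.combination b T \<omega> = B.combination (\<lambda>i t. - b i t) T \<omega>" for \<omega>
    by (simp add: B.combination_def B.component_def sum_negf)
  have "A.indep_var borel (\<lambda>\<omega>. iexp (?F \<omega>)) borel (\<lambda>\<omega>. iexp (- ?G \<omega>))"
  proof -
    have f: "(\<lambda>p. iexp (\<Sum>i\<in>UNIV. \<Sum>t\<in>T. b i t * p t $ i)) \<in> borel_measurable (Pi\<^sub>M UNIV (\<lambda>_. borel :: (real ^ 'd) measure))"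
      by measurable
    have g: "(\<lambda>p. iexp (- (\<Sum>i\<in>UNIV. \<Sum>t\<in>T. b i t * p t $ i))) \<in> borel_measurable (Pi\<^sub>M UNIV (\<lambda>_. borel :: (real ^ 'd) measure))"
      by measurable
    show ?thesis
      using A.indep_var_compose[OF indep[unfolded independent_fields_def] f g]
      by (simp add: comp_def A.combination_def B.combination_def A.component_def B.component_def)
  qed
  then have "(\<integral>\<omega>. iexp (?F \<omega>) * iexp (- ?G \<omega>) \<partial>M) = (\<integral>\<omega>. iexp (?F \<omega>) \<partial>M) * (\<integral>\<omega>. iexp (- ?G \<omega>) \<partial>M)"
    by (rule A.indep_var_lebesgue_integral) (auto intro!: A.integrable_const_bound[where B = 1])
  moreover have "(\<integral>\<omega>. iexp (?F \<omega>) * iexp (- ?G \<omega>) \<partial>M) = (\<integral>\<omega>. iexp (comb b T \<omega>) \<partial>M)"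
    by (simp add: comb_eq mult_exp_exp right_diff_distrib)
  moreover have "(\<integral>\<omega>. iexp (- ?G \<omega>) \<partial>M) = of_real (exp (- (\<integral>\<omega>. (?G \<omega>)\<^sup>2 \<partial>M) / 2))"
    using B.combination_cf[OF T, of "\<lambda>i t. - b i t"] by (simp flip: neg)
  ultimately have "(\<integral>\<omega>. iexp (comb b T \<omega>) \<partial>M) =
      of_real (exp (- (\<integral>\<omega>. (?F \<omega>)\<^sup>2 \<partial>M) / 2)) * of_real (exp (- (\<integral>\<omega>. (?G \<omega>)\<^sup>2 \<partial>M) / 2))"
    using A.combination_cf[OF T, of b] by simp
  then show ?thesis
    unfolding var of_real_mult[symmetric] mult_exp_exp by (simp add: add_divide_distrib)
qed

lemma comb_meas [measurable]: "comb b T \<in> borel_measurable M"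
  unfolding comb_eq[abs_def] by measurable

lemma comb_exp:
  assumes T: "finite T"
  shows "integrable M (\<lambda>\<omega>. exp \<bar>comb b T \<omega>\<bar>)"
proof -
  have "integrable M (\<lambda>\<omega>. exp \<bar>A.combination b T \<omega> + (- 1) * B.combination b T \<omega>\<bar>)"
    using A.combination_exp[OF T, of 2 b] B.combination_exp[OF T, of "- 2" b]
    by (intro A.exp_abs_add_integrable) auto
  then show ?thesis by (simp add: comb_eq)
qed

sublocale gaussian_space M S
proof
  fix U W assume "U \<in> S" "W \<in> S"
  then obtain b T b' T' where U: "U = comb b T" "finite T" and W: "W = comb b' T'" "finite T'"
    by (auto simp: S_def)
  have ext: "comb b T \<omega> = comb (\<lambda>i t. if t \<in> T then b i t else 0) (T \<union> T') \<omega>"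
    if "finite T" "finite T'" for b T T' \<omega>
    unfolding comb_def using that by (intro sum.cong refl sum.mono_neutral_cong_left) auto
  have "U \<omega> + W \<omega> = comb (\<lambda>i t. (if t \<in> T then b i t else 0) + (if t \<in> T' then b' i t else 0)) (T \<union> T') \<omega>" for \<omega>
    unfolding U W ext[OF U(2) W(2)] ext[OF W(2) U(2)] Un_commute[of T' T]
    by (simp add: comb_def distrib_right sum.distrib)
  then show "(\<lambda>\<omega>. U \<omega> + W \<omega>) \<in> S" using U(2) W(2) by (auto simp: S_def fun_eq_iff intro!: exI[of _ "T \<union> T'"])
next
  fix W a assume "W \<in> S"
  then obtain b T where W: "W = comb b T" "finite T" by (auto simp: S_def)
  have "a * W \<omega> = comb (\<lambda>i t. a * b i t) T \<omega>" for \<omega>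
    by (simp add: W comb_def sum_distrib_left mult.assoc)
  then show "(\<lambda>\<omega>. a * W \<omega>) \<in> S" using W(2) by (auto simp: S_def fun_eq_iff)
qed (auto simp: S_def comb_cf comb_exp)

lemma XY_uncorrelated: "(\<integral>\<omega>. X s \<omega> $ i * Y t \<omega> $ j \<partial>M) = 0"
  using combinations_uncorrelated[of "{s}" "{t}" "\<lambda>k _. if k = i then 1 else 0" "\<lambda>k _. if k = j then 1 else 0"]
  by (simp add: A.combination_def B.combination_def A.component_def B.component_def if_distrib[where f = "\<lambda>x. x * _"] cong: if_cong)

lemma Z_cov: "(\<integral>\<omega>. Z s \<omega> $ i * Z t \<omega> $ j \<partial>M) = (if i = j then R s t else 0)"
proof -
  note i = A.L2_mult_integrable[OF A.X_L2 A.X_L2] A.L2_mult_integrable[OF A.X_L2 B.X_L2]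
    A.L2_mult_integrable[OF B.X_L2 A.X_L2] A.L2_mult_integrable[OF B.X_L2 B.X_L2]
  have "(\<integral>\<omega>. Z s \<omega> $ i * Z t \<omega> $ j \<partial>M) =
      (\<integral>\<omega>. X s \<omega> $ i * X t \<omega> $ j - X s \<omega> $ i * Y t \<omega> $ j - Y s \<omega> $ i * X t \<omega> $ j + Y s \<omega> $ i * Y t \<omega> $ j \<partial>M)"
    by (intro Bochner_Integration.integral_cong refl) (simp add: Z_def algebra_simps)
  also have "\<dots> = (\<integral>\<omega>. X s \<omega> $ i * X t \<omega> $ j \<partial>M) - (\<integral>\<omega>. X s \<omega> $ i * Y t \<omega> $ j \<partial>M)
     - (\<integral>\<omega>. Y s \<omega> $ i * X t \<omega> $ j \<partial>M) + (\<integral>\<omega>. Y s \<omega> $ i * Y t \<omega> $ j \<partial>M)"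
    using i by simp
  also have "\<dots> = (if i = j then R s t else 0)"
    using XY_uncorrelated[of s i t j] XY_uncorrelated[of t j s i]
    by (simp add: A.X_cov B.X_cov R_def mult.commute)
  finally show ?thesis .
qed

lemma Z_L2: "(\<lambda>\<omega>. Z s \<omega> $ i) \<in> L2 M"
  using A.L2_diff[OF A.X_L2 B.X_L2, of s i s i] by (simp add: Z_def)

lemma Z_meas [measurable]: "(\<lambda>\<omega>. Z s \<omega> $ i) \<in> borel_measurable M"
  by (rule A.L2_meas[OF Z_L2])

lemma Z_continuous: "\<omega> \<in> space M \<Longrightarrow> continuous_on unit_cube (\<lambda>s. Z s \<omega>)"
  using A.field B.field unfolding Z_def gaussian_random_field_def by (auto intro!: continuous_intros)

lemma R_continuous: "continuous_on UNIV (\<lambda>(s, t). R s t)"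
  using continuous_on_add[OF A.R_continuous B.R_continuous] by (simp add: R_def case_prod_beta')

text \<open>
  Outside of the cube the variable is set to \<open>0\<close>, since \<open>difference_variables\<close> contains only values of \<open>Z\<close>
  on the cube; the weight \<open>w\<close> vanishes there.
\<close>

definition U :: "(real ^ 'n) \<times> (real ^ 'd) \<Rightarrow> 'w \<Rightarrow> real" where
  "U \<theta> \<omega> = (if fst \<theta> \<in> unit_cube then snd \<theta> \<bullet> Z (fst \<theta>) \<omega> else 0)"

definition w :: "real \<Rightarrow> (real ^ 'n) \<times> (real ^ 'd) \<Rightarrow> real" where
  "w \<epsilon> \<theta> = indicator unit_cube (fst \<theta>) * (1 / (2 * pi) ^ CARD('d) * exp (- (\<epsilon> * (norm (snd \<theta>))\<^sup>2) / 2))"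

definition approx :: "nat \<Rightarrow> (real ^ 'n) \<times> (real ^ 'd) \<Rightarrow> (real ^ 'n) \<times> (real ^ 'd)" where
  "approx k \<theta> = (vec_grid k (fst \<theta>), vec_grid k (snd \<theta>))"

lemma inner_Z: "\<xi> \<bullet> Z s \<omega> = (\<Sum>i\<in>UNIV. \<xi> $ i * Z s \<omega> $ i)"
  by (simp add: inner_vec_def)

lemma U_in_S: "U \<theta> \<in> S"
proof (cases "fst \<theta> \<in> unit_cube")
  case True
  then have "U \<theta> = comb (\<lambda>i _. snd \<theta> $ i) {fst \<theta>}" by (simp add: U_def comb_def inner_Z fun_eq_iff)
  then show ?thesis by (auto simp: S_def)
next
  case False
  then have "U \<theta> = comb (\<lambda>_ _. 0) {}" by (simp add: U_def comb_def fun_eq_iff)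
  then show ?thesis by (auto simp: S_def)
qed

lemma cov_U:
  assumes "fst \<theta> \<in> unit_cube" "fst \<eta> \<in> unit_cube"
  shows "cov (U \<theta>) (U \<eta>) = R (fst \<theta>) (fst \<eta>) * (snd \<theta> \<bullet> snd \<eta>)"
proof -
  have "cov (U \<theta>) (U \<eta>) = (\<integral>\<omega>. (\<Sum>i\<in>UNIV. \<Sum>j\<in>UNIV. (snd \<theta> $ i * snd \<eta> $ j) * (Z (fst \<theta>) \<omega> $ i * Z (fst \<eta>) \<omega> $ j)) \<partial>M)"
    unfolding U_def inner_Z if_P[OF assms(1)] if_P[OF assms(2)] sum_product
    by (intro Bochner_Integration.integral_cong sum.cong refl) (simp add: mult_ac)
  also have "\<dots> = (\<Sum>i\<in>UNIV. \<Sum>j\<in>UNIV. (snd \<theta> $ i * snd \<eta> $ j) * (\<integral>\<omega>. Z (fst \<theta>) \<omega> $ i * Z (fst \<eta>) \<omega> $ j \<partial>M))"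
    using A.L2_mult_integrable[OF Z_L2 Z_L2] by simp
  also have "\<dots> = (\<Sum>i\<in>UNIV. \<Sum>j\<in>UNIV. if i = j then snd \<theta> $ i * snd \<eta> $ i * R (fst \<theta>) (fst \<eta>) else 0)"
    by (intro sum.cong refl) (simp add: Z_cov)
  also have "\<dots> = R (fst \<theta>) (fst \<eta>) * (snd \<theta> \<bullet> snd \<eta>)"
    by (simp add: inner_vec_def sum_distrib_left mult_ac)
  finally show ?thesis .
qed

lemma V_in_S: "difference_variables X Y \<subseteq> S"
proof
  fix v assume "v \<in> difference_variables X Y"
  then obtain s i where v: "v = (\<lambda>\<omega>. (X s \<omega> - Y s \<omega>) $ i)" by (auto simp: difference_variables_def)
  have "v = comb (\<lambda>k _. if k = i then 1 else 0) {s}"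
    by (simp add: v comb_def Z_def fun_eq_iff if_distrib[where f = "\<lambda>x. x * _"] cong: if_cong)
  then show "v \<in> S" by (auto simp: S_def)
qed

lemma U_polynomial: "U \<theta> \<in> polynomials_upto (difference_variables X Y) 1"
proof (cases "fst \<theta> \<in> unit_cube")
  case True
  have "(\<lambda>\<omega>. \<Sum>i\<in>UNIV. snd \<theta> $ i * (\<Prod>v\<leftarrow>[\<lambda>\<omega>. (X (fst \<theta>) \<omega> - Y (fst \<theta>) \<omega>) $ i]. v \<omega>)) \<in> polynomials_upto (difference_variables X Y) 1"
    using True by (intro polynomials_upto_sum polynomials_upto_monomial) (auto simp: difference_variables_def)
  then show ?thesis using True by (simp add: U_def[abs_def] inner_vec_def Z_def)
next
  case False
  then show ?thesis using polynomials_upto_zero by (simp add: U_def[abs_def])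
qed

lemma fst_snd_meas [measurable]:
  "fst \<in> borel_measurable (borel :: ((real ^ 'n) \<times> (real ^ 'd)) measure)"
  "snd \<in> borel_measurable (borel :: ((real ^ 'n) \<times> (real ^ 'd)) measure)"
  by (intro borel_measurable_continuous_onI continuous_intros)+

text \<open>
  Paths are continuous, hence \<open>U\<close> is the limit of functions that depend on finitely many values of
  the path.
\<close>

lemma U_joint_meas: "(\<lambda>x. U (fst x) (snd x)) \<in> borel_measurable (lborel \<Otimes>\<^sub>M M)"
proof -
  have m[measurable]: "(\<lambda>x. fst (fst x)) \<in> borel_measurable ((lborel :: ((real ^ 'n) \<times> (real ^ 'd)) measure) \<Otimes>\<^sub>M M)"
    "(\<lambda>x. snd (fst x)) \<in> borel_measurable ((lborel :: ((real ^ 'n) \<times> (real ^ 'd)) measure) \<Otimes>\<^sub>M M)"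
    by (rule measurable_compose[OF measurable_fst]; simp)+
  have m1: "(\<lambda>x. snd (fst x) $ i) \<in> borel_measurable ((lborel :: ((real ^ 'n) \<times> (real ^ 'd)) measure) \<Otimes>\<^sub>M M)" for i
    by (rule measurable_compose[OF m(2)]) simp
  have m2: "{x \<in> space ((lborel :: ((real ^ 'n) \<times> (real ^ 'd)) measure) \<Otimes>\<^sub>M M). fst (fst x) \<in> unit_cube} \<in> sets (lborel \<Otimes>\<^sub>M M)"
    using measurable_sets[OF m(1), of unit_cube] by (simp add: vimage_def Int_def conj_commute)
  define g where "g k x = (if fst (fst x) \<in> unit_cube then \<Sum>i\<in>UNIV. snd (fst x) $ i * Z (vec_grid k (fst (fst x))) (snd x) $ i else 0)"
    for k and x :: "((real ^ 'n) \<times> (real ^ 'd)) \<times> 'w"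
  have g_meas: "g k \<in> borel_measurable (lborel \<Otimes>\<^sub>M M)" for k
  proof -
    have "Z (vec_grid k s) \<omega> $ i = (\<Sum>p\<in>range (vec_grid k). indicator {p} (vec_grid k s) * Z p \<omega> $ i)" for s \<omega> i
    proof -
      have "(\<Sum>p\<in>range (vec_grid k). indicator {p} (vec_grid k s) * Z p \<omega> $ i) = (\<Sum>p\<in>{vec_grid k s}. indicator {p} (vec_grid k s) * Z p \<omega> $ i)"
        by (intro sum.mono_neutral_right finite_range_vec_grid) auto
      then show ?thesis by simp
    qed
    then have "(\<lambda>x. Z (vec_grid k (fst (fst x))) (snd x) $ i) \<in> borel_measurable ((lborel :: ((real ^ 'n) \<times> (real ^ 'd)) measure) \<Otimes>\<^sub>M M)" for i
      by (simp only:) measurable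
    then show ?thesis
      unfolding g_def[abs_def]
      by (intro measurable_If borel_measurable_sum borel_measurable_times m1 m2 borel_measurable_const)
  qed
  show ?thesis
  proof (rule borel_measurable_LIMSEQ_real[OF _ g_meas])
    fix x :: "((real ^ 'n) \<times> (real ^ 'd)) \<times> 'w"
    assume "x \<in> space (lborel \<Otimes>\<^sub>M M)"
    then have \<omega>: "snd x \<in> space M" by (auto simp: space_pair_measure)
    show "(\<lambda>k. g k x) \<longlonglongrightarrow> U (fst x) (snd x)"
    proof (cases "fst (fst x) \<in> unit_cube")
      case True
      have "(\<lambda>k. Z (vec_grid k (fst (fst x))) (snd x)) \<longlonglongrightarrow> Z (fst (fst x)) (snd x)"
        by (rule continuous_on_tendsto_compose[OF Z_continuous[OF \<omega>] vec_grid_tendsto True])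
           (simp add: vec_grid_cube True)
      then have "(\<lambda>k. \<Sum>i\<in>UNIV. snd (fst x) $ i * Z (vec_grid k (fst (fst x))) (snd x) $ i) \<longlonglongrightarrow> (\<Sum>i\<in>UNIV. snd (fst x) $ i * Z (fst (fst x)) (snd x) $ i)"
        by (intro tendsto_intros)
      then show ?thesis using True by (simp add: g_def U_def inner_Z)
    qed (simp add: g_def U_def)
  qed
qed

lemma w_integrable: "0 < \<epsilon> \<Longrightarrow> integrable lborel (w \<epsilon>)"
proof -
  assume \<epsilon>: "0 < \<epsilon>"
  have "integrable (lborel \<Otimes>\<^sub>M lborel) (\<lambda>(s, \<xi>). w \<epsilon> (s, \<xi>))"
  proof (rule lborel_pair.Fubini_integrable)
    note gi = gaussian_integrable[OF \<epsilon>, where 'a = "real ^ 'd"]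
    show "(\<lambda>(s, \<xi>). w \<epsilon> (s, \<xi>)) \<in> borel_measurable (lborel \<Otimes>\<^sub>M lborel)" unfolding w_def by measurable
    have "(\<integral>\<xi>. norm (case (s, \<xi>) of (s, \<xi>) \<Rightarrow> w \<epsilon> (s, \<xi>)) \<partial>lborel) =
       indicator unit_cube s * (\<integral>\<xi>. 1 / (2 * pi) ^ CARD('d) * exp (- (\<epsilon> * (norm (\<xi> :: real ^ 'd))\<^sup>2) / 2) \<partial>lborel)" for s
      by (simp add: w_def abs_mult)
    then show "integrable lborel (\<lambda>s. \<integral>\<xi>. norm (case (s, \<xi>) of (s, \<xi>) \<Rightarrow> w \<epsilon> (s, \<xi>)) \<partial>lborel)"
      by (simp only:) (intro integrable_mult_left integrable_real_indicator, auto simp: emeasure_lborel_cbox_finite[unfolded infinity_ennreal_def])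
    show "AE s in lborel. integrable lborel (\<lambda>\<xi>. case (s, \<xi>) of (s, \<xi>) \<Rightarrow> w \<epsilon> (s, \<xi>))"
      using gi by (intro AE_I2) (simp add: w_def)
  qed
  then show ?thesis by (simp add: lborel_prod)
qed

lemma approx_cov_tendsto:
  assumes "w 0 \<theta> \<noteq> 0"
  shows "(\<lambda>k. cov (U (approx k \<theta>)) (U (approx k \<theta>))) \<longlonglongrightarrow> cov (U \<theta>) (U \<theta>)"
    and "(\<lambda>k. cov (U (approx k \<theta>)) (U \<theta>)) \<longlonglongrightarrow> cov (U \<theta>) (U \<theta>)"
proof -
  have \<theta>: "fst \<theta> \<in> unit_cube" using assms by (auto simp: w_def split: split_indicator_asm)
  then have a: "fst (approx k \<theta>) \<in> unit_cube" for k by (simp add: approx_def vec_grid_cube)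
  have lim: "(\<lambda>k. fst (approx k \<theta>)) \<longlonglongrightarrow> fst \<theta>" "(\<lambda>k. snd (approx k \<theta>)) \<longlonglongrightarrow> snd \<theta>"
    by (simp_all add: approx_def vec_grid_tendsto)
  have Rlim: "(\<lambda>k. R (f k) (g k)) \<longlonglongrightarrow> R x y" if "f \<longlonglongrightarrow> x" "g \<longlonglongrightarrow> y" for f g x y
    using continuous_on_tendsto_compose[OF R_continuous, of "\<lambda>k. (f k, g k)" "(x, y)"] that
    by (simp add: tendsto_Pair)
  show "(\<lambda>k. cov (U (approx k \<theta>)) (U (approx k \<theta>))) \<longlonglongrightarrow> cov (U \<theta>) (U \<theta>)"
    unfolding cov_U[OF a a] cov_U[OF \<theta> \<theta>] by (intro tendsto_intros Rlim lim)
  show "(\<lambda>k. cov (U (approx k \<theta>)) (U \<theta>)) \<longlonglongrightarrow> cov (U \<theta>) (U \<theta>)"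
    unfolding cov_U[OF a \<theta>] cov_U[OF \<theta> \<theta>] by (intro tendsto_intros Rlim lim)
qed

sublocale G: gaussian_family M S lborel U w "difference_variables X Y" approx
proof unfold_locales
  show "(\<lambda>x. U (fst x) (snd x)) \<in> borel_measurable (lborel \<Otimes>\<^sub>M M)" by (rule U_joint_meas)
  show "w 0 \<in> borel_measurable lborel" unfolding w_def by measurable
  show ap: "approx k \<in> measurable lborel lborel" for k
  proof -
    have "approx k \<in> borel_measurable borel" unfolding approx_def[abs_def] by (intro borel_measurable_Pair) measurable
    then show ?thesis by simp
  qed
  show "approx k -` {p} \<inter> space lborel \<in> sets lborel" for k p
    using measurable_sets[OF ap, of "{p}" k] by simp
  show "finite (range (approx k))" for k
    by (rule finite_subset[of _ "range (vec_grid k) \<times> range (vec_grid k)"])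
       (auto simp: approx_def finite_range_vec_grid)
  show "w \<delta> \<theta> \<le> w \<epsilon> \<theta>" if "0 \<le> \<epsilon>" "\<epsilon> \<le> \<delta>" for \<epsilon> \<delta> \<theta>
    unfolding w_def using that by (intro mult_left_mono) (auto intro: mult_right_mono)
  show "(\<lambda>k. w (inverse (real (Suc k))) \<theta>) \<longlonglongrightarrow> w 0 \<theta>" for \<theta>
    unfolding w_def by (intro tendsto_intros LIMSEQ_inverse_real_of_nat) auto
qed (auto simp: U_in_S V_in_S U_polynomial[unfolded One_nat_def] w_integrable approx_cov_tendsto, auto simp: w_def)

text \<open>
  Fubini's theorem and Fourier inversion of the heat kernel.
\<close>

lemma local_time_eq:
  assumes \<epsilon>: "0 < \<epsilon>" and \<omega>: "\<omega> \<in> space M"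
  shows "G.local_time \<epsilon> \<omega> = approx_collision_local_time X Y \<epsilon> \<omega>"
proof -
  have [measurable]: "(\<lambda>\<theta>. U \<theta> \<omega>) \<in> borel_measurable lborel"
    using measurable_compose[OF measurable_Pair2'[OF \<omega>] U_joint_meas] by simp
  have [measurable]: "w \<epsilon> \<in> borel_measurable lborel" using w_integrable[OF \<epsilon>] by simp
  have "integrable lborel (\<lambda>\<theta>. w \<epsilon> \<theta> * cos (U \<theta> \<omega>))"
    by (rule Bochner_Integration.integrable_bound[OF w_integrable[OF \<epsilon>]])
       (auto simp: abs_mult intro!: mult_left_le)
  then have i: "integrable (lborel \<Otimes>\<^sub>M lborel) (\<lambda>\<theta>. w \<epsilon> \<theta> * cos (U \<theta> \<omega>))" by (simp add: lborel_prod)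
  have "G.local_time \<epsilon> \<omega> = (\<integral>\<theta>. w \<epsilon> \<theta> * cos (U \<theta> \<omega>) \<partial>(lborel \<Otimes>\<^sub>M lborel))"
    by (simp add: G.local_time_def lborel_prod)
  also have "\<dots> = (\<integral>s. (\<integral>\<xi>. w \<epsilon> (s, \<xi>) * cos (U (s, \<xi>) \<omega>) \<partial>lborel) \<partial>lborel)"
    by (rule lborel_pair.integral_fst'[OF i, symmetric])
  also have "\<dots> = (\<integral>s. indicator unit_cube s *\<^sub>R heat_kernel \<epsilon> (X s \<omega> - Y s \<omega>) \<partial>lborel)"
    by (intro Bochner_Integration.integral_cong refl)
       (auto simp: w_def U_def heat_kernel_fourier[OF \<epsilon>] Z_def indicator_def)
  finally show ?thesis by (simp add: approx_collision_local_time_def set_lebesgue_integral_def)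
qed

lemma tendsto_local_time_iff:
  "tendsto_L2 M G.local_time L (at_right 0) \<longleftrightarrow> is_collision_local_time M X Y L"
proof -
  have ev: "\<forall>\<^sub>F \<epsilon> in at_right (0::real). 0 < \<epsilon>" by (simp add: eventually_at_right_less)
  have L2: "G.local_time \<epsilon> \<in> L2 M \<longleftrightarrow> approx_collision_local_time X Y \<epsilon> \<in> L2 M" if "0 < \<epsilon>" for \<epsilon>
    unfolding L2_def using local_time_eq[OF that]
    by (simp cong: measurable_cong Bochner_Integration.integrable_cong)
  have int: "(\<integral>\<omega>. (G.local_time \<epsilon> \<omega> - L \<omega>)\<^sup>2 \<partial>M) = (\<integral>\<omega>. (approx_collision_local_time X Y \<epsilon> \<omega> - L \<omega>)\<^sup>2 \<partial>M)" if "0 < \<epsilon>" for \<epsilon>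
    using local_time_eq[OF that] by (intro Bochner_Integration.integral_cong) auto
  have "(\<forall>\<^sub>F \<epsilon> in at_right 0. G.local_time \<epsilon> \<in> L2 M) \<longleftrightarrow> (\<forall>\<^sub>F \<epsilon> in at_right 0. approx_collision_local_time X Y \<epsilon> \<in> L2 M)"
    by (rule eventually_cong[OF ev L2])
  moreover have "((\<lambda>\<epsilon>. \<integral>\<omega>. (G.local_time \<epsilon> \<omega> - L \<omega>)\<^sup>2 \<partial>M) \<longlongrightarrow> 0) (at_right 0) \<longleftrightarrow>
     ((\<lambda>\<epsilon>. \<integral>\<omega>. (approx_collision_local_time X Y \<epsilon> \<omega> - L \<omega>)\<^sup>2 \<partial>M) \<longlongrightarrow> 0) (at_right 0)"
    by (rule tendsto_cong) (use ev int in \<open>auto elim!: eventually_mono\<close>)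
  ultimately show ?thesis by (simp add: is_collision_local_time_def tendsto_L2_def)
qed

end

section \<open>The masses as integrals over the cube\<close>

lemma nn_integral_lborel_four:
  fixes F :: "('a::euclidean_space \<times> 'b::euclidean_space) \<times> ('a \<times> 'b) \<Rightarrow> ennreal"
  assumes F: "F \<in> borel_measurable (lborel \<Otimes>\<^sub>M lborel)"
  shows "(\<integral>\<^sup>+x. F x \<partial>(lborel \<Otimes>\<^sub>M lborel)) =
    (\<integral>\<^sup>+s. \<integral>\<^sup>+t. \<integral>\<^sup>+\<xi>. \<integral>\<^sup>+\<eta>. F ((s, \<xi>), (t, \<eta>)) \<partial>lborel \<partial>lborel \<partial>lborel \<partial>lborel)"
proof -
  have Fb: "F \<in> borel_measurable borel" using F by (simp add: lborel_prod)
  have split: "(\<integral>\<^sup>+\<theta>. f \<theta> \<partial>lborel) = (\<integral>\<^sup>+s. \<integral>\<^sup>+\<xi>. f (s, \<xi>) \<partial>lborel \<partial>lborel)"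
    if f: "f \<in> borel_measurable lborel" for f :: "'a \<times> 'b \<Rightarrow> ennreal"
  proof -
    have "f \<in> borel_measurable (lborel \<Otimes>\<^sub>M lborel)" using f by (simp add: lborel_prod)
    from lborel.nn_integral_fst[OF this] show ?thesis by (simp add: lborel_prod)
  qed
  have "(\<integral>\<^sup>+x. F x \<partial>(lborel \<Otimes>\<^sub>M lborel)) = (\<integral>\<^sup>+\<theta>. \<integral>\<^sup>+\<theta>'. F (\<theta>, \<theta>') \<partial>lborel \<partial>lborel)"
    by (rule lborel.nn_integral_fst[OF F, symmetric])
  also have "\<dots> = (\<integral>\<^sup>+s. \<integral>\<^sup>+\<xi>. \<integral>\<^sup>+\<theta>'. F ((s, \<xi>), \<theta>') \<partial>lborel \<partial>lborel \<partial>lborel)"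
    using lborel.borel_measurable_nn_integral_fst[OF F] by (rule split)
  also have "\<dots> = (\<integral>\<^sup>+s. \<integral>\<^sup>+\<xi>. \<integral>\<^sup>+t. \<integral>\<^sup>+\<eta>. F ((s, \<xi>), (t, \<eta>)) \<partial>lborel \<partial>lborel \<partial>lborel \<partial>lborel)"
  proof (intro nn_integral_cong)
    fix s :: 'a and \<xi> :: 'b
    show "(\<integral>\<^sup>+\<theta>'. F ((s, \<xi>), \<theta>') \<partial>lborel) = (\<integral>\<^sup>+t. \<integral>\<^sup>+\<eta>. F ((s, \<xi>), (t, \<eta>)) \<partial>lborel \<partial>lborel)"
      by (rule split) (rule measurable_compose[OF measurable_Pair1' F], simp)
  qed
  also have "\<dots> = (\<integral>\<^sup>+s. \<integral>\<^sup>+t. \<integral>\<^sup>+\<xi>. \<integral>\<^sup>+\<eta>. F ((s, \<xi>), (t, \<eta>)) \<partial>lborel \<partial>lborel \<partial>lborel \<partial>lborel)"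
  proof (rule nn_integral_cong)
    fix s :: 'a
    have "(\<lambda>y. ((s, fst (fst y)), (snd (fst y), snd y))) \<in> borel_measurable ((lborel \<Otimes>\<^sub>M lborel) \<Otimes>\<^sub>M lborel :: (('b \<times> 'a) \<times> 'b) measure)"
      by (intro borel_measurable_Pair) measurable
    from measurable_compose[OF this Fb]
    have m: "(\<lambda>y. F ((s, fst (fst y)), (snd (fst y), snd y))) \<in> borel_measurable ((lborel \<Otimes>\<^sub>M lborel) \<Otimes>\<^sub>M lborel)" .
    have "(\<lambda>(\<xi>, t). \<integral>\<^sup>+\<eta>. F ((s, \<xi>), (t, \<eta>)) \<partial>lborel) \<in> borel_measurable (lborel \<Otimes>\<^sub>M lborel)"
      using lborel.borel_measurable_nn_integral_fst[OF m] by (simp add: case_prod_beta')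
    from lborel_pair.Fubini'[OF this]
    show "(\<integral>\<^sup>+\<xi>. \<integral>\<^sup>+t. \<integral>\<^sup>+\<eta>. F ((s, \<xi>), (t, \<eta>)) \<partial>lborel \<partial>lborel \<partial>lborel) =
        (\<integral>\<^sup>+t. \<integral>\<^sup>+\<xi>. \<integral>\<^sup>+\<eta>. F ((s, \<xi>), (t, \<eta>)) \<partial>lborel \<partial>lborel \<partial>lborel)" by simp
  qed
  finally show ?thesis .
qed

context independent_gaussian_fields
begin

text \<open>
  The kernels depend on the points of the cube only through variances and covariance; integrating over
  the frequencies first leaves a function of these.
\<close>

lemma mass_eq:
  fixes k :: "((real ^ 'n) \<times> (real ^ 'd)) \<times> ((real ^ 'n) \<times> (real ^ 'd)) \<Rightarrow> real"
  assumes k: "k \<in> borel_measurable (lborel \<Otimes>\<^sub>M lborel)"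
    and eq: "\<And>s t \<xi> \<eta>. s \<in> unit_cube \<Longrightarrow> t \<in> unit_cube \<Longrightarrow> k ((s, \<xi>), (t, \<eta>)) = g (R s s) (R t t) (R s t) \<xi> \<eta>"
    and g: "\<And>a b r. (\<lambda>x. g a b r (fst x) (snd x)) \<in> borel_measurable (lborel \<Otimes>\<^sub>M lborel)"
  shows "G.mass k = (\<integral>\<^sup>+s. indicator unit_cube s * (\<integral>\<^sup>+t. indicator unit_cube t *
    (ennreal ((1 / (2 * pi) ^ CARD('d))\<^sup>2) * (\<integral>\<^sup>+\<xi>. \<integral>\<^sup>+\<eta>. ennreal (g (R s s) (R t t) (R s t) \<xi> \<eta>) \<partial>lborel \<partial>lborel)) \<partial>lborel) \<partial>lborel)"
proof -
  note [measurable] = k g G.w_meas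
  let ?c = "1 / (2 * pi) ^ CARD('d)"
  have "G.mass k = (\<integral>\<^sup>+s. \<integral>\<^sup>+t. \<integral>\<^sup>+\<xi>. \<integral>\<^sup>+\<eta>. ennreal (w 0 (s, \<xi>) * w 0 (t, \<eta>) * k ((s, \<xi>), (t, \<eta>))) \<partial>lborel \<partial>lborel \<partial>lborel \<partial>lborel)"
    unfolding G.mass_def by (subst nn_integral_lborel_four) auto
  also have "\<dots> = (\<integral>\<^sup>+s. indicator unit_cube s * (\<integral>\<^sup>+t. indicator unit_cube t *
    (ennreal (?c\<^sup>2) * (\<integral>\<^sup>+\<xi>. \<integral>\<^sup>+\<eta>. ennreal (g (R s s) (R t t) (R s t) \<xi> \<eta>) \<partial>lborel \<partial>lborel)) \<partial>lborel) \<partial>lborel)"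
  proof (intro nn_integral_cong)
    fix s :: "real ^ 'n"
    show "(\<integral>\<^sup>+t. \<integral>\<^sup>+\<xi>. \<integral>\<^sup>+\<eta>. ennreal (w 0 (s, \<xi>) * w 0 (t, \<eta>) * k ((s, \<xi>), (t, \<eta>))) \<partial>lborel \<partial>lborel \<partial>lborel) =
      indicator unit_cube s * (\<integral>\<^sup>+t. indicator unit_cube t *
    (ennreal (?c\<^sup>2) * (\<integral>\<^sup>+\<xi>. \<integral>\<^sup>+\<eta>. ennreal (g (R s s) (R t t) (R s t) \<xi> \<eta>) \<partial>lborel \<partial>lborel)) \<partial>lborel)"
    proof (cases "s \<in> unit_cube")
      case s: True
      have "(\<integral>\<^sup>+\<xi>. \<integral>\<^sup>+\<eta>. ennreal (w 0 (s, \<xi>) * w 0 (t, \<eta>) * k ((s, \<xi>), (t, \<eta>))) \<partial>lborel \<partial>lborel) =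
        indicator unit_cube t * (ennreal (?c\<^sup>2) * (\<integral>\<^sup>+\<xi>. \<integral>\<^sup>+\<eta>. ennreal (g (R s s) (R t t) (R s t) \<xi> \<eta>) \<partial>lborel \<partial>lborel))" for t
      proof (cases "t \<in> unit_cube")
        case t: True
        have [measurable]: "(\<lambda>\<eta>. g a b r \<xi> \<eta>) \<in> borel_measurable lborel" for a b r \<xi>
          using measurable_compose[OF measurable_Pair1' g[of a b r], of \<xi>] by simp
        have [measurable]: "(\<lambda>\<xi>. \<integral>\<^sup>+\<eta>. ennreal (g a b r \<xi> \<eta>) \<partial>lborel) \<in> borel_measurable lborel" for a b r
          using lborel.borel_measurable_nn_integral_fst[of "\<lambda>x. ennreal (g a b r (fst x) (snd x))" lborel] g[of a b r] by simp
        have "(\<integral>\<^sup>+\<xi>. \<integral>\<^sup>+\<eta>. ennreal (w 0 (s, \<xi>) * w 0 (t, \<eta>) * k ((s, \<xi>), (t, \<eta>))) \<partial>lborel \<partial>lborel) =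
          (\<integral>\<^sup>+\<xi>. \<integral>\<^sup>+\<eta>. ennreal (?c\<^sup>2) * ennreal (g (R s s) (R t t) (R s t) \<xi> \<eta>) \<partial>lborel \<partial>lborel)"
          using s t by (intro nn_integral_cong) (simp add: w_def eq power2_eq_square ennreal_mult'[symmetric])
        also have "\<dots> = ennreal (?c\<^sup>2) * (\<integral>\<^sup>+\<xi>. \<integral>\<^sup>+\<eta>. ennreal (g (R s s) (R t t) (R s t) \<xi> \<eta>) \<partial>lborel \<partial>lborel)"
          by (simp add: nn_integral_cmult)
        finally show ?thesis using t by simp
      qed (simp add: w_def)
      then show ?thesis using s by simp
    qed (simp add: w_def)
  qed
  finally show ?thesis .
qed

lemma G_simps:
  assumes "s \<in> unit_cube" "t \<in> unit_cube"
  shows "G.v (s, \<xi>) = R s s * (norm \<xi>)\<^sup>2" "G.C (s, \<xi>) (t, \<eta>) = R s t * (\<xi> \<bullet> \<eta>)"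
  using assms by (simp_all add: G.v_def G.C_def cov_U power2_norm_eq_inner)

lemma mass_cosh:
  "G.mass G.\<kappa> = (\<integral>\<^sup>+s. indicator unit_cube s * (\<integral>\<^sup>+t. indicator unit_cube t *
    (ennreal ((1 / (2 * pi) ^ CARD('d))\<^sup>2) * pair_cosh TYPE(real ^ 'd) (R s s) (R t t) (R s t)) \<partial>lborel) \<partial>lborel)"
  unfolding pair_cosh_def
proof (rule mass_eq[of G.\<kappa> "\<lambda>a b r \<xi> \<eta>. exp (- (a * (norm \<xi>)\<^sup>2 + b * (norm \<eta>)\<^sup>2) / 2) * cosh (r * (\<xi> \<bullet> \<eta>))"])
  show "G.\<kappa> ((s, \<xi>), (t, \<eta>)) = exp (- (R s s * (norm \<xi>)\<^sup>2 + R t t * (norm \<eta>)\<^sup>2) / 2) * cosh (R s t * (\<xi> \<bullet> \<eta>))"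
    if "s \<in> unit_cube" "t \<in> unit_cube" for s t \<xi> \<eta>
    using that by (simp add: G.\<kappa>_def G_simps[of s t] G_simps[of t t])
qed (auto simp: cosh_field_def)

lemma \<kappa>'_meas: "G.\<kappa>' \<in> borel_measurable (lborel \<Otimes>\<^sub>M lborel)"
  unfolding G.\<kappa>'_def sinh_field_def by measurable

lemma mass_sinh:
  "G.mass G.\<kappa>' = (\<integral>\<^sup>+s. indicator unit_cube s * (\<integral>\<^sup>+t. indicator unit_cube t *
    (ennreal ((1 / (2 * pi) ^ CARD('d))\<^sup>2) * pair_sinh TYPE(real ^ 'd) (R s s) (R t t) (R s t)) \<partial>lborel) \<partial>lborel)"
  unfolding pair_sinh_def
proof (rule mass_eq[of G.\<kappa>' "\<lambda>a b r \<xi> \<eta>. exp (- (a * (norm \<xi>)\<^sup>2 + b * (norm \<eta>)\<^sup>2) / 2) * (r * (\<xi> \<bullet> \<eta>) * sinh (r * (\<xi> \<bullet> \<eta>)))"])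
  show "G.\<kappa>' ((s, \<xi>), (t, \<eta>)) = exp (- (R s s * (norm \<xi>)\<^sup>2 + R t t * (norm \<eta>)\<^sup>2) / 2) * (R s t * (\<xi> \<bullet> \<eta>) * sinh (R s t * (\<xi> \<bullet> \<eta>)))"
    if "s \<in> unit_cube" "t \<in> unit_cube" for s t \<xi> \<eta>
    using that by (simp add: G.\<kappa>'_def G_simps[of s t] G_simps[of t t])
qed (auto simp: sinh_field_def \<kappa>'_meas)

end

context gaussian_vector_field
begin

lemma residual_eq: "(\<integral>\<omega>. (X0 t \<omega> - a * X0 s \<omega>)\<^sup>2 \<partial>M) = R t t - 2 * a * R s t + a\<^sup>2 * R s s"
  unfolding integral_diff_square[OF X0_L2 L2_scale[OF X0_L2]]
  by (simp add: R_def power2_eq_square mult_ac)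

lemma condition_C1_R:
  assumes "condition_C1 M X0 H"
  obtains c where "0 < c" "\<And>s t. s \<in> unit_cube \<Longrightarrow> t \<in> unit_cube \<Longrightarrow>
    R s s - 2 * R s t + R t t \<le> c * (\<Sum>j\<in>UNIV. \<bar>s $ j - t $ j\<bar> powr (2 * H $ j))"
proof -
  have "(\<integral>\<omega>. (X0 s \<omega> - X0 t \<omega>)\<^sup>2 \<partial>M) = R s s - 2 * R s t + R t t" for s t
    unfolding integral_diff_square[OF X0_L2 X0_L2] by (simp add: R_def power2_eq_square)
  then show ?thesis using assms that unfolding condition_C1_def by auto
qed

lemma condition_C2_R:
  assumes "condition_C2 M X0 H"
  obtains c where "0 < c" "\<And>s t a. s \<in> unit_cube \<Longrightarrow> t \<in> unit_cube \<Longrightarrow>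
    c * (\<Sum>j\<in>UNIV. min (\<bar>s $ j - t $ j\<bar> powr (2 * H $ j)) (\<bar>t $ j\<bar> powr (2 * H $ j))) \<le> R t t - 2 * a * R s t + a\<^sup>2 * R s s"
proof -
  obtain c where c: "0 < c" "\<forall>s\<in>unit_cube. \<forall>t\<in>unit_cube. AE \<omega> in M.
        cond_variance M (X0 t) (X0 s) \<omega> \<ge>
          c * (\<Sum>j\<in>UNIV. min (\<bar>s $ j - t $ j\<bar> powr (2 * H $ j)) (\<bar>t $ j\<bar> powr (2 * H $ j)))"
    using assms unfolding condition_C2_def by blast
  show ?thesis
    by (rule that[OF c(1)], unfold residual_eq[symmetric], rule residual_ge_of_cond_variance[OF X0_L2 X0_L2]) (use c(2) in blast)
qed

end

section \<open>The collision local time\<close>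

theorem theorem2p12:
  fixes M :: "'w measure"
    and H K :: "real ^ 'n"
    and XH XK :: "real ^ 'n \<Rightarrow> 'w \<Rightarrow> real ^ 'd"
    and XH0 XK0 :: "real ^ 'n \<Rightarrow> 'w \<Rightarrow> real"
  assumes "prob_space M"
    and "\<And>j. 0 < H $ j \<and> H $ j < 1"
    and "\<And>j. 0 < K $ j \<and> K $ j < 1"
    and "gaussian_random_field M XH XH0"
    and "gaussian_random_field M XK XK0"
    and "independent_fields M XH XK"
    and "condition_C1 M XH0 H" and "condition_C2 M XH0 H"
    and "condition_C1 M XK0 K" and "condition_C2 M XK0 K"
  shows "((\<exists>L. is_collision_local_time M XH XK L) \<longleftrightarrow>
            (\<Sum>j\<in>UNIV. 1 / min (H $ j) (K $ j)) > real CARD('d)) \<and>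
         ((\<exists>L. is_collision_local_time M XH XK L \<and> L \<in> D1 M (difference_variables XH XK)) \<longleftrightarrow>
            (\<Sum>j\<in>UNIV. 1 / min (H $ j) (K $ j)) > real CARD('d) + 2)"
proof -
  interpret prob_space M by (rule assms(1))
  interpret F: independent_gaussian_fields M XH XH0 XK XK0
    by unfold_locales (use assms in auto)
  obtain a\<^sub>1 where a1: "0 < a\<^sub>1" "\<And>s t. s \<in> unit_cube \<Longrightarrow> t \<in> unit_cube \<Longrightarrow>
    F.A.R s s - 2 * F.A.R s t + F.A.R t t \<le> a\<^sub>1 * (\<Sum>j\<in>UNIV. \<bar>s $ j - t $ j\<bar> powr (2 * H $ j))"
    using F.A.condition_C1_R[OF assms(7)] by blast
  obtain b\<^sub>1 where b1: "0 < b\<^sub>1" "\<And>s t. s \<in> unit_cube \<Longrightarrow> t \<in> unit_cube \<Longrightarrow>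
    F.B.R s s - 2 * F.B.R s t + F.B.R t t \<le> b\<^sub>1 * (\<Sum>j\<in>UNIV. \<bar>s $ j - t $ j\<bar> powr (2 * K $ j))"
    using F.B.condition_C1_R[OF assms(9)] by blast
  obtain a\<^sub>2 where a2: "0 < a\<^sub>2" "\<And>s t a. s \<in> unit_cube \<Longrightarrow> t \<in> unit_cube \<Longrightarrow>
    a\<^sub>2 * (\<Sum>j\<in>UNIV. min (\<bar>s $ j - t $ j\<bar> powr (2 * H $ j)) (\<bar>t $ j\<bar> powr (2 * H $ j))) \<le> F.A.R t t - 2 * a * F.A.R s t + a\<^sup>2 * F.A.R s s"
    using F.A.condition_C2_R[OF assms(8)] by blast
  obtain b\<^sub>2 where b2: "0 < b\<^sub>2" "\<And>s t a. s \<in> unit_cube \<Longrightarrow> t \<in> unit_cube \<Longrightarrow>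
    b\<^sub>2 * (\<Sum>j\<in>UNIV. min (\<bar>s $ j - t $ j\<bar> powr (2 * K $ j)) (\<bar>t $ j\<bar> powr (2 * K $ j))) \<le> F.B.R t t - 2 * a * F.B.R s t + a\<^sup>2 * F.B.R s s"
    using F.B.condition_C2_R[OF assms(10)] by blast
  define \<alpha> where "\<alpha> j = min (H $ j) (K $ j)" for j
  interpret E: anisotropic_covariance F.R \<alpha> "a\<^sub>1 + b\<^sub>1" "min a\<^sub>2 b\<^sub>2"
  proof
    show "0 < \<alpha> j" "\<alpha> j < 1" for j using assms(2,3) by (auto simp: \<alpha>_def min_def)
    show "0 < a\<^sub>1 + b\<^sub>1" "0 < min a\<^sub>2 b\<^sub>2" using a1 b1 a2 b2 by auto
    show "continuous_on UNIV (\<lambda>(s, t). F.R s t)" by (rule F.R_continuous)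
    fix s t :: "real ^ 'n" assume s: "s \<in> unit_cube" and t: "t \<in> unit_cube"
    \<comment> \<open>increments are at most \<open>1\<close>, so the smaller index gives the larger power\<close>
    have diff: "\<bar>s $ j - t $ j\<bar> \<le> 1" for j
    proof -
      have "0 \<le> s $ j" "s $ j \<le> 1" "0 \<le> t $ j" "t $ j \<le> 1" using s t by (auto simp: mem_box_cart)
      then show ?thesis by simp
    qed
    let ?d = "\<lambda>\<gamma> j. \<bar>s $ j - t $ j\<bar> powr (2 * \<gamma>)"
    have "(\<Sum>j\<in>UNIV. ?d (H $ j) j) \<le> (\<Sum>j\<in>UNIV. ?d (\<alpha> j) j)" "(\<Sum>j\<in>UNIV. ?d (K $ j) j) \<le> (\<Sum>j\<in>UNIV. ?d (\<alpha> j) j)"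
      using diff by (auto simp: \<alpha>_def intro!: sum_mono powr_mono')
    then have "a\<^sub>1 * (\<Sum>j\<in>UNIV. ?d (H $ j) j) + b\<^sub>1 * (\<Sum>j\<in>UNIV. ?d (K $ j) j) \<le> a\<^sub>1 * (\<Sum>j\<in>UNIV. ?d (\<alpha> j) j) + b\<^sub>1 * (\<Sum>j\<in>UNIV. ?d (\<alpha> j) j)"
      using a1 b1 by (intro add_mono mult_left_mono) auto
    then show "F.R s s - 2 * F.R s t + F.R t t \<le> (a\<^sub>1 + b\<^sub>1) * (\<Sum>j\<in>UNIV. \<bar>s $ j - t $ j\<bar> powr (2 * \<alpha> j))"
      using a1(2)[OF s t] b1(2)[OF s t] by (simp add: F.R_def distrib_right)
    fix a :: real
    let ?m = "\<lambda>\<gamma> j. min (\<bar>s $ j - t $ j\<bar> powr (2 * \<gamma>)) (\<bar>t $ j\<bar> powr (2 * \<gamma>))"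
    \<comment> \<open>for each \<open>j\<close> the term with index \<open>\<alpha> j\<close> is one of the two nonnegative terms on the right\<close>
    have "min a\<^sub>2 b\<^sub>2 * (\<Sum>j\<in>UNIV. ?m (\<alpha> j) j) \<le> min a\<^sub>2 b\<^sub>2 * (\<Sum>j\<in>UNIV. ?m (H $ j) j + ?m (K $ j) j)"
      using a2 b2 by (intro mult_left_mono sum_mono) (auto simp: \<alpha>_def min_def)
    also have "\<dots> = min a\<^sub>2 b\<^sub>2 * (\<Sum>j\<in>UNIV. ?m (H $ j) j) + min a\<^sub>2 b\<^sub>2 * (\<Sum>j\<in>UNIV. ?m (K $ j) j)"
      by (simp add: sum.distrib distrib_left)
    also have "\<dots> \<le> a\<^sub>2 * (\<Sum>j\<in>UNIV. ?m (H $ j) j) + b\<^sub>2 * (\<Sum>j\<in>UNIV. ?m (K $ j) j)"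
      by (intro add_mono mult_right_mono sum_nonneg) auto
    also have "\<dots> \<le> F.R t t - 2 * a * F.R s t + a\<^sup>2 * F.R s s"
      using a2(2)[OF s t, of a] b2(2)[OF s t, of a] by (simp add: F.R_def algebra_simps)
    finally show "min a\<^sub>2 b\<^sub>2 * (\<Sum>j\<in>UNIV. ?m (\<alpha> j) j) \<le> F.R t t - 2 * a * F.R s t + a\<^sup>2 * F.R s s" .
  qed
  have Q: "E.Q = (\<Sum>j\<in>UNIV. 1 / min (H $ j) (K $ j))" by (simp add: E.Q_def \<alpha>_def)
  have c: "0 < (1 / (2 * pi) ^ CARD('d))\<^sup>2" by simp
  have cosh: "F.G.mass F.G.\<kappa> < \<infinity> \<longleftrightarrow> real CARD('d) < E.Q"
    using E.cosh_kernel_finite_iff[OF c, where 'a = "real ^ 'd"] by (simp add: F.mass_cosh E.cube_integral_def)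
  have sinh: "F.G.mass F.G.\<kappa>' < \<infinity> \<longleftrightarrow> real CARD('d) + 2 < E.Q"
    using E.sinh_kernel_finite_iff[OF c, where 'a = "real ^ 'd"] by (simp add: F.mass_sinh E.cube_integral_def add.commute)
  have "(\<exists>L. is_collision_local_time M XH XK L) \<longleftrightarrow> real CARD('d) < E.Q"
    using F.G.local_time_exists_iff cosh by (simp add: F.tendsto_local_time_iff)
  moreover have "(\<exists>L. is_collision_local_time M XH XK L \<and> L \<in> D1 M (difference_variables XH XK)) \<longleftrightarrow> real CARD('d) + 2 < E.Q"
    using F.G.local_time_D1_iff cosh sinh by (auto simp: F.tendsto_local_time_iff)
  ultimately show ?thesis by (simp add: Q)
qed

end
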